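(* Assume that $W$ satisfies the following three conditions. (1) For every $\delta>0$ there exists $\eta>0$ such that for every $x\in\mathbb{R}^d$, every $\xi\in\mathrm{dom}\,W(x,\cdot)$ and every $t\in[0,1)$: $1-t\le\eta$ implies $W(x,t\xi)\le W(x,\xi)+\delta$. (2) For every compact set $K\subset\mathrm{int}\,C$, the function $x\mapsto\sup\{W(x,\xi):\xi\in K\}$ belongs to $L^\infty_{\rm loc}(\mathbb{R}^d)$. (3) For every $s>0$ there exists a compact set $K_s\subset\mathrm{int}\,C$ such that for every $x\in\mathbb{R}^d$, $\inf\{W(x,\xi):\xi\in\overline{C}\setminus K_s\}\ge s$. For $\varepsilon>0$ let $J_\varepsilon:W^{1,\infty}(\Omega;\mathbb{R}^m)\to[0,+\infty]$ be given by $J_\varepsilon(u)=\int_\Omega W\left(\frac{x}{\varepsilon},\nabla u(x)\right)dx$ if $u\in W^{1,\infty}_0(\Omega;\mathbb{R}^m)$ and $J_\varepsilon(u)=+\infty$ otherwise. Then $\{J_\varepsilon\}_{\varepsilon>0}$ $\Gamma$-converges, with respect to $L^1(\Omega;\mathbb{R}^m)$-convergence as $\varepsilon\to0$, to $J_{\rm hom}$, where $$J_{\rm hom}(u)=\begin{cases}\displaystyle\int_\Omega W_{\rm hom}(\nabla u(x))\,dx&\text{if }u\in W^{1,\infty}_0(\Omega;\mathbb{R}^m),\\+\infty&\text{if }u\in W^{1,\infty}(\Omega;\mathbb{R}^m)\setminus W^{1,\infty}_0(\Omega;\mathbb{R}^m),\end{cases}$$ and $W_{\rm hom}=\overline{\mathcal{H}W}$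 is the lower semicontinuous envelope of $\mathcal{H}W$.
   Context: Let $m,d\ge1$ be integers, $\mathbb{M}^{m\times d}$ the space of real $m\times d$ matrices, $Y=(0,1)^d$, and $\Omega\subset\mathbb{R}^d$ a nonempty bounded open domain with Lipschitz boundary. Let $C\subset\mathbb{M}^{m\times d}$ be a bounded convex set with $0\in\mathrm{int}\,C$; $\overline{C}$ is its closure. Let $W:\mathbb{R}^d\times\mathbb{M}^{m\times d}\to[0,+\infty]$ be Borel measurable, $Y$-periodic in its first variable ($W(x+z,\xi)=W(x,\xi)$ for all $z\in\mathbb{Z}^d$), with $\mathrm{dom}\,W(x,\cdot):=\{\xi:W(x,\xi)<+\infty\}\subset\overline{C}$ for all $x\in\mathbb{R}^d$. For a bounded open $D\subset\mathbb{R}^d$ with $|\partial D|=0$, $W^{1,\infty}_0(D;\mathbb{R}^m)=\{\varphi\in W^{1,\infty}(D;\mathbb{R}^m):\varphi=0\text{ on }\partial D\}$. Define $\mathcal{H}W:\mathbb{M}^{m\times d}\to[0,+\infty]$ by $$\mathcal{H}W(\xi)=\inf_{n\ge1}\frac1{n^d}\inf\left\{\int_{nY}W(x,\xi+\nabla\phi(x))\,dx:\phi\in W^{1,\infty}_0(nY;\mathbb{R}^m)\right\}.$$ $\Gamma$-convergence of $\{F_\varepsilon\}$ to $F$ (functionals $W^{1,\infty}(\Omega;\mathbb{R}^m)\to[0,+\infty]$) with respect to $L^1$-convergence as $\varepsilon\to0$ means that for every $u\in W^{1,\infty}(\Omega;\mathbb{R}^m)$, $\Gamma\text{-}\liminf_{\varepsilon\to0}F_\varepsilon(u)\ge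 F(u)$ and $\Gamma\text{-}\limsup_{\varepsilon\to0}F_\varepsilon(u)\le F(u)$, where $\Gamma\text{-}\liminf_{\varepsilon\to0}F_\varepsilon(u)=\inf\{\liminf_{\varepsilon\to0}F_\varepsilon(u_\varepsilon):u_\varepsilon\to u\text{ in }L^1(\Omega;\mathbb{R}^m)\}$ and $\Gamma\text{-}\limsup_{\varepsilon\to0}F_\varepsilon(u)=\inf\{\limsup_{\varepsilon\to0}F_\varepsilon(u_\varepsilon):u_\varepsilon\to u\text{ in }L^1(\Omega;\mathbb{R}^m)\}$, with $u_\varepsilon\in W^{1,\infty}(\Omega;\mathbb{R}^m)$. *)

theory Defs
  imports "HOL-Analysis.Analysis"
begin

text \<open>
  Conventions. \<open>\<real>\<^sup>d\<close> is \<open>real^'d\<close> and the \<open>m \<times> d\<close> matrices are \<open>real^'d^'m\<close>, so that \<open>\<xi> $ i $ j\<close>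
  has row \<open>i\<close> and column \<open>j\<close>. Elements of function spaces on \<open>D\<close> are represented by
  functions on all of \<open>real^'d\<close> whose values outside \<open>D\<close> are irrelevant; measurability on \<open>D\<close>,
  ``almost everywhere'' and integrals over \<open>D\<close> refer to \<open>lebesgue_on D\<close>.
\<close>

section \<open>The spaces \<open>W\<^sup>1\<^sup>,\<^sup>\<infinity>\<close>\<close>

definition Linf :: "(real^'d) set \<Rightarrow> (real^'d \<Rightarrow> 'b::euclidean_space) set" where
  "Linf D = {f. f \<in> borel_measurable (lebesgue_on D) \<and>
                (\<exists>M. AE x in lebesgue_on D. norm (f x) \<le> M)}"

definition locally_integrable :: "(real^'d) set \<Rightarrow> (real^'d \<Rightarrow> 'b::euclidean_space) \<Rightarrow> bool" where
  "locally_integrable D f \<longleftrightarrow> (\<forall>K. compact K \<and> K \<subseteq> D \<longrightarrow> set_integrable lebesgue K f)"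

text \<open>\<open>\<phi> \<in> C\<^sup>1\<^sub>c(D)\<close> with gradient \<open>g\<close>.\<close>

definition test_function :: "(real^'d) set \<Rightarrow> (real^'d \<Rightarrow> real) \<Rightarrow> (real^'d \<Rightarrow> real^'d) \<Rightarrow> bool" where
  "test_function D \<phi> g \<longleftrightarrow>
     (\<forall>x. GDERIV \<phi> x :> g x) \<and> continuous_on UNIV g \<and>
     compact (closure {x. \<phi> x \<noteq> 0}) \<and> closure {x. \<phi> x \<noteq> 0} \<subseteq> D"

text \<open>Weak gradients, tested against \<open>C\<^sup>1\<^sub>c(D)\<close> as in Evans and Gariepy, \<^emph>\<open>Measure Theory and Fine
  Properties of Functions\<close>, Section 4.1; by mollification, testing against \<open>C\<^sup>\<infinity>\<^sub>c(D)\<close>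
  gives the same notion.\<close>

definition has_weak_gradient ::
    "(real^'d) set \<Rightarrow> (real^'d \<Rightarrow> real^'m) \<Rightarrow> (real^'d \<Rightarrow> real^'d^'m) \<Rightarrow> bool" where
  "has_weak_gradient D u G \<longleftrightarrow>
     locally_integrable D u \<and> locally_integrable D G \<and>
     (\<forall>\<phi> g i j. test_function D \<phi> g \<longrightarrow>
        (\<integral>x. u x $ i * g x $ j \<partial>lebesgue_on D) = - (\<integral>x. G x $ i $ j * \<phi> x \<partial>lebesgue_on D))"

text \<open>The weak gradient on an open set \<open>D\<close> is unique up to null sets, so the choice is immaterial in
  integrals over \<open>D\<close>.\<close>

definition weak_gradient ::
    "(real^'d) set \<Rightarrow> (real^'d \<Rightarrow> real^'m) \<Rightarrow> real^'d \<Rightarrow> real^'d^'m" where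
  "weak_gradient D u = (SOME G. has_weak_gradient D u G)"

definition W1inf :: "(real^'d) set \<Rightarrow> (real^'d \<Rightarrow> real^'m) set" where
  "W1inf D = {u \<in> Linf D. \<exists>G \<in> Linf D. has_weak_gradient D u G}"

text \<open>``\<open>u = 0\<close> on the boundary'' is a statement about the continuous representative of \<open>u\<close>:
  it extends continuously to \<open>closure D\<close> with boundary values \<open>0\<close>.\<close>

definition W1inf0 :: "(real^'d) set \<Rightarrow> (real^'d \<Rightarrow> real^'m) set" where
  "W1inf0 D = {u \<in> W1inf D. \<exists>v. continuous_on (closure D) v \<and>
                 (AE x in lebesgue_on D. v x = u x) \<and> (\<forall>x \<in> frontier D. v x = 0)}"


section \<open>Lipschitz boundary\<close>

text \<open>Near each boundary point, \<open>D\<close> is the part strictly above the graph, in some unit direction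
  \<open>\<nu>\<close>, of a Lipschitz function on the hyperplane orthogonal to \<open>\<nu>\<close>.\<close>

definition lipschitz_boundary :: "(real^'d) set \<Rightarrow> bool" where
  "lipschitz_boundary D \<longleftrightarrow>
     (\<forall>a \<in> frontier D. \<exists>r > 0. \<exists>\<nu> :: real^'d. \<exists>\<gamma> :: real^'d \<Rightarrow> real. \<exists>L.
        norm \<nu> = 1 \<and> L-lipschitz_on {y. y \<bullet> \<nu> = 0} \<gamma> \<and>
        D \<inter> ball a r = {x \<in> ball a r. x \<bullet> \<nu> > \<gamma> (x - (x \<bullet> \<nu>) *\<^sub>R \<nu>)})"


section \<open>\<open>\<Gamma>\<close>-convergence\<close>

text \<open>Families \<open>(v\<^sub>\<epsilon>)\<close> with \<open>\<epsilon> > 0\<close> in \<open>W\<^sup>1\<^sup>,\<^sup>\<infinity>\<close> that converge to \<open>u\<close> in \<open>L\<^sup>1\<close> as \<open>\<epsilon> \<rightarrow> 0\<close>.\<close>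

definition L1_families ::
    "(real^'d) set \<Rightarrow> (real^'d \<Rightarrow> real^'m) \<Rightarrow> (real \<Rightarrow> real^'d \<Rightarrow> real^'m) set" where
  "L1_families \<Omega> u = {v. (\<forall>\<epsilon> > 0. v \<epsilon> \<in> W1inf \<Omega>) \<and>
     ((\<lambda>\<epsilon>. \<integral>\<^sup>+x. ennreal (norm (v \<epsilon> x - u x)) \<partial>lebesgue_on \<Omega>) \<longlongrightarrow> 0) (at_right 0)}"

definition Gamma_liminf ::
    "(real^'d) set \<Rightarrow> (real \<Rightarrow> (real^'d \<Rightarrow> real^'m) \<Rightarrow> ennreal) \<Rightarrow> (real^'d \<Rightarrow> real^'m) \<Rightarrow> ennreal" where
  "Gamma_liminf \<Omega> F u = (INF v \<in> L1_families \<Omega> u. Liminf (at_right 0) (\<lambda>\<epsilon>. F \<epsilon> (v \<epsilon>)))"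

definition Gamma_limsup ::
    "(real^'d) set \<Rightarrow> (real \<Rightarrow> (real^'d \<Rightarrow> real^'m) \<Rightarrow> ennreal) \<Rightarrow> (real^'d \<Rightarrow> real^'m) \<Rightarrow> ennreal" where
  "Gamma_limsup \<Omega> F u = (INF v \<in> L1_families \<Omega> u. Limsup (at_right 0) (\<lambda>\<epsilon>. F \<epsilon> (v \<epsilon>)))"

definition Gamma_converges ::
    "(real^'d) set \<Rightarrow> (real \<Rightarrow> (real^'d \<Rightarrow> real^'m) \<Rightarrow> ennreal) \<Rightarrow>
     ((real^'d \<Rightarrow> real^'m) \<Rightarrow> ennreal) \<Rightarrow> bool" where
  "Gamma_converges \<Omega> F F0 \<longleftrightarrow>
     (\<forall>u \<in> W1inf \<Omega>. Gamma_liminf \<Omega> F u \<ge> F0 u \<and> Gamma_limsup \<Omega> F u \<le> F0 u)"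


section \<open>Integrands and integral functionals\<close>

definition eff_dom :: "('a \<Rightarrow> ennreal) \<Rightarrow> 'a set" where
  "eff_dom f = {\<xi>. f \<xi> < \<infinity>}"

definition periodic :: "(real^'d \<Rightarrow> 'a \<Rightarrow> ennreal) \<Rightarrow> bool" where
  "periodic W \<longleftrightarrow> (\<forall>x z \<xi>. (\<forall>i. z $ i \<in> \<int>) \<longrightarrow> W (x + z) \<xi> = W x \<xi>)"

definition locally_Linf :: "(real^'d \<Rightarrow> ennreal) \<Rightarrow> bool" where
  "locally_Linf f \<longleftrightarrow> f \<in> borel_measurable lebesgue \<and>
     (\<forall>B. compact B \<longrightarrow> (\<exists>M::real. AE x in lebesgue_on B. f x \<le> ennreal M))"

text \<open>The unit cell \<open>Y = (0,1)\<^sup>d\<close>.\<close>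

definition Y :: "(real^'d) set" where
  "Y = {x. \<forall>i. 0 < x $ i \<and> x $ i < 1}"

definition HW :: "(real^'d \<Rightarrow> real^'d^'m \<Rightarrow> ennreal) \<Rightarrow> real^'d^'m \<Rightarrow> ennreal" where
  "HW W \<xi> = (INF n \<in> {1::nat..}.
     ennreal (1 / real n ^ CARD('d)) *
     (INF \<phi> \<in> W1inf0 ((*\<^sub>R) (real n) ` Y).
        \<integral>\<^sup>+x. W x (\<xi> + weak_gradient ((*\<^sub>R) (real n) ` Y) \<phi> x) \<partial>lebesgue_on ((*\<^sub>R) (real n) ` Y)))"

definition lower_semicontinuous :: "('a::topological_space \<Rightarrow> ennreal) \<Rightarrow> bool" where
  "lower_semicontinuous f \<longleftrightarrow> (\<forall>a. open {x. a < f x})"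

definition lsc_envelope :: "('a::topological_space \<Rightarrow> ennreal) \<Rightarrow> 'a \<Rightarrow> ennreal" where
  "lsc_envelope f x = (SUP g \<in> {g. lower_semicontinuous g \<and> g \<le> f}. g x)"

definition W_hom :: "(real^'d \<Rightarrow> real^'d^'m \<Rightarrow> ennreal) \<Rightarrow> real^'d^'m \<Rightarrow> ennreal" where
  "W_hom W = lsc_envelope (HW W)"

definition J ::
    "(real^'d) set \<Rightarrow> (real^'d \<Rightarrow> real^'d^'m \<Rightarrow> ennreal) \<Rightarrow> real \<Rightarrow> (real^'d \<Rightarrow> real^'m) \<Rightarrow> ennreal" where
  "J \<Omega> W \<epsilon> u =
     (if u \<in> W1inf0 \<Omega>
      then \<integral>\<^sup>+x. W (x /\<^sub>R \<epsilon>) (weak_gradient \<Omega> u x) \<partial>lebesgue_on \<Omega>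
      else \<infinity>)"

definition J_hom ::
    "(real^'d) set \<Rightarrow> (real^'d \<Rightarrow> real^'d^'m \<Rightarrow> ennreal) \<Rightarrow> (real^'d \<Rightarrow> real^'m) \<Rightarrow> ennreal" where
  "J_hom \<Omega> W u =
     (if u \<in> W1inf0 \<Omega>
      then \<integral>\<^sup>+x. W_hom W (weak_gradient \<Omega> u x) \<partial>lebesgue_on \<Omega>
      else \<infinity>)"

end

theory Submission
  imports Defs
begin

text \<open>
  Functions in \<open>W\<^sup>1\<^sup>,\<^sup>\<infinity>\<^sub>0\<close> are Lipschitz functions on the whole space whose weak gradient is, at almost
  every \<open>x\<close>, the derivative at \<open>x\<close> within the orthant \<open>{x..}\<close>.

  Lower bound: competitors of bounded energy have gradients in \<open>closure C\<close>, so they are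
  equi-Lipschitz and converge uniformly. On a small cube with corner at a point \<open>x\<close> of
  differentiability of the limit \<open>u\<close>, a competitor is cut off to the affine function with gradient
  \<open>\<nabla>u(x)\<close> and multiplied by \<open>t < 1\<close>; the factor moves the gradient of the transition layer into a
  compact subset of \<open>interior C\<close>, where \<open>W\<close> is bounded, and the radial condition (1) controls the rest. The result
  is admissible for \<open>HW\<close>. Averaging over all cubes of side \<open>\<rho>\<close> with Tonelli's theorem and applying Fatou's
  lemma twice gives the inequality, after \<open>t \<rightarrow> 1\<close>.

  Upper bound: cover \<open>\<Omega>\<close> by a grid of cubes whose offset is chosen such that the Riemann sum of
  \<open>W_hom (\<nabla>u)\<close> over the corners where \<open>u\<close> is nearly affine does not exceed the integral. On each of
  these cubes, replace \<open>t u\<close> by \<open>t\<close> times an affine function whose gradient \<open>\<zeta>\<close> is close to \<open>\<nabla>u\<close> and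
  satisfies \<open>HW \<zeta> \<approx> W_hom (\<nabla>u)\<close>, plus a rescaled periodic tiling of an almost optimal cell function.
  On the rest of \<open>\<Omega>\<close>, which is small, \<open>t u\<close> has bounded energy density.
\<close>

section \<open>Bumps averaged along segments\<close>

text \<open>The obstacle is that \<open>W\<close> is infinite outside \<open>closure C\<close>. A
  cutoff adds to the gradient a term of size error over side, which may leave the domain however
  small it is. Multiplying by \<open>t < 1\<close> makes room, since
  \<open>t *\<^sub>R closure C\<close> plus a small ball stays in a compact part of
  \<open>interior C\<close>; the price is the radial condition where the gradient is untouched, and
  on the transition layer a bound \<open>M\<close> that depends on \<open>t\<close>. Both halves
  therefore fix their constants in the same order: the tolerance \<delta>, then \<open>t\<close>,
  then \<open>M\<close> and the radius \<open>r\<close> of the ball, then the relative width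
  \<kappa> of the layer, then the slope of the cutoff and the admissible deviation from an affine
  map, then the side \<rho> of the cubes, and \<epsilon> last. Energies on cubes are compared with
  \<open>HW\<close> through blocks of whole \<epsilon>-cells; the rounding changes the side by a
  bounded multiple of \<epsilon> and disappears as \<epsilon> tends to 0 at fixed \<rho>. Since
  \<open>W_hom\<close> is an envelope, \<open>HW\<close> at a matrix need not be close to
  \<open>W_hom\<close> there, which is why the upper bound moves to a nearby gradient.\<close>

text \<open>The support, the unit ball about \<open>(1, \<dots>, 1)\<close>, lies in the orthant \<open>{0..}\<close>, so that a bump of
  size \<open>r\<close> at \<open>x\<close> only sees a cube with corner \<open>x\<close>.\<close>

definition bump :: "real^'d \<Rightarrow> real" where
  "bump z = (max 0 (1 - (z - 1) \<bullet> (z - 1)))\<^sup>2"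

definition bump_grad :: "real^'d \<Rightarrow> real^'d" where
  "bump_grad z = (- 4 * max 0 (1 - (z - 1) \<bullet> (z - 1))) *\<^sub>R (z - 1)"

lemma DERIV_max0_square: "((\<lambda>y::real. (max 0 y)\<^sup>2) has_real_derivative 2 * max 0 y) (at y)"
proof -
  consider "y > 0" | "y < 0" | "y = 0" by linarith
  then show ?thesis
  proof cases
    case 1
    have "((\<lambda>y::real. y\<^sup>2) has_real_derivative 2 * max 0 y) (at y)"
      using 1 by (auto intro!: derivative_eq_intros)
    moreover have "\<forall>\<^sub>F x in nhds y. x\<^sup>2 = (max 0 x)\<^sup>2"
      using eventually_nhds_in_open[of "{0<..}" y] 1 by (auto elim!: eventually_mono)
    ultimately show ?thesis by (subst DERIV_cong_ev[OF refl, symmetric]) auto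
  next
    case 2
    have "((\<lambda>y::real. 0) has_real_derivative 2 * max 0 y) (at y)"
      using 2 by (auto intro!: derivative_eq_intros)
    moreover have "\<forall>\<^sub>F x in nhds y. 0 = (max 0 x)\<^sup>2"
      using eventually_nhds_in_open[of "{..<0}" y] 2 by (auto elim!: eventually_mono)
    ultimately show ?thesis by (subst DERIV_cong_ev[OF refl, symmetric]) auto
  next
    case 3
    have "((\<lambda>h::real. ((max 0 (0 + h))\<^sup>2 - (max 0 0)\<^sup>2) / h) \<longlongrightarrow> 0) (at 0)"
    proof (rule tendsto_0_le[where K=1])
      show "((\<lambda>h::real. h) \<longlongrightarrow> 0) (at 0)" by (rule tendsto_ident_at)
      show "\<forall>\<^sub>F h::real in at 0. norm (((max 0 (0 + h))\<^sup>2 - (max 0 0)\<^sup>2) / h) \<le> norm h * 1"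
        by (rule always_eventually) (auto simp: max_def power2_eq_square)
    qed
    then show ?thesis using 3 by (simp add: DERIV_def)
  qed
qed

lemma bump_has_derivative: "(bump has_derivative (\<lambda>h. bump_grad z \<bullet> h)) (at z)"
proof -
  have 1: "((\<lambda>z::real^'a. 1 - (z - 1) \<bullet> (z - 1)) has_derivative (\<lambda>h. - 2 * ((z - 1) \<bullet> h))) (at z)"
    by (auto intro!: derivative_eq_intros simp: inner_commute)
  have 2: "((\<lambda>y::real. (max 0 y)\<^sup>2) has_derivative (\<lambda>h. h * (2 * max 0 (1 - (z - 1) \<bullet> (z - 1)))))
      (at (1 - (z - 1) \<bullet> (z - 1)))"
    by (rule has_derivative_eq_rhs[OF DERIV_max0_square[unfolded has_field_derivative_def]]) (simp add: fun_eq_iff)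
  show ?thesis
    unfolding bump_def[abs_def]
    by (rule has_derivative_eq_rhs[OF has_derivative_compose[OF 1 2]])
       (auto simp: bump_grad_def fun_eq_iff algebra_simps)
qed

lemma continuous_on_bump [continuous_intros]:
  "continuous_on S f \<Longrightarrow> continuous_on S (\<lambda>x. bump (f x))"
  unfolding bump_def by (intro continuous_intros)

lemma continuous_on_bump_grad [continuous_intros]:
  "continuous_on S f \<Longrightarrow> continuous_on S (\<lambda>x. bump_grad (f x))"
  unfolding bump_grad_def by (intro continuous_intros)

lemma bump_nonneg: "0 \<le> bump z" by (simp add: bump_def)

lemma bump_le_1: "bump z \<le> 1"
  unfolding bump_def by (rule power_le_one) auto

lemma bump_eq_0: "z \<notin> cball 1 1 \<Longrightarrow> bump z = 0"
proof -
  assume "z \<notin> cball 1 1"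
  then have "1 < norm (z - 1)" by (simp add: dist_norm norm_minus_commute)
  then have "1 < (norm (z - 1))\<^sup>2" by (simp add: one_less_power)
  then show ?thesis by (simp add: bump_def power2_norm_eq_inner)
qed

text \<open>The average of the bumps of size \<open>r\<close> with corners on the segment from \<open>x\<close> to \<open>x + h\<close>: its
  derivative in direction \<open>h\<close> is the difference of the two extreme bumps, so that testing a weak
  gradient against it gives a difference quotient.\<close>

definition seg_bump :: "real \<Rightarrow> real^'d \<Rightarrow> real^'d \<Rightarrow> real^'d \<Rightarrow> real" where
  "seg_bump r x h z = integral (cbox 0 1) (\<lambda>s. bump ((z - x - s *\<^sub>R h) /\<^sub>R r))"

definition seg_bump_grad :: "real \<Rightarrow> real^'d \<Rightarrow> real^'d \<Rightarrow> real^'d \<Rightarrow> real^'d" where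
  "seg_bump_grad r x h z = integral (cbox 0 1) (\<lambda>s. bump_grad ((z - x - s *\<^sub>R h) /\<^sub>R r) /\<^sub>R r)"

text \<open>Contains the supports of all the bumps averaged in \<open>seg_bump\<close>. As a
  continuous image of a product of compact sets it is compact, which supplies the compact support of
  the test function.\<close>

definition seg_nbhd :: "real \<Rightarrow> real^'d \<Rightarrow> real^'d \<Rightarrow> (real^'d) set" where
  "seg_nbhd r x h = (\<lambda>(s, w). x + s *\<^sub>R h + r *\<^sub>R w) ` ({0..1} \<times> cball 1 1)"

lemma compact_seg_nbhd: "compact (seg_nbhd r x h)"
  unfolding seg_nbhd_def
  by (intro compact_continuous_image compact_Times) (auto intro!: continuous_intros simp: split_def)

text \<open>Differentiation under the integral sign. The Leibniz rule expects the derivative as a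
  bounded linear map depending continuously on the point and the parameter, so the gradient is
  wrapped by \<open>blinfun_inner_right\<close> and unwrapped at the end.\<close>

lemma seg_bump_GDERIV: "GDERIV (seg_bump r x h) z :> seg_bump_grad r x h z"
proof -
  have c: "continuous_on (cbox 0 1) (\<lambda>s. blinfun_inner_right (bump_grad ((z - x - s *\<^sub>R h) /\<^sub>R r) /\<^sub>R r))" for z
    by (intro continuous_intros bounded_linear.continuous_on[OF bounded_linear_blinfun_inner_right])
  have "((\<lambda>z. integral (cbox 0 1) (\<lambda>s. bump ((z - x - s *\<^sub>R h) /\<^sub>R r))) has_derivative
     integral (cbox 0 1) (\<lambda>s. blinfun_inner_right (bump_grad ((z - x - s *\<^sub>R h) /\<^sub>R r) /\<^sub>R r)))
      (at z within UNIV)"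
  proof (rule leibniz_rule)
    fix z :: "real^'a" and s :: real
    have "((\<lambda>z. (z - x - s *\<^sub>R h) /\<^sub>R r) has_derivative (\<lambda>v. v /\<^sub>R r)) (at z)"
      by (auto intro!: derivative_eq_intros)
    from has_derivative_compose[OF this bump_has_derivative]
    show "((\<lambda>z. bump ((z - x - s *\<^sub>R h) /\<^sub>R r)) has_derivative
         blinfun_inner_right (bump_grad ((z - x - s *\<^sub>R h) /\<^sub>R r) /\<^sub>R r)) (at z within UNIV)"
      by (rule has_derivative_eq_rhs) (auto simp: fun_eq_iff)
  next
    fix z show "(\<lambda>s. bump ((z - x - s *\<^sub>R h) /\<^sub>R r)) integrable_on cbox 0 1"
      by (intro integrable_continuous continuous_intros)
  next
    show "continuous_on (UNIV \<times> cbox 0 1)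
       (\<lambda>(z, s). blinfun_inner_right (bump_grad ((z - x - s *\<^sub>R h) /\<^sub>R r) /\<^sub>R r))"
      unfolding split_def
      by (intro continuous_intros bounded_linear.continuous_on[OF bounded_linear_blinfun_inner_right])
  qed auto
  moreover have "blinfun_apply (integral (cbox 0 1) (\<lambda>s. blinfun_inner_right (bump_grad ((z - x - s *\<^sub>R h) /\<^sub>R r) /\<^sub>R r))) v
       = v \<bullet> seg_bump_grad r x h z" for v
  proof -
    have "(\<lambda>s. bump_grad ((z - x - s *\<^sub>R h) /\<^sub>R r) /\<^sub>R r) integrable_on cbox 0 1"
      by (intro integrable_continuous continuous_intros)
    from integral_linear[OF this bounded_linear_inner_right[of v]]
    have e: "v \<bullet> seg_bump_grad r x h z =
        integral (cbox 0 1) (\<lambda>s. v \<bullet> (bump_grad ((z - x - s *\<^sub>R h) /\<^sub>R r) /\<^sub>R r))"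
      unfolding seg_bump_grad_def o_def by (rule sym)
    have "(\<lambda>s. blinfun_inner_right (bump_grad ((z - x - s *\<^sub>R h) /\<^sub>R r) /\<^sub>R r)) integrable_on cbox 0 1"
      by (rule integrable_continuous[OF c])
    from blinfun_apply_integral[OF this, of v] show ?thesis unfolding e
      by (simp add: inner_commute)
  qed
  ultimately show ?thesis
    unfolding gderiv_def seg_bump_def[abs_def] by (auto intro: has_derivative_eq_rhs)
qed

lemma continuous_on_seg_bump_grad: "continuous_on UNIV (seg_bump_grad r x h)"
proof -
  have "continuous_on UNIV (\<lambda>z. integral (cbox 0 1) (\<lambda>s. bump_grad ((z - x - s *\<^sub>R h) /\<^sub>R r) /\<^sub>R r))"
    by (rule integral_continuous_on_param) (auto simp: split_def intro!: continuous_intros)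
  then show ?thesis by (simp add: seg_bump_grad_def[abs_def])
qed

text \<open>Fundamental theorem of calculus in the averaging parameter \<open>s\<close>: the
  integrand is the derivative of \<open>- bump\<close> along the segment, so only the two end bumps
  survive.\<close>

lemma seg_bump_grad_inner:
  "seg_bump_grad r x h z \<bullet> h = bump ((z - x) /\<^sub>R r) - bump ((z - x - h) /\<^sub>R r)"
proof -
  have "(\<lambda>s. bump_grad ((z - x - s *\<^sub>R h) /\<^sub>R r) /\<^sub>R r) integrable_on cbox 0 1"
    by (intro integrable_continuous continuous_intros)
  from integral_linear[OF this bounded_linear_inner_left[of h]]
  have e: "seg_bump_grad r x h z \<bullet> h =
        integral (cbox 0 1) (\<lambda>s. (bump_grad ((z - x - s *\<^sub>R h) /\<^sub>R r) /\<^sub>R r) \<bullet> h)"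
    unfolding seg_bump_grad_def o_def by (rule sym)
  have "((\<lambda>s. (bump_grad ((z - x - s *\<^sub>R h) /\<^sub>R r) /\<^sub>R r) \<bullet> h) has_integral
      (- bump ((z - x - 1 *\<^sub>R h) /\<^sub>R r)) - (- bump ((z - x - 0 *\<^sub>R h) /\<^sub>R r))) {0..1}"
  proof (rule fundamental_theorem_of_calculus)
    fix s :: real
    have "((\<lambda>s. (z - x - s *\<^sub>R h) /\<^sub>R r) has_derivative (\<lambda>v. (- v *\<^sub>R h) /\<^sub>R r)) (at s within {0..1})"
      by (auto intro!: derivative_eq_intros)
    from has_derivative_compose[OF this bump_has_derivative]
    have "((\<lambda>s. bump ((z - x - s *\<^sub>R h) /\<^sub>R r)) has_derivative
      (\<lambda>v. v * (- ((bump_grad ((z - x - s *\<^sub>R h) /\<^sub>R r) /\<^sub>R r) \<bullet> h)))) (at s within {0..1})"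
      by (simp add: mult_ac)
    then have "((\<lambda>s. - bump ((z - x - s *\<^sub>R h) /\<^sub>R r)) has_real_derivative
      (bump_grad ((z - x - s *\<^sub>R h) /\<^sub>R r) /\<^sub>R r) \<bullet> h) (at s within {0..1})"
      by (auto simp: has_field_derivative_def intro!: derivative_eq_intros)
    then show "((\<lambda>s. - bump ((z - x - s *\<^sub>R h) /\<^sub>R r)) has_vector_derivative
      (bump_grad ((z - x - s *\<^sub>R h) /\<^sub>R r) /\<^sub>R r) \<bullet> h) (at s within {0..1})"
      by (simp add: has_real_derivative_iff_has_vector_derivative)
  qed auto
  from integral_unique[OF this] show ?thesis unfolding e box_real by simp
qed

lemma seg_bump_eq_0: assumes "z \<notin> seg_nbhd r x h" "r > 0" shows "seg_bump r x h z = 0"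
proof -
  have "bump ((z - x - s *\<^sub>R h) /\<^sub>R r) = 0" if "s \<in> cbox 0 1" for s
  proof (rule bump_eq_0, rule notI)
    assume "(z - x - s *\<^sub>R h) /\<^sub>R r \<in> cball 1 1"
    moreover have "z = x + s *\<^sub>R h + r *\<^sub>R ((z - x - s *\<^sub>R h) /\<^sub>R r)" using assms(2) by simp
    ultimately have "z \<in> seg_nbhd r x h" unfolding seg_nbhd_def using that
      by (auto intro!: image_eqI[where x="(s, (z - x - s *\<^sub>R h) /\<^sub>R r)"])
    with assms show False by blast
  qed
  then show ?thesis unfolding seg_bump_def by (subst Henstock_Kurzweil_Integration.integral_cong[where g="\<lambda>_. 0"]) auto
qed

lemma test_function_seg_bump:
  assumes "seg_nbhd r x h \<subseteq> D" "r > 0"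
  shows "test_function D (seg_bump r x h) (seg_bump_grad r x h)"
proof -
  have "closure {z. seg_bump r x h z \<noteq> 0} \<subseteq> seg_nbhd r x h"
    by (rule closure_minimal) (use seg_bump_eq_0 assms in \<open>auto intro!: compact_imp_closed compact_seg_nbhd\<close>)
  then show ?thesis unfolding test_function_def
    using seg_bump_GDERIV continuous_on_seg_bump_grad assms
      compact_seg_nbhd[of r x h] by (meson closed_closure compact_closure bounded_subset closure_subset compact_imp_bounded order_trans)
qed

lemma continuous_on_seg_bump: "continuous_on UNIV (seg_bump r x h)"
  using seg_bump_GDERIV unfolding gderiv_def
  by (metis has_derivative_continuous continuous_at_imp_continuous_on)

lemma seg_bump_nonneg: "0 \<le> seg_bump r x h z"
  unfolding seg_bump_def by (intro integral_nonneg integrable_continuous continuous_intros) (simp add: bump_nonneg)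

lemma seg_bump_le_1: "seg_bump r x h z \<le> 1"
proof -
  have "seg_bump r x h z \<le> integral (cbox 0 1) (\<lambda>s::real. 1)"
    unfolding seg_bump_def by (intro integral_le integrable_continuous continuous_intros) (simp add: bump_le_1)
  then show ?thesis by simp
qed

section \<open>Affine changes of variables and the mass of the bumps\<close>

lemma sum_Basis_vec_eq_1: "(\<Sum>Basis :: real^'d) = 1"
proof -
  have "(\<Sum>Basis :: real^'d) $ i = 1" for i
  proof -
    have "(\<Sum>Basis :: real^'d) $ i = (\<Sum>Basis :: real^'d) \<bullet> axis i 1" by (simp add: inner_axis)
    also have "\<dots> = 1" using inner_sum_Basis[of "axis i 1 :: real^'d"] by (simp add: axis_in_Basis_iff)
    finally show ?thesis .
  qed
  then show ?thesis by (simp add: vec_eq_iff)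
qed

text \<open>The coordinatewise affine change of variables, specialised to one common factor, so that
  the Jacobian is \<open>r ^ CARD('d)\<close>.\<close>

lemma measurable_affine_lebesgue:
  "r \<noteq> 0 \<Longrightarrow> (\<lambda>x::real^'d. a + r *\<^sub>R x) \<in> lebesgue \<rightarrow>\<^sub>M lebesgue"
  and nn_integral_affine_lebesgue:
  "f \<in> borel_measurable lebesgue \<Longrightarrow> r > 0 \<Longrightarrow>
    (\<integral>\<^sup>+x. f x \<partial>lebesgue) = ennreal (r ^ CARD('d)) * (\<integral>\<^sup>+x. f (a + r *\<^sub>R x :: real^'d) \<partial>lebesgue)"
proof -
  have T: "(\<lambda>x::real^'d. a + (\<Sum>j\<in>Basis. (r * (x \<bullet> j)) *\<^sub>R j)) = (\<lambda>x. a + r *\<^sub>R x)" for r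
    by (simp add: scaleR_scaleR[symmetric] scaleR_sum_right[symmetric] euclidean_representation del: scaleR_scaleR)
  show 1: "(\<lambda>x::real^'d. a + r *\<^sub>R x) \<in> lebesgue \<rightarrow>\<^sub>M lebesgue" if "r \<noteq> 0" for r
    using lebesgue_affine_measurable[of "\<lambda>_. r" a] that by (simp add: T)
  assume f: "f \<in> borel_measurable lebesgue" and r: "r > 0"
  have "lebesgue = density (distr lebesgue lebesgue (\<lambda>x::real^'d. a + r *\<^sub>R x)) (\<lambda>_. ennreal (r ^ CARD('d)))"
    using lebesgue_affine_euclidean[of "\<lambda>_. r" a] r by (simp add: T)
  then have "(\<integral>\<^sup>+x. f x \<partial>lebesgue) =
     (\<integral>\<^sup>+x. f x \<partial>density (distr lebesgue lebesgue (\<lambda>x::real^'d. a + r *\<^sub>R x)) (\<lambda>_. ennreal (r ^ CARD('d))))"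
    by simp
  also have "\<dots> = (\<integral>\<^sup>+x. ennreal (r ^ CARD('d)) * f x \<partial>distr lebesgue lebesgue (\<lambda>x::real^'d. a + r *\<^sub>R x))"
    using f by (subst nn_integral_density) auto
  also have "\<dots> = (\<integral>\<^sup>+x. ennreal (r ^ CARD('d)) * f (a + r *\<^sub>R x) \<partial>lebesgue)"
    using 1 r f by (subst nn_integral_distr) auto
  also have "\<dots> = ennreal (r ^ CARD('d)) * (\<integral>\<^sup>+x. f (a + r *\<^sub>R x :: real^'d) \<partial>lebesgue)"
    using measurable_compose[OF 1 f] r by (subst nn_integral_cmult) auto
  finally show "(\<integral>\<^sup>+x. f x \<partial>lebesgue) = ennreal (r ^ CARD('d)) * (\<integral>\<^sup>+x. f (a + r *\<^sub>R x :: real^'d) \<partial>lebesgue)" .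
qed

lemma AE_affine_lebesgue:
  assumes "AE x::real^'d in lebesgue. P x" "r > 0"
  shows "AE x in lebesgue. P (a + r *\<^sub>R x)"
proof -
  obtain N where N: "{x. \<not> P x} \<subseteq> N" "emeasure lebesgue N = 0" "N \<in> sets lebesgue"
    using assms(1) by (auto elim!: AE_E)
  have m: "(\<lambda>x. indicator N x :: ennreal) \<in> borel_measurable lebesgue" using N by simp
  have "0 = (\<integral>\<^sup>+x. indicator N x \<partial>lebesgue)" using N by simp
  also have "\<dots> = ennreal (r ^ CARD('d)) * (\<integral>\<^sup>+x. indicator N (a + r *\<^sub>R x) \<partial>lebesgue)"
    using nn_integral_affine_lebesgue[OF m assms(2), of a] by simp
  finally have "(\<integral>\<^sup>+x. indicator N (a + r *\<^sub>R x) \<partial>lebesgue) = 0"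
    using zero_less_power[OF assms(2), of "CARD('d)"] by (auto simp: ennreal_eq_0_iff)
  then have "AE x in lebesgue. (indicator N (a + r *\<^sub>R x) :: ennreal) = 0"
    using measurable_compose[OF measurable_affine_lebesgue m] assms(2)
    by (subst (asm) nn_integral_0_iff_AE) auto
  then show ?thesis by (rule AE_mp) (use N in \<open>auto split: split_indicator\<close>)
qed

lemma continuous_imp_measurable_lebesgue:
  "continuous_on UNIV f \<Longrightarrow> f \<in> borel_measurable lebesgue"
  by (simp add: measurable_completion borel_measurable_continuous_onI)

text \<open>Only the dimension enters, hence the \<open>itself\<close> argument. Estimates are
  normalised by \<open>r ^ CARD('d) * bump_mass TYPE('d)\<close>, the mass of a bump of size
  \<open>r\<close>.\<close>

definition bump_mass :: "'d::finite itself \<Rightarrow> real" where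
  "bump_mass _ = (\<integral>x. bump (x :: real^'d) \<partial>lebesgue)"

lemma cball_1_subset: "cball 1 1 \<subseteq> cbox 0 (2 :: real^'d)"
proof
  fix z :: "real^'d" assume "z \<in> cball 1 1"
  then have "norm (z - 1) \<le> 1" by (simp add: dist_norm norm_minus_commute)
  then have "\<bar>z $ i - 1\<bar> \<le> 1" for i using component_le_norm_cart[of "z - 1" i] by simp
  then have "0 \<le> z $ i \<and> z $ i \<le> 2" for i using \<open>\<And>i. \<bar>z $ i - 1\<bar> \<le> 1\<close>[of i] by linarith
  then show "z \<in> cbox 0 2" by (simp add: mem_box_cart)
qed

lemma integrable_bump: "integrable lebesgue (bump :: real^'d \<Rightarrow> real)"
proof (rule Bochner_Integration.integrable_bound)
  show "integrable lebesgue (indicat_real (cball 1 1 :: (real^'d) set))"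
    by (simp add: lmeasurable_iff_integrable[symmetric])
  show "bump \<in> borel_measurable lebesgue"
    by (rule continuous_imp_measurable_lebesgue) (rule continuous_on_bump[OF continuous_on_id])
  show "AE x :: real^'d in lebesgue. norm (bump x) \<le> norm (indicat_real (cball 1 1) x)"
  proof (intro always_eventually allI)
    show "norm (bump x) \<le> norm (indicat_real (cball 1 1) x)" for x :: "real^'d"
      using bump_eq_0[of x] bump_le_1[of x] bump_nonneg[of x] by (cases "x \<in> cball 1 1") auto
  qed
qed

lemma bump_mass_pos: "bump_mass TYPE('d::finite) > 0"
proof -
  have "bump_mass TYPE('d) \<noteq> 0"
  proof
    assume "bump_mass TYPE('d) = 0"
    then have "AE x :: real^'d in lebesgue. bump x = 0"
      unfolding bump_mass_def
      by (subst (asm) integral_nonneg_eq_0_iff_AE) (auto simp: integrable_bump bump_nonneg)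
    moreover have "bump x \<noteq> 0" if "x \<in> ball 1 1" for x :: "real^'d"
    proof -
      have "norm (x - 1) < 1" using that by (simp add: dist_norm norm_minus_commute)
      then have "(norm (x - 1))\<^sup>2 < 1" by (simp add: power_less_one_iff)
      then show ?thesis by (simp add: bump_def power2_norm_eq_inner)
    qed
    ultimately have "AE x :: real^'d in lebesgue. x \<notin> ball 1 1"
      by (auto elim!: AE_mp)
    then have "emeasure lebesgue (ball (1::real^'d) 1) = 0"
      by (subst (asm) AE_iff_measurable[OF _ refl]) (auto simp: ball_def)
    moreover have "measure lborel (ball (1::real^'d) 1) > 0" by (rule content_ball_pos) simp
    ultimately show False by (simp add: measure_def)
  qed
  moreover have "bump_mass TYPE('d) \<ge> 0" unfolding bump_mass_def by (simp add: bump_nonneg)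
  ultimately show ?thesis by simp
qed

lemma nn_integral_bump:
  fixes x :: "real^'d"
  assumes "r > 0"
  shows "(\<integral>\<^sup>+z. ennreal (bump ((z - x) /\<^sub>R r)) \<partial>lebesgue) = ennreal (r ^ CARD('d) * bump_mass TYPE('d))"
proof -
  have m: "(\<lambda>z. ennreal (bump ((z - x) /\<^sub>R r))) \<in> borel_measurable lebesgue"
    by (intro measurable_compose[OF _ measurable_ennreal] continuous_imp_measurable_lebesgue continuous_intros)
  have "(\<integral>\<^sup>+z. ennreal (bump ((z - x) /\<^sub>R r)) \<partial>lebesgue) =
     ennreal (r ^ CARD('d)) * (\<integral>\<^sup>+z. ennreal (bump ((x + r *\<^sub>R z - x) /\<^sub>R r)) \<partial>lebesgue)"
    by (rule nn_integral_affine_lebesgue[OF m assms])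
  also have "(\<lambda>z. ennreal (bump ((x + r *\<^sub>R z - x) /\<^sub>R r))) = (\<lambda>z. ennreal (bump z))"
    using assms by simp
  also have "(\<integral>\<^sup>+z. ennreal (bump (z::real^'d)) \<partial>lebesgue) = ennreal (bump_mass TYPE('d))"
    unfolding bump_mass_def by (rule nn_integral_eq_integral[OF integrable_bump]) (simp add: bump_nonneg)
  finally show ?thesis using assms by (simp add: ennreal_mult')
qed

text \<open>Tonelli in space and in the averaging parameter: all bumps on the segment have the same
  mass, so the average has it too, independently of \<open>h\<close>. The integral over
  \<open>s\<close> is first rewritten as a nonnegative integral over \<open>lborel\<close> to make
  the exchange available.\<close>

lemma nn_integral_seg_bump:
  fixes x :: "real^'d"
  assumes "r > 0"
  shows "(\<integral>\<^sup>+z. ennreal (seg_bump r x h z) \<partial>lebesgue) = ennreal (r ^ CARD('d) * bump_mass TYPE('d))"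
proof -
  have e: "ennreal (seg_bump r x h z) =
      (\<integral>\<^sup>+s. ennreal (bump ((z - x - s *\<^sub>R h) /\<^sub>R r)) * indicator {0..1} s \<partial>lborel)" for z
    unfolding seg_bump_def
    by (subst nn_integral_has_integral_lebesgue') (auto simp: bump_nonneg intro!: integrable_integral integrable_continuous_real continuous_intros)
  have "(\<integral>\<^sup>+z. ennreal (seg_bump r x h z) \<partial>lebesgue) = 
     (\<integral>\<^sup>+z. \<integral>\<^sup>+s. ennreal (bump ((z - x - s *\<^sub>R h) /\<^sub>R r)) * indicator {0..1} s \<partial>lborel \<partial>lborel)"
    unfolding e[symmetric] by (rule nn_integral_completion)
  also have "\<dots> = (\<integral>\<^sup>+s. \<integral>\<^sup>+z. ennreal (bump ((z - x - s *\<^sub>R h) /\<^sub>R r)) * indicator {0..1} s \<partial>lborel \<partial>lborel)"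
  proof (rule lborel_pair.Fubini')
    have "(\<lambda>(s, z). bump ((z - x - s *\<^sub>R h) /\<^sub>R r)) \<in> borel_measurable borel"
      by (intro borel_measurable_continuous_onI) (auto simp: split_def intro!: continuous_intros)
    then have "(\<lambda>(s, z). bump ((z - x - s *\<^sub>R h) /\<^sub>R r)) \<in> borel_measurable (lborel \<Otimes>\<^sub>M lborel)"
      by (simp add: lborel_prod)
    then show "(\<lambda>(s, z). ennreal (bump ((z - x - s *\<^sub>R h) /\<^sub>R r)) * indicator {0..1} s) \<in> borel_measurable (lborel \<Otimes>\<^sub>M lborel)"
      unfolding split_def by (intro borel_measurable_times_ennreal measurable_compose[OF _ measurable_ennreal]) auto
  qed
  also have "\<dots> = (\<integral>\<^sup>+s. ennreal (r ^ CARD('d) * bump_mass TYPE('d)) * indicator {0..1::real} s \<partial>lborel)"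
  proof (rule nn_integral_cong)
    fix s :: real
    have m: "(\<lambda>z. ennreal (bump ((z - x - s *\<^sub>R h) /\<^sub>R r))) \<in> borel_measurable lborel"
      by (intro measurable_compose[OF _ measurable_ennreal]) (simp, intro borel_measurable_continuous_onI continuous_intros)
    have "(\<integral>\<^sup>+z. ennreal (bump ((z - x - s *\<^sub>R h) /\<^sub>R r)) * indicator {0..1} s \<partial>lborel)
      = (\<integral>\<^sup>+z. ennreal (bump ((z - (x + s *\<^sub>R h)) /\<^sub>R r)) \<partial>lebesgue) * indicator {0..1} s"
      using m by (subst nn_integral_multc) (auto simp: nn_integral_completion diff_diff_eq)
    also have "\<dots> = ennreal (r ^ CARD('d) * bump_mass TYPE('d)) * indicator {0..1::real} s"
      by (subst nn_integral_bump[OF assms]) simp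
    finally show "(\<integral>\<^sup>+z. ennreal (bump ((z - x - s *\<^sub>R h) /\<^sub>R r)) * indicator {0..1} s \<partial>lborel) = \<dots>" .
  qed
  also have "\<dots> = ennreal (r ^ CARD('d) * bump_mass TYPE('d))"
    by (subst nn_integral_cmult) auto
  finally show ?thesis .
qed

section \<open>Weak gradients tested against averaged bumps\<close>

text \<open>The integral over \<open>D\<close> is one over \<open>K\<close>, where the continuous
  factor is bounded. Demanding zero off a given \<open>K\<close>, rather than off the closed
  support, lets the lemma serve test functions and the components of their gradients alike.\<close>

lemma integrable_locally_mult:
  assumes "locally_integrable D w" "compact K" "K \<subseteq> D" "open D" "continuous_on UNIV \<phi>" "\<And>x. x \<notin> K \<Longrightarrow> \<phi> x = 0"
  shows "integrable (lebesgue_on D) (\<lambda>x. (w x \<bullet> b) * \<phi> x)"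
proof -
  have wK: "set_integrable lebesgue K (\<lambda>x. w x \<bullet> b)"
    using assms absolutely_integrable_component unfolding locally_integrable_def by blast
  have "set_integrable lebesgue K (\<lambda>x. \<phi> x * (w x \<bullet> b))"
  proof (rule absolutely_integrable_bounded_measurable_product[OF bilinear_times])
    show "\<phi> \<in> borel_measurable (lebesgue_on K)"
      using continuous_imp_measurable_lebesgue[OF assms(5)] by (rule measurable_restrict_space1)
    show "bounded (\<phi> ` K)"
      by (meson assms(2,5) compact_continuous_image compact_imp_bounded continuous_on_subset subset_UNIV)
  qed (use assms wK in \<open>auto intro: lmeasurable_compact fmeasurableD\<close>)
  then have "integrable lebesgue (\<lambda>x. indicator K x *\<^sub>R (\<phi> x * (w x \<bullet> b)))"
    by (simp add: set_integrable_def)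
  also have "(\<lambda>x. indicator K x *\<^sub>R (\<phi> x * (w x \<bullet> b))) = (\<lambda>x. indicator D x *\<^sub>R ((w x \<bullet> b) * \<phi> x))"
    using assms by (auto simp: fun_eq_iff indicator_def)
  finally show ?thesis using assms(4) by (subst integrable_restrict_space) auto
qed

lemma bump_grad_eq_0: "z \<notin> cball 1 1 \<Longrightarrow> bump_grad z = 0"
proof -
  assume "z \<notin> cball 1 1"
  then have "1 < norm (z - 1)" by (simp add: dist_norm norm_minus_commute)
  then have "1 < (norm (z - 1))\<^sup>2" by (simp add: one_less_power)
  then show ?thesis by (simp add: bump_grad_def power2_norm_eq_inner)
qed

lemma seg_bump_grad_eq_0: assumes "z \<notin> seg_nbhd r x h" "r > 0" shows "seg_bump_grad r x h z = 0"
proof -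
  have "bump_grad ((z - x - s *\<^sub>R h) /\<^sub>R r) = 0" if "s \<in> cbox 0 1" for s
  proof (rule bump_grad_eq_0, rule notI)
    assume "(z - x - s *\<^sub>R h) /\<^sub>R r \<in> cball 1 1"
    moreover have "z = x + s *\<^sub>R h + r *\<^sub>R ((z - x - s *\<^sub>R h) /\<^sub>R r)" using assms(2) by simp
    ultimately have "z \<in> seg_nbhd r x h" unfolding seg_nbhd_def using that
      by (auto intro!: image_eqI[where x="(s, (z - x - s *\<^sub>R h) /\<^sub>R r)"])
    with assms show False by blast
  qed
  then show ?thesis unfolding seg_bump_grad_def by (subst Henstock_Kurzweil_Integration.integral_cong[where g="\<lambda>_. 0"]) auto
qed

text \<open>The identities for the partial derivatives are combined with the weights
  \<open>h $ j\<close>. The directional derivative of the averaged bump is a difference of two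
  bumps, so an identity about derivatives of test functions becomes one about a finite difference of
  \<open>u\<close>.\<close>

lemma weak_gradient_seg_bump:
  fixes u :: "real^'d \<Rightarrow> real^'m"
  assumes wg: "has_weak_gradient D u G" and D: "open D" "seg_nbhd r x h \<subseteq> D" and r: "r > 0"
  shows "(\<integral>z. u z $ i * (bump ((z - x) /\<^sub>R r) - bump ((z - x - h) /\<^sub>R r)) \<partial>lebesgue_on D)
       = - (\<integral>z. (G z *v h) $ i * seg_bump r x h z \<partial>lebesgue_on D)"
proof -
  have li: "locally_integrable D u" "locally_integrable D G"
    using wg by (auto simp: has_weak_gradient_def)
  have I1: "integrable (lebesgue_on D) (\<lambda>z. u z $ i * seg_bump_grad r x h z $ j)" for j
  proof -
    have "continuous_on UNIV (\<lambda>z. seg_bump_grad r x h z $ j)"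
      by (intro continuous_on_component continuous_on_seg_bump_grad)
    from integrable_locally_mult[OF li(1) compact_seg_nbhd D(2) D(1) this, of "axis i 1"]
    show ?thesis using seg_bump_grad_eq_0[OF _ r, of _ x h] by (auto simp: inner_axis)
  qed
  have I2: "integrable (lebesgue_on D) (\<lambda>z. G z $ i $ j * seg_bump r x h z)" for j
    using integrable_locally_mult[OF li(2) compact_seg_nbhd D(2) D(1),
        of "\<lambda>z. seg_bump r x h z" "axis i (axis j 1)"] seg_bump_eq_0[OF _ r]
    by (auto simp: inner_axis continuous_on_seg_bump)
  have "(\<integral>z. u z $ i * (bump ((z - x) /\<^sub>R r) - bump ((z - x - h) /\<^sub>R r)) \<partial>lebesgue_on D)
     = (\<integral>z. (\<Sum>j\<in>UNIV. h $ j * (u z $ i * seg_bump_grad r x h z $ j)) \<partial>lebesgue_on D)"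
    unfolding seg_bump_grad_inner[symmetric]
    by (intro Bochner_Integration.integral_cong) (auto simp: inner_vec_def sum_distrib_left mult_ac)
  also have "\<dots> = (\<Sum>j\<in>UNIV. h $ j * (\<integral>z. u z $ i * seg_bump_grad r x h z $ j \<partial>lebesgue_on D))"
    using I1 by (subst Bochner_Integration.integral_sum) auto
  also have "\<dots> = (\<Sum>j\<in>UNIV. h $ j * - (\<integral>z. G z $ i $ j * seg_bump r x h z \<partial>lebesgue_on D))"
  proof (intro sum.cong refl arg_cong2[where f="(*)"])
    show "(\<integral>z. u z $ i * seg_bump_grad r x h z $ j \<partial>lebesgue_on D)
       = - (\<integral>z. G z $ i $ j * seg_bump r x h z \<partial>lebesgue_on D)" for j
      using wg test_function_seg_bump[OF D(2) r] unfolding has_weak_gradient_def by blast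
  qed
  also have "\<dots> = - (\<integral>z. (\<Sum>j\<in>UNIV. h $ j * (G z $ i $ j * seg_bump r x h z)) \<partial>lebesgue_on D)"
    using I2 by (subst Bochner_Integration.integral_sum) (auto simp: sum_negf)
  also have "\<dots> = - (\<integral>z. (G z *v h) $ i * seg_bump r x h z \<partial>lebesgue_on D)"
    by (simp add: matrix_vector_mult_def sum_distrib_left sum_distrib_right mult_ac)
  finally show ?thesis .
qed

section \<open>Lebesgue points with respect to corner cubes\<close>

lemma AE_lebesgue_on_iff:
  "D \<in> sets lebesgue \<Longrightarrow> (AE x in lebesgue_on D. P x) \<longleftrightarrow> (AE x in lebesgue. x \<in> D \<longrightarrow> P x)"
  by (rule AE_restrict_space_iff) simp

lemma emeasure_corner_cube:
  assumes "r \<ge> 0" shows "emeasure lebesgue (cbox x (x + r *\<^sub>R 1 :: real^'d)) = ennreal (r ^ CARD('d))"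
proof -
  have "measure lborel (cbox x (x + r *\<^sub>R 1)) = r ^ CARD('d)"
    using assms by (subst content_cbox_cart) (auto simp: interval_ne_empty_cart)
  then show ?thesis by (simp add: emeasure_eq_measure2 measure_completion)
qed

lemma corner_cube_subset_ball:
  assumes "r \<ge> 0" "y \<in> cbox x (x + r *\<^sub>R 1 :: real^'d)" shows "dist x y \<le> r * CARD('d)"
proof -
  have "norm (y - x) \<le> (\<Sum>i\<in>UNIV. \<bar>(y - x) $ i\<bar>)" by (rule norm_le_l1_cart)
  also have "\<dots> \<le> (\<Sum>i\<in>(UNIV::'d set). r)"
    using assms(2) by (intro sum_mono) (auto simp: mem_box_cart abs_le_iff algebra_simps intro: order_trans[OF _ assms(1)])
  finally show ?thesis by (simp add: dist_norm norm_minus_commute mult.commute)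
qed

text \<open>The differentiation theorem for corner cubes is applied to the countably many real
  functions \<open>norm (G x - q)\<close>, with \<open>q\<close> in a countable dense set, each
  localised to a member of a compact exhaustion of \<open>D\<close>. Off one null set, choosing
  \<open>q\<close> close to \<open>G x\<close> then makes the mean deviation of \<open>G\<close>
  from \<open>G x\<close> small, which is more than convergence of the means.\<close>

lemma lebesgue_points:
  fixes G :: "real^'d \<Rightarrow> 'b::euclidean_space"
  assumes G: "locally_integrable D G" and D: "open D"
  shows "AE x in lebesgue. x \<in> D \<longrightarrow> (\<forall>e>0. \<exists>\<delta>>0. \<forall>r. 0 < r \<and> r < \<delta> \<longrightarrow> cbox x (x + r *\<^sub>R 1) \<subseteq> D \<and>
     (\<integral>\<^sup>+z. ennreal (norm (G z - G x)) * indicator (cbox x (x + r *\<^sub>R 1)) z \<partial>lebesgue) \<le> ennreal (e * r ^ CARD('d)))"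
proof -
  obtain C where C: "\<And>n. compact (C n)" "\<And>n. C n \<subseteq> D" "\<And>n. C n \<subseteq> interior (C (Suc n))" "\<Union>(range C) = D"
    using open_Union_compact_subsets[OF D] by metis
  obtain Q :: "'b set" where Q: "countable Q" "\<And>X. open X \<Longrightarrow> X \<noteq> {} \<Longrightarrow> \<exists>d\<in>Q. d \<in> X"
    using countable_dense_setE by blast
  define F where "F = (\<lambda>n q x. indicator (C n) x * norm (G x - q))"
  have Fint: "integrable lebesgue (F n q)" for n q
  proof -
    have "set_integrable lebesgue (C n) G" using G C by (auto simp: locally_integrable_def)
    moreover have "set_integrable lebesgue (C n) (\<lambda>_. q)"
      unfolding set_integrable_def using C(1)
      by (intro integrable_scaleR_left) (auto simp: lmeasurable_iff_integrable[symmetric] intro: lmeasurable_compact)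
    ultimately have "set_integrable lebesgue (C n) (\<lambda>x. G x - q)" by (rule set_integral_diff)
    then have "set_integrable lebesgue (C n) (\<lambda>x. norm (G x - q))" by (rule set_integrable_norm)
    then show ?thesis by (simp add: set_integrable_def F_def)
  qed
  have Fint': "F n q integrable_on cbox a b" for n q a b
  proof -
    have "F n q absolutely_integrable_on UNIV" using Fint by (simp add: set_integrable_def)
    then show ?thesis
      using absolutely_integrable_on_def integrable_on_subcbox by blast
  qed
  have "\<exists>N. negligible N \<and> (\<forall>x e. x \<notin> N \<and> 0 < e \<longrightarrow>
               (\<exists>d>0. \<forall>h. 0 < h \<and> h < d \<longrightarrow>
                  norm(integral (cbox x (x + h *\<^sub>R 1)) (F n q) /\<^sub>R h ^ CARD('d) - F n q x) < e))" for n q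
    using integrable_ccontinuous_explicit[OF Fint'[of n q]] unfolding sum_Basis_vec_eq_1 by simp metis
  then obtain N where N: "\<And>n q. negligible (N n q)"
    "\<And>n q x e. x \<notin> N n q \<Longrightarrow> 0 < e \<Longrightarrow>
               (\<exists>d>0. \<forall>h. 0 < h \<and> h < d \<longrightarrow>
                  norm(integral (cbox x (x + h *\<^sub>R 1)) (F n q) /\<^sub>R h ^ CARD('d) - F n q x) < e)"
    by metis
  have "(\<Union>n. \<Union>q\<in>Q. N n q) \<in> null_sets lebesgue"
    using N(1) Q(1) by (intro null_sets_UN null_sets_UN') (auto simp: negligible_iff_null_sets)
  moreover have "\<exists>\<delta>>0. \<forall>r. 0 < r \<and> r < \<delta> \<longrightarrow> cbox x (x + r *\<^sub>R 1) \<subseteq> D \<and>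
     (\<integral>\<^sup>+z. ennreal (norm (G z - G x)) * indicator (cbox x (x + r *\<^sub>R 1)) z \<partial>lebesgue) \<le> ennreal (e * r ^ CARD('d))"
    if x: "x \<in> D" "x \<notin> (\<Union>n. \<Union>q\<in>Q. N n q)" and e: "e > 0" for x e
  proof -
    \<comment> \<open>With \<open>q\<close> within \<open>e / 4\<close> of \<open>G x\<close>, the
      mean of \<open>F n q\<close> ends below \<open>e / 2\<close>, and replacing \<open>q\<close>
      by \<open>G x\<close> costs another \<open>e / 4\<close>.\<close>
    obtain q where q: "q \<in> Q" "dist (G x) q < e / 4" using Q(2)[of "ball (G x) (e / 4)"] e by auto
    obtain n where "x \<in> interior (C n)" using C x by blast
    then obtain \<delta>0 where \<delta>0: "\<delta>0 > 0" "cball x \<delta>0 \<subseteq> C n" by (meson mem_interior_cball)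
    obtain d where d: "d > 0" "\<And>h. 0 < h \<Longrightarrow> h < d \<Longrightarrow>
                  norm(integral (cbox x (x + h *\<^sub>R 1)) (F n q) /\<^sub>R h ^ CARD('d) - F n q x) < e / 4"
      using N(2)[of x n q "e/4"] x e q by auto
    \<comment> \<open>A point of the corner cube is at distance at most \<open>r * CARD('d)\<close>
      from the corner, by comparison with the sum of the coordinates; hence the division of
      \<open>\<delta>0\<close> by the dimension.\<close>
    have "cbox x (x + r *\<^sub>R 1) \<subseteq> D \<and>
       (\<integral>\<^sup>+z. ennreal (norm (G z - G x)) * indicator (cbox x (x + r *\<^sub>R 1)) z \<partial>lebesgue) \<le> ennreal (e * r ^ CARD('d))"
      if r: "0 < r" "r < min d (\<delta>0 / CARD('d))" for r
    proof -
      let ?B = "cbox x (x + r *\<^sub>R 1)"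
      have B: "?B \<subseteq> C n"
      proof
        fix y assume "y \<in> ?B"
        from corner_cube_subset_ball[OF _ this] r have "dist x y \<le> r * CARD('d)" by simp
        also have "\<dots> \<le> \<delta>0" using r by (simp add: field_simps)
        finally show "y \<in> C n" using \<delta>0 by auto
      qed
      have xC: "x \<in> C n" using \<delta>0 by auto
      let ?I = "integral ?B (F n q)"
      have I: "?I \<le> e / 2 * r ^ CARD('d)"
      proof -
        have "\<bar>?I / r ^ CARD('d) - norm (G x - q)\<bar> < e / 4"
        proof -
          have "F n q x = norm (G x - q)" using xC by (simp add: F_def)
          then show ?thesis using d(2)[of r] r by (simp only: real_norm_def real_scaleR_def divide_inverse mult.commute)
        qed
        then have "?I / r ^ CARD('d) < e / 2" using q(2) unfolding dist_norm abs_less_iff by linarith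
        then show ?thesis using r by (simp add: field_simps)
      qed
      have 1: "(\<integral>\<^sup>+z. ennreal (F n q z) * indicator ?B z \<partial>lebesgue) = ennreal ?I"
        using nn_integral_has_integral_lebesgue'[of ?B "F n q" ?I] integrable_integral[OF Fint'[of n q]]
        by (simp add: nn_integral_completion F_def)
      have "(\<integral>\<^sup>+z. ennreal (norm (G z - G x)) * indicator ?B z \<partial>lebesgue)
         \<le> (\<integral>\<^sup>+z. ennreal (F n q z) * indicator ?B z + ennreal (e / 4) * indicator ?B z \<partial>lebesgue)"
      proof (rule nn_integral_mono)
        fix z :: "real^'d"
        have "norm (G z - G x) \<le> F n q z + e / 4" if "z \<in> ?B"
        proof -
          have "norm (G z - G x) \<le> norm (G z - q) + norm (G x - q)"
            by (metis norm_minus_commute norm_triangle_sub dist_norm dist_triangle3 dist_commute)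
          then show ?thesis using q(2) that B by (auto simp: F_def dist_norm)
        qed
        then show "ennreal (norm (G z - G x)) * indicator ?B z \<le> ennreal (F n q z) * indicator ?B z + ennreal (e / 4) * indicator ?B z"
          using e by (auto simp: indicator_def F_def simp flip: ennreal_plus intro!: ennreal_leI)
      qed
      also have "\<dots> = ennreal ?I + ennreal (e / 4) * emeasure lebesgue ?B"
      proof (subst nn_integral_add)
        have i: "(indicator ?B :: _ \<Rightarrow> ennreal) \<in> borel_measurable lebesgue" by (rule borel_measurable_indicator) simp
        show "(\<lambda>z. ennreal (F n q z) * indicator ?B z) \<in> borel_measurable lebesgue"
          using Fint[of n q] by (intro borel_measurable_times_ennreal i) auto
        show "(\<lambda>z. ennreal (e / 4) * indicator ?B z) \<in> borel_measurable lebesgue"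
          by (intro borel_measurable_times_ennreal i) auto
        have "(\<integral>\<^sup>+z. ennreal (e / 4) * indicator ?B z \<partial>lebesgue) = ennreal (e / 4) * emeasure lebesgue ?B"
          by (rule nn_integral_cmult_indicator) simp
        then show "(\<integral>\<^sup>+z. ennreal (F n q z) * indicator ?B z \<partial>lebesgue) + (\<integral>\<^sup>+z. ennreal (e / 4) * indicator ?B z \<partial>lebesgue)
          = ennreal ?I + ennreal (e / 4) * emeasure lebesgue ?B" unfolding 1 by (simp only:)
      qed
      also have "\<dots> = ennreal ?I + ennreal (e / 4 * r ^ CARD('d))"
        using ennreal_mult[of "e / 4" "r ^ CARD('d)"] emeasure_corner_cube[of r x] r e by simp
      also have "\<dots> \<le> ennreal (e / 2 * r ^ CARD('d)) + ennreal (e / 2 * r ^ CARD('d))"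
        using I e r by (intro add_mono ennreal_leI) auto
      also have "\<dots> = ennreal (e * r ^ CARD('d))" using e r by (subst ennreal_plus[symmetric]) (auto simp: field_simps)
      finally show ?thesis using B C(2) by auto
    qed
    moreover have "min d (\<delta>0 / CARD('d)) > 0" using d \<delta>0 by simp
    ultimately show ?thesis by blast
  qed
  ultimately show ?thesis by (intro AE_I'[where N="\<Union>n. \<Union>q\<in>Q. N n q"]) blast+
qed

lemma norm_matrix_vector_mult_le: "norm (A *v h) \<le> norm A * norm h" for A :: "real^'n^'m"
proof -
  have "norm (A *v h) = L2_set (\<lambda>i. norm ((A *v h) $ i)) UNIV" by (simp add: norm_vec_def)
  also have "\<dots> \<le> L2_set (\<lambda>i. norm (A $ i) * norm h) UNIV"
    by (intro L2_set_mono) (auto simp: matrix_vector_mul_component Cauchy_Schwarz_ineq2)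
  also have "\<dots> = norm A * norm h"
    by (simp add: L2_set_left_distrib norm_vec_def)
  finally show ?thesis .
qed

lemma integral_lebesgue_on_eq:
  fixes f :: "_ \<Rightarrow> 'b::euclidean_space"
  assumes "open D" "\<And>x. x \<notin> D \<Longrightarrow> f x = 0"
  shows "integral\<^sup>L (lebesgue_on D) f = integral\<^sup>L lebesgue f"
proof -
  have "(\<lambda>x. indicator D x *\<^sub>R f x) = f" using assms by (auto simp: fun_eq_iff indicator_def)
  then show ?thesis using assms by (subst integral_restrict_space) auto
qed

lemma integral_seg_bump:
  fixes x :: "real^'d"
  assumes "r > 0"
  shows "integrable lebesgue (seg_bump r x h)"
    and "(\<integral>z. seg_bump r x h z \<partial>lebesgue) = r ^ CARD('d) * bump_mass TYPE('d)"
proof -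
  have "has_bochner_integral lebesgue (seg_bump r x h) (r ^ CARD('d) * bump_mass TYPE('d))"
    using nn_integral_seg_bump[OF assms, of x h] bump_mass_pos[where 'd='d] assms
    by (intro has_bochner_integral_nn_integral continuous_imp_measurable_lebesgue continuous_on_seg_bump)
       (auto simp: seg_bump_nonneg)
  then show "integrable lebesgue (seg_bump r x h)"
    and "(\<integral>z. seg_bump r x h z \<partial>lebesgue) = r ^ CARD('d) * bump_mass TYPE('d)"
    by (auto simp: has_bochner_integral_iff)
qed

lemma seg_bump_0: "seg_bump r x 0 z = bump ((z - x) /\<^sub>R r)"
  by (simp add: seg_bump_def)

lemma seg_nbhd_subset_corner_cube:
  assumes "0 \<le> h" "r > 0" "norm h + 2 * r \<le> R"
  shows "seg_nbhd r x h \<subseteq> cbox x (x + R *\<^sub>R 1 :: real^'d)"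
proof
  fix z assume "z \<in> seg_nbhd r x h"
  then obtain s w where z: "z = x + s *\<^sub>R h + r *\<^sub>R w" "s \<in> {0..1}" "w \<in> cbox 0 2"
    using cball_1_subset unfolding seg_nbhd_def by auto
  have "x $ i \<le> z $ i \<and> z $ i \<le> x $ i + R" for i
  proof -
    have h: "0 \<le> h $ i" "h $ i \<le> norm h" using assms(1) component_le_norm_cart[of h i] by (auto simp: less_eq_vec_def)
    then have "0 \<le> s * h $ i" "s * h $ i \<le> norm h" using z(2) mult_left_le_one_le[of "h $ i" s] by (auto simp: mult_nonneg_nonneg)
    moreover have "0 \<le> w $ i" "w $ i \<le> 2" using z(3) by (auto simp: mem_box_cart)
    then have "0 \<le> r * w $ i" "r * w $ i \<le> 2 * r" using assms(2) by auto
    ultimately show ?thesis using z(1) assms(3) by simp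
  qed
  then show "z \<in> cbox x (x + R *\<^sub>R 1)" by (simp add: mem_box_cart)
qed

text \<open>At a Lebesgue point of the difference \<open>F\<close>, testing with a single bump (the
  case \<open>h = 0\<close>) gives integral zero, while the same integral is close to
  \<open>F x\<close> times the mass of the bump.\<close>

lemma weak_gradient_unique:
  fixes u :: "real^'d \<Rightarrow> real^'m"
  assumes D: "open D" and G: "has_weak_gradient D u G" and H: "has_weak_gradient D u H"
  shows "AE x in lebesgue. x \<in> D \<longrightarrow> G x = H x"
proof -
  define F where "F = (\<lambda>x. G x - H x)"
  have F: "locally_integrable D F"
  proof -
    have "locally_integrable D G" "locally_integrable D H" using G H by (auto simp: has_weak_gradient_def)
    then show ?thesis unfolding locally_integrable_def F_def using set_integral_diff(1) by blast
  qed
  let ?m = "bump_mass TYPE('d)"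
  have claim: "G x = H x" if *: "x \<in> D \<longrightarrow> (\<forall>e>0. \<exists>\<delta>>0. \<forall>r. 0 < r \<and> r < \<delta> \<longrightarrow> cbox x (x + r *\<^sub>R 1) \<subseteq> D \<and>
     (\<integral>\<^sup>+z. ennreal (norm (F z - F x)) * indicator (cbox x (x + r *\<^sub>R 1)) z \<partial>lebesgue) \<le> ennreal (e * r ^ CARD('d)))"
     and x: "x \<in> D" for x
  proof -
    have "\<bar>F x $ i $ j\<bar> * ?m \<le> e" if "e > 0" for e i j
    proof -
      \<comment> \<open>The bump of size \<open>r\<close> lives in a cube of side
        \<open>2 * r\<close>; dividing by \<open>2 ^ CARD('d)\<close> beforehand absorbs the ratio
        of the volumes.\<close>
      define e' where "e' = e / 2 ^ CARD('d)"
      have e': "e' > 0" using that by (simp add: e'_def)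
      obtain \<delta> where \<delta>: "\<delta> > 0" "\<And>r. 0 < r \<Longrightarrow> r < \<delta> \<Longrightarrow> cbox x (x + r *\<^sub>R 1) \<subseteq> D"
        "\<And>r. 0 < r \<Longrightarrow> r < \<delta> \<Longrightarrow> (\<integral>\<^sup>+z. ennreal (norm (F z - F x)) * indicator (cbox x (x + r *\<^sub>R 1)) z \<partial>lebesgue) \<le> ennreal (e' * r ^ CARD('d))"
        using *[rule_format, OF x e'] by blast
      define r where "r = \<delta> / 4"
      have r: "r > 0" "2 * r < \<delta>" using \<delta>(1) by (auto simp: r_def)
      let ?\<phi> = "seg_bump r x 0" and ?g = "seg_bump_grad r x 0" and ?B = "cbox x (x + (2 * r) *\<^sub>R 1)"
      have sub: "seg_nbhd r x 0 \<subseteq> ?B" by (rule seg_nbhd_subset_corner_cube) (use r in auto)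
      then have subD: "seg_nbhd r x 0 \<subseteq> D" using \<delta>(2)[of "2 * r"] r by auto
      note tf = test_function_seg_bump[OF subD r(1)]
      have I: "integrable (lebesgue_on D) (\<lambda>z. K z $ i $ j * ?\<phi> z)" if "locally_integrable D K" for K :: "real^'d \<Rightarrow> real^'d^'m"
        using integrable_locally_mult[OF that compact_seg_nbhd subD D, of ?\<phi> "axis i (axis j 1)"] seg_bump_eq_0[OF _ r(1), of _ x 0]
        by (auto simp: inner_axis continuous_on_seg_bump)
      have z: "(\<integral>z. F z $ i $ j * ?\<phi> z \<partial>lebesgue_on D) = 0"
      proof -
        have "(\<integral>z. F z $ i $ j * ?\<phi> z \<partial>lebesgue_on D) = (\<integral>z. G z $ i $ j * ?\<phi> z \<partial>lebesgue_on D) - (\<integral>z. H z $ i $ j * ?\<phi> z \<partial>lebesgue_on D)"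
        proof -
          have "(\<lambda>z. F z $ i $ j * ?\<phi> z) = (\<lambda>z. G z $ i $ j * ?\<phi> z - H z $ i $ j * ?\<phi> z)"
            by (simp add: F_def left_diff_distrib)
          moreover have "locally_integrable D G" "locally_integrable D H" using G H by (auto simp: has_weak_gradient_def)
          ultimately show ?thesis using Bochner_Integration.integral_diff[OF I I] by simp
        qed
        moreover have "- (\<integral>z. G z $ i $ j * ?\<phi> z \<partial>lebesgue_on D) = - (\<integral>z. H z $ i $ j * ?\<phi> z \<partial>lebesgue_on D)"
        proof -
          have "(\<integral>z. u z $ i * ?g z $ j \<partial>lebesgue_on D) = - (\<integral>z. G z $ i $ j * ?\<phi> z \<partial>lebesgue_on D)"
            using G tf unfolding has_weak_gradient_def by blast
          moreover have "(\<integral>z. u z $ i * ?g z $ j \<partial>lebesgue_on D) = - (\<integral>z. H z $ i $ j * ?\<phi> z \<partial>lebesgue_on D)"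
            using H tf unfolding has_weak_gradient_def by blast
          ultimately show ?thesis by linarith
        qed
        ultimately show ?thesis by linarith
      qed
      have zD: "?\<phi> z = 0" if "z \<notin> D" for z using seg_bump_eq_0[OF _ r(1)] subD that by blast
      have i1: "(\<integral>z. F x $ i $ j * ?\<phi> z \<partial>lebesgue_on D) = F x $ i $ j * (r ^ CARD('d) * ?m)"
        using integral_seg_bump(2)[OF r(1), of x 0] integral_lebesgue_on_eq[OF D, of ?\<phi>] zD by simp
      have i2: "integrable (lebesgue_on D) (\<lambda>z. F x $ i $ j * ?\<phi> z)"
        using integrable_mult_indicator[OF _ integral_seg_bump(1)[OF r(1), of x 0], of D] D
        by (intro integrable_mult_right) (simp add: integrable_restrict_space)
      have e1: "F x $ i $ j * (r ^ CARD('d) * ?m) = (\<integral>z. (F x $ i $ j - F z $ i $ j) * ?\<phi> z \<partial>lebesgue_on D)"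
        by (simp only: left_diff_distrib Bochner_Integration.integral_diff[OF i2 I[OF F]] z i1 diff_zero)
      have "integrable (lebesgue_on D) (\<lambda>z. (F x $ i $ j - F z $ i $ j) * ?\<phi> z)"
        using I[OF F] i2 by (simp add: left_diff_distrib)
      from integral_norm_bound_ennreal[OF this, folded e1]
      have "ennreal (\<bar>F x $ i $ j\<bar> * (r ^ CARD('d) * ?m)) \<le> (\<integral>\<^sup>+z. ennreal (norm ((F x $ i $ j - F z $ i $ j) * ?\<phi> z)) \<partial>lebesgue_on D)"
        using r bump_mass_pos[where 'd='d] by (simp add: abs_mult)
      also have "\<dots> = (\<integral>\<^sup>+z. ennreal (norm ((F x $ i $ j - F z $ i $ j) * ?\<phi> z)) * indicator D z \<partial>lebesgue)"
        using D by (subst nn_integral_restrict_space) auto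
      also have "\<dots> \<le> (\<integral>\<^sup>+z. ennreal (norm (F z - F x)) * indicator ?B z \<partial>lebesgue)"
      proof (intro nn_integral_mono)
        fix z
        have "norm ((F x $ i $ j - F z $ i $ j) * ?\<phi> z) \<le> norm (F z - F x) * 1"
          unfolding norm_mult
        proof (rule mult_mono)
          have "norm (F x $ i $ j - F z $ i $ j) \<le> norm ((F z - F x) $ i $ j)" by simp
          also have "\<dots> \<le> norm ((F z - F x) $ i)" by (rule Finite_Cartesian_Product.norm_nth_le)
          also have "\<dots> \<le> norm (F z - F x)" by (rule Finite_Cartesian_Product.norm_nth_le)
          finally show "norm (F x $ i $ j - F z $ i $ j) \<le> norm (F z - F x)" .
        qed (auto simp: seg_bump_nonneg seg_bump_le_1)
        then show "ennreal (norm ((F x $ i $ j - F z $ i $ j) * ?\<phi> z)) * indicator D z \<le> ennreal (norm (F z - F x)) * indicator ?B z"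
          using seg_bump_eq_0[OF _ r(1), of z x 0] sub by (cases "z \<in> ?B") (auto split: split_indicator intro!: ennreal_leI)
      qed
      also have "\<dots> \<le> ennreal (e' * (2 * r) ^ CARD('d))" using \<delta>(3)[of "2 * r"] r by simp
      also have "e' * (2 * r) ^ CARD('d) = e * r ^ CARD('d)" by (simp add: e'_def power_mult_distrib)
      finally have "\<bar>F x $ i $ j\<bar> * (r ^ CARD('d) * ?m) \<le> e * r ^ CARD('d)"
        using r that by (subst (asm) ennreal_le_iff) auto
      then show ?thesis using r by (simp add: mult.left_commute[of _ "r ^ _"] mult.commute[of e])
    qed
    then have "\<bar>F x $ i $ j\<bar> * ?m \<le> 0" for i j by (rule field_le_epsilon) simp
    then have "F x $ i $ j = 0" for i j using bump_mass_pos[where 'd='d] by (smt (verit) mult_pos_pos)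
    then show "G x = H x" by (simp add: F_def vec_eq_iff)
  qed
  show ?thesis using lebesgue_points[OF F D] by (rule eventually_mono) (use claim in blast)
qed

section \<open>From bounds on the weak gradient to bounds on differences\<close>

lemma seg_nbhd_mono:
  assumes "0 \<le> s" "s \<le> 1" shows "seg_nbhd r (x + s *\<^sub>R h) 0 \<subseteq> seg_nbhd r x h"
proof
  fix z assume "z \<in> seg_nbhd r (x + s *\<^sub>R h) 0"
  then obtain w where "z = x + s *\<^sub>R h + r *\<^sub>R w" "w \<in> cball 1 1" unfolding seg_nbhd_def by force
  then show "z \<in> seg_nbhd r x h"
    unfolding seg_nbhd_def using assms by (intro image_eqI[where x="(s, w)"]) auto
qed

lemma integral_seg_bump_on:
  fixes x :: "real^'d"
  assumes "r > 0" "open D" "seg_nbhd r x h \<subseteq> D"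
  shows "integrable (lebesgue_on D) (seg_bump r x h)"
    and "(\<integral>z. seg_bump r x h z \<partial>lebesgue_on D) = r ^ CARD('d) * bump_mass TYPE('d)"
proof -
  show "integrable (lebesgue_on D) (seg_bump r x h)"
    using integrable_mult_indicator[OF _ integral_seg_bump(1)[OF assms(1), of x h], of D] assms(2)
    by (simp add: integrable_restrict_space)
  have "seg_bump r x h z = 0" if "z \<notin> D" for z using seg_bump_eq_0 assms that by blast
  from integral_lebesgue_on_eq[of D "seg_bump r x h", OF assms(2) this]
  show "(\<integral>z. seg_bump r x h z \<partial>lebesgue_on D) = r ^ CARD('d) * bump_mass TYPE('d)"
    using integral_seg_bump(2)[OF assms(1)] by simp
qed

text \<open>The mean values of \<open>v\<close> over the two end bumps differ from
  \<open>v x\<close> and \<open>v (x + h)\<close> by at most \<open>b\<close>, and their difference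
  is the mean of \<open>G z *v h\<close> over the averaged bump, whose distance from
  \<open>A *v h\<close> is controlled by \<open>norm h * I\<close>. Taking \<open>A = 0\<close>
  gives Lipschitz bounds; taking \<open>A = G x\<close> at a Lebesgue point gives
  differentiability.\<close>

lemma seg_difference_estimate:
  fixes v :: "real^'d \<Rightarrow> real^'m"
  assumes wg: "has_weak_gradient D v G" and D: "open D" "seg_nbhd r x h \<subseteq> D" and r: "r > 0"
    and b0: "\<And>z. z \<in> seg_nbhd r x 0 \<Longrightarrow> norm (v z - v x) \<le> b"
    and b1: "\<And>z. z \<in> seg_nbhd r (x + h) 0 \<Longrightarrow> norm (v z - v (x + h)) \<le> b"
    and I: "(\<integral>\<^sup>+z. ennreal (norm (G z - A) * seg_bump r x h z) \<partial>lebesgue_on D) \<le> ennreal I" "I \<ge> 0"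
  shows "\<bar>(v (x + h) - v x - A *v h) $ i\<bar> * (r ^ CARD('d) * bump_mass TYPE('d))
     \<le> 2 * b * (r ^ CARD('d) * bump_mass TYPE('d)) + norm h * I"
proof -
  let ?M = "lebesgue_on D" and ?\<mu> = "r ^ CARD('d) * bump_mass TYPE('d)"
  let ?p = "seg_bump r x 0" and ?q = "seg_bump r (x + h) 0" and ?f = "seg_bump r x h"
  have li: "locally_integrable D v" "locally_integrable D G"
    using wg by (auto simp: has_weak_gradient_def)
  have sub: "seg_nbhd r x 0 \<subseteq> D" "seg_nbhd r (x + h) 0 \<subseteq> D"
    using seg_nbhd_mono[of 0 r x h] seg_nbhd_mono[of 1 r x h] D(2) by auto
  have Iv: "integrable ?M (\<lambda>z. v z $ i * seg_bump r y 0 z)" if "seg_nbhd r y 0 \<subseteq> D" for y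
    using integrable_locally_mult[OF li(1) compact_seg_nbhd that D(1), of "seg_bump r y 0" "axis i 1"] seg_bump_eq_0[OF _ r, of _ y 0]
    by (auto simp: inner_axis continuous_on_seg_bump)
  have IG: "integrable ?M (\<lambda>z. G z $ i $ j * ?f z)" for j
    using integrable_locally_mult[OF li(2) compact_seg_nbhd D(2) D(1), of ?f "axis i (axis j 1)"] seg_bump_eq_0[OF _ r, of _ x h]
    by (auto simp: inner_axis continuous_on_seg_bump)
  have IGh: "integrable ?M (\<lambda>z. (G z *v h) $ i * ?f z)"
  proof -
    have "(\<lambda>z. (G z *v h) $ i * ?f z) = (\<lambda>z. \<Sum>j\<in>UNIV. h $ j * (G z $ i $ j * ?f z))"
      by (simp add: matrix_vector_mult_def sum_distrib_left sum_distrib_right mult_ac)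
    then show ?thesis using IG by simp
  qed
  have osc: "\<bar>(\<integral>z. v z $ i * seg_bump r y 0 z \<partial>?M) - v y $ i * ?\<mu>\<bar> \<le> b * ?\<mu>"
    if y: "seg_nbhd r y 0 \<subseteq> D" and b: "\<And>z. z \<in> seg_nbhd r y 0 \<Longrightarrow> norm (v z - v y) \<le> b" for y
  proof -
    note J = integral_seg_bump_on[OF r D(1) y]
    have i2: "integrable ?M (\<lambda>z. v y $ i * seg_bump r y 0 z)" using J by simp
    have "(\<integral>z. v z $ i * seg_bump r y 0 z \<partial>?M) - v y $ i * ?\<mu> = (\<integral>z. v z $ i * seg_bump r y 0 z - v y $ i * seg_bump r y 0 z \<partial>?M)"
      using Bochner_Integration.integral_diff[OF Iv[OF y] i2] J by simp
    moreover have "norm (\<integral>z. v z $ i * seg_bump r y 0 z - v y $ i * seg_bump r y 0 z \<partial>?M) \<le> (\<integral>z. b * seg_bump r y 0 z \<partial>?M)"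
    proof (rule Bochner_Integration.integral_norm_bound_integral)
      fix z
      show "norm (v z $ i * seg_bump r y 0 z - v y $ i * seg_bump r y 0 z) \<le> b * seg_bump r y 0 z"
      proof (cases "z \<in> seg_nbhd r y 0")
        case True
        have "\<bar>v z $ i - v y $ i\<bar> \<le> b"
          using b[OF True] Finite_Cartesian_Product.norm_nth_le[of "v z - v y" i] by simp
        then show ?thesis
          by (simp add: left_diff_distrib[symmetric] abs_mult seg_bump_nonneg mult_right_mono)
      qed (simp add: seg_bump_eq_0 r)
    qed (use Iv[OF y] i2 J in auto)
    ultimately show ?thesis using J by simp
  qed
  have w: "(\<integral>z. v z $ i * ?p z \<partial>?M) - (\<integral>z. v z $ i * ?q z \<partial>?M) = - (\<integral>z. (G z *v h) $ i * ?f z \<partial>?M)"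
  proof -
    have "(\<integral>z. v z $ i * ?p z \<partial>?M) - (\<integral>z. v z $ i * ?q z \<partial>?M) = (\<integral>z. v z $ i * ?p z - v z $ i * ?q z \<partial>?M)"
      by (rule Bochner_Integration.integral_diff[symmetric, OF Iv[OF sub(1)] Iv[OF sub(2)]])
    also have "\<dots> = (\<integral>z. v z $ i * (bump ((z - x) /\<^sub>R r) - bump ((z - x - h) /\<^sub>R r)) \<partial>?M)"
      by (simp add: seg_bump_0 right_diff_distrib diff_diff_eq)
    finally show ?thesis using weak_gradient_seg_bump[OF wg D r] by simp
  qed
  have g: "\<bar>(\<integral>z. (G z *v h) $ i * ?f z \<partial>?M) - (A *v h) $ i * ?\<mu>\<bar> \<le> norm h * I"
  proof -
    note J = integral_seg_bump_on[OF r D(1) D(2)]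
    have i2: "integrable ?M (\<lambda>z. (A *v h) $ i * ?f z)" using J by simp
    have e: "(\<integral>z. (G z *v h) $ i * ?f z \<partial>?M) - (A *v h) $ i * ?\<mu> = (\<integral>z. (G z *v h) $ i * ?f z - (A *v h) $ i * ?f z \<partial>?M)"
      using Bochner_Integration.integral_diff[OF IGh i2] J by simp
    have "ennreal (norm (\<integral>z. (G z *v h) $ i * ?f z - (A *v h) $ i * ?f z \<partial>?M)) \<le>
       (\<integral>\<^sup>+z. ennreal (norm ((G z *v h) $ i * ?f z - (A *v h) $ i * ?f z)) \<partial>?M)"
      by (rule integral_norm_bound_ennreal) (intro Bochner_Integration.integrable_diff IGh i2)
    also have "\<dots> \<le> (\<integral>\<^sup>+z. ennreal (norm h) * ennreal (norm (G z - A) * ?f z) \<partial>?M)"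
    proof (rule nn_integral_mono)
      fix z
      have "\<bar>((G z - A) *v h) $ i\<bar> \<le> norm (G z - A) * norm h"
        using Finite_Cartesian_Product.norm_nth_le[of "(G z - A) *v h" i] norm_matrix_vector_mult_le[of "G z - A" h] by simp
      from mult_right_mono[OF this seg_bump_nonneg[of r x h z]]
      have "\<bar>((G z - A) *v h) $ i\<bar> * ?f z \<le> norm h * (norm (G z - A) * ?f z)" by (simp add: mult_ac)
      moreover have "(G z *v h) $ i * ?f z - (A *v h) $ i * ?f z = ((G z - A) *v h) $ i * ?f z"
        by (simp add: matrix_vector_mult_diff_rdistrib left_diff_distrib)
      ultimately have "norm ((G z *v h) $ i * ?f z - (A *v h) $ i * ?f z) \<le> norm h * (norm (G z - A) * ?f z)"
        by (simp only: real_norm_def abs_mult abs_of_nonneg[OF seg_bump_nonneg])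
      then have "ennreal (norm ((G z *v h) $ i * ?f z - (A *v h) $ i * ?f z)) \<le> ennreal (norm h * (norm (G z - A) * ?f z))"
        by (rule ennreal_leI)
      also have "\<dots> = ennreal (norm h) * ennreal (norm (G z - A) * ?f z)"
        by (rule ennreal_mult) (simp_all add: seg_bump_nonneg)
      finally show "ennreal (norm ((G z *v h) $ i * ?f z - (A *v h) $ i * ?f z)) \<le> ennreal (norm h) * ennreal (norm (G z - A) * ?f z)" .
    qed
    also have "\<dots> = ennreal (norm h) * (\<integral>\<^sup>+z. ennreal (norm (G z - A) * ?f z) \<partial>?M)"
    proof (rule nn_integral_cmult)
      \<comment> \<open>\<open>G\<close> is only known to be measurable on compact subsets of
        \<open>D\<close>, so it is replaced by its restriction to the compact set off which the
        averaged bump vanishes.\<close>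
      obtain K where K: "K = seg_nbhd r x h" "compact K" "K \<subseteq> D" using D compact_seg_nbhd by blast
      have "set_integrable lebesgue K G" using li(2) K by (simp add: locally_integrable_def)
      then have "(\<lambda>z. indicator K z *\<^sub>R G z) \<in> borel_measurable lebesgue" by (simp add: set_integrable_def borel_measurable_integrable)
      moreover have "(\<lambda>w. norm (w - A)) \<in> borel_measurable borel"
        by (intro borel_measurable_continuous_onI continuous_intros)
      ultimately have "(\<lambda>z. norm (indicator K z *\<^sub>R G z - A)) \<in> borel_measurable lebesgue"
        by (rule measurable_compose)
      then have "(\<lambda>z. norm (indicator K z *\<^sub>R G z - A) * ?f z) \<in> borel_measurable lebesgue"
        by (intro borel_measurable_times continuous_imp_measurable_lebesgue[OF continuous_on_seg_bump])
      also have "(\<lambda>z. norm (indicator K z *\<^sub>R G z - A) * ?f z) = (\<lambda>z. norm (G z - A) * ?f z)"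
        using seg_bump_eq_0[OF _ r, of _ x h] K by (auto simp: fun_eq_iff indicator_def)
      finally show "(\<lambda>z. ennreal (norm (G z - A) * ?f z)) \<in> borel_measurable ?M"
        by (intro measurable_restrict_space1 measurable_compose[OF _ measurable_ennreal])
    qed
    also have "\<dots> \<le> ennreal (norm h) * ennreal I" by (rule mult_left_mono[OF I(1)]) simp
    also have "\<dots> = ennreal (norm h * I)" using I(2) by (simp add: ennreal_mult)
    finally show ?thesis unfolding e using I(2) by (subst (asm) ennreal_le_iff) auto
  qed
  have \<mu>: "?\<mu> > 0" using r bump_mass_pos[where 'd='d] by simp
  have "(v (x + h) - v x - A *v h) $ i * ?\<mu> = v (x + h) $ i * ?\<mu> - v x $ i * ?\<mu> - (A *v h) $ i * ?\<mu>"
    by (simp add: left_diff_distrib)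
  then have "\<bar>(v (x + h) - v x - A *v h) $ i * ?\<mu>\<bar> \<le> 2 * (b * ?\<mu>) + norm h * I"
    using osc[OF sub(1) b0] osc[OF sub(2) b1] w g by linarith
  then show ?thesis unfolding abs_mult[of _ ?\<mu>] abs_of_pos[OF \<mu>] by (simp only: mult.assoc)
qed

text \<open>The averaged bump is at most 1 and vanishes off \<open>B\<close>. This trades the weight
  for the plain integral that the Lebesgue point property controls.\<close>

lemma nn_integral_norm_diff_seg_bump_le:
  assumes "r > 0" "open D" "seg_nbhd r x h \<subseteq> B" "B \<subseteq> D"
  shows "(\<integral>\<^sup>+z. ennreal (norm (G z - A) * seg_bump r x h z) \<partial>lebesgue_on D)
     \<le> (\<integral>\<^sup>+z. ennreal (norm (G z - A)) * indicator B z \<partial>lebesgue)"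
proof -
  have "(\<integral>\<^sup>+z. ennreal (norm (G z - A) * seg_bump r x h z) \<partial>lebesgue_on D) =
    (\<integral>\<^sup>+z. ennreal (norm (G z - A) * seg_bump r x h z) * indicator D z \<partial>lebesgue)"
    using assms(2) by (subst nn_integral_restrict_space) auto
  also have "\<dots> \<le> (\<integral>\<^sup>+z. ennreal (norm (G z - A)) * indicator B z \<partial>lebesgue)"
  proof (rule nn_integral_mono)
    fix z
    have "norm (G z - A) * seg_bump r x h z \<le> norm (G z - A)"
      using mult_left_mono[OF seg_bump_le_1[of r x h z], of "norm (G z - A)"] by simp
    moreover have "seg_bump r x h z = 0" if "z \<notin> B" using seg_bump_eq_0[OF _ assms(1), of z x h] assms(3) that by blast
    ultimately show "ennreal (norm (G z - A) * seg_bump r x h z) * indicator D z \<le> ennreal (norm (G z - A)) * indicator B z"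
      by (cases "z \<in> B") (auto split: split_indicator intro!: ennreal_leI)
  qed
  finally show ?thesis .
qed

lemma seg_nbhd_dist:
  assumes "r \<ge> 0" "z \<in> seg_nbhd r x 0" shows "dist z (x::real^'d) \<le> r * (1 + norm (1::real^'d))"
proof -
  obtain w where w: "z = x + r *\<^sub>R w" "w \<in> cball 1 1" using assms(2) unfolding seg_nbhd_def by force
  have "norm w \<le> 1 + norm (1::real^'d)"
    using w(2) norm_triangle_sub[of w 1] by (simp add: dist_norm norm_minus_commute)
  then show ?thesis using w(1) assms(1) by (simp add: dist_norm mult_left_mono)
qed

text \<open>The estimate of differences with \<open>A = 0\<close>: a gradient bounded by
  \<open>R\<close> contributes \<open>R * norm (y - x)\<close> whatever the size of the bumps, and
  the oscillation of \<open>v\<close> on the end bumps is arbitrarily small for small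
  \<open>r\<close>. Adding the components produces the factor \<open>CARD('m)\<close>.\<close>

lemma weak_gradient_lipschitz_on_segment:
  fixes v :: "real^'d \<Rightarrow> real^'m" and R :: real
  assumes wg: "has_weak_gradient D v G" and D: "open D" "continuous_on D v" and R: "R \<ge> 0"
    and bound: "AE z in lebesgue. z \<in> D \<longrightarrow> norm (G z) \<le> R" and seg: "closed_segment x y \<subseteq> D"
  shows "norm (v y - v x) \<le> CARD('m) * R * norm (y - x)"
proof -
  let ?h = "y - x"
  have comp: "\<bar>(v y - v x) $ i\<bar> \<le> R * norm ?h" for i
  proof (rule field_le_epsilon)
    fix e :: real assume e: "e > 0"
    let ?c = "1 + norm (1::real^'d)"
    have "\<exists>\<delta>>0. (\<forall>z. dist z p < \<delta> \<longrightarrow> norm (v z - v p) \<le> e / 2)" if "p \<in> D" for p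
    proof -
      have "isCont v p" using D that by (simp add: continuous_on_eq_continuous_at)
      then obtain \<delta> where "\<delta> > 0" "\<forall>z. dist z p < \<delta> \<longrightarrow> dist (v z) (v p) < e / 2"
        unfolding continuous_at_eps_delta using half_gt_zero[OF e] by blast
      then show ?thesis by (intro exI[of _ \<delta>]) (auto simp: dist_norm less_imp_le)
    qed
    then obtain \<delta>0 \<delta>1 where \<delta>: "\<delta>0 > 0" "\<And>z. dist z x < \<delta>0 \<Longrightarrow> norm (v z - v x) \<le> e / 2"
      "\<delta>1 > 0" "\<And>z. dist z y < \<delta>1 \<Longrightarrow> norm (v z - v y) \<le> e / 2"
      using seg by (meson ends_in_segment subsetD)
    obtain \<delta>2 where \<delta>2: "\<delta>2 > 0" "(\<Union>p\<in>closed_segment x y. ball p \<delta>2) \<subseteq> D"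
      using compact_subset_open_imp_ball_epsilon_subset[OF compact_segment D(1) seg] by metis
    \<comment> \<open>The bump of size \<open>r\<close> at a point reaches at most
      \<open>r * ?c\<close> away from it; this has to stay below the two continuity radii and the
      radius of a neighbourhood of the segment inside \<open>D\<close>.\<close>
    define r where "r = min \<delta>0 (min \<delta>1 \<delta>2) / 2 / ?c"
    have c: "?c > 0" by (simp add: add_pos_nonneg)
    have r: "r > 0" using \<delta> \<delta>2 c by (simp add: r_def)
    have rc: "r * ?c < \<delta>0" "r * ?c < \<delta>1" "r * ?c < \<delta>2"
    proof -
      have "r * ?c = min \<delta>0 (min \<delta>1 \<delta>2) / 2" using c unfolding r_def by (intro nonzero_eq_divide_eq[THEN iffD1]) auto
      then show "r * ?c < \<delta>0" "r * ?c < \<delta>1" "r * ?c < \<delta>2" using \<delta>(1,3) \<delta>2(1) by auto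
    qed
    have sub: "seg_nbhd r x ?h \<subseteq> D"
    proof
      fix z assume "z \<in> seg_nbhd r x ?h"
      then obtain s w where z: "z = x + s *\<^sub>R ?h + r *\<^sub>R w" "s \<in> {0..1}" "w \<in> cball 1 1"
        unfolding seg_nbhd_def by auto
      have p: "x + s *\<^sub>R ?h \<in> closed_segment x y"
        using z(2) by (auto simp: in_segment algebra_simps intro!: exI[of _ s])
      have "z \<in> seg_nbhd r (x + s *\<^sub>R ?h) 0"
        unfolding seg_nbhd_def using z by (intro image_eqI[where x="(0, w)"]) auto
      from seg_nbhd_dist[OF _ this] r rc(3) have "dist z (x + s *\<^sub>R ?h) < \<delta>2" by linarith
      then have "z \<in> ball (x + s *\<^sub>R ?h) \<delta>2" by (simp add: dist_commute)
      then show "z \<in> D" using \<delta>2(2) p by blast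
    qed
    let ?\<mu> = "r ^ CARD('d) * bump_mass TYPE('d)"
    have \<mu>: "?\<mu> > 0" using r bump_mass_pos[where 'd='d] by simp
    have "\<bar>(v (x + ?h) - v x - 0 *v ?h) $ i\<bar> * ?\<mu> \<le> 2 * (e / 2) * ?\<mu> + norm ?h * (R * ?\<mu>)"
    proof (rule seg_difference_estimate[OF wg D(1) sub r])
      show "norm (v z - v x) \<le> e / 2" if "z \<in> seg_nbhd r x 0" for z
        using seg_nbhd_dist[OF _ that] r rc \<delta>(2) by force
      show "norm (v z - v (x + ?h)) \<le> e / 2" if "z \<in> seg_nbhd r (x + ?h) 0" for z
        using seg_nbhd_dist[OF _ that] r rc \<delta>(4) by force
      have "(\<integral>\<^sup>+z. ennreal (norm (G z - 0) * seg_bump r x ?h z) \<partial>lebesgue_on D) \<le>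
        (\<integral>\<^sup>+z. ennreal (R * seg_bump r x ?h z) \<partial>lebesgue_on D)"
      proof (rule nn_integral_mono_AE)
        have "AE z in lebesgue_on D. norm (G z) \<le> R" using bound D(1) by (subst AE_lebesgue_on_iff) auto
        then show "AE z in lebesgue_on D. ennreal (norm (G z - 0) * seg_bump r x ?h z) \<le> ennreal (R * seg_bump r x ?h z)"
          by (rule eventually_mono) (auto intro!: ennreal_leI mult_right_mono seg_bump_nonneg)
      qed
      also have "\<dots> = ennreal (\<integral>z. R * seg_bump r x ?h z \<partial>lebesgue_on D)"
        using integral_seg_bump_on(1)[OF r D(1) sub] R by (intro nn_integral_eq_integral) (auto simp: seg_bump_nonneg)
      also have "\<dots> = ennreal (R * ?\<mu>)"
        using integral_seg_bump_on[OF r D(1) sub] by simp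
      finally show "(\<integral>\<^sup>+z. ennreal (norm (G z - 0) * seg_bump r x ?h z) \<partial>lebesgue_on D) \<le> ennreal (R * ?\<mu>)" .
      show "0 \<le> R * ?\<mu>" using R \<mu> by simp
    qed
    also have "\<dots> = (R * norm ?h + e) * ?\<mu>" by (simp add: algebra_simps)
    finally have "\<bar>(v y - v x) $ i\<bar> * ?\<mu> \<le> (R * norm ?h + e) * ?\<mu>" by simp
    then show "\<bar>(v y - v x) $ i\<bar> \<le> R * norm ?h + e" using \<mu> by (rule mult_right_le_imp_le)
  qed
  have "norm (v y - v x) \<le> (\<Sum>i\<in>UNIV. \<bar>(v y - v x) $ i\<bar>)" by (rule norm_le_l1_cart)
  also have "\<dots> \<le> (\<Sum>i\<in>(UNIV::'m set). R * norm ?h)" by (intro sum_mono comp)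
  finally show ?thesis by simp
qed

text \<open>The bound is given only along segments inside \<open>D\<close>, and \<open>D\<close>
  need not be convex. A segment that leaves \<open>D\<close> meets the frontier, where
  \<open>v\<close> vanishes, so the value at an endpoint in \<open>D\<close> is at most
  \<open>K\<close> times its distance to any point of the segment outside \<open>D\<close>.\<close>

lemma zero_extension_lipschitz:
  fixes v :: "'a::euclidean_space \<Rightarrow> 'b::real_normed_vector"
  assumes D: "open D" and v: "continuous_on (closure D) v" "\<And>x. x \<in> frontier D \<Longrightarrow> v x = 0" and K: "K \<ge> 0"
    and seg: "\<And>x y. closed_segment x y \<subseteq> D \<Longrightarrow> norm (v y - v x) \<le> K * norm (y - x)"
  shows "K-lipschitz_on UNIV (\<lambda>x. if x \<in> D then v x else 0)"
proof -
  have exit: "norm (v x) \<le> K * norm (y - x)" if x: "x \<in> D" and y: "y \<notin> D" for x y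
  proof -
    let ?p = "\<lambda>t. x + t *\<^sub>R (y - x)"
    \<comment> \<open>The parameters outside \<open>D\<close> form a compact set that contains 1;
      its least element is the first exit time. The bound up to any earlier time passes to the limit
      by continuity of \<open>v\<close> on \<open>closure D\<close>.\<close>
    define T where "T = {0..1} \<inter> ?p -` (- D)"
    have cp: "continuous_on S ?p" for S by (intro continuous_intros)
    have "closed (?p -` (- D))" using D by (intro closed_vimage) (auto intro!: continuous_intros)
    then have "compact T" unfolding T_def by (intro compact_Int_closed) auto
    moreover have "1 \<in> T" using y by (simp add: T_def)
    ultimately obtain t0 where t0: "t0 \<in> T" "\<And>t. t \<in> T \<Longrightarrow> t0 \<le> t"
      using compact_attains_inf[of T] by blast
    have in01: "0 \<le> t0" "t0 \<le> 1" and nD: "?p t0 \<notin> D" using t0(1) by (auto simp: T_def)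
    have "t0 \<noteq> 0" using nD x by auto
    then have pos: "t0 > 0" using in01 by simp
    have inD: "?p t \<in> D" if "0 \<le> t" "t < t0" for t
      using t0(2)[of t] that in01 by (auto simp: T_def)
    have cl: "closure {0..<t0} = {0..t0}" using pos by simp
    have pcl: "?p ` {0..t0} \<subseteq> closure D"
    proof -
      have "?p ` closure {0..<t0} \<subseteq> closure (?p ` {0..<t0})"
        by (rule image_closure_subset[OF cp]) (auto intro: closure_subset[THEN subsetD])
      also have "\<dots> \<subseteq> closure D" by (rule closure_mono) (use inD in auto)
      finally show ?thesis unfolding cl .
    qed
    then have "?p t0 \<in> closure D" using in01 by (meson atLeastAtMost_iff image_subset_iff order_refl)
    then have "?p t0 \<in> frontier D" using nD D by (simp add: frontier_def interior_open)
    then have v0: "v (?p t0) = 0" by (rule v(2))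
    have "norm (v (?p t0) - v x) - K * (t0 * norm (y - x)) \<le> 0"
    proof (rule continuous_le_on_closure[where S="{0..<t0}" and f="\<lambda>t. norm (v (?p t) - v x) - K * (t * norm (y - x))"])
      have "continuous_on {0..t0} (\<lambda>t. v (?p t))"
        by (rule continuous_on_compose2[OF v(1) cp pcl])
      then show "continuous_on (closure {0..<t0}) (\<lambda>t. norm (v (?p t) - v x) - K * (t * norm (y - x)))"
        unfolding cl by (intro continuous_intros)
      show "t0 \<in> closure {0..<t0}" using pos by (simp add: cl)
      fix t assume t: "t \<in> {0..<t0}"
      have "closed_segment x (?p t) \<subseteq> D"
      proof
        fix z assume "z \<in> closed_segment x (?p t)"
        then obtain s where s: "0 \<le> s" "s \<le> 1" "z = (1 - s) *\<^sub>R x + s *\<^sub>R ?p t" by (auto simp: in_segment)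
        have "z = ?p (s * t)" using s(3) by (simp add: algebra_simps)
        moreover have "s * t \<le> t" using s t by (simp add: mult_left_le_one_le)
        ultimately show "z \<in> D" using inD[of "s * t"] s t by auto
      qed
      from seg[OF this] show "norm (v (?p t) - v x) - K * (t * norm (y - x)) \<le> 0" using t by simp
    qed
    then have "norm (v x) \<le> K * (t0 * norm (y - x))" using v0 by (simp add: norm_minus_commute)
    also have "\<dots> \<le> K * norm (y - x)" using K in01 by (intro mult_left_mono mult_left_le_one_le) auto
    finally show ?thesis .
  qed
  show ?thesis
  proof (rule lipschitz_onI)
    fix x y :: 'a
    let ?f = "\<lambda>x. if x \<in> D then v x else 0"
    consider "x \<in> D" "y \<in> D" "closed_segment x y \<subseteq> D" | q where "x \<in> D" "y \<in> D" "q \<in> closed_segment x y" "q \<notin> D"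
      | "x \<in> D" "y \<notin> D" | "x \<notin> D" "y \<in> D" | "x \<notin> D" "y \<notin> D" by blast
    then show "dist (?f x) (?f y) \<le> K * dist x y"
    proof cases
      case 1 then show ?thesis using seg[of x y] by (simp add: dist_norm norm_minus_commute)
    next
      \<comment> \<open>Both values are controlled by the distances to \<open>q\<close>, and these
        add up to the distance of the endpoints because \<open>q\<close> lies on the
        segment.\<close>
      case 2
      have "dist (v x) (v y) \<le> norm (v x) + norm (v y)" by (simp add: dist_norm norm_triangle_ineq4)
      also have "\<dots> \<le> K * norm (q - x) + K * norm (q - y)" by (intro add_mono exit 2)
      also have "\<dots> = K * dist x y"
        using 2(3) by (simp add: between_mem_segment[symmetric] between dist_norm norm_minus_commute flip: distrib_left)
      finally show ?thesis using 2 by simp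
    next
      case 3 then show ?thesis using exit[of x y] by (simp add: dist_norm norm_minus_commute)
    next
      case 4 then show ?thesis using exit[of y x] by (simp add: dist_norm norm_minus_commute)
    qed (use K in simp)
  qed (rule K)
qed

section \<open>One-sided gradients of Lipschitz functions\<close>

text \<open>The one-sided derivative is enough for all that follows, and it is what the Lebesgue
  differentiation theorem for cubes with a corner at \<open>x\<close> provides.\<close>

definition lip_grad :: "(real^'d) set \<Rightarrow> (real^'d \<Rightarrow> real^'m) \<Rightarrow> (real^'d \<Rightarrow> real^'d^'m) \<Rightarrow> bool" where
  "lip_grad D f G \<longleftrightarrow> (\<exists>L. L-lipschitz_on UNIV f) \<and>
     (AE x in lebesgue. x \<in> D \<longrightarrow> (f has_derivative (\<lambda>h. G x *v h)) (at x within {x..}))"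

text \<open>Bumps of size \<open>\<kappa> * norm h\<close>, with \<kappa> small but fixed, balance
  the two errors: the oscillation of the Lipschitz function on a bump is a small multiple of
  \<open>norm h\<close>, and the cube that carries the averaged bump has a side comparable with the
  bump, so that the Lebesgue point property controls the gradient error. Only
  \<open>h \<ge> 0\<close> is reached, because the cubes have their corner at
  \<open>x\<close>.\<close>

lemma lebesgue_point_has_derivative:
  fixes f :: "real^'d \<Rightarrow> real^'m"
  assumes wg: "has_weak_gradient D f G" and D: "open D" and L: "L-lipschitz_on UNIV f"
    and pt: "\<forall>e>0. \<exists>\<delta>>0. \<forall>r. 0 < r \<and> r < \<delta> \<longrightarrow> cbox x (x + r *\<^sub>R 1) \<subseteq> D \<and>
     (\<integral>\<^sup>+z. ennreal (norm (G z - G x)) * indicator (cbox x (x + r *\<^sub>R 1)) z \<partial>lebesgue) \<le> ennreal (e * r ^ CARD('d))"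
  shows "(f has_derivative (\<lambda>h. G x *v h)) (at x within {x..})"
proof -
  let ?m = "bump_mass TYPE('d)" and ?c = "1 + norm (1::real^'d)"
  have m: "?m > 0" by (rule bump_mass_pos)
  have c: "?c > 0" by (simp add: add_pos_nonneg)
  have L0: "L \<ge> 0" using L by (rule lipschitz_on_nonneg)
  have main: "\<exists>\<delta>>0. \<forall>h\<ge>0. 0 < norm h \<and> norm h < \<delta> \<longrightarrow> (\<forall>i. \<bar>(f (x + h) - f x - G x *v h) $ i\<bar> \<le> e * norm h)"
    if e: "e > 0" for e
  proof -
    \<comment> \<open>Makes the oscillation of \<open>f\<close> on the two end bumps contribute at
      most \<open>e / 2 * norm h\<close>.\<close>
    define \<kappa> where "\<kappa> = e / (4 * L * ?c + 1)"
    have den: "4 * L * ?c + 1 > 0" using L0 c by (simp add: add_nonneg_pos)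
    have \<kappa>: "\<kappa> > 0" using e den by (simp add: \<kappa>_def)
    have "\<kappa> * (4 * L * ?c + 1) = e" using den by (simp add: \<kappa>_def)
    then have \<kappa>2: "2 * (L * \<kappa> * ?c) \<le> e / 2" using \<kappa> by (simp add: algebra_simps)
    \<comment> \<open>The ratio of the side \<open>norm h + 2 * r\<close> of the enclosing cube to
      the bump size \<open>r = \<kappa> * norm h\<close>; its power is divided out in
      \<open>e'\<close>.\<close>
    define q where "q = (1 + 2 * \<kappa>) / \<kappa>"
    have q: "q > 0" using \<kappa> by (simp add: q_def)
    define e' where "e' = (e / 2) * ?m / q ^ CARD('d)"
    have e': "e' > 0" using e m q by (simp add: e'_def)
    obtain \<delta> where \<delta>: "\<delta> > 0" "\<And>r. 0 < r \<Longrightarrow> r < \<delta> \<Longrightarrow> cbox x (x + r *\<^sub>R 1) \<subseteq> D"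
      "\<And>r. 0 < r \<Longrightarrow> r < \<delta> \<Longrightarrow> (\<integral>\<^sup>+z. ennreal (norm (G z - G x)) * indicator (cbox x (x + r *\<^sub>R 1)) z \<partial>lebesgue) \<le> ennreal (e' * r ^ CARD('d))"
      using pt[rule_format, OF e'] by blast
    have "\<bar>(f (x + h) - f x - G x *v h) $ i\<bar> \<le> e * norm h"
      if h: "h \<ge> 0" "0 < norm h" "norm h < \<delta> / (1 + 2 * \<kappa>)" for h i
    proof -
      define r where "r = \<kappa> * norm h"
      define \<rho> where "\<rho> = q * r"
      have r: "r > 0" using \<kappa> h by (simp add: r_def)
      have \<rho>: "\<rho> = norm h + 2 * r" using \<kappa> by (simp add: \<rho>_def q_def r_def field_simps)
      have \<rho>': "0 < \<rho>" "\<rho> < \<delta>" using r q h \<kappa> by (auto simp: \<rho> r_def field_simps add_pos_pos)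
      have sub: "seg_nbhd r x h \<subseteq> cbox x (x + \<rho> *\<^sub>R 1)"
        by (rule seg_nbhd_subset_corner_cube) (use h r \<rho> in auto)
      have subD: "seg_nbhd r x h \<subseteq> D" using sub \<delta>(2)[OF \<rho>'] by blast
      let ?\<mu> = "r ^ CARD('d) * ?m"
      have \<mu>: "?\<mu> > 0" using r m by simp
      have "\<bar>(f (x + h) - f x - G x *v h) $ i\<bar> * ?\<mu> \<le> 2 * (L * (r * ?c)) * ?\<mu> + norm h * (e' * \<rho> ^ CARD('d))"
      proof (rule seg_difference_estimate[OF wg D subD r])
        show "norm (f z - f y) \<le> L * (r * ?c)" if "z \<in> seg_nbhd r y 0" for z y
        proof -
          have "dist (f z) (f y) \<le> L * dist z y" using lipschitz_onD[OF L] by blast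
          also have "\<dots> \<le> L * (r * ?c)" using seg_nbhd_dist[OF _ that] r L0 by (intro mult_left_mono) auto
          finally show ?thesis by (simp add: dist_norm)
        qed
        then show "norm (f z - f y) \<le> L * (r * ?c)" if "z \<in> seg_nbhd r y 0" for z y using that .
        show "(\<integral>\<^sup>+z. ennreal (norm (G z - G x) * seg_bump r x h z) \<partial>lebesgue_on D) \<le> ennreal (e' * \<rho> ^ CARD('d))"
          using nn_integral_norm_diff_seg_bump_le[OF r D sub \<delta>(2)[OF \<rho>'], of G "G x"] \<delta>(3)[OF \<rho>'] by (rule order_trans)
        show "0 \<le> e' * \<rho> ^ CARD('d)" using e' \<rho>' by simp
      qed
      also have "norm h * (e' * \<rho> ^ CARD('d)) = (e / 2 * norm h) * ?\<mu>"
        using q by (simp add: e'_def \<rho>_def power_mult_distrib)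
      also have "2 * (L * (r * ?c)) * ?\<mu> = (2 * (L * \<kappa> * ?c) * norm h) * ?\<mu>"
        by (simp add: r_def)
      also have "\<dots> + (e / 2 * norm h) * ?\<mu> \<le> (e / 2 * norm h) * ?\<mu> + (e / 2 * norm h) * ?\<mu>"
        using \<kappa>2 \<mu> by (intro add_right_mono mult_right_mono) auto
      also have "\<dots> = (e * norm h) * ?\<mu>" by (simp add: algebra_simps)
      finally show ?thesis using \<mu> by (rule mult_right_le_imp_le)
    qed
    moreover have "\<delta> / (1 + 2 * \<kappa>) > 0" using \<delta> \<kappa> by simp
    ultimately show ?thesis by blast
  qed
  show ?thesis
    unfolding has_derivative_within'
  proof (intro conjI allI impI)
    show "bounded_linear ((*v) (G x))" by (rule matrix_vector_mul_bounded_linear)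
    fix e :: real assume e: "e > 0"
    then have "e / (2 * CARD('m)) > 0" by simp
    then obtain \<delta> where \<delta>: "\<delta> > 0" "\<And>h i. h \<ge> 0 \<Longrightarrow> 0 < norm h \<Longrightarrow> norm h < \<delta> \<Longrightarrow>
      \<bar>(f (x + h) - f x - G x *v h) $ i\<bar> \<le> e / (2 * CARD('m)) * norm h" using main by metis
    have "norm (f y - f x - G x *v (y - x)) / norm (y - x) < e"
      if y: "y \<in> {x..}" "0 < norm (y - x)" "norm (y - x) < \<delta>" for y
    proof -
      have "norm (f y - f x - G x *v (y - x)) \<le> (\<Sum>i\<in>UNIV. \<bar>(f y - f x - G x *v (y - x)) $ i\<bar>)"
        by (rule norm_le_l1_cart)
      also have "\<dots> \<le> (\<Sum>i\<in>(UNIV::'m set). e / (2 * CARD('m)) * norm (y - x))"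
        using \<delta>(2)[of "y - x"] y by (intro sum_mono) (auto simp: less_eq_vec_def)
      also have "\<dots> = e / 2 * norm (y - x)" by simp
      also have "\<dots> < e * norm (y - x)" using e y by simp
      finally show ?thesis using y by (simp add: divide_less_eq)
    qed
    then show "\<exists>d>0. \<forall>x'\<in>{x..}. 0 < norm (x' - x) \<and> norm (x' - x) < d \<longrightarrow>
       norm (f x' - f x - G x *v (x' - x)) / norm (x' - x) < e" using \<delta>(1) by blast
  qed
qed

section \<open>Lipschitz representatives of functions vanishing on the boundary\<close>

lemma locally_integrable_continuous:
  "continuous_on D v \<Longrightarrow> locally_integrable D (v :: real^'d \<Rightarrow> 'b::euclidean_space)"
  unfolding locally_integrable_def set_integrable_def
proof (intro allI impI)
  fix K :: "(real^'d) set" assume v: "continuous_on D v" and K: "compact K \<and> K \<subseteq> D"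
  then have "integrable lborel (\<lambda>x. indicator K x *\<^sub>R v x)"
    by (intro borel_integrable_compact) (auto intro: continuous_on_subset)
  then show "integrable lebesgue (\<lambda>x. indicator K x *\<^sub>R v x)" using borel_measurable_integrable by (subst integrable_completion) auto
qed

text \<open>The defining integrals see a function only up to null sets. The lemma moves a weak
  gradient from \<open>u\<close> to a continuous representative.\<close>

lemma has_weak_gradient_cong_AE:
  assumes wg: "has_weak_gradient D u G" and D: "open D" and v: "continuous_on D v"
    and u: "u \<in> borel_measurable (lebesgue_on D)" and eq: "AE x in lebesgue_on D. v x = u x"
  shows "has_weak_gradient D v G"
  unfolding has_weak_gradient_def
proof (intro conjI allI impI)
  show "locally_integrable D v" using v by (rule locally_integrable_continuous)
  show "locally_integrable D G" using wg by (simp add: has_weak_gradient_def)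
  fix \<phi> g i j assume tf: "test_function D \<phi> g"
  have g: "(\<lambda>x. g x $ j) \<in> borel_measurable (lebesgue_on D)"
    using tf unfolding test_function_def
    by (intro measurable_restrict_space1 continuous_imp_measurable_lebesgue continuous_on_component) auto
  have vm: "v \<in> borel_measurable (lebesgue_on D)"
    using v D by (intro continuous_imp_measurable_on_sets_lebesgue) auto
  have cm: "(\<lambda>x. w x $ i) \<in> borel_measurable (lebesgue_on D)" if "w \<in> borel_measurable (lebesgue_on D)" for w :: "real^'a \<Rightarrow> real^'b"
    by (rule measurable_compose[OF that]) (intro borel_measurable_continuous_onI continuous_intros)
  have "(\<integral>x. v x $ i * g x $ j \<partial>lebesgue_on D) = (\<integral>x. u x $ i * g x $ j \<partial>lebesgue_on D)"
    by (intro integral_cong_AE borel_measurable_times cm g u vm) (use eq in \<open>auto elim!: eventually_mono\<close>)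
  then show "(\<integral>x. v x $ i * g x $ j \<partial>lebesgue_on D) = - (\<integral>x. G x $ i $ j * \<phi> x \<partial>lebesgue_on D)"
    using wg tf by (simp add: has_weak_gradient_def)
qed

lemma has_weak_gradient_weak_gradient:
  "has_weak_gradient D u G \<Longrightarrow> has_weak_gradient D u (weak_gradient D u)"
  unfolding weak_gradient_def using someI[of "has_weak_gradient D u"] by blast

text \<open>The passage from the function space to Lipschitz functions: \<open>f\<close> is the
  continuous representative extended by zero. The last clause expresses the Lipschitz constant
  through the gradient bound alone, which is what makes functions of finite energy
  equi-Lipschitz.\<close>

lemma W1inf0_obtain_lip_grad:
  fixes u :: "real^'d \<Rightarrow> real^'m"
  assumes D: "open D" and u: "u \<in> W1inf0 D"
  obtains f where "lip_grad D f (weak_gradient D u)" "AE x in lebesgue. x \<in> D \<longrightarrow> f x = u x"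
    "\<And>x. x \<notin> D \<Longrightarrow> f x = 0"
    "\<And>R::real. R \<ge> 0 \<Longrightarrow> AE x in lebesgue. x \<in> D \<longrightarrow> norm (weak_gradient D u x) \<le> R \<Longrightarrow>
       (CARD('m) * R)-lipschitz_on UNIV f"
proof -
  obtain G v where G: "G \<in> Linf D" "has_weak_gradient D u G" and um: "u \<in> borel_measurable (lebesgue_on D)"
    and v: "continuous_on (closure D) v" "AE x in lebesgue_on D. v x = u x" "\<And>x. x \<in> frontier D \<Longrightarrow> v x = 0"
    using u unfolding W1inf0_def W1inf_def Linf_def by auto
  define f where "f = (\<lambda>x. if x \<in> D then v x else 0)"
  let ?G = "weak_gradient D u"
  have wg: "has_weak_gradient D u ?G" using G(2) by (rule has_weak_gradient_weak_gradient)
  have vD: "continuous_on D v" using v(1) closure_subset continuous_on_subset by blast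
  have wgv: "has_weak_gradient D v ?G" by (rule has_weak_gradient_cong_AE[OF wg D vD um v(2)])
  have lip: "(CARD('m) * R)-lipschitz_on UNIV f" if "R \<ge> 0" "AE x in lebesgue. x \<in> D \<longrightarrow> norm (?G x) \<le> R" for R :: real
    unfolding f_def
    by (rule zero_extension_lipschitz[OF D v(1) v(3)])
       (use that weak_gradient_lipschitz_on_segment[OF wgv D vD that] in \<open>auto simp: mult.assoc\<close>)
  obtain M where M: "AE x in lebesgue. x \<in> D \<longrightarrow> norm (G x) \<le> M"
    using G(1) D AE_lebesgue_on_iff[of D] unfolding Linf_def by auto
  \<comment> \<open>\<open>weak_gradient\<close> is a choice among all weak gradients and comes
    without a bound; uniqueness transfers the bound of the essentially bounded one.\<close>
  have "AE x in lebesgue. x \<in> D \<longrightarrow> norm (?G x) \<le> max 0 M"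
    using weak_gradient_unique[OF D wg G(2)] M by eventually_elim auto
  then have L: "\<exists>L. L-lipschitz_on UNIV f" using lip[of "max 0 M"] by auto
  then obtain L where L': "L-lipschitz_on UNIV f" by blast
  have fu: "AE x in lebesgue. x \<in> D \<longrightarrow> f x = u x"
    using v(2) D by (subst (asm) AE_lebesgue_on_iff) (auto simp: f_def)
  have wgf: "has_weak_gradient D f ?G"
  proof (rule has_weak_gradient_cong_AE[OF wg D _ um])
    show "continuous_on D f" using lipschitz_on_continuous_on[OF L'] continuous_on_subset by blast
    show "AE x in lebesgue_on D. f x = u x" using fu D by (subst AE_lebesgue_on_iff) auto
  qed
  have "locally_integrable D ?G" using wg by (simp add: has_weak_gradient_def)
  from lebesgue_points[OF this D]
  have "AE x in lebesgue. x \<in> D \<longrightarrow> (f has_derivative (\<lambda>h. ?G x *v h)) (at x within {x..})"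
    by (rule eventually_mono) (use lebesgue_point_has_derivative[OF wgf D L'] in blast)
  then have "lip_grad D f ?G" using L by (simp add: lip_grad_def)
  then show ?thesis using that[of f] fu lip by (auto simp: f_def)
qed

section \<open>Difference quotients and the weak gradient of a Lipschitz function\<close>

text \<open>The step runs through a sequence, so that gradients become limits of countably many
  continuous functions, as measurability and dominated convergence require.\<close>

lemma has_derivative_within_difference_quotient:
  fixes f :: "'a::real_normed_vector \<Rightarrow> 'b::real_normed_vector"
  assumes f: "(f has_derivative F) (at x within S)" and S: "\<And>t. t > 0 \<Longrightarrow> x + t *\<^sub>R e \<in> S"
  shows "(\<lambda>n. (f (x + (1 / real (Suc n)) *\<^sub>R e) - f x) /\<^sub>R (1 / real (Suc n))) \<longlonglongrightarrow> F e"
proof -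
  have "((\<lambda>t. x + t *\<^sub>R e) has_derivative (\<lambda>t. t *\<^sub>R e)) (at 0 within {0<..})"
    by (auto intro!: derivative_eq_intros)
  moreover have "(f has_derivative F) (at (x + 0 *\<^sub>R e) within (\<lambda>t. x + t *\<^sub>R e) ` {0<..})"
    using f S by (auto intro: has_derivative_subset)
  ultimately have "((\<lambda>t. f (x + t *\<^sub>R e)) has_derivative (\<lambda>t. F (t *\<^sub>R e))) (at 0 within {0<..})"
    by (rule has_derivative_in_compose)
  moreover have "F (t *\<^sub>R e) = t *\<^sub>R F e" for t
    using has_derivative_bounded_linear[OF f] by (simp add: linear_simps)
  ultimately have "((\<lambda>t. (1 / norm (t - 0)) *\<^sub>R (f (x + t *\<^sub>R e) - (f (x + 0 *\<^sub>R e) + (t - 0) *\<^sub>R F e))) \<longlongrightarrow> 0) (at 0 within {0<..})"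
    by (simp add: has_derivative_within)
  moreover have "\<forall>\<^sub>F t in at (0::real) within {0<..}.
      (1 / norm (t - 0)) *\<^sub>R (f (x + t *\<^sub>R e) - (f (x + 0 *\<^sub>R e) + (t - 0) *\<^sub>R F e)) = (f (x + t *\<^sub>R e) - f x) /\<^sub>R t - F e"
    unfolding eventually_at_filter by (rule always_eventually) (auto simp: algebra_simps divide_inverse)
  ultimately have "((\<lambda>t. (f (x + t *\<^sub>R e) - f x) /\<^sub>R t - F e) \<longlongrightarrow> 0) (at 0 within {0<..})"
    by (rule Lim_transform_eventually)
  then have "((\<lambda>t. (f (x + t *\<^sub>R e) - f x) /\<^sub>R t) \<longlongrightarrow> F e) (at 0 within {0<..})"
    by (rule LIM_zero_cancel)
  moreover have "filterlim (\<lambda>n. 1 / real (Suc n)) (at 0 within {0<..}) sequentially"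
    unfolding filterlim_at using LIMSEQ_inverse_real_of_nat by (auto simp: inverse_eq_divide)
  ultimately show ?thesis by (drule_tac filterlim_compose) auto
qed

lemma one_sided_difference_quotient:
  fixes f :: "real^'d \<Rightarrow> real^'m"
  assumes "(f has_derivative (\<lambda>h. A *v h)) (at x within {x..})"
  shows "(\<lambda>n. (f (x + (1 / real (Suc n)) *\<^sub>R axis j 1) $ i - f x $ i) / (1 / real (Suc n))) \<longlonglongrightarrow> A $ i $ j"
proof -
  have "x + t *\<^sub>R axis j 1 \<in> {x..}" if "t > 0" for t
    using that by (auto simp: less_eq_vec_def axis_def)
  from has_derivative_within_difference_quotient[OF assms this]
  have "(\<lambda>n. ((f (x + (1 / real (Suc n)) *\<^sub>R axis j 1) - f x) /\<^sub>R (1 / real (Suc n))) $ i) \<longlonglongrightarrow> (A *v axis j 1) $ i"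
    by (rule tendsto_vec_nth)
  then show ?thesis by (simp add: matrix_vector_mult_basis column_def divide_inverse mult.commute)
qed

text \<open>At almost every point of \<open>D\<close> the gradient is the limit of forward
  difference quotients, which are continuous; completeness of Lebesgue measure takes care of the
  exceptional set. The indicator is there because \<open>G\<close> is arbitrary outside
  \<open>D\<close>.\<close>

lemma lip_grad_measurable:
  fixes f :: "real^'d \<Rightarrow> real^'m"
  assumes lg: "lip_grad D f G" and D: "open D"
  shows "(\<lambda>x. indicator D x *\<^sub>R G x) \<in> borel_measurable lebesgue"
proof -
  obtain L where L: "L-lipschitz_on UNIV f" using lg by (auto simp: lip_grad_def)
  have cf: "continuous_on UNIV f" by (rule lipschitz_on_continuous_on[OF L])
  define F where "F = (\<lambda>n x. (\<chi> i j. (f (x + (1 / real (Suc n)) *\<^sub>R axis j 1) $ i - f x $ i) / (1 / real (Suc n))))"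
  have "continuous_on UNIV (F n)" for n
    unfolding F_def
    by (intro continuous_on_vec_lambda continuous_intros continuous_on_compose2[OF cf]) auto
  then have F: "(\<lambda>x. indicator D x *\<^sub>R F n x) \<in> borel_measurable lebesgue" for n
    using D by (intro borel_measurable_scaleR continuous_imp_measurable_lebesgue borel_measurable_indicator) auto
  have "(\<lambda>x. lim (\<lambda>n. indicator D x *\<^sub>R F n x)) \<in> borel_measurable lebesgue"
    by (rule borel_measurable_lim_metric[OF F])
  moreover have "AE x in lebesgue. lim (\<lambda>n. indicator D x *\<^sub>R F n x) = indicator D x *\<^sub>R G x"
  proof -
    have "AE x in lebesgue. x \<in> D \<longrightarrow> (f has_derivative (\<lambda>h. G x *v h)) (at x within {x..})"
      using lg by (simp add: lip_grad_def)
    then show ?thesis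
    proof (rule eventually_mono)
      fix x assume *: "x \<in> D \<longrightarrow> (f has_derivative (\<lambda>h. G x *v h)) (at x within {x..})"
      show "lim (\<lambda>n. indicator D x *\<^sub>R F n x) = indicator D x *\<^sub>R G x"
      proof (cases "x \<in> D")
        case True
        then have "(\<lambda>n. F n x) \<longlonglongrightarrow> G x"
          unfolding F_def using * by (intro vec_tendstoI) (simp only: vec_lambda_beta, rule one_sided_difference_quotient, simp)
        then show ?thesis using True by (simp add: limI)
      qed simp
    qed
  qed
  ultimately show ?thesis by (rule borel_measurable_AE)
qed

lemma lip_grad_entry_bound:
  fixes f :: "real^'d \<Rightarrow> real^'m"
  assumes "L-lipschitz_on UNIV f" "(f has_derivative (\<lambda>h. A *v h)) (at x within {x..})"
  shows "\<bar>A $ i $ j\<bar> \<le> L"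
proof (rule tendsto_le[OF sequentially_bot tendsto_const tendsto_rabs[OF one_sided_difference_quotient[OF assms(2)]]])
  show "\<forall>\<^sub>F n in sequentially. \<bar>(f (x + (1 / real (Suc n)) *\<^sub>R axis j 1) $ i - f x $ i) / (1 / real (Suc n))\<bar> \<le> L"
  proof (rule always_eventually, rule allI)
    fix n
    let ?y = "x + (1 / real (Suc n)) *\<^sub>R axis j 1"
    have "\<bar>f ?y $ i - f x $ i\<bar> \<le> norm (f ?y - f x)"
      using Finite_Cartesian_Product.norm_nth_le[of "f ?y - f x" i] by simp
    also have "\<dots> \<le> L * dist ?y x" using lipschitz_onD[OF assms(1), of ?y x] by (simp add: dist_norm)
    also have "\<dots> = L * (1 / real (Suc n))" by (simp add: dist_norm)
    finally show "\<bar>(f ?y $ i - f x $ i) / (1 / real (Suc n))\<bar> \<le> L"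
      unfolding abs_divide by (subst pos_divide_le_eq) auto
  qed
qed

lemma norm_matrix_le:
  fixes A :: "real^'d^'m" and L :: real
  assumes "\<And>i j. \<bar>A $ i $ j\<bar> \<le> L"
  shows "norm A \<le> CARD('m) * CARD('d) * L"
proof -
  have "norm A \<le> (\<Sum>i\<in>UNIV. norm (A $ i))" by (simp add: norm_vec_def L2_set_le_sum)
  also have "\<dots> \<le> (\<Sum>i\<in>UNIV. \<Sum>j\<in>UNIV. \<bar>A $ i $ j\<bar>)" by (intro sum_mono norm_le_l1_cart)
  also have "\<dots> \<le> (\<Sum>i\<in>(UNIV::'m set). \<Sum>j\<in>(UNIV::'d set). L)" by (intro sum_mono assms)
  finally show ?thesis by (simp add: mult.assoc)
qed

lemma lip_grad_bounded:
  fixes f :: "real^'d \<Rightarrow> real^'m"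
  assumes "lip_grad D f G"
  obtains M where "AE x in lebesgue. x \<in> D \<longrightarrow> norm (G x) \<le> M"
proof -
  obtain L where L: "L-lipschitz_on UNIV f" using assms by (auto simp: lip_grad_def)
  have "AE x in lebesgue. x \<in> D \<longrightarrow> (f has_derivative (\<lambda>h. G x *v h)) (at x within {x..})"
    using assms by (simp add: lip_grad_def)
  then have "AE x in lebesgue. x \<in> D \<longrightarrow> norm (G x) \<le> CARD('m) * CARD('d) * L"
    by (rule eventually_mono) (use lip_grad_entry_bound[OF L] norm_matrix_le in blast)
  then show ?thesis by (rule that)
qed

lemma test_function_lipschitz:
  fixes \<phi> :: "real^'d \<Rightarrow> real"
  assumes "test_function D \<phi> g"
  obtains B where "B \<ge> 0" "\<And>x. norm (g x) \<le> B" "\<And>x y. \<bar>\<phi> x - \<phi> y\<bar> \<le> B * norm (x - y)"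
    "\<And>x. x \<notin> closure {x. \<phi> x \<noteq> 0} \<Longrightarrow> g x = 0"
proof -
  let ?K = "closure {x. \<phi> x \<noteq> 0}"
  have g: "\<And>x. (\<phi> has_derivative (\<lambda>h. h \<bullet> g x)) (at x)" "continuous_on UNIV g" "compact ?K"
    using assms by (auto simp: test_function_def gderiv_def)
  have g0: "g x = 0" if "x \<notin> ?K" for x
  proof -
    have "((\<lambda>_. 0) has_derivative (\<lambda>h. h \<bullet> g x)) (at x)"
      by (rule has_derivative_transform_within_open[OF g(1), of "- ?K"]) (use that closure_subset[of "{x. \<phi> x \<noteq> 0}"] in auto)
    from has_derivative_unique[OF this has_derivative_const[of 0]]
    have "g x \<bullet> g x = 0" by (metis (no_types))
    then show ?thesis by simp
  qed
  have "bounded (g ` ?K)"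
    by (intro compact_imp_bounded compact_continuous_image) (use g in \<open>auto intro: continuous_on_subset\<close>)
  then obtain B0 where B0: "\<And>x. x \<in> ?K \<Longrightarrow> norm (g x) \<le> B0" by (auto simp: bounded_iff)
  define B where "B = max 0 B0"
  have B: "norm (g x) \<le> B" for x using B0[of x] g0[of x] by (cases "x \<in> ?K") (auto simp: B_def)
  have "norm (\<phi> x - \<phi> y) \<le> B * norm (x - y)" for x y
  proof (rule differentiable_bound[of UNIV \<phi> "\<lambda>x h. h \<bullet> g x"])
    fix x
    show "onorm (\<lambda>h. h \<bullet> g x) \<le> B"
    proof (rule onorm_bound)
      show "norm (h \<bullet> g x) \<le> B * norm h" for h
      proof -
        have "norm (h \<bullet> g x) \<le> norm h * norm (g x)" by (simp add: Cauchy_Schwarz_ineq2)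
        also have "\<dots> \<le> norm h * B" by (intro mult_left_mono B) simp
        finally show ?thesis by (simp add: mult.commute)
      qed
    qed (simp add: B_def)
  qed (use g in auto)
  then show ?thesis using that[of B] B g0 by (auto simp: B_def)
qed

lemma lebesgue_integral_translation:
  fixes f :: "'a::euclidean_space \<Rightarrow> real"
  assumes f: "continuous_on UNIV f"
  shows "(\<integral>x. f (x + c) \<partial>lebesgue) = (\<integral>x. f x \<partial>lebesgue)"
proof -
  have m: "f \<in> borel_measurable borel" "(\<lambda>x. f (x + c)) \<in> borel_measurable borel"
    by (intro borel_measurable_continuous_onI f continuous_on_compose2[OF f] continuous_intros; simp)+
  have "(\<integral>x. f x \<partial>lborel) = (\<integral>x. f x \<partial>distr lborel borel ((+) c))" by (simp add: lborel_distr_plus)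
  also have "\<dots> = (\<integral>x. f (c + x) \<partial>lborel)" using m by (subst integral_distr) auto
  finally show ?thesis using m by (simp add: integral_completion add.commute)
qed

text \<open>Summation by parts: translation invariance turns backward quotients of \<phi> against
  \<open>f\<close> into forward quotients of \<open>f\<close> against \<phi>, and both sides
  converge by dominated convergence. The direction matters, since \<open>f\<close> is differentiated
  only along \<open>{x..}\<close>, whereas \<phi> has derivatives in every direction.\<close>

lemma lip_grad_has_weak_gradient:
  fixes f :: "real^'d \<Rightarrow> real^'m"
  assumes lg: "lip_grad D f G" and D: "open D"
  shows "has_weak_gradient D f G"
  unfolding has_weak_gradient_def
proof (intro conjI allI impI)
  obtain L where L: "L-lipschitz_on UNIV f" using lg by (auto simp: lip_grad_def)
  have cf: "continuous_on UNIV f" by (rule lipschitz_on_continuous_on[OF L])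
  obtain M where M: "AE x in lebesgue. x \<in> D \<longrightarrow> norm (G x) \<le> M" by (rule lip_grad_bounded[OF lg])
  note mG = lip_grad_measurable[OF lg D]
  show "locally_integrable D f" using cf locally_integrable_continuous continuous_on_subset by blast
  show "locally_integrable D G"
    unfolding locally_integrable_def set_integrable_def
  proof (intro allI impI)
    fix K :: "(real^'d) set" assume K: "compact K \<and> K \<subseteq> D"
    have Km: "K \<in> sets lebesgue" using K by (simp add: fmeasurableD lmeasurable_compact)
    show "integrable lebesgue (\<lambda>x. indicator K x *\<^sub>R G x)"
    proof (rule Bochner_Integration.integrable_bound)
      show "integrable lebesgue (\<lambda>x. indicator K x *\<^sub>R M)"
        using K by (intro integrable_scaleR_left) (simp add: lmeasurable_iff_integrable[symmetric] lmeasurable_compact)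
      have "(\<lambda>x. indicator K x *\<^sub>R indicator D x *\<^sub>R G x) \<in> borel_measurable lebesgue"
        using Km by (intro borel_measurable_scaleR mG borel_measurable_indicator)
      also have "(\<lambda>x. indicator K x *\<^sub>R indicator D x *\<^sub>R G x) = (\<lambda>x. indicator K x *\<^sub>R G x)"
        using K by (auto simp: fun_eq_iff indicator_def)
      finally show "(\<lambda>x. indicator K x *\<^sub>R G x) \<in> borel_measurable lebesgue" .
      show "AE x in lebesgue. norm (indicator K x *\<^sub>R G x) \<le> norm (indicator K x *\<^sub>R M)"
        using M by (rule eventually_mono) (use K in \<open>auto simp: indicator_def\<close>)
    qed
  qed
  fix \<phi> g i j assume tf: "test_function D \<phi> g"
  obtain B where B: "B \<ge> 0" "\<And>x. norm (g x) \<le> B" "\<And>x y. \<bar>\<phi> x - \<phi> y\<bar> \<le> B * norm (x - y)"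
    "\<And>x. x \<notin> closure {x. \<phi> x \<noteq> 0} \<Longrightarrow> g x = 0" using test_function_lipschitz[OF tf] by blast
  define K where "K = closure {x. \<phi> x \<noteq> 0}"
  have K: "compact K" "K \<subseteq> D" using tf by (auto simp: test_function_def K_def)
  have \<phi>0: "\<phi> x = 0" if "x \<notin> K" for x using that closure_subset[of "{x. \<phi> x \<noteq> 0}"] by (auto simp: K_def)
  have der: "(\<phi> has_derivative (\<lambda>h. h \<bullet> g x)) (at x)" for x using tf by (simp add: test_function_def gderiv_def)
  have c\<phi>: "continuous_on UNIV \<phi>"
    using der has_derivative_continuous continuous_at_imp_continuous_on by blast
  have cg: "continuous_on UNIV g" using tf by (simp add: test_function_def)
  let ?e = "axis j 1 :: real^'d"
  define t where "t = (\<lambda>n. 1 / real (Suc n))"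
  have t: "0 < t n" "t n \<le> 1" for n by (auto simp: t_def)
  define P where "P = (\<lambda>n x. f x $ i * ((\<phi> (x + t n *\<^sub>R (- ?e)) - \<phi> x) / t n))"
  define Q where "Q = (\<lambda>n x. \<phi> x * ((f (x + t n *\<^sub>R ?e) $ i - f x $ i) / t n))"
  have cP: "continuous_on UNIV (P n)" and cQ: "continuous_on UNIV (Q n)" for n
    unfolding P_def Q_def using t[of n]
    by (intro continuous_intros cf c\<phi> continuous_on_compose2[OF cf] continuous_on_compose2[OF c\<phi>]; simp)+
  have compact_int: "integrable lebesgue h" if "continuous_on UNIV h" "compact S" "\<And>x. x \<notin> S \<Longrightarrow> h x = 0" for h :: "real^'d \<Rightarrow> real" and S
  proof -
    have "set_integrable lebesgue S h"
      using locally_integrable_continuous[OF that(1)] that(2) by (simp add: locally_integrable_def)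
    moreover have "(\<lambda>x. indicator S x *\<^sub>R h x) = h" using that(3) by (auto simp: fun_eq_iff indicator_def)
    ultimately show ?thesis by (simp add: set_integrable_def)
  qed
  have PQ: "(\<integral>x. P n x \<partial>lebesgue) = (\<integral>x. Q n x \<partial>lebesgue)" for n
  proof -
    let ?a = "\<lambda>x. f (x + t n *\<^sub>R ?e) $ i * \<phi> x" and ?b = "\<lambda>x. f x $ i * \<phi> x"
    have ca: "continuous_on UNIV ?a" "continuous_on UNIV ?b"
      by (intro continuous_intros cf c\<phi> continuous_on_compose2[OF cf]; simp)+
    have ia: "integrable lebesgue ?a" "integrable lebesgue ?b"
      by (rule compact_int[OF _ K(1)]; use ca \<phi>0 in simp)+
    have c1: "continuous_on UNIV (\<lambda>x. ?a (x + t n *\<^sub>R (- ?e)))"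
      by (rule continuous_on_compose2[OF ca(1)]) (auto intro!: continuous_intros)
    have i1: "integrable lebesgue (\<lambda>x. ?a (x + t n *\<^sub>R (- ?e)))"
    proof (rule compact_int[OF c1])
      show "compact ((\<lambda>x. x + t n *\<^sub>R ?e) ` K)" by (intro compact_continuous_image continuous_intros K)
      show "?a (x + t n *\<^sub>R (- ?e)) = 0" if "x \<notin> (\<lambda>x. x + t n *\<^sub>R ?e) ` K" for x
      proof -
        have "x + t n *\<^sub>R (- ?e) \<notin> K"
        proof
          assume "x + t n *\<^sub>R (- ?e) \<in> K"
          then have "x \<in> (\<lambda>x. x + t n *\<^sub>R ?e) ` K" by (intro image_eqI[where x="x + t n *\<^sub>R (- ?e)"]) auto
          with that show False ..
        qed
        from \<phi>0[OF this] show ?thesis by (simp only: mult_zero_right)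
      qed
    qed
    have "(\<integral>x. P n x \<partial>lebesgue) = (\<integral>x. (?a (x + t n *\<^sub>R (- ?e)) - ?b x) / t n \<partial>lebesgue)"
      by (simp add: P_def algebra_simps diff_divide_distrib)
    also have "\<dots> = ((\<integral>x. ?a (x + t n *\<^sub>R (- ?e)) \<partial>lebesgue) - (\<integral>x. ?b x \<partial>lebesgue)) / t n"
      using Bochner_Integration.integral_diff[OF i1 ia(2)] by (simp del: scaleR_minus_right)
    also have "\<dots> = ((\<integral>x. ?a x \<partial>lebesgue) - (\<integral>x. ?b x \<partial>lebesgue)) / t n"
      by (subst lebesgue_integral_translation[OF ca(1)]) simp
    also have "\<dots> = (\<integral>x. (?a x - ?b x) / t n \<partial>lebesgue)"
      using Bochner_Integration.integral_diff[OF ia] by simp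
    also have "\<dots> = (\<integral>x. Q n x \<partial>lebesgue)"
      by (simp add: Q_def algebra_simps diff_divide_distrib)
    finally show ?thesis .
  qed
  have limP: "(\<lambda>n. \<integral>x. P n x \<partial>lebesgue) \<longlonglongrightarrow> (\<integral>x. - (f x $ i * g x $ j) \<partial>lebesgue)"
  proof -
    \<comment> \<open>Contains \<open>K\<close> and its shifts by \<open>t n\<close> along the axis,
      hence the support of every \<open>P n\<close>; it carries the dominating function.\<close>
    define K' where "K' = (\<lambda>(s, x). x + s *\<^sub>R ?e) ` ({0..1} \<times> K)"
    have K': "compact K'" unfolding K'_def
      by (intro compact_continuous_image compact_Times K) (auto intro!: continuous_intros simp: split_def)
    have "bounded ((\<lambda>x. f x $ i) ` K')"
      by (intro compact_imp_bounded compact_continuous_image K' continuous_intros continuous_on_subset[OF cf]) auto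
    then obtain R where R: "\<And>x. x \<in> K' \<Longrightarrow> \<bar>f x $ i\<bar> \<le> R" by (auto simp: bounded_iff)
    show ?thesis
    proof (rule integral_dominated_convergence[where w="\<lambda>x. indicator K' x *\<^sub>R (R * B)"])
      show "(\<lambda>x. - (f x $ i * g x $ j)) \<in> borel_measurable lebesgue"
        by (intro continuous_imp_measurable_lebesgue continuous_intros cf cg)
      show "P n \<in> borel_measurable lebesgue" for n by (rule continuous_imp_measurable_lebesgue[OF cP])
      show "integrable lebesgue (\<lambda>x. indicator K' x *\<^sub>R (R * B))"
        using K' by (intro integrable_scaleR_left) (simp add: lmeasurable_iff_integrable[symmetric] lmeasurable_compact)
      show "AE x in lebesgue. (\<lambda>n. P n x) \<longlonglongrightarrow> - (f x $ i * g x $ j)"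
      proof (rule always_eventually, rule allI)
        fix x
        have "(\<lambda>n. (\<phi> (x + t n *\<^sub>R (- ?e)) - \<phi> x) /\<^sub>R t n) \<longlonglongrightarrow> (- ?e) \<bullet> g x"
          using has_derivative_within_difference_quotient[OF der[of x], of "- ?e"] by (simp add: t_def)
        then have "(\<lambda>n. (\<phi> (x + t n *\<^sub>R (- ?e)) - \<phi> x) / t n) \<longlonglongrightarrow> - g x $ j"
          by (simp add: inner_axis inner_commute divide_inverse mult.commute)
        from tendsto_mult[OF tendsto_const[of "f x $ i"] this] show "(\<lambda>n. P n x) \<longlonglongrightarrow> - (f x $ i * g x $ j)"
          by (simp add: P_def)
      qed
      show "AE x in lebesgue. norm (P n x) \<le> indicator K' x *\<^sub>R (R * B)" for n
      proof (rule always_eventually, rule allI)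
        fix x
        show "norm (P n x) \<le> indicator K' x *\<^sub>R (R * B)"
        proof (cases "x \<in> K'")
          case True
          have "\<bar>\<phi> (x + t n *\<^sub>R (- ?e)) - \<phi> x\<bar> \<le> B * norm ((x + t n *\<^sub>R (- ?e)) - x)" by (rule B(3))
          also have "\<dots> = B * t n" using t[of n] by simp
          finally have "\<bar>(\<phi> (x + t n *\<^sub>R (- ?e)) - \<phi> x) / t n\<bar> \<le> B" using t[of n] by (simp add: divide_le_eq)
          moreover have "\<bar>f x $ i\<bar> \<le> R" by (rule R[OF True])
          ultimately have "\<bar>f x $ i\<bar> * \<bar>(\<phi> (x + t n *\<^sub>R (- ?e)) - \<phi> x) / t n\<bar> \<le> R * B" by (intro mult_mono) auto
          then show ?thesis using True by (simp add: P_def abs_mult)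
        next
          case False
          have "x \<notin> K" using False unfolding K'_def by (force intro!: image_eqI[where x="(0, x)"])
          moreover have "x + t n *\<^sub>R (- ?e) \<notin> K"
          proof
            assume "x + t n *\<^sub>R (- ?e) \<in> K"
            then have "x \<in> K'" unfolding K'_def using t[of n]
              by (intro image_eqI[where x="(t n, x + t n *\<^sub>R (- ?e))"]) auto
            with False show False ..
          qed
          ultimately show ?thesis using \<phi>0 False by (simp add: P_def)
        qed
      qed
    qed
  qed
  have limQ: "(\<lambda>n. \<integral>x. Q n x \<partial>lebesgue) \<longlonglongrightarrow> (\<integral>x. \<phi> x * (indicator D x *\<^sub>R G x) $ i $ j \<partial>lebesgue)"
  proof (rule integral_dominated_convergence[where w="\<lambda>x. \<bar>\<phi> x\<bar> * L"])
    have "(\<lambda>w::real^'d^'m. w $ i $ j) \<in> borel_measurable borel"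
      by (intro borel_measurable_continuous_onI continuous_intros)
    from measurable_compose[OF mG this]
    show "(\<lambda>x. \<phi> x * (indicator D x *\<^sub>R G x) $ i $ j) \<in> borel_measurable lebesgue"
      by (intro borel_measurable_times continuous_imp_measurable_lebesgue[OF c\<phi>])
    show "Q n \<in> borel_measurable lebesgue" for n by (rule continuous_imp_measurable_lebesgue[OF cQ])
    show "integrable lebesgue (\<lambda>x. \<bar>\<phi> x\<bar> * L)"
      using \<phi>0 by (intro compact_int[OF _ K(1)] continuous_intros c\<phi>) auto
    have "AE x in lebesgue. x \<in> D \<longrightarrow> (f has_derivative (\<lambda>h. G x *v h)) (at x within {x..})"
      using lg by (simp add: lip_grad_def)
    then show "AE x in lebesgue. (\<lambda>n. Q n x) \<longlonglongrightarrow> \<phi> x * (indicator D x *\<^sub>R G x) $ i $ j"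
    proof (rule eventually_mono)
      fix x assume *: "x \<in> D \<longrightarrow> (f has_derivative (\<lambda>h. G x *v h)) (at x within {x..})"
      show "(\<lambda>n. Q n x) \<longlonglongrightarrow> \<phi> x * (indicator D x *\<^sub>R G x) $ i $ j"
      proof (cases "x \<in> D")
        case True
        then show ?thesis
          using tendsto_mult[OF tendsto_const[of "\<phi> x"] one_sided_difference_quotient[OF *[rule_format], of j i]]
          by (simp add: Q_def t_def)
      next
        case False
        then have "\<phi> x = 0" using \<phi>0[of x] K(2) by blast
        then show ?thesis by (simp add: Q_def)
      qed
    qed
    show "AE x in lebesgue. norm (Q n x) \<le> \<bar>\<phi> x\<bar> * L" for n
    proof (rule always_eventually, rule allI)
      fix x
      let ?y = "x + t n *\<^sub>R ?e"
      have "\<bar>f ?y $ i - f x $ i\<bar> \<le> norm (f ?y - f x)"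
        using Finite_Cartesian_Product.norm_nth_le[of "f ?y - f x" i] by simp
      also have "\<dots> \<le> L * dist ?y x" using lipschitz_onD[OF L, of ?y x] by (simp add: dist_norm)
      also have "\<dots> = L * t n" using t[of n] by (simp add: dist_norm)
      finally have "\<bar>(f ?y $ i - f x $ i) / t n\<bar> \<le> L" using t[of n] by (simp add: divide_le_eq)
      then show "norm (Q n x) \<le> \<bar>\<phi> x\<bar> * L" unfolding Q_def real_norm_def abs_mult by (rule mult_left_mono) simp
    qed
  qed
  have "(\<integral>x. - (f x $ i * g x $ j) \<partial>lebesgue) = (\<integral>x. \<phi> x * (indicator D x *\<^sub>R G x) $ i $ j \<partial>lebesgue)"
    using limP limQ unfolding PQ by (rule LIMSEQ_unique)
  also have "\<dots> = (\<integral>x. G x $ i $ j * \<phi> x \<partial>lebesgue)"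
    using \<phi>0 K(2) by (intro Bochner_Integration.integral_cong) (auto simp: indicator_def)
  finally have "(\<integral>x. f x $ i * g x $ j \<partial>lebesgue) = - (\<integral>x. G x $ i $ j * \<phi> x \<partial>lebesgue)" by simp
  moreover have "(\<integral>x. f x $ i * g x $ j \<partial>lebesgue_on D) = (\<integral>x. f x $ i * g x $ j \<partial>lebesgue)"
  proof (intro integral_lebesgue_on_eq D)
    show "f x $ i * g x $ j = 0" if "x \<notin> D" for x
    proof -
      have "g x = 0" using B(4)[of x] K(2) that by (auto simp: K_def)
      then show ?thesis by simp
    qed
  qed
  moreover have "(\<integral>x. G x $ i $ j * \<phi> x \<partial>lebesgue_on D) = (\<integral>x. G x $ i $ j * \<phi> x \<partial>lebesgue)"
  proof (intro integral_lebesgue_on_eq D)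
    show "G x $ i $ j * \<phi> x = 0" if "x \<notin> D" for x
      using \<phi>0[of x] K(2) that by auto
  qed
  ultimately show "(\<integral>x. f x $ i * g x $ j \<partial>lebesgue_on D) = - (\<integral>x. G x $ i $ j * \<phi> x \<partial>lebesgue_on D)" by simp
qed

text \<open>Converse of the passage to Lipschitz representatives. The second claim links the
  functionals, which are evaluated at \<open>weak_gradient\<close>, with competitors that are built
  together with an explicit gradient.\<close>

lemma lip_grad_W1inf0:
  fixes f :: "real^'d \<Rightarrow> real^'m"
  assumes lg: "lip_grad D f G" and D: "open D" "bounded D" and f0: "\<And>x. x \<notin> D \<Longrightarrow> f x = 0"
  shows "f \<in> W1inf0 D" and "AE x in lebesgue. x \<in> D \<longrightarrow> weak_gradient D f x = G x"
proof -
  note wg = lip_grad_has_weak_gradient[OF lg D(1)]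
  have "has_weak_gradient D f (weak_gradient D f)" using wg by (rule has_weak_gradient_weak_gradient)
  from weak_gradient_unique[OF D(1) this wg]
  show "AE x in lebesgue. x \<in> D \<longrightarrow> weak_gradient D f x = G x" .
  obtain L where L: "L-lipschitz_on UNIV f" using lg by (auto simp: lip_grad_def)
  have cf: "continuous_on UNIV f" by (rule lipschitz_on_continuous_on[OF L])
  have "compact (closure D)" using D(2) by (simp add: compact_closure)
  then have "bounded (f ` closure D)"
    by (intro compact_imp_bounded compact_continuous_image continuous_on_subset[OF cf]) auto
  then obtain R where R: "\<And>x. x \<in> closure D \<Longrightarrow> norm (f x) \<le> R" by (auto simp: bounded_iff)
  have "f \<in> Linf D"
    unfolding Linf_def using R closure_subset[of D] D(1)
    by (auto intro!: measurable_restrict_space1 continuous_imp_measurable_lebesgue[OF cf] exI[of _ R] AE_lebesgue_on_iff[THEN iffD2])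
  moreover have "G \<in> Linf D"
  proof -
    obtain M where "AE x in lebesgue. x \<in> D \<longrightarrow> norm (G x) \<le> M" by (rule lip_grad_bounded[OF lg])
    then show ?thesis unfolding Linf_def using lip_grad_measurable[OF lg D(1)] D(1)
      by (auto simp: AE_lebesgue_on_iff borel_measurable_restrict_space_iff)
  qed
  ultimately have "f \<in> W1inf D" using wg by (auto simp: W1inf_def)
  moreover have "\<forall>x\<in>frontier D. f x = 0" using f0 D(1) by (auto simp: frontier_def interior_open)
  ultimately show "f \<in> W1inf0 D"
    unfolding W1inf0_def using continuous_on_subset[OF cf] by (auto intro!: exI[of _ f])
qed

section \<open>Calculus of one-sided gradients\<close>

lemma lip_grad_add:
  assumes "lip_grad D f F" "lip_grad D g G"
  shows "lip_grad D (\<lambda>x. f x + g x) (\<lambda>x. F x + G x)"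
proof -
  obtain L M where "L-lipschitz_on UNIV f" "M-lipschitz_on UNIV g" using assms by (auto simp: lip_grad_def)
  then have "(L + M)-lipschitz_on UNIV (\<lambda>x. f x + g x)" by (rule lipschitz_on_add)
  moreover have "AE x in lebesgue. x \<in> D \<longrightarrow> ((\<lambda>x. f x + g x) has_derivative (\<lambda>h. (F x + G x) *v h)) (at x within {x..})"
    using assms[unfolded lip_grad_def, THEN conjunct2]
    by eventually_elim (auto intro!: has_derivative_eq_rhs[OF has_derivative_add] simp: matrix_vector_mult_add_rdistrib)
  ultimately show ?thesis unfolding lip_grad_def by blast
qed

lemma lip_grad_scaleR:
  assumes "lip_grad D f F"
  shows "lip_grad D (\<lambda>x. c *\<^sub>R f x) (\<lambda>x. c *\<^sub>R F x)"
proof -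
  obtain L where "L-lipschitz_on UNIV f" using assms by (auto simp: lip_grad_def)
  then have "(\<bar>c\<bar> * L)-lipschitz_on UNIV (\<lambda>x. c *\<^sub>R f x)" by (rule lipschitz_on_cmult)
  moreover have "AE x in lebesgue. x \<in> D \<longrightarrow> ((\<lambda>x. c *\<^sub>R f x) has_derivative (\<lambda>h. (c *\<^sub>R F x) *v h)) (at x within {x..})"
    using assms[unfolded lip_grad_def, THEN conjunct2]
    by eventually_elim (auto intro!: has_derivative_eq_rhs[OF has_derivative_scaleR_right] simp: scaleR_matrix_vector_assoc)
  ultimately show ?thesis unfolding lip_grad_def by blast
qed

lemma lip_grad_diff:
  assumes "lip_grad D f F" "lip_grad D g G"
  shows "lip_grad D (\<lambda>x. f x - g x) (\<lambda>x. F x - G x)"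
  using lip_grad_add[OF assms(1) lip_grad_scaleR[OF assms(2), of "-1"]] by simp

lemma lip_grad_affine: "lip_grad D (\<lambda>x. c + A *v (x - a)) (\<lambda>_. A)"
proof -
  have "dist (c + A *v (x - a)) (c + A *v (y - a)) \<le> norm A * dist x y" for x y
    using norm_matrix_vector_mult_le[of A "x - y"] by (simp add: dist_norm matrix_vector_mult_diff_distrib)
  then have "(norm A)-lipschitz_on UNIV (\<lambda>x. c + A *v (x - a))" by (intro lipschitz_onI) auto
  moreover have "((\<lambda>x. c + A *v (x - a)) has_derivative (\<lambda>h. A *v h)) (at x within {x..})" for x
  proof -
    have "((\<lambda>x. A *v x) has_derivative (\<lambda>h. A *v h)) (at x within {x..})"
      by (rule bounded_linear_imp_has_derivative[OF matrix_vector_mul_bounded_linear])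
    from has_derivative_add[OF has_derivative_const[of "c - A *v a"] this] show ?thesis
      by (simp add: matrix_vector_mult_diff_distrib algebra_simps)
  qed
  ultimately show ?thesis unfolding lip_grad_def by auto
qed

lemma lip_grad_zero: "lip_grad D (\<lambda>_. 0) (\<lambda>_. 0)"
  using lip_grad_affine[of D 0 0 0] by simp

lemma lip_grad_sum:
  assumes "finite I" "\<And>i. i \<in> I \<Longrightarrow> lip_grad D (f i) (F i)"
  shows "lip_grad D (\<lambda>x. \<Sum>i\<in>I. f i x) (\<lambda>x. \<Sum>i\<in>I. F i x)"
  using assms by (induction I rule: finite_induct) (auto intro: lip_grad_zero lip_grad_add)

lemma lip_grad_subset: "lip_grad D f F \<Longrightarrow> E \<subseteq> D \<Longrightarrow> lip_grad E f F"
  unfolding lip_grad_def by (auto elim!: eventually_mono)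

text \<open>A homothety with positive factor maps the orthant \<open>{y..}\<close> into the orthant
  at the image of \<open>y\<close>, so one-sided differentiability survives; the exceptional null
  set is transported by the affine change of variables.\<close>

lemma lip_grad_rescale:
  fixes f :: "real^'d \<Rightarrow> real^'m"
  assumes "lip_grad D f F" "r > 0" "\<And>y. y \<in> E \<Longrightarrow> (y - a) /\<^sub>R r \<in> D"
  shows "lip_grad E (\<lambda>y. c *\<^sub>R f ((y - a) /\<^sub>R r)) (\<lambda>y. (c / r) *\<^sub>R F ((y - a) /\<^sub>R r))"
proof -
  obtain L where L: "L-lipschitz_on UNIV f" using assms by (auto simp: lip_grad_def)
  have "(\<bar>c\<bar> * (L * (1 / r)))-lipschitz_on UNIV (\<lambda>y. c *\<^sub>R f ((y - a) /\<^sub>R r))"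
  proof (rule lipschitz_on_cmult)
    have 1: "(1 / r)-lipschitz_on UNIV (\<lambda>y. (y - a) /\<^sub>R r)"
      using assms(2) by (intro lipschitz_onI) (auto simp: dist_norm divide_inverse mult.commute simp flip: scaleR_diff_right)
    have "L-lipschitz_on ((\<lambda>y. (y - a) /\<^sub>R r) ` UNIV) f" using L lipschitz_on_subset by blast
    then show "(L * (1 / r))-lipschitz_on UNIV (\<lambda>y. f ((y - a) /\<^sub>R r))" by (rule lipschitz_on_compose2[OF 1])
  qed
  moreover have "AE y in lebesgue. y \<in> E \<longrightarrow>
     ((\<lambda>y. c *\<^sub>R f ((y - a) /\<^sub>R r)) has_derivative (\<lambda>h. ((c / r) *\<^sub>R F ((y - a) /\<^sub>R r)) *v h)) (at y within {y..})"
  proof -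
    have "AE x in lebesgue. x \<in> D \<longrightarrow> (f has_derivative (\<lambda>h. F x *v h)) (at x within {x..})"
      using assms by (simp add: lip_grad_def)
    from AE_affine_lebesgue[OF this, of "1 / r" "- (a /\<^sub>R r)"]
    have "AE y in lebesgue. (y - a) /\<^sub>R r \<in> D \<longrightarrow>
       (f has_derivative (\<lambda>h. F ((y - a) /\<^sub>R r) *v h)) (at ((y - a) /\<^sub>R r) within {(y - a) /\<^sub>R r..})"
      using assms(2) by (simp add: algebra_simps divide_inverse)
    then show ?thesis
    proof (rule eventually_mono, intro impI)
      fix y assume *: "(y - a) /\<^sub>R r \<in> D \<longrightarrow>
       (f has_derivative (\<lambda>h. F ((y - a) /\<^sub>R r) *v h)) (at ((y - a) /\<^sub>R r) within {(y - a) /\<^sub>R r..})" and y: "y \<in> E"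
      have 1: "((\<lambda>y. (y - a) /\<^sub>R r) has_derivative (\<lambda>h. h /\<^sub>R r)) (at y within {y..})"
        by (auto intro!: derivative_eq_intros)
      have "(f has_derivative (\<lambda>h. F ((y - a) /\<^sub>R r) *v h)) (at ((y - a) /\<^sub>R r) within (\<lambda>y. (y - a) /\<^sub>R r) ` {y..})"
        by (rule has_derivative_subset[OF *[rule_format, OF assms(3)[OF y]]])
           (use assms(2) in \<open>auto simp: less_eq_vec_def intro!: mult_left_mono\<close>)
      from has_derivative_scaleR_right[OF has_derivative_in_compose[OF 1 this], of c]
      show "((\<lambda>y. c *\<^sub>R f ((y - a) /\<^sub>R r)) has_derivative (\<lambda>h. ((c / r) *\<^sub>R F ((y - a) /\<^sub>R r)) *v h)) (at y within {y..})"
        by (simp add: scaleR_matrix_vector_assoc[symmetric] matrix_vector_mult_scaleR divide_inverse)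
    qed
  qed
  ultimately show ?thesis unfolding lip_grad_def by blast
qed

section \<open>Cutoff on cubes and extension by zero\<close>

text \<open>The rank-one matrix that the gradient of a scalar cutoff contributes to the product rule
  for a vector-valued function.\<close>

definition outer :: "real^'m \<Rightarrow> real^'d \<Rightarrow> real^'d^'m" where
  "outer u w = (\<chi> i. u $ i *\<^sub>R w)"

lemma outer_mult: "outer u w *v h = (w \<bullet> h) *\<^sub>R u"
  by (simp add: outer_def vec_eq_iff matrix_vector_mul_component)

lemma norm_outer: "norm (outer u w) = norm u * norm w"
  by (simp add: outer_def norm_vec_def[of "vec_lambda _"] L2_set_left_distrib[symmetric] norm_vec_def[of u])

text \<open>\<open>?p\<close> penalises each coordinate that lies within \<kappa> of a face of the
  unit cube or beyond it. It vanishes on the inner cube and is at least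
  \<open>\<kappa>\<^sup>2\<close> off the open unit cube, so with
  \<open>c = 1 / \<kappa>\<^sup>2\<close> the expression \<open>1 - c * ?p\<close> falls from 1 to a
  nonpositive value across the layer. Squaring positive parts keeps everything continuously
  differentiable, as a test function requires.\<close>

lemma cube_cutoff:
  assumes \<kappa>: "\<kappa> > 0"
  obtains \<psi> :: "real^'d \<Rightarrow> real" and g \<Lambda> where
    "\<And>x. (\<psi> has_derivative (\<lambda>h. h \<bullet> g x)) (at x)" "\<And>x. 0 \<le> \<psi> x" "\<And>x. \<psi> x \<le> 1"
    "\<And>x. x \<notin> box 0 1 \<Longrightarrow> \<psi> x = 0" "\<And>x. x \<notin> cbox 0 1 \<Longrightarrow> g x = 0"
    "\<And>x. x \<in> cbox (\<kappa> *\<^sub>R 1) ((1 - \<kappa>) *\<^sub>R 1) \<Longrightarrow> \<psi> x = 1"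
    "\<Lambda> \<ge> 0" "\<And>x. norm (g x) \<le> \<Lambda>" "\<And>x y. \<bar>\<psi> x - \<psi> y\<bar> \<le> \<Lambda> * norm (x - y)" "test_function UNIV \<psi> g"
proof -
  let ?p = "\<lambda>x::real^'d. \<Sum>i\<in>UNIV. (max 0 (\<kappa> - x $ i))\<^sup>2 + (max 0 (x $ i - (1 - \<kappa>)))\<^sup>2"
  define p' where "p' = (\<lambda>x::real^'d. \<chi> i. 2 * max 0 (x $ i - (1 - \<kappa>)) - 2 * max 0 (\<kappa> - x $ i))"
  define c where "c = 1 / \<kappa>\<^sup>2"
  have c: "c > 0" using \<kappa> by (simp add: c_def)
  define \<psi> where "\<psi> = (\<lambda>x. (max 0 (1 - c * ?p x))\<^sup>2)"
  define g where "g = (\<lambda>x. (- 2 * max 0 (1 - c * ?p x) * c) *\<^sub>R p' x)"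
  have sq: "((\<lambda>y. (max 0 y)\<^sup>2) has_derivative (\<lambda>h. 2 * max 0 y * h)) (at y)" for y :: real
    by (rule has_derivative_eq_rhs[OF DERIV_max0_square[unfolded has_field_derivative_def]]) simp
  have p: "(?p has_derivative (\<lambda>h. h \<bullet> p' x)) (at x)" for x
  proof -
    have 1: "((\<lambda>x. (max 0 (\<kappa> - x $ i))\<^sup>2) has_derivative (\<lambda>h. 2 * max 0 (\<kappa> - x $ i) * (- h $ i))) (at x)" for i
      by (rule has_derivative_compose[OF _ sq]) (auto intro!: derivative_eq_intros bounded_linear_imp_has_derivative bounded_linear_vec_nth)
    have 2: "((\<lambda>x. (max 0 (x $ i - (1 - \<kappa>)))\<^sup>2) has_derivative (\<lambda>h. 2 * max 0 (x $ i - (1 - \<kappa>)) * h $ i)) (at x)" for i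
      by (rule has_derivative_compose[OF _ sq]) (auto intro!: derivative_eq_intros bounded_linear_imp_has_derivative bounded_linear_vec_nth)
    show ?thesis
      by (rule has_derivative_eq_rhs[OF has_derivative_sum[OF has_derivative_add[OF 1 2]]])
         (auto simp: fun_eq_iff p'_def inner_vec_def algebra_simps)
  qed
  have d: "(\<psi> has_derivative (\<lambda>h. h \<bullet> g x)) (at x)" for x
  proof -
    have "((\<lambda>x. 1 - c * ?p x) has_derivative (\<lambda>h. 0 - c * (h \<bullet> p' x))) (at x)"
      by (intro has_derivative_diff has_derivative_const has_derivative_mult_right p)
    from has_derivative_compose[OF this sq] show ?thesis
      unfolding \<psi>_def by (rule has_derivative_eq_rhs) (auto simp: fun_eq_iff g_def)
  qed
  have p0: "0 \<le> ?p x" for x by (intro sum_nonneg) auto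
  have term_le: "(max 0 (\<kappa> - x $ i))\<^sup>2 + (max 0 (x $ i - (1 - \<kappa>)))\<^sup>2 \<le> ?p x" for x :: "real^'d" and i
    by (rule member_le_sum) auto
  have pbig: "1 - c * ?p x \<le> 0" if out: "x \<notin> box 0 1" for x
  proof -
    obtain i where i: "x $ i \<le> 0 \<or> x $ i \<ge> 1" using out by (auto simp: mem_box_cart not_less)
    have "\<kappa>\<^sup>2 \<le> (max 0 (\<kappa> - x $ i))\<^sup>2 + (max 0 (x $ i - (1 - \<kappa>)))\<^sup>2"
    proof (cases "x $ i \<le> 0")
      case True
      then have "\<kappa>\<^sup>2 \<le> (max 0 (\<kappa> - x $ i))\<^sup>2" using \<kappa> by (intro power_mono) auto
      then show ?thesis by (simp add: add_increasing2)
    next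
      case False
      then have "\<kappa>\<^sup>2 \<le> (max 0 (x $ i - (1 - \<kappa>)))\<^sup>2" using \<kappa> i by (intro power_mono) auto
      then show ?thesis by (simp add: add_increasing)
    qed
    then have "\<kappa>\<^sup>2 \<le> ?p x" using term_le order_trans by blast
    then show ?thesis using mult_left_mono[of "\<kappa>\<^sup>2" "?p x" c] c \<kappa> by (simp add: c_def)
  qed
  have \<psi>0: "\<psi> x = 0" if "x \<notin> box 0 1" for x using pbig[OF that] by (simp add: \<psi>_def max_absorb1)
  have g0: "g x = 0" if "x \<notin> box 0 1" for x using pbig[OF that] by (simp add: g_def max_absorb1)
  have \<psi>1: "\<psi> x = 1" if "x \<in> cbox (\<kappa> *\<^sub>R 1) ((1 - \<kappa>) *\<^sub>R 1)" for x
  proof -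
    have "?p x = 0" using that by (intro sum.neutral) (auto simp: mem_box_cart)
    then show ?thesis by (simp add: \<psi>_def)
  qed
  have cg: "continuous_on UNIV g"
    unfolding g_def p'_def using \<kappa> by (intro continuous_intros continuous_on_vec_lambda)
  have "closure {x. \<psi> x \<noteq> 0} \<subseteq> cbox 0 1"
    by (rule closure_minimal) (use \<psi>0 box_subset_cbox in auto)
  then have tf: "test_function UNIV \<psi> g"
    unfolding test_function_def gderiv_def using d cg
    by (meson closed_closure compact_closure bounded_subset bounded_cbox closure_subset order_trans top_greatest)
  obtain B where B: "B \<ge> 0" "\<And>x. norm (g x) \<le> B" "\<And>x y. \<bar>\<psi> x - \<psi> y\<bar> \<le> B * norm (x - y)"
    using test_function_lipschitz[OF tf] by metis
  have le1: "\<psi> x \<le> 1" for x unfolding \<psi>_def using mult_nonneg_nonneg[OF less_imp_le[OF c] p0[of x]] by (intro power_le_one) auto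
  have "0 \<le> \<psi> x" for x by (simp add: \<psi>_def)
  moreover have "g x = 0" if "x \<notin> cbox 0 1" for x using g0[of x] that box_subset_cbox by blast
  ultimately show ?thesis
    using that[of \<psi> g B] d \<psi>0 \<psi>1 B le1 tf by blast
qed

text \<open>\<open>k\<close> may be unbounded on the whole space, but \<psi> vanishes off the
  rescaled cube, on which \<open>k\<close> is bounded by compactness. The Lipschitz estimate
  therefore pairs the difference of \<psi> with the value of \<open>k\<close> at a point known to
  lie in the cube; the remaining case follows by exchanging the points.\<close>

lemma lip_grad_cutoff:
  fixes k :: "real^'d \<Rightarrow> real^'m"
  assumes k: "lip_grad D k K" and \<rho>: "\<rho> > 0"
    and \<psi>: "\<And>x. (\<psi> has_derivative (\<lambda>h. h \<bullet> g x)) (at x)" "\<And>x. 0 \<le> \<psi> x" "\<And>x. \<psi> x \<le> 1"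
      "\<And>x. x \<notin> box 0 1 \<Longrightarrow> \<psi> x = 0" "\<Lambda> \<ge> 0" "\<And>x y. \<bar>\<psi> x - \<psi> y\<bar> \<le> \<Lambda> * norm (x - y)"
  shows "lip_grad D (\<lambda>y. \<psi> ((y - a) /\<^sub>R \<rho>) *\<^sub>R k y)
     (\<lambda>y. \<psi> ((y - a) /\<^sub>R \<rho>) *\<^sub>R K y + (1 / \<rho>) *\<^sub>R outer (k y) (g ((y - a) /\<^sub>R \<rho>)))"
proof -
  obtain L where L: "L-lipschitz_on UNIV k" using k by (auto simp: lip_grad_def)
  have L0: "L \<ge> 0" using L by (rule lipschitz_on_nonneg)
  let ?s = "\<lambda>y. (y - a) /\<^sub>R \<rho>"
  have ck: "continuous_on UNIV k" by (rule lipschitz_on_continuous_on[OF L])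
  have "bounded (k ` cbox a (a + \<rho> *\<^sub>R 1))"
    by (intro compact_imp_bounded compact_continuous_image compact_cbox continuous_on_subset[OF ck]) auto
  then obtain R where R: "\<And>y. y \<in> cbox a (a + \<rho> *\<^sub>R 1) \<Longrightarrow> norm (k y) \<le> R" by (auto simp: bounded_iff)
  define R' where "R' = max 0 R"
  have in_cube: "y \<in> cbox a (a + \<rho> *\<^sub>R 1)" if "?s y \<in> box 0 1" for y
    using that \<rho> by (auto simp: mem_box_cart divide_inverse_commute[symmetric] less_imp_le divide_less_eq)
       (auto simp: field_simps intro!: less_imp_le)
  have R': "norm (k y) \<le> R'" if "?s y \<in> box 0 1" for y using R[OF in_cube[OF that]] by (simp add: R'_def)
  have half: "norm (\<psi> (?s x) *\<^sub>R k x - \<psi> (?s y) *\<^sub>R k y) \<le> (\<Lambda> / \<rho> * R' + L) * norm (x - y)"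
    if x: "?s x \<in> box 0 1" for x y
  proof -
    have "\<psi> (?s x) *\<^sub>R k x - \<psi> (?s y) *\<^sub>R k y = (\<psi> (?s x) - \<psi> (?s y)) *\<^sub>R k x + \<psi> (?s y) *\<^sub>R (k x - k y)"
      by (simp add: algebra_simps)
    then have "norm (\<psi> (?s x) *\<^sub>R k x - \<psi> (?s y) *\<^sub>R k y) \<le> \<bar>\<psi> (?s x) - \<psi> (?s y)\<bar> * norm (k x) + \<psi> (?s y) * norm (k x - k y)"
      using norm_triangle_ineq[of "(\<psi> (?s x) - \<psi> (?s y)) *\<^sub>R k x" "\<psi> (?s y) *\<^sub>R (k x - k y)"] \<psi>(2)[of "?s y"] by simp
    also have "\<dots> \<le> (\<Lambda> / \<rho> * norm (x - y)) * R' + 1 * (L * norm (x - y))"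
    proof (intro add_mono mult_mono)
      have "?s x - ?s y = (x - y) /\<^sub>R \<rho>" by (simp add: algebra_simps)
      then show "\<bar>\<psi> (?s x) - \<psi> (?s y)\<bar> \<le> \<Lambda> / \<rho> * norm (x - y)"
        using \<psi>(6)[of "?s x" "?s y"] \<rho> by (simp add: divide_inverse)
      show "norm (k x - k y) \<le> L * norm (x - y)" using lipschitz_onD[OF L, of x y] by (simp add: dist_norm)
    qed (use R'[OF x] \<psi> \<rho> L0 in auto)
    finally show ?thesis by (simp add: algebra_simps)
  qed
  have "(\<Lambda> / \<rho> * R' + L)-lipschitz_on UNIV (\<lambda>y. \<psi> (?s y) *\<^sub>R k y)"
  proof (rule lipschitz_onI)
    fix x y
    consider "?s x \<in> box 0 1" | "?s y \<in> box 0 1" | "?s x \<notin> box 0 1" "?s y \<notin> box 0 1" by blast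
    then show "dist (\<psi> (?s x) *\<^sub>R k x) (\<psi> (?s y) *\<^sub>R k y) \<le> (\<Lambda> / \<rho> * R' + L) * dist x y"
    proof cases
      case 1 then show ?thesis using half by (simp add: dist_norm)
    next
      case 2 then show ?thesis using half[of y x] by (simp add: dist_norm norm_minus_commute)
    next
      case 3 then show ?thesis using \<psi> \<rho> L0 by (simp add: R'_def)
    qed
  qed (use \<psi> \<rho> L0 in \<open>auto simp: R'_def\<close>)
  moreover have "AE y in lebesgue. y \<in> D \<longrightarrow> ((\<lambda>y. \<psi> (?s y) *\<^sub>R k y) has_derivative
     (\<lambda>h. (\<psi> (?s y) *\<^sub>R K y + (1 / \<rho>) *\<^sub>R outer (k y) (g (?s y))) *v h)) (at y within {y..})"
    using k[unfolded lip_grad_def, THEN conjunct2]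
  proof (rule eventually_mono, intro impI)
    fix y assume "y \<in> D \<longrightarrow> (k has_derivative (\<lambda>h. K y *v h)) (at y within {y..})" "y \<in> D"
    then have 1: "(k has_derivative (\<lambda>h. K y *v h)) (at y within {y..})" by simp
    have "(?s has_derivative (\<lambda>h. h /\<^sub>R \<rho>)) (at y within {y..})" by (auto intro!: derivative_eq_intros)
    from has_derivative_scaleR[OF has_derivative_compose[OF this \<psi>(1)] 1]
    show "((\<lambda>y. \<psi> (?s y) *\<^sub>R k y) has_derivative
     (\<lambda>h. (\<psi> (?s y) *\<^sub>R K y + (1 / \<rho>) *\<^sub>R outer (k y) (g (?s y))) *v h)) (at y within {y..})"
      by (rule has_derivative_eq_rhs)
        (auto simp: fun_eq_iff matrix_vector_mult_add_rdistrib outer_mult scaleR_matrix_vector_assoc[symmetric] divide_inverse inner_commute)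
  qed
  ultimately show ?thesis unfolding lip_grad_def by blast
qed

text \<open>Off the closure of \<open>D\<close> the function is locally zero, and the frontier is a
  null set. This turns a competitor on a cube into a function with a gradient on the whole
  space.\<close>

lemma lip_grad_zero_extension:
  fixes f :: "real^'d \<Rightarrow> real^'m"
  assumes lg: "lip_grad D f G" and D: "open D" "negligible (frontier D)" and f0: "\<And>x. x \<notin> D \<Longrightarrow> f x = 0"
  shows "lip_grad UNIV f (\<lambda>x. indicator D x *\<^sub>R G x)"
proof -
  have "AE x in lebesgue. x \<notin> frontier D"
    using D(2) by (simp add: negligible_iff_null_sets AE_not_in)
  then have "AE x in lebesgue. x \<in> UNIV \<longrightarrow> (f has_derivative (\<lambda>h. (indicator D x *\<^sub>R G x) *v h)) (at x within {x..})"
    using lg[unfolded lip_grad_def, THEN conjunct2]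
  proof eventually_elim
    case (elim x)
    show ?case
    proof (cases "x \<in> D")
      case True then show ?thesis using elim by simp
    next
      case False
      then have x: "x \<in> - closure D" using elim(1) D(1) by (auto simp: frontier_def interior_open)
      have "(f has_derivative (\<lambda>h. 0)) (at x)"
        by (rule has_derivative_transform_within_open[OF has_derivative_const[of 0], of "- closure D"])
           (use x f0 closure_subset[of D] in auto)
      then show ?thesis using False by (auto intro: has_derivative_at_withinI)
    qed
  qed
  then show ?thesis using lg by (simp add: lip_grad_def)
qed

section \<open>Mean values of gradients\<close>

lemma test_function_rescale:
  assumes "\<And>x. (\<psi> has_derivative (\<lambda>h. h \<bullet> g x)) (at x)" "test_function UNIV \<psi> g" "\<And>x. x \<notin> box 0 1 \<Longrightarrow> \<psi> x = 0" "\<rho> > 0"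
  shows "test_function UNIV (\<lambda>y. \<psi> ((y - a) /\<^sub>R \<rho>)) (\<lambda>y. g ((y - a) /\<^sub>R \<rho>) /\<^sub>R \<rho>)"
  unfolding test_function_def
proof (intro conjI allI)
  fix y
  have "((\<lambda>y. (y - a) /\<^sub>R \<rho>) has_derivative (\<lambda>h. h /\<^sub>R \<rho>)) (at y)" by (auto intro!: derivative_eq_intros)
  from has_derivative_compose[OF this assms(1)]
  show "GDERIV (\<lambda>y. \<psi> ((y - a) /\<^sub>R \<rho>)) y :> g ((y - a) /\<^sub>R \<rho>) /\<^sub>R \<rho>" by (simp add: gderiv_def)
next
  have "continuous_on UNIV g" using assms(2) by (simp add: test_function_def)
  then show "continuous_on UNIV (\<lambda>y. g ((y - a) /\<^sub>R \<rho>) /\<^sub>R \<rho>)"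
    by (intro continuous_intros) (rule continuous_on_compose2, auto intro!: continuous_intros)
next
  have "closure {x. \<psi> ((x - a) /\<^sub>R \<rho>) \<noteq> 0} \<subseteq> (\<lambda>y. a + \<rho> *\<^sub>R y) ` cbox 0 1"
  proof (rule closure_minimal)
    show "{x. \<psi> ((x - a) /\<^sub>R \<rho>) \<noteq> 0} \<subseteq> (\<lambda>y. a + \<rho> *\<^sub>R y) ` cbox 0 1"
    proof
      fix x assume "x \<in> {x. \<psi> ((x - a) /\<^sub>R \<rho>) \<noteq> 0}"
      then have "(x - a) /\<^sub>R \<rho> \<in> cbox 0 1" using assms(3)[of "(x - a) /\<^sub>R \<rho>"] box_subset_cbox by blast
      then show "x \<in> (\<lambda>y. a + \<rho> *\<^sub>R y) ` cbox 0 1"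
        using assms(4) by (intro image_eqI[where x="(x - a) /\<^sub>R \<rho>"]) auto
    qed
    show "closed ((\<lambda>y. a + \<rho> *\<^sub>R y) ` cbox 0 1)"
      by (intro compact_imp_closed compact_continuous_image compact_cbox continuous_intros)
  qed
  moreover have "compact ((\<lambda>y. a + \<rho> *\<^sub>R y) ` cbox 0 1)"
    by (intro compact_continuous_image compact_cbox continuous_intros)
  ultimately show "compact (closure {x. \<psi> ((x - a) /\<^sub>R \<rho>) \<noteq> 0})"
    unfolding compact_closure by (meson bounded_subset closure_subset compact_imp_bounded)
qed simp

text \<open>The zero extension is tested against a cutoff that equals 1 around the box: the gradient
  of the cutoff vanishes where \<open>f\<close> lives, so one side of the weak identity is zero and
  the other is the integral of an entry of \<open>G\<close>.\<close>

lemma lip_grad_integral_eq_0: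
  fixes f :: "real^'d \<Rightarrow> real^'m"
  assumes lg: "lip_grad (box a b) f G" and f0: "\<And>x. x \<notin> box a b \<Longrightarrow> f x = 0"
  shows "integrable lebesgue (\<lambda>x. indicator (box a b) x *\<^sub>R G x)"
    and "(\<integral>x. A \<bullet> (indicator (box a b) x *\<^sub>R G x) \<partial>lebesgue) = 0"
proof -
  let ?G = "\<lambda>x. indicator (box a b) x *\<^sub>R G x"
  have "lip_grad UNIV f ?G"
    by (rule lip_grad_zero_extension[OF lg _ _ f0]) (auto intro: negligible_convex_frontier)
  from lip_grad_has_weak_gradient[OF this] have wg: "has_weak_gradient UNIV f ?G" by simp
  have "set_integrable lebesgue (cbox a b) ?G"
    using wg by (auto simp: has_weak_gradient_def locally_integrable_def)
  moreover have "(\<lambda>x. indicator (cbox a b) x *\<^sub>R ?G x) = ?G"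
    using box_subset_cbox[of a b] by (auto simp: fun_eq_iff indicator_def)
  ultimately show I: "integrable lebesgue ?G" by (simp add: set_integrable_def)
  have z: "(\<integral>x. ?G x $ i $ j \<partial>lebesgue) = 0" for i j
  proof -
    have "bounded (cbox a b)" by simp
    then obtain R where R: "R > 0" "cbox a b \<subseteq> ball 0 R" by (meson bounded_subset_ballD)
    \<comment> \<open>The rescaled unit cube has half-width \<open>2 * R\<close> about the origin;
      its inner cube for the layer width 1/4 has half-width \<open>R\<close> and contains
      \<open>box a b\<close>.\<close>
    define \<rho> where "\<rho> = 4 * R"
    define c :: "real^'d" where "c = (- 2 * R) *\<^sub>R 1"
    have \<rho>: "\<rho> > 0" using R by (simp add: \<rho>_def)
    obtain \<psi> :: "real^'d \<Rightarrow> real" and g \<Lambda> where \<psi>: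
      "\<And>x. (\<psi> has_derivative (\<lambda>h. h \<bullet> g x)) (at x)" "\<And>x. x \<notin> box 0 1 \<Longrightarrow> \<psi> x = 0"
      "\<And>x. x \<in> cbox ((1/4) *\<^sub>R 1) ((1 - 1/4) *\<^sub>R 1) \<Longrightarrow> \<psi> x = 1" "test_function UNIV \<psi> g"
      by (rule cube_cutoff[of "1/4"]) auto
    note tf = test_function_rescale[OF \<psi>(1,4,2) \<rho>, of c]
    have core: "(x - c) /\<^sub>R \<rho> \<in> box ((1/4) *\<^sub>R 1) ((1 - 1/4) *\<^sub>R 1)" if "x \<in> box a b" for x
    proof -
      have "norm x < R" using that R box_subset_cbox[of a b] by auto
      then have "\<bar>x $ i\<bar> < R" for i using component_le_norm_cart[of x i] by linarith
      then have x: "- R < x $ i \<and> x $ i < R" for i by (metis abs_less_iff minus_less_iff)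
      have "1 / 4 < (x $ i + 2 * R) / (4 * R) \<and> (x $ i + 2 * R) / (4 * R) < 3 / 4" for i
        using R(1) x[of i] by (simp add: less_divide_eq divide_less_eq)
      then show ?thesis
        by (auto simp: mem_box_cart c_def \<rho>_def divide_inverse_commute[symmetric] mult.commute[of R])
    qed
    have g0: "g y = 0" if "y \<in> box ((1/4) *\<^sub>R 1) ((1 - 1/4) *\<^sub>R 1)" for y
    proof -
      have "((\<lambda>_. 1) has_derivative (\<lambda>h. h \<bullet> g y)) (at y)"
        by (rule has_derivative_transform_within_open[OF \<psi>(1) open_box that]) (use \<psi>(3) box_subset_cbox in blast)
      from has_derivative_unique[OF this has_derivative_const[of 1]]
      have "g y \<bullet> g y = 0" by (metis (no_types))
      then show ?thesis by simp
    qed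
    have "(\<integral>x. f x $ i * (g ((x - c) /\<^sub>R \<rho>) /\<^sub>R \<rho>) $ j \<partial>lebesgue_on UNIV) =
        - (\<integral>x. ?G x $ i $ j * \<psi> ((x - c) /\<^sub>R \<rho>) \<partial>lebesgue_on UNIV)"
      using wg tf unfolding has_weak_gradient_def by blast
    moreover have "f x $ i * (g ((x - c) /\<^sub>R \<rho>) /\<^sub>R \<rho>) $ j = 0" for x
      using f0[of x] g0[OF core[of x]] by (cases "x \<in> box a b") auto
    moreover have "?G x $ i $ j * \<psi> ((x - c) /\<^sub>R \<rho>) = ?G x $ i $ j" for x
    proof (cases "x \<in> box a b")
      case True
      then have "\<psi> ((x - c) /\<^sub>R \<rho>) = 1" using core[of x] \<psi>(3) box_subset_cbox by blast
      then show ?thesis by simp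
    qed simp
    ultimately have "0 = - (\<integral>x. ?G x $ i $ j \<partial>lebesgue)"
      by (simp only: lebesgue_on_UNIV_eq Bochner_Integration.integral_zero)
    then show ?thesis by linarith
  qed
  have "(\<integral>x. A \<bullet> ?G x \<partial>lebesgue) = A \<bullet> (\<integral>x. ?G x \<partial>lebesgue)"
    by (rule integral_bounded_linear[OF bounded_linear_inner_right I])
  moreover have "(\<integral>x. ?G x \<partial>lebesgue) $ i $ j = 0" for i j
  proof -
    have "bounded_linear (\<lambda>w::real^'d^'m. w $ i $ j)"
      using bounded_linear_compose[OF bounded_linear_vec_nth[of j] bounded_linear_vec_nth[of i]] by simp
    from integral_bounded_linear[OF this I] z show ?thesis by simp
  qed
  then have "(\<integral>x. ?G x \<partial>lebesgue) = 0" by (simp add: vec_eq_iff)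
  ultimately show "(\<integral>x. A \<bullet> ?G x \<partial>lebesgue) = 0" by simp
qed

text \<open>Since gradients of functions vanishing on the boundary have mean zero, a lower bound for a
  linear functional of the gradient cannot be positive on average.\<close>

lemma lip_grad_mean_bound:
  fixes f :: "real^'d \<Rightarrow> real^'m"
  assumes lg: "lip_grad (box a b) f G" and f0: "\<And>x. x \<notin> box a b \<Longrightarrow> f x = 0"
    and E: "E \<in> sets lebesgue" "E \<subseteq> box a b"
    and bound: "AE x in lebesgue. x \<in> box a b \<longrightarrow> \<alpha> * indicator E x - \<beta> \<le> A \<bullet> G x"
  shows "\<alpha> * measure lebesgue E \<le> \<beta> * measure lebesgue (box a b)"
proof -
  let ?B = "box a b"
  have El: "E \<in> lmeasurable" using E by (meson lmeasurable_box fmeasurableI2)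
  have i: "integrable lebesgue (\<lambda>x. \<alpha> * indicator E x)" "integrable lebesgue (\<lambda>x. \<beta> * indicator ?B x)"
    using El by (auto simp: lmeasurable_iff_integrable[symmetric])
  have "\<alpha> * measure lebesgue E - \<beta> * measure lebesgue ?B = (\<integral>x. \<alpha> * indicator E x - \<beta> * indicator ?B x \<partial>lebesgue)"
    using Bochner_Integration.integral_diff[OF i] E(1) by simp
  also have "\<dots> \<le> (\<integral>x. A \<bullet> (indicator ?B x *\<^sub>R G x) \<partial>lebesgue)"
  proof (rule integral_mono_AE)
    show "AE x in lebesgue. \<alpha> * indicator E x - \<beta> * indicator ?B x \<le> A \<bullet> (indicator ?B x *\<^sub>R G x)"
      using bound by (rule eventually_mono) (use E(2) in \<open>auto simp: indicator_def\<close>)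
    show "integrable lebesgue (\<lambda>x. A \<bullet> (indicator ?B x *\<^sub>R G x))"
      by (rule integrable_inner_right) (rule lip_grad_integral_eq_0(1)[OF lg f0])
  qed (rule Bochner_Integration.integrable_diff[OF i])
  also have "\<dots> = 0" by (rule lip_grad_integral_eq_0(2)[OF lg f0])
  finally show ?thesis by simp
qed

lemma measure_cube:
  "r \<ge> 0 \<Longrightarrow> measure lebesgue (box a (a + r *\<^sub>R 1 :: real^'d)) = r ^ CARD('d)"
  "r \<ge> 0 \<Longrightarrow> measure lebesgue (cbox a (a + r *\<^sub>R 1 :: real^'d)) = r ^ CARD('d)"
  "r \<ge> 0 \<Longrightarrow> emeasure lebesgue (box a (a + r *\<^sub>R 1 :: real^'d)) = ennreal (r ^ CARD('d))"
proof -
  assume r: "r \<ge> 0"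
  show 1: "measure lebesgue (cbox a (a + r *\<^sub>R 1 :: real^'d)) = r ^ CARD('d)"
    using emeasure_corner_cube[OF r, of a] r by (simp add: measure_def del: emeasure_completion)
  have "measure lborel (box a (a + r *\<^sub>R 1)) = measure lborel (cbox a (a + r *\<^sub>R 1))" by (simp only: measure_lborel_box_eq measure_lborel_cbox_eq)
  then show 2: "measure lebesgue (box a (a + r *\<^sub>R 1 :: real^'d)) = r ^ CARD('d)" using 1 by (simp add: measure_completion)
  then show "emeasure lebesgue (box a (a + r *\<^sub>R 1 :: real^'d)) = ennreal (r ^ CARD('d))"
    by (simp add: emeasure_eq_measure2 del: emeasure_completion measure_completion)
qed

text \<open>If \<open>\<xi>\<close> were outside \<open>S\<close>, a separating functional would be
  bounded below by a positive constant on \<open>G\<close> almost everywhere, although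
  \<open>G\<close> has mean zero.\<close>

lemma mean_gradient_in_convex:
  fixes f :: "real^'d \<Rightarrow> real^'m"
  assumes S: "closed S" "convex S" and n: "n > 0"
    and lg: "lip_grad (box a (a + n *\<^sub>R 1)) f G" and f0: "\<And>x. x \<notin> box a (a + n *\<^sub>R 1) \<Longrightarrow> f x = 0"
    and mem: "AE x in lebesgue. x \<in> box a (a + n *\<^sub>R 1) \<longrightarrow> \<xi> + G x \<in> S"
  shows "\<xi> \<in> S"
proof (rule ccontr)
  assume "\<xi> \<notin> S"
  then obtain A \<beta> where A: "A \<bullet> \<xi> < \<beta>" "\<And>x. x \<in> S \<Longrightarrow> \<beta> < A \<bullet> x"
    using separating_hyperplane_closed_point[OF S(2,1)] by blast
  let ?B = "box a (a + n *\<^sub>R 1)"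
  have "AE x in lebesgue. x \<in> ?B \<longrightarrow> (\<beta> - A \<bullet> \<xi>) * indicator ?B x - 0 \<le> A \<bullet> G x"
    using mem by (rule eventually_mono) (use A(2) in \<open>force simp: inner_add_right\<close>)
  from lip_grad_mean_bound[OF lg f0 _ order_refl this]
  have "(\<beta> - A \<bullet> \<xi>) * measure lebesgue ?B \<le> 0" by simp
  then have "(\<beta> - A \<bullet> \<xi>) * n ^ CARD('d) \<le> 0" using n by (subst (asm) measure_cube) auto
  then show False using A(1) zero_less_power[OF n, of "CARD('d)"] by (simp add: mult_le_0_iff not_le)
qed

section \<open>The cell formula and its lower semicontinuous envelope\<close>

lemma lower_semicontinuous_measurable:
  "lower_semicontinuous f \<Longrightarrow> f \<in> borel_measurable borel"
  by (rule borel_measurableI_greater) (auto simp: lower_semicontinuous_def)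

lemma lsc_envelope_le: "lsc_envelope f x \<le> f x"
  unfolding lsc_envelope_def by (rule SUP_least) (auto simp: le_fun_def)

lemma lsc_envelope_greatest: "lower_semicontinuous g \<Longrightarrow> g \<le> f \<Longrightarrow> g x \<le> lsc_envelope f x"
  unfolding lsc_envelope_def by (rule SUP_upper2[of g]) auto

lemma lower_semicontinuous_lsc_envelope: "lower_semicontinuous (lsc_envelope f)"
  unfolding lower_semicontinuous_def
proof
  fix a
  have "{x. a < lsc_envelope f x} = (\<Union>g\<in>{g. lower_semicontinuous g \<and> g \<le> f}. {x. a < g x})"
    by (auto simp: lsc_envelope_def less_SUP_iff)
  moreover have "open (\<Union>g\<in>{g. lower_semicontinuous g \<and> g \<le> f}. {x. a < g x})"
    by (rule open_UN) (simp add: lower_semicontinuous_def)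
  ultimately show "open {x. a < lsc_envelope f x}" by simp
qed

lemma lower_semicontinuous_const_on_open:
  assumes "open S" shows "lower_semicontinuous (\<lambda>x. if x \<in> S then c else 0 :: ennreal)"
  unfolding lower_semicontinuous_def
proof
  fix a
  have "{x. a < (if x \<in> S then c else 0)} = (if a < c then S else {})" by auto
  then show "open {x. a < (if x \<in> S then c else 0)}" using assms by simp
qed

text \<open>Otherwise \<open>c\<close> on a ball and 0 elsewhere would be a lower semicontinuous
  minorant with value \<open>c\<close> at the centre. The lemma leads from the envelope back to
  genuine values of \<open>f\<close> at nearby points.\<close>

lemma lsc_envelope_less_obtain:
  fixes f :: "'a::metric_space \<Rightarrow> ennreal"
  assumes "lsc_envelope f x < c" "e > 0"
  obtains y where "dist y x < e" "f y < c"
proof (rule ccontr)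
  assume n: "\<not> thesis"
  have "(\<lambda>y. if y \<in> ball x e then c else 0) \<le> f"
  proof (rule le_funI)
    fix y show "(if y \<in> ball x e then c else 0) \<le> f y"
    proof (cases "y \<in> ball x e")
      case True
      then have "dist y x < e" by (simp add: dist_commute)
      then have "\<not> f y < c" using n that by blast
      then show ?thesis by (simp add: not_less)
    qed (simp del: mem_ball)
  qed
  from lsc_envelope_greatest[OF lower_semicontinuous_const_on_open[OF open_ball] this, of x]
  show False using assms by simp
qed

lemma lower_semicontinuous_le_Liminf:
  fixes f :: "'a::topological_space \<Rightarrow> ennreal"
  assumes "lower_semicontinuous f" "(X \<longlongrightarrow> x) F"
  shows "f x \<le> Liminf F (\<lambda>n. f (X n))"
proof (rule le_Liminf_iff[THEN iffD2], intro allI impI)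
  fix y assume "y < f x"
  then have "x \<in> {z. y < f z}" by simp
  moreover have "open {z. y < f z}" using assms(1) by (simp add: lower_semicontinuous_def)
  ultimately show "\<forall>\<^sub>F n in F. y < f (X n)" using topological_tendstoD[OF assms(2)] by fastforce
qed

section \<open>Room inside \<open>C\<close> and periodic bounds\<close>

text \<open>\<open>t *\<^sub>R p + q\<close> is a convex combination of \<open>p\<close> in the
  closure and \<open>q /\<^sub>R (1 - t)\<close>, which lies in the interior if \<open>q\<close> has
  norm at most \<open>(1 - t) * r0\<close>. This is the room that the factor \<open>t\<close> buys
  for the gradient of a cutoff.\<close>

lemma shrunk_compact:
  fixes C :: "'a::euclidean_space set"
  assumes C: "bounded C" "convex C" "0 \<in> interior C" and t: "0 < t" "t < 1"
  obtains K r where "compact K" "K \<subseteq> interior C" "r > 0"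
    "\<And>p q. p \<in> closure C \<Longrightarrow> norm q \<le> r \<Longrightarrow> t *\<^sub>R p + q \<in> K"
proof -
  obtain r0 where r0: "r0 > 0" "cball 0 r0 \<subseteq> interior C"
    by (metis C(3) open_contains_cball open_interior)
  define r where "r = (1 - t) * r0"
  define K where "K = (\<lambda>(p, q). t *\<^sub>R p + q) ` (closure C \<times> cball 0 r)"
  have "compact K" unfolding K_def
    using C(1) by (intro compact_continuous_image compact_Times) (auto simp: split_def compact_closure intro!: continuous_intros)
  moreover have "K \<subseteq> interior C"
  proof
    fix x assume "x \<in> K"
    then obtain p q where x: "x = t *\<^sub>R p + q" "p \<in> closure C" "norm q \<le> r" by (auto simp: K_def)
    have "norm (q /\<^sub>R (1 - t)) \<le> r0" using x(3) t by (simp add: r_def field_simps)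
    then have q: "q /\<^sub>R (1 - t) \<in> interior C" using r0(2) by auto
    have "p - (1 - t) *\<^sub>R (p - q /\<^sub>R (1 - t)) \<in> interior C"
      using t by (intro mem_interior_closure_convex_shrink[OF C(2) q x(2)]) auto
    moreover have "p - (1 - t) *\<^sub>R (p - q /\<^sub>R (1 - t)) = x"
      using t x(1) by (simp add: scaleR_diff_right) (simp add: scaleR_diff_left)
    ultimately show "x \<in> interior C" by simp
  qed
  moreover have "r > 0" using r0 t by (simp add: r_def)
  ultimately show ?thesis by (rule that) (auto simp: K_def)
qed

lemma countable_integer_vectors: "countable {z::real^'d. \<forall>i. z $ i \<in> \<int>}"
proof -
  have "{z::real^'d. \<forall>i. z $ i \<in> \<int>} \<subseteq> (\<lambda>k::'d \<Rightarrow> int. \<chi> i. of_int (k i)) ` UNIV"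
  proof
    fix z :: "real^'d" assume "z \<in> {z. \<forall>i. z $ i \<in> \<int>}"
    then have "z = (\<chi> i. of_int \<lfloor>z $ i\<rfloor>)" by (auto simp: vec_eq_iff floor_of_int elim!: Ints_cases)
    then show "z \<in> (\<lambda>k::'d \<Rightarrow> int. \<chi> i. of_int (k i)) ` UNIV" by (intro image_eqI[where x="\<lambda>i. \<lfloor>z $ i\<rfloor>"]) simp_all
  qed
  moreover have "countable ((\<lambda>k::'d \<Rightarrow> int. (\<chi> i. of_int (k i)) :: real^'d) ` UNIV)" by simp
  ultimately show ?thesis by (rule countable_subset)
qed

text \<open>Essential boundedness on one closed cell spreads to the whole space through countably
  many integer translates. Since the supremum over \<open>K\<close> is taken at each point first,
  the null set is the same for all matrices in \<open>K\<close>, and gradients may be substituted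
  pointwise.\<close>

lemma periodic_AE_bound:
  fixes W :: "real^'d \<Rightarrow> real^'d^'m \<Rightarrow> ennreal"
  assumes per: "periodic W" and K: "locally_Linf (\<lambda>x. SUP \<xi>\<in>K. W x \<xi>)"
  obtains M :: real where "M \<ge> 0" "AE x in lebesgue. \<forall>\<xi>\<in>K. W x \<xi> \<le> ennreal M"
proof -
  obtain M0 :: real where "AE x in lebesgue_on (cbox 0 1). (SUP \<xi>\<in>K. W x \<xi>) \<le> ennreal M0"
    using K compact_cbox unfolding locally_Linf_def by blast
  then have M0: "AE x in lebesgue. x \<in> cbox 0 1 \<longrightarrow> (SUP \<xi>\<in>K. W x \<xi>) \<le> ennreal M0"
    by (subst (asm) AE_lebesgue_on_iff) auto
  define M where "M = max 0 M0"
  have 1: "AE x in lebesgue. x \<in> cbox 0 1 \<longrightarrow> (\<forall>\<xi>\<in>K. W x \<xi> \<le> ennreal M)"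
    using M0
  proof (rule eventually_mono, intro impI ballI)
    fix x \<xi> assume "x \<in> cbox 0 1 \<longrightarrow> (SUP \<xi>\<in>K. W x \<xi>) \<le> ennreal M0" "x \<in> cbox 0 1" "\<xi> \<in> K"
    then have "W x \<xi> \<le> ennreal M0" by (meson SUP_le_iff)
    also have "\<dots> \<le> ennreal M" by (rule ennreal_leI) (simp add: M_def)
    finally show "W x \<xi> \<le> ennreal M" .
  qed
  have "AE x in lebesgue. x - z \<in> cbox 0 1 \<longrightarrow> (\<forall>\<xi>\<in>K. W (x - z) \<xi> \<le> ennreal M)" for z
    using AE_affine_lebesgue[OF 1, of 1 "- z"] by simp
  then have "AE x in lebesgue. \<forall>z\<in>{z. \<forall>i. z $ i \<in> \<int>}. x - z \<in> cbox 0 1 \<longrightarrow> (\<forall>\<xi>\<in>K. W (x - z) \<xi> \<le> ennreal M)"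
    by (subst AE_ball_countable[OF countable_integer_vectors]) auto
  then have "AE x in lebesgue. \<forall>\<xi>\<in>K. W x \<xi> \<le> ennreal M"
  proof (rule eventually_mono)
    fix x assume *: "\<forall>z\<in>{z. \<forall>i. z $ i \<in> \<int>}. x - z \<in> cbox 0 1 \<longrightarrow> (\<forall>\<xi>\<in>K. W (x - z) \<xi> \<le> ennreal M)"
    define z :: "real^'d" where "z = (\<chi> i. of_int \<lfloor>x $ i\<rfloor>)"
    have z: "\<forall>i. z $ i \<in> \<int>" by (simp add: z_def)
    moreover have "x - z \<in> cbox 0 1"
      by (auto simp: mem_box_cart z_def) (metis add.commute diff_le_eq real_of_int_floor_add_one_ge)
    moreover have "W x \<xi> = W (x - z) \<xi>" for \<xi>
      using per[unfolded periodic_def, rule_format, OF z[rule_format], of "x - z" \<xi>] by simp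
    ultimately show "\<forall>\<xi>\<in>K. W x \<xi> \<le> ennreal M" using * by auto
  qed
  then show ?thesis by (rule that[rotated]) (simp add: M_def)
qed

section \<open>The cell formula in terms of Lipschitz functions\<close>

lemma scaled_Y_eq_box: "n > 0 \<Longrightarrow> (*\<^sub>R) (real n) ` (Y :: (real^'d) set) = box 0 (real n *\<^sub>R 1)"
proof (intro set_eqI iffI)
  fix x :: "real^'d" assume n: "n > 0" and "x \<in> box 0 (real n *\<^sub>R 1)"
  then have "x = real n *\<^sub>R (x /\<^sub>R real n)" "x /\<^sub>R real n \<in> Y"
    by (auto simp: Y_def mem_box_cart divide_inverse_commute[symmetric] divide_less_eq)
  then show "x \<in> (*\<^sub>R) (real n) ` Y" by blast
qed (auto simp: Y_def mem_box_cart)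

lemma nn_integral_lebesgue_on:
  "open D \<Longrightarrow> integral\<^sup>N (lebesgue_on D) f = (\<integral>\<^sup>+x. f x * indicator D x \<partial>lebesgue)"
  by (subst nn_integral_restrict_space) auto

text \<open>A Lipschitz function that vanishes off an integer cube is a competitor, and its explicit
  gradient agrees with the chosen weak gradient almost everywhere.\<close>

lemma HW_le:
  fixes W :: "real^'d \<Rightarrow> real^'d^'m \<Rightarrow> ennreal"
  assumes n: "n \<ge> 1" and lg: "lip_grad (box 0 (real n *\<^sub>R 1)) f G" and f0: "\<And>x. x \<notin> box 0 (real n *\<^sub>R 1) \<Longrightarrow> f x = 0"
  shows "HW W \<xi> \<le> ennreal (1 / real n ^ CARD('d)) * (\<integral>\<^sup>+x. W x (\<xi> + G x) * indicator (box 0 (real n *\<^sub>R 1)) x \<partial>lebesgue)"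
proof -
  let ?B = "box 0 (real n *\<^sub>R 1) :: (real^'d) set"
  have B: "(*\<^sub>R) (real n) ` Y = ?B" using n by (intro scaled_Y_eq_box) simp
  note w = lip_grad_W1inf0[OF lg open_box bounded_box f0]
  have "HW W \<xi> \<le> ennreal (1 / real n ^ CARD('d)) * (INF \<phi> \<in> W1inf0 ?B. \<integral>\<^sup>+x. W x (\<xi> + weak_gradient ?B \<phi> x) \<partial>lebesgue_on ?B)"
    unfolding HW_def using n by (intro INF_lower2[of n]) (auto simp: B)
  also have "\<dots> \<le> ennreal (1 / real n ^ CARD('d)) * (\<integral>\<^sup>+x. W x (\<xi> + weak_gradient ?B f x) \<partial>lebesgue_on ?B)"
    by (intro mult_left_mono INF_lower w(1)) auto
  also have "(\<integral>\<^sup>+x. W x (\<xi> + weak_gradient ?B f x) \<partial>lebesgue_on ?B) =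
      (\<integral>\<^sup>+x. W x (\<xi> + weak_gradient ?B f x) * indicator ?B x \<partial>lebesgue)" by (rule nn_integral_lebesgue_on[OF open_box])
  also have "\<dots> = (\<integral>\<^sup>+x. W x (\<xi> + G x) * indicator ?B x \<partial>lebesgue)"
    by (rule nn_integral_cong_AE, use w(2) in \<open>rule eventually_mono\<close>) (auto simp: indicator_def)
  finally show ?thesis .
qed

text \<open>The infimum over \<phi> stands inside a product, so a good \<phi> is found by
  contradiction: dividing by the positive finite factor \<open>?a\<close> carries the lower bound
  through the infimum.\<close>

lemma HW_less_obtain:
  fixes W :: "real^'d \<Rightarrow> real^'d^'m \<Rightarrow> ennreal"
  assumes "HW W \<xi> < c"
  obtains n f G where "n \<ge> 1" "lip_grad (box 0 (real n *\<^sub>R 1)) f G" "\<And>x. x \<notin> box 0 (real n *\<^sub>R 1) \<Longrightarrow> f x = 0"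
    "ennreal (1 / real n ^ CARD('d)) * (\<integral>\<^sup>+x. W x (\<xi> + G x) * indicator (box 0 (real n *\<^sub>R 1)) x \<partial>lebesgue) < c"
proof -
  obtain n where n: "n \<ge> 1" and lt: "ennreal (1 / real n ^ CARD('d)) *
     (INF \<phi> \<in> W1inf0 ((*\<^sub>R) (real n) ` Y).
        \<integral>\<^sup>+x. W x (\<xi> + weak_gradient ((*\<^sub>R) (real n) ` Y) \<phi> x) \<partial>lebesgue_on ((*\<^sub>R) (real n) ` Y)) < c"
    using assms unfolding HW_def INF_less_iff by auto
  let ?B = "box 0 (real n *\<^sub>R 1) :: (real^'d) set" and ?a = "ennreal (1 / real n ^ CARD('d))"
  have B: "(*\<^sub>R) (real n) ` Y = ?B" using n by (intro scaled_Y_eq_box) simp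
  let ?F = "\<lambda>\<phi>. \<integral>\<^sup>+x. W x (\<xi> + weak_gradient ?B \<phi> x) \<partial>lebesgue_on ?B"
  have a: "?a \<noteq> 0" "?a \<noteq> top" using n by auto
  have "\<exists>\<phi>\<in>W1inf0 ?B. ?a * ?F \<phi> < c"
  proof (rule ccontr)
    assume "\<not> ?thesis"
    then have "c \<le> ?a * ?F \<phi>" if "\<phi> \<in> W1inf0 ?B" for \<phi> using that by (auto simp: not_less)
    then have "c / ?a \<le> ?F \<phi>" if "\<phi> \<in> W1inf0 ?B" for \<phi>
      using that a divide_right_mono_ennreal[of c "?a * ?F \<phi>" ?a] by (simp add: ennreal_mult_divide_eq mult.commute[of ?a])
    then have "c / ?a \<le> (INF \<phi> \<in> W1inf0 ?B. ?F \<phi>)" by (rule INF_greatest)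
    then have "?a * (c / ?a) \<le> ?a * (INF \<phi> \<in> W1inf0 ?B. ?F \<phi>)" by (rule mult_left_mono) simp
    then have "c \<le> ?a * (INF \<phi> \<in> W1inf0 ?B. ?F \<phi>)"
      using a by (simp add: ennreal_times_divide ennreal_mult_divide_eq mult.commute[of ?a])
    then show False using lt unfolding B by simp
  qed
  then obtain \<phi> where \<phi>: "\<phi> \<in> W1inf0 ?B" "?a * ?F \<phi> < c" by blast
  obtain f where f: "lip_grad ?B f (weak_gradient ?B \<phi>)" "\<And>x. x \<notin> ?B \<Longrightarrow> f x = 0"
    using W1inf0_obtain_lip_grad[OF open_box \<phi>(1)] by metis
  show ?thesis by (rule that[OF n f]) (use \<phi>(2) in \<open>simp_all add: nn_integral_lebesgue_on[OF open_box]\<close>)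
qed

lemma measurable_integrand:
  fixes W :: "real^'d \<Rightarrow> real^'d^'m \<Rightarrow> ennreal"
  assumes W: "(\<lambda>(x, \<xi>). W x \<xi>) \<in> borel_measurable borel" and c: "continuous_on UNIV c"
    and G: "G \<in> borel_measurable lebesgue"
  shows "(\<lambda>x. W (c x) (G x)) \<in> borel_measurable lebesgue"
proof -
  have "(\<lambda>x. (c x, G x)) \<in> borel_measurable lebesgue"
    by (rule borel_measurable_Pair[OF continuous_imp_measurable_lebesgue[OF c] G])
  from measurable_compose[OF this W] show ?thesis by simp
qed

text \<open>Only the restriction of \<open>G\<close> to \<open>D\<close> is known to be measurable;
  the indicator outside \<open>W\<close> makes the values of \<open>G\<close> off \<open>D\<close>
  irrelevant.\<close>

lemma measurable_integrand_indicator: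
  fixes W :: "real^'d \<Rightarrow> real^'d^'m \<Rightarrow> ennreal"
  assumes W: "(\<lambda>(x, \<xi>). W x \<xi>) \<in> borel_measurable borel" and c: "continuous_on UNIV c"
    and G: "(\<lambda>x. indicator D x *\<^sub>R G x) \<in> borel_measurable lebesgue" and D: "D \<in> sets lebesgue"
  shows "(\<lambda>x. W (c x) (\<xi> + s *\<^sub>R G x) * indicator D x) \<in> borel_measurable lebesgue"
proof -
  have "(\<lambda>w. \<xi> + s *\<^sub>R w) \<in> borel_measurable borel"
    by (intro borel_measurable_continuous_onI continuous_intros)
  from measurable_integrand[OF W c measurable_compose[OF G this]]
  have "(\<lambda>x. W (c x) (\<xi> + s *\<^sub>R indicator D x *\<^sub>R G x) * indicator D x) \<in> borel_measurable lebesgue"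
    using D by (intro borel_measurable_times_ennreal borel_measurable_indicator)
  also have "(\<lambda>x. W (c x) (\<xi> + s *\<^sub>R indicator D x *\<^sub>R G x) * indicator D x) = (\<lambda>x. W (c x) (\<xi> + s *\<^sub>R G x) * indicator D x)"
    by (auto simp: fun_eq_iff indicator_def)
  finally show ?thesis .
qed

section \<open>The lower bound\<close>

lemma cutoff_gradient_core:
  assumes "\<And>x. (\<psi> has_derivative (\<lambda>h. h \<bullet> g x)) (at x)"
    and "\<And>x. x \<in> cbox (\<kappa> *\<^sub>R 1) ((1 - \<kappa>) *\<^sub>R 1) \<Longrightarrow> \<psi> x = 1"
    and y: "y \<in> box (\<kappa> *\<^sub>R 1) ((1 - \<kappa>) *\<^sub>R 1 :: real^'d)"
  shows "g y = 0"
proof -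
  have "((\<lambda>_. 1) has_derivative (\<lambda>h. h \<bullet> g y)) (at y)"
    by (rule has_derivative_transform_within_open[OF assms(1) open_box y]) (use assms(2) box_subset_cbox in blast)
  from has_derivative_unique[OF this has_derivative_const[of 1]]
  have "g y \<bullet> g y = 0" by (metis (no_types))
  then show ?thesis by simp
qed

lemma rescale_mem_box:
  assumes "\<rho> > 0"
  shows "(y - a) /\<^sub>R \<rho> \<in> box (\<alpha> *\<^sub>R 1) (\<beta> *\<^sub>R 1) \<longleftrightarrow> y \<in> box (a + (\<rho> * \<alpha>) *\<^sub>R 1) (a + (\<rho> * \<beta>) *\<^sub>R 1 :: real^'d)"
  using assms by (simp add: mem_box_cart field_simps)

lemma inner_box_subset:
  assumes "\<rho> > 0" "0 \<le> \<alpha>" "\<beta> \<le> 1"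
  shows "box (a + (\<rho> * \<alpha>) *\<^sub>R 1) (a + (\<rho> * \<beta>) *\<^sub>R 1) \<subseteq> box a (a + \<rho> *\<^sub>R 1 :: real^'d)"
proof
  fix y assume y: "y \<in> box (a + (\<rho> * \<alpha>) *\<^sub>R 1) (a + (\<rho> * \<beta>) *\<^sub>R 1)"
  have "a $ i < y $ i \<and> y $ i < a $ i + \<rho>" for i
  proof -
    have "a $ i + \<rho> * \<alpha> < y $ i" "y $ i < a $ i + \<rho> * \<beta>" using y by (auto simp: mem_box_cart)
    moreover have "0 \<le> \<rho> * \<alpha>" "\<rho> * \<beta> \<le> \<rho>" using assms by (auto simp: mult_left_le)
    ultimately show ?thesis by linarith
  qed
  then show "y \<in> box a (a + \<rho> *\<^sub>R 1)" by (simp add: mem_box_cart)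
qed

text \<open>Separation again, now for functions that are only close to an affine map. Cutting off
  the deviation costs a gradient of size \<open>\<tau> * \<Lambda>\<close> at every scale \<rho>,
  while the separating functional gains a fixed amount on the inner cube, which is contradictory for
  small \<tau>. Thus limits inherit the constraint that gradients lie in a closed convex
  set.\<close>

lemma affine_limit_gradient_in_convex:
  fixes \<xi> :: "real^'d^'m"
  assumes S: "closed S" "convex S"
    and approx: "\<And>\<tau>::real. \<tau> > 0 \<Longrightarrow> \<exists>f F a \<rho> c. \<rho> > 0 \<and> lip_grad (box a (a + \<rho> *\<^sub>R 1)) f F \<and>
      (AE y in lebesgue. y \<in> box a (a + \<rho> *\<^sub>R 1) \<longrightarrow> F y \<in> S) \<and>
      (\<forall>y\<in>box a (a + \<rho> *\<^sub>R 1). norm (f y - (c + \<xi> *v (y - a))) \<le> \<tau> * \<rho>)"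
  shows "\<xi> \<in> S"
proof (rule ccontr)
  assume "\<xi> \<notin> S"
  then obtain A \<beta> where A: "A \<bullet> \<xi> < \<beta>" "\<And>x. x \<in> S \<Longrightarrow> \<beta> < A \<bullet> x"
    using separating_hyperplane_closed_point[OF S(2,1)] by blast
  obtain \<psi> :: "real^'d \<Rightarrow> real" and g \<Lambda> where \<psi>:
    "\<And>x. (\<psi> has_derivative (\<lambda>h. h \<bullet> g x)) (at x)" "\<And>x. 0 \<le> \<psi> x" "\<And>x. \<psi> x \<le> 1"
    "\<And>x. x \<notin> box 0 1 \<Longrightarrow> \<psi> x = 0" "\<And>x. x \<in> cbox ((1/4) *\<^sub>R 1) ((1 - 1/4) *\<^sub>R 1) \<Longrightarrow> \<psi> x = 1"
    "\<Lambda> \<ge> 0" "\<And>x. norm (g x) \<le> \<Lambda>" "\<And>x y. \<bar>\<psi> x - \<psi> y\<bar> \<le> \<Lambda> * norm (x - y)"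
    by (rule cube_cutoff[of "1/4"]) auto
  \<comment> \<open>The gain per unit volume of the outer cube: the inner cube has half its side,
    hence the power of 1/2.\<close>
  define \<gamma> where "\<gamma> = (\<beta> - A \<bullet> \<xi>) * (1/2) ^ CARD('d)"
  have \<gamma>: "\<gamma> > 0" using A(1) by (simp add: \<gamma>_def)
  have bound: "\<gamma> \<le> norm A * \<tau> * \<Lambda>" if \<tau>: "\<tau> > 0" for \<tau>
  proof -
    obtain f F a \<rho> c where *: "\<rho> > 0 \<and> lip_grad (box a (a + \<rho> *\<^sub>R 1)) f F \<and>
      (AE y in lebesgue. y \<in> box a (a + \<rho> *\<^sub>R 1) \<longrightarrow> F y \<in> S) \<and>
      (\<forall>y\<in>box a (a + \<rho> *\<^sub>R 1). norm (f y - (c + \<xi> *v (y - a))) \<le> \<tau> * \<rho>)"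
      using approx[OF \<tau>] by (elim exE)
    then have \<rho>: "\<rho> > 0" and f: "lip_grad (box a (a + \<rho> *\<^sub>R 1)) f F"
      and FS: "AE y in lebesgue. y \<in> box a (a + \<rho> *\<^sub>R 1) \<longrightarrow> F y \<in> S"
      and near: "\<And>y. y \<in> box a (a + \<rho> *\<^sub>R 1) \<Longrightarrow> norm (f y - (c + \<xi> *v (y - a))) \<le> \<tau> * \<rho>"
      by blast+
    let ?B = "box a (a + \<rho> *\<^sub>R 1) :: (real^'d) set"
    let ?E = "box (a + (\<rho> * (1/4)) *\<^sub>R 1) (a + (\<rho> * (1 - 1/4)) *\<^sub>R 1) :: (real^'d) set"
    let ?s = "\<lambda>y. (y - a) /\<^sub>R \<rho>"
    define k where "k = (\<lambda>y. f y - (c + \<xi> *v (y - a)))"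
    have k: "lip_grad ?B k (\<lambda>y. F y - \<xi>)" unfolding k_def by (intro lip_grad_diff f lip_grad_affine)
    define H where "H = (\<lambda>y. \<psi> (?s y) *\<^sub>R (F y - \<xi>) + (1 / \<rho>) *\<^sub>R outer (k y) (g (?s y)))"
    have w: "lip_grad ?B (\<lambda>y. \<psi> (?s y) *\<^sub>R k y) H"
      unfolding H_def by (rule lip_grad_cutoff[OF k \<rho> \<psi>(1-4,6,8)])
    have w0: "\<psi> (?s y) *\<^sub>R k y = 0" if "y \<notin> ?B" for y
      using \<psi>(4)[of "?s y"] rescale_mem_box[OF \<rho>, of y a 0 1] that by simp
    have "AE y in lebesgue. y \<in> ?B \<longrightarrow> (\<beta> - A \<bullet> \<xi>) * indicator ?E y - norm A * \<tau> * \<Lambda> \<le> A \<bullet> H y"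
      using FS
    proof (rule eventually_mono, intro impI)
      fix y assume "y \<in> ?B \<longrightarrow> F y \<in> S" and y: "y \<in> ?B"
      then have Fy: "\<beta> \<le> A \<bullet> F y" using A(2) by (auto intro: less_imp_le)
      have "\<bar>A \<bullet> outer (k y) (g (?s y))\<bar> \<le> norm A * (norm (k y) * norm (g (?s y)))"
        using Cauchy_Schwarz_ineq2[of A "outer (k y) (g (?s y))"] by (simp add: norm_outer)
      also have "\<dots> \<le> norm A * ((\<tau> * \<rho>) * \<Lambda>)"
        using near[OF y] \<psi>(7) \<tau> \<rho> by (intro mult_left_mono mult_mono) (auto simp: k_def)
      finally have "\<bar>A \<bullet> outer (k y) (g (?s y))\<bar> / \<rho> \<le> norm A * \<tau> * \<Lambda>" using \<rho> by (simp add: divide_le_eq mult_ac)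
      then have o: "- (norm A * \<tau> * \<Lambda>) \<le> (1 / \<rho>) * (A \<bullet> outer (k y) (g (?s y)))"
        using \<rho> by (simp add: abs_le_iff abs_divide[symmetric, of _ \<rho>] field_simps)
      have "(\<beta> - A \<bullet> \<xi>) * indicator ?E y \<le> \<psi> (?s y) * (A \<bullet> F y - A \<bullet> \<xi>)"
      proof (cases "y \<in> ?E")
        case True
        then have "?s y \<in> cbox ((1/4) *\<^sub>R 1) ((1 - 1/4) *\<^sub>R 1)"
          using rescale_mem_box[OF \<rho>, of y a "1/4" "1 - 1/4"] box_subset_cbox by blast
        then show ?thesis using \<psi>(5) True Fy by simp
      next
        case False then show ?thesis using \<psi>(2)[of "?s y"] Fy A(1) by simp
      qed
      then show "(\<beta> - A \<bullet> \<xi>) * indicator ?E y - norm A * \<tau> * \<Lambda> \<le> A \<bullet> H y"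
        using o by (simp add: H_def inner_add_right inner_diff_right)
    qed
    moreover have "?E \<subseteq> ?B" using \<rho> by (intro inner_box_subset) auto
    ultimately have "(\<beta> - A \<bullet> \<xi>) * measure lebesgue ?E \<le> (norm A * \<tau> * \<Lambda>) * measure lebesgue ?B"
      using lip_grad_mean_bound[OF w w0, of ?E] by simp
    moreover have "measure lebesgue ?E = (\<rho> / 2) ^ CARD('d)"
    proof -
      have "?E = box (a + (\<rho> * (1/4)) *\<^sub>R 1) ((a + (\<rho> * (1/4)) *\<^sub>R 1) + (\<rho> / 2) *\<^sub>R 1)"
        by (simp add: add.assoc scaleR_add_left[symmetric] mult.commute[of \<rho>])
      then show ?thesis using measure_cube(1)[of "\<rho>/2" "a + (\<rho> * (1/4)) *\<^sub>R 1"] \<rho> by simp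
    qed
    moreover have "measure lebesgue ?B = \<rho> ^ CARD('d)" using \<rho> by (intro measure_cube) auto
    ultimately have "\<gamma> * \<rho> ^ CARD('d) \<le> (norm A * \<tau> * \<Lambda>) * \<rho> ^ CARD('d)"
      by (simp add: \<gamma>_def power_divide mult_ac)
    then show ?thesis using \<rho> by simp
  qed
  \<comment> \<open>\<tau> is chosen so that the error equals \<open>\<gamma> / 2\<close>; if its
    coefficient is zero, any positive \<tau> will do.\<close>
  have "\<gamma> \<le> \<gamma> / 2"
  proof (cases "norm A * \<Lambda> = 0")
    case True then show ?thesis using bound[of 1] \<gamma> by auto
  next
    case False
    then have "norm A * \<Lambda> > 0" using \<psi>(6) by (metis mult_nonneg_nonneg norm_ge_zero order_le_less)
    then have "norm A * (\<gamma> / 2 / (norm A * \<Lambda>)) * \<Lambda> = \<gamma> / 2" "\<gamma> / 2 / (norm A * \<Lambda>) > 0" using \<gamma> by (auto simp: field_simps)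
    then show ?thesis using bound[of "\<gamma> / 2 / (norm A * \<Lambda>)"] by simp
  qed
  then show False using \<gamma> by simp
qed

section \<open>The integrand and the energy on one cube\<close>

locale homogenization =
  fixes C :: "(real^'d^'m) set" and W :: "real^'d \<Rightarrow> real^'d^'m \<Rightarrow> ennreal"
  assumes bounded_C: "bounded C" and convex_C: "convex C" and zero_C: "0 \<in> interior C"
    and W_measurable: "(\<lambda>(x, \<xi>). W x \<xi>) \<in> borel_measurable borel"
    and W_periodic: "periodic W"
    and W_dom: "\<And>x. eff_dom (W x) \<subseteq> closure C"
    and radial: "\<And>\<delta>::real. \<delta> > 0 \<Longrightarrow>
          \<exists>\<eta>::real. \<eta> > 0 \<and> (\<forall>x. \<forall>\<xi> \<in> eff_dom (W x). \<forall>t \<in> {0..<1}.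
            1 - t \<le> \<eta> \<longrightarrow> W x (t *\<^sub>R \<xi>) \<le> W x \<xi> + ennreal \<delta>)"
    and locally_bounded: "\<And>K. compact K \<Longrightarrow> K \<subseteq> interior C \<Longrightarrow> locally_Linf (\<lambda>x. SUP \<xi>\<in>K. W x \<xi>)"
begin

lemma mem_closure_C: "W x \<xi> < \<infinity> \<Longrightarrow> \<xi> \<in> closure C"
  using W_dom[of x] by (auto simp: eff_dom_def)

lemma W_plus_integer: "(\<And>i. z $ i \<in> \<int>) \<Longrightarrow> W (x + z) \<xi> = W x \<xi>"
  using W_periodic by (auto simp: periodic_def)

lemma convex_closure_C: "convex (closure C)" using convex_C by (rule convex_closure)

text \<open>The null set is fixed before \<open>p\<close> and \<open>q\<close>, since both will
  depend on the point: \<open>p\<close> is a convex combination of gradients, \<open>q\<close> the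
  contribution of a cutoff.\<close>

lemma bounded_on_shrunk:
  assumes t: "0 < t" "t < 1"
  obtains M r :: real where "M \<ge> 0" "r > 0"
    "AE x in lebesgue. \<forall>p q. p \<in> closure C \<longrightarrow> norm q \<le> r \<longrightarrow> W x (t *\<^sub>R p + q) \<le> ennreal M"
proof -
  obtain K r where K: "compact K" "K \<subseteq> interior C" "r > 0"
    "\<And>p q. p \<in> closure C \<Longrightarrow> norm q \<le> r \<Longrightarrow> t *\<^sub>R p + q \<in> K"
    by (rule shrunk_compact[OF bounded_C convex_C zero_C t]) blast
  obtain M where M: "M \<ge> 0" "AE x in lebesgue. \<forall>\<xi>\<in>K. W x \<xi> \<le> ennreal M"
    by (rule periodic_AE_bound[OF W_periodic locally_bounded[OF K(1,2)]])
  show ?thesis by (rule that[OF M(1) K(3)], use M(2) in \<open>rule eventually_mono\<close>) (use K(4) in blast)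
qed

lemma AE_scaled:
  assumes "AE x::real^'d in lebesgue. P x" "\<epsilon> > 0" shows "AE x in lebesgue. P (x /\<^sub>R \<epsilon>)"
  using AE_affine_lebesgue[OF assms(1), of "1 / \<epsilon>" 0] assms(2) by (simp add: divide_inverse)

text \<open>The blow-up estimate on one cube: a function that is nearly affine on the cube is cut off to
  the affine function, at the cost of the factor \<open>t\<close>, and the cube is embedded in an integer
  multiple of the \<open>\<epsilon>\<close>-cell, where the result is a competitor for \<open>HW\<close>.\<close>

lemma HW_le_cube_energy:
  fixes \<psi> :: "real^'d \<Rightarrow> real" and g :: "real^'d \<Rightarrow> real^'d" and f :: "real^'d \<Rightarrow> real^'m"
  assumes t: "0 < t" "t < 1"
    and rad: "\<And>x \<xi>. \<xi> \<in> eff_dom (W x) \<Longrightarrow> W x (t *\<^sub>R \<xi>) \<le> W x \<xi> + ennreal \<delta>" and \<delta>: "\<delta> \<ge> 0"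
    and M: "M \<ge> 0" and r: "r > 0"
    and MW: "AE x in lebesgue. \<forall>p q. p \<in> closure C \<longrightarrow> norm q \<le> r \<longrightarrow> W x (t *\<^sub>R p + q) \<le> ennreal M"
    and \<kappa>: "0 < \<kappa>" "\<kappa> < 1/2"
    and \<psi>: "\<And>x. (\<psi> has_derivative (\<lambda>h. h \<bullet> g x)) (at x)" "\<And>x. 0 \<le> \<psi> x" "\<And>x. \<psi> x \<le> 1"
      "\<And>x. x \<notin> box 0 1 \<Longrightarrow> \<psi> x = 0" "\<And>x. x \<in> cbox (\<kappa> *\<^sub>R 1) ((1 - \<kappa>) *\<^sub>R 1) \<Longrightarrow> \<psi> x = 1"
      "\<Lambda> \<ge> 0" "\<And>x. norm (g x) \<le> \<Lambda>" "\<And>x y. \<bar>\<psi> x - \<psi> y\<bar> \<le> \<Lambda> * norm (x - y)"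
    and f: "lip_grad (box a (a + \<rho> *\<^sub>R 1)) f F" and \<rho>: "\<rho> > 0"
    and FC: "AE y in lebesgue. y \<in> box a (a + \<rho> *\<^sub>R 1) \<longrightarrow> F y \<in> closure C" and \<xi>: "\<xi> \<in> closure C"
    and near: "\<And>y. y \<in> box a (a + \<rho> *\<^sub>R 1) \<Longrightarrow> norm (f y - (c + \<xi> *v (y - a))) \<le> \<sigma> * \<rho>" and \<sigma>: "t * (\<sigma> * \<Lambda>) \<le> r" "\<sigma> \<ge> 0"
    and \<epsilon>: "\<epsilon> > 0"
  shows "HW W (t *\<^sub>R \<xi>) \<le> ennreal (1 / \<rho> ^ CARD('d)) *
      (\<integral>\<^sup>+y. W (y /\<^sub>R \<epsilon>) (F y) * indicator (box a (a + \<rho> *\<^sub>R 1)) y \<partial>lebesgue)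
     + ennreal (\<delta> + M * (1 - ((1 - 2 * \<kappa>) * \<rho> / (\<rho> + 2 * \<epsilon>)) ^ CARD('d)))"
proof -
  let ?Q = "box a (a + \<rho> *\<^sub>R 1) :: (real^'d) set"
  let ?E = "box (a + (\<rho> * \<kappa>) *\<^sub>R 1) (a + (\<rho> * (1 - \<kappa>)) *\<^sub>R 1) :: (real^'d) set"
  let ?s = "\<lambda>y. (y - a) /\<^sub>R \<rho>"
  define k where "k = (\<lambda>y. f y - (c + \<xi> *v (y - a)))"
  have k: "lip_grad ?Q k (\<lambda>y. F y - \<xi>)" unfolding k_def by (intro lip_grad_diff f lip_grad_affine)
  define H where "H = (\<lambda>y. \<psi> (?s y) *\<^sub>R (F y - \<xi>) + (1 / \<rho>) *\<^sub>R outer (k y) (g (?s y)))"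
  define w where "w = (\<lambda>y. \<psi> (?s y) *\<^sub>R k y)"
  have w: "lip_grad ?Q w H"
    unfolding H_def w_def by (rule lip_grad_cutoff[OF k \<rho> \<psi>(1-4,6,8)])
  have w0: "w y = 0" if "y \<notin> ?Q" for y
    using \<psi>(4)[of "?s y"] rescale_mem_box[OF \<rho>, of y a 0 1] that by (simp add: w_def)
  define H' where "H' = (\<lambda>y. indicator ?Q y *\<^sub>R H y)"
  have w': "lip_grad UNIV w H'"
    unfolding H'_def by (rule lip_grad_zero_extension[OF w open_box _ w0]) (auto intro: negligible_convex_frontier)
  have H'm: "H' \<in> borel_measurable lebesgue"
    using lip_grad_measurable[OF w'] by simp
  \<comment> \<open>The lower corner is rounded down to the \<epsilon>-lattice, so one cell beyond
    the ceiling of \<open>\<rho> / \<epsilon>\<close> is taken to make the block of side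
    \<open>R\<close> cover \<open>?Q\<close>; hence
    \<open>R \<le> \<rho> + 2 * \<epsilon>\<close>.\<close>
  define z :: "real^'d" where "z = (\<chi> i. of_int \<lfloor>a $ i / \<epsilon>\<rfloor>)"
  define N where "N = nat \<lceil>\<rho> / \<epsilon>\<rceil> + 1"
  have zint: "z $ i \<in> \<int>" for i by (simp add: z_def)
  have N1: "N \<ge> 1" by (simp add: N_def)
  have N: "\<rho> / \<epsilon> + 1 \<le> real N" "real N \<le> \<rho> / \<epsilon> + 2"
  proof -
    have "real N = of_int \<lceil>\<rho> / \<epsilon>\<rceil> + 1" using \<rho> \<epsilon> by (simp add: N_def)
    then show "\<rho> / \<epsilon> + 1 \<le> real N" "real N \<le> \<rho> / \<epsilon> + 2" by linarith+
  qed
  define R where "R = \<epsilon> * real N"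
  have R: "\<rho> \<le> R" "R \<le> \<rho> + 2 * \<epsilon>" "R > 0"
    using N \<epsilon> \<rho> by (auto simp: R_def field_simps)
  let ?B = "box (\<epsilon> *\<^sub>R z) (\<epsilon> *\<^sub>R z + R *\<^sub>R 1) :: (real^'d) set" and ?Y = "box 0 (real N *\<^sub>R 1) :: (real^'d) set"
  have QB: "?Q \<subseteq> ?B"
  proof
    fix y assume y: "y \<in> ?Q"
    have "\<epsilon> * z $ i < y $ i \<and> y $ i < \<epsilon> * z $ i + R" for i
    proof -
      have zi: "\<epsilon> * z $ i \<le> a $ i" "a $ i < \<epsilon> * z $ i + \<epsilon>"
        using floor_divide_lower[OF \<epsilon>, of "a $ i"] floor_divide_upper[OF \<epsilon>, of "a $ i"] by (auto simp: z_def algebra_simps)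
      have "\<rho> + \<epsilon> \<le> R" using N(1) \<epsilon> by (simp add: R_def field_simps)
      moreover have "a $ i < y $ i" "y $ i < a $ i + \<rho>" using y by (auto simp: mem_box_cart)
      ultimately show ?thesis using zi by linarith
    qed
    then show "y \<in> ?B" by (simp add: mem_box_cart)
  qed
  have EQ: "?E \<subseteq> ?Q" using \<rho> \<kappa> by (intro inner_box_subset) auto
  \<comment> \<open>The energy density of the competitor in the variable of \<open>f\<close>;
    scaling and periodicity turn its integral into a cell energy with \<open>N\<close> cells in each
    direction.\<close>
  define P where "P = (\<lambda>y. W (y /\<^sub>R \<epsilon>) (t *\<^sub>R \<xi> + t *\<^sub>R H' y) * indicator ?B y)"
  have cs: "continuous_on UNIV (\<lambda>y::real^'d. y /\<^sub>R \<epsilon>)" by (intro continuous_intros)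
  have Pm: "P \<in> borel_measurable lebesgue"
    unfolding P_def using H'm
    by (intro measurable_integrand_indicator[OF W_measurable cs] borel_measurable_scaleR borel_measurable_indicator) auto
  have HW1: "HW W (t *\<^sub>R \<xi>) \<le> ennreal (1 / R ^ CARD('d)) * (\<integral>\<^sup>+y. P y \<partial>lebesgue)"
  proof -
    let ?\<Phi> = "\<lambda>x. (t / \<epsilon>) *\<^sub>R w ((x - (- z)) /\<^sub>R (1 / \<epsilon>))"
    let ?G = "\<lambda>x. (t / \<epsilon> / (1 / \<epsilon>)) *\<^sub>R H' ((x - (- z)) /\<^sub>R (1 / \<epsilon>))"
    have \<Phi>: "lip_grad ?Y ?\<Phi> ?G" by (rule lip_grad_rescale[OF w']) (use \<epsilon> in auto)
    have box_iff: "\<epsilon> *\<^sub>R z + \<epsilon> *\<^sub>R x \<in> ?B \<longleftrightarrow> x \<in> ?Y" for x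
      using \<epsilon> by (simp add: mem_box_cart R_def zero_less_mult_iff)
    have \<Phi>0: "?\<Phi> x = 0" if "x \<notin> ?Y" for x
    proof -
      have "\<epsilon> *\<^sub>R z + \<epsilon> *\<^sub>R x \<notin> ?Q" using box_iff[of x] that QB by blast
      then show ?thesis using w0 by (simp add: algebra_simps)
    qed
    have "HW W (t *\<^sub>R \<xi>) \<le> ennreal (1 / real N ^ CARD('d)) * (\<integral>\<^sup>+x. W x (t *\<^sub>R \<xi> + ?G x) * indicator ?Y x \<partial>lebesgue)"
      by (rule HW_le[OF N1 \<Phi> \<Phi>0])
    also have "(\<lambda>x. W x (t *\<^sub>R \<xi> + ?G x) * indicator ?Y x) = (\<lambda>x. P (\<epsilon> *\<^sub>R z + \<epsilon> *\<^sub>R x))"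
    proof
      fix x
      have "(\<epsilon> *\<^sub>R z + \<epsilon> *\<^sub>R x) /\<^sub>R \<epsilon> = x + z" using \<epsilon> by (simp add: algebra_simps)
      moreover have "indicator ?B (\<epsilon> *\<^sub>R z + \<epsilon> *\<^sub>R x) = (indicator ?Y x :: ennreal)"
        using box_iff[of x] by (simp add: indicator_def)
      ultimately show "W x (t *\<^sub>R \<xi> + ?G x) * indicator ?Y x = P (\<epsilon> *\<^sub>R z + \<epsilon> *\<^sub>R x)"
        using W_plus_integer[OF zint] \<epsilon> by (simp add: P_def algebra_simps)
    qed
    also have "ennreal (1 / real N ^ CARD('d)) * (\<integral>\<^sup>+x. P (\<epsilon> *\<^sub>R z + \<epsilon> *\<^sub>R x) \<partial>lebesgue) =
       ennreal (1 / R ^ CARD('d)) * (ennreal (\<epsilon> ^ CARD('d)) * (\<integral>\<^sup>+x. P (\<epsilon> *\<^sub>R z + \<epsilon> *\<^sub>R x) \<partial>lebesgue))"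
    proof -
      have "1 / real N ^ CARD('d) = (1 / R ^ CARD('d)) * \<epsilon> ^ CARD('d)"
        using \<epsilon> by (simp add: R_def power_mult_distrib)
      then have "ennreal (1 / real N ^ CARD('d)) = ennreal (1 / R ^ CARD('d)) * ennreal (\<epsilon> ^ CARD('d))"
        using \<epsilon> R by (simp only: ennreal_mult[symmetric] zero_le_power zero_le_divide_1_iff less_imp_le)
      then show ?thesis by (simp only: mult.assoc)
    qed
    also have "\<dots> = ennreal (1 / R ^ CARD('d)) * (\<integral>\<^sup>+y. P y \<partial>lebesgue)"
      using nn_integral_affine_lebesgue[OF Pm \<epsilon>, of "\<epsilon> *\<^sub>R z"] by (simp only:)
    finally show ?thesis .
  qed
  let ?I = "\<integral>\<^sup>+y. W (y /\<^sub>R \<epsilon>) (F y) * indicator ?Q y \<partial>lebesgue"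
  have "(\<integral>\<^sup>+y. P y \<partial>lebesgue) \<le>
     (\<integral>\<^sup>+y. (W (y /\<^sub>R \<epsilon>) (F y) * indicator ?Q y + ennreal \<delta> * indicator ?Q y) + ennreal M * indicator (?B - ?E) y \<partial>lebesgue)"
  proof (rule nn_integral_mono_AE)
    show "AE y in lebesgue. P y \<le> (W (y /\<^sub>R \<epsilon>) (F y) * indicator ?Q y + ennreal \<delta> * indicator ?Q y) + ennreal M * indicator (?B - ?E) y"
      using AE_scaled[OF MW \<epsilon>] FC
    proof eventually_elim
      case (elim y)
      have bd: "W (y /\<^sub>R \<epsilon>) (t *\<^sub>R p + q) \<le> ennreal M" if "p \<in> closure C" "norm q \<le> r" for p q
        using elim(1) that by blast
      \<comment> \<open>On the core \<open>?E\<close> the competitor has gradient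
        \<open>t *\<^sub>R F y\<close>, and the radial condition applies. On the layer the gradient
        is \<open>t\<close> times a convex combination of \<open>\<xi>\<close> and
        \<open>F y\<close> plus a small rank-one term, and between \<open>?Q\<close> and
        \<open>?B\<close> it is \<open>t *\<^sub>R \<xi>\<close>; both are covered by the bound
        \<open>M\<close>.\<close>
      consider "y \<in> ?E" | "y \<in> ?Q" "y \<notin> ?E" | "y \<in> ?B" "y \<notin> ?Q" | "y \<notin> ?B" by blast
      then show ?case
      proof cases
        case 1
        then have yQ: "y \<in> ?Q" using EQ by blast
        have sy: "?s y \<in> box (\<kappa> *\<^sub>R 1) ((1 - \<kappa>) *\<^sub>R 1)" using 1 rescale_mem_box[OF \<rho>, of y a \<kappa> "1 - \<kappa>"] by simp
        then have "\<psi> (?s y) = 1" using \<psi>(5) box_subset_cbox by blast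
        moreover have "g (?s y) = 0" by (rule cutoff_gradient_core[OF \<psi>(1,5) sy])
        ultimately have "H' y = F y - \<xi>" using yQ by (simp add: H'_def H_def outer_def vec_eq_iff)
        then have e: "t *\<^sub>R \<xi> + t *\<^sub>R H' y = t *\<^sub>R F y" by (simp add: scaleR_diff_right)
        have "W (y /\<^sub>R \<epsilon>) (t *\<^sub>R F y) \<le> W (y /\<^sub>R \<epsilon>) (F y) + ennreal \<delta>"
        proof (cases "F y \<in> eff_dom (W (y /\<^sub>R \<epsilon>))")
          case True then show ?thesis by (rule rad)
        next
          case False then show ?thesis by (simp add: eff_dom_def not_less top_unique)
        qed
        moreover have "P y = W (y /\<^sub>R \<epsilon>) (t *\<^sub>R F y)"
          unfolding P_def e using yQ QB by (simp add: subset_iff del: mem_box)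
        ultimately show ?thesis using 1 yQ by simp
      next
        case 2
        let ?p = "(1 - \<psi> (?s y)) *\<^sub>R \<xi> + \<psi> (?s y) *\<^sub>R F y" and ?q = "(t / \<rho>) *\<^sub>R outer (k y) (g (?s y))"
        have "?p \<in> closure C"
          using elim(2) 2 \<xi> \<psi>(2,3)[of "?s y"] by (intro convexD[OF convex_closure_C]) auto
        moreover have "norm ?q \<le> r"
        proof -
          have "norm (k y) * norm (g (?s y)) \<le> (\<sigma> * \<rho>) * \<Lambda>"
            using near[OF 2(1)] \<psi>(7) \<sigma>(2) \<rho> by (intro mult_mono) (auto simp: k_def)
          then have "t / \<rho> * (norm (k y) * norm (g (?s y))) \<le> t / \<rho> * ((\<sigma> * \<rho>) * \<Lambda>)"
            using t \<rho> by (intro mult_left_mono) auto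
          also have "\<dots> = t * (\<sigma> * \<Lambda>)" using \<rho> by simp
          finally show ?thesis using \<sigma>(1) t \<rho> by (simp add: norm_outer)
        qed
        moreover have "t *\<^sub>R \<xi> + t *\<^sub>R H' y = t *\<^sub>R ?p + ?q"
          using 2 by (simp add: H'_def H_def algebra_simps)
        ultimately have "W (y /\<^sub>R \<epsilon>) (t *\<^sub>R \<xi> + t *\<^sub>R H' y) \<le> ennreal M" using bd by metis
        moreover have "y \<in> ?B" using 2 QB by blast
        ultimately show ?thesis using 2 by (simp add: P_def add_increasing)
      next
        case 3
        have "W (y /\<^sub>R \<epsilon>) (t *\<^sub>R \<xi> + t *\<^sub>R H' y) \<le> ennreal M" using bd[OF \<xi>, of 0] 3 r by (simp add: H'_def)
        moreover have "y \<notin> ?E" using 3 EQ by blast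
        ultimately show ?thesis using 3 by (simp add: P_def)
      next
        case 4 then show ?thesis by (simp add: P_def)
      qed
    qed
  qed
  also have "\<dots> = (?I + ennreal \<delta> * emeasure lebesgue ?Q) + ennreal M * emeasure lebesgue (?B - ?E)"
  proof -
    have m1: "(\<lambda>y. W (y /\<^sub>R \<epsilon>) (F y) * indicator ?Q y) \<in> borel_measurable lebesgue"
      using measurable_integrand_indicator[OF W_measurable cs lip_grad_measurable[OF f open_box], of 0 1] by simp
    have m2: "(indicator ?Q :: _ \<Rightarrow> ennreal) \<in> borel_measurable lebesgue" by (rule borel_measurable_indicator) simp
    have m3: "(indicator (?B - ?E) :: _ \<Rightarrow> ennreal) \<in> borel_measurable lebesgue" by (rule borel_measurable_indicator) simp
    have c1: "(\<integral>\<^sup>+y. ennreal \<delta> * indicator ?Q y \<partial>lebesgue) = ennreal \<delta> * emeasure lebesgue ?Q"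
      by (rule nn_integral_cmult_indicator) simp
    have c2: "(\<integral>\<^sup>+y. ennreal M * indicator (?B - ?E) y \<partial>lebesgue) = ennreal M * emeasure lebesgue (?B - ?E)"
      by (rule nn_integral_cmult_indicator) simp
    have "(\<integral>\<^sup>+y. W (y /\<^sub>R \<epsilon>) (F y) * indicator ?Q y + ennreal \<delta> * indicator ?Q y \<partial>lebesgue) = ?I + ennreal \<delta> * emeasure lebesgue ?Q"
      by (subst nn_integral_add[OF m1]) (auto simp only: c1 intro!: borel_measurable_times_ennreal m2 borel_measurable_const)
    then show ?thesis
      by (subst nn_integral_add) (auto simp only: c2 intro!: borel_measurable_add borel_measurable_times_ennreal m1 m2 m3 borel_measurable_const)
  qed
  also have "emeasure lebesgue (?B - ?E) = ennreal (R ^ CARD('d) - ((1 - 2 * \<kappa>) * \<rho>) ^ CARD('d))"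
  proof -
    have "?E = box (a + (\<rho> * \<kappa>) *\<^sub>R 1) ((a + (\<rho> * \<kappa>) *\<^sub>R 1) + ((1 - 2 * \<kappa>) * \<rho>) *\<^sub>R 1)"
    proof -
      have "\<rho> * (1 - \<kappa>) = \<rho> * \<kappa> + (1 - 2 * \<kappa>) * \<rho>" by (simp add: algebra_simps)
      then show ?thesis by (simp only: scaleR_add_left add.assoc)
    qed
    then have "emeasure lebesgue ?E = ennreal (((1 - 2 * \<kappa>) * \<rho>) ^ CARD('d))"
      using measure_cube(3)[of "(1 - 2 * \<kappa>) * \<rho>" "a + (\<rho> * \<kappa>) *\<^sub>R 1"] \<kappa> \<rho> by simp
    moreover have "emeasure lebesgue ?B = ennreal (R ^ CARD('d))" using R by (intro measure_cube) auto
    moreover have "emeasure lebesgue (?B - ?E) = emeasure lebesgue ?B - emeasure lebesgue ?E"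
      using EQ QB calculation by (intro emeasure_Diff) auto
    ultimately show ?thesis using \<kappa> \<rho> by (simp add: ennreal_minus)
  qed
  also have "emeasure lebesgue ?Q = ennreal (\<rho> ^ CARD('d))" using \<rho> by (intro measure_cube) auto
  finally have a: "(\<integral>\<^sup>+y. P y \<partial>lebesgue) \<le> ?I + ennreal \<delta> * ennreal (\<rho> ^ CARD('d)) + ennreal M * ennreal (R ^ CARD('d) - ((1 - 2 * \<kappa>) * \<rho>) ^ CARD('d))" .
  have PI: "(\<integral>\<^sup>+y. P y \<partial>lebesgue) \<le> ?I + ennreal (\<delta> * \<rho> ^ CARD('d) + M * (R ^ CARD('d) - ((1 - 2 * \<kappa>) * \<rho>) ^ CARD('d)))"
    (is "_ \<le> _ + ennreal (?X + ?Z)")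
  proof -
    have le: "((1 - 2 * \<kappa>) * \<rho>) ^ CARD('d) \<le> R ^ CARD('d)"
    proof (rule power_mono)
      have "(1 - 2 * \<kappa>) * \<rho> \<le> 1 * \<rho>" using \<kappa> \<rho> by (intro mult_right_mono) auto
      then show "(1 - 2 * \<kappa>) * \<rho> \<le> R" using R by simp
    qed (use \<kappa> \<rho> in auto)
    have "?X \<ge> 0" "?Z \<ge> 0" using \<delta> M \<rho> le by auto
    then have "ennreal (?X + ?Z) = ennreal \<delta> * ennreal (\<rho> ^ CARD('d)) + ennreal M * ennreal (R ^ CARD('d) - ((1 - 2 * \<kappa>) * \<rho>) ^ CARD('d))"
      using \<delta> M \<rho> le by (simp add: ennreal_plus ennreal_mult)
    then show ?thesis using a by (simp add: add.assoc)
  qed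
  have "HW W (t *\<^sub>R \<xi>) \<le> ennreal (1 / R ^ CARD('d)) * (?I + ennreal (?X + ?Z))"
    using HW1 mult_left_mono[OF PI, of "ennreal (1 / R ^ CARD('d))"] by (meson order_trans zero_le)
  also have "\<dots> = ennreal (1 / R ^ CARD('d)) * ?I + ennreal (1 / R ^ CARD('d)) * ennreal (?X + ?Z)"
    by (simp add: distrib_left)
  also have "\<dots> \<le> ennreal (1 / \<rho> ^ CARD('d)) * ?I + ennreal (\<delta> + M * (1 - ((1 - 2 * \<kappa>) * \<rho> / (\<rho> + 2 * \<epsilon>)) ^ CARD('d)))"
  proof (rule add_mono)
    have "1 / R ^ CARD('d) \<le> 1 / \<rho> ^ CARD('d)" using R \<rho> by (intro divide_left_mono power_mono) auto
    then show "ennreal (1 / R ^ CARD('d)) * ?I \<le> ennreal (1 / \<rho> ^ CARD('d)) * ?I"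
      by (intro mult_right_mono ennreal_leI) auto
    have "1 / R ^ CARD('d) * (?X + ?Z) \<le> \<delta> + M * (1 - ((1 - 2 * \<kappa>) * \<rho> / (\<rho> + 2 * \<epsilon>)) ^ CARD('d))"
    proof -
      have "1 / R ^ CARD('d) * (?X + ?Z) = \<delta> * (\<rho> / R) ^ CARD('d) + M * (1 - ((1 - 2 * \<kappa>) * \<rho> / R) ^ CARD('d))"
        using R by (simp add: power_divide field_simps)
      also have "\<dots> \<le> \<delta> * 1 + M * (1 - ((1 - 2 * \<kappa>) * \<rho> / (\<rho> + 2 * \<epsilon>)) ^ CARD('d))"
      proof (intro add_mono mult_left_mono diff_left_mono)
        show "(\<rho> / R) ^ CARD('d) \<le> 1" using R \<rho> by (intro power_le_one) auto
        show "((1 - 2 * \<kappa>) * \<rho> / (\<rho> + 2 * \<epsilon>)) ^ CARD('d) \<le> ((1 - 2 * \<kappa>) * \<rho> / R) ^ CARD('d)"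
          using R \<rho> \<kappa> \<epsilon> by (intro power_mono divide_left_mono) auto
      qed (use \<delta> M in auto)
      finally show ?thesis by simp
    qed
    then show "ennreal (1 / R ^ CARD('d)) * ennreal (?X + ?Z) \<le> ennreal (\<delta> + M * (1 - ((1 - 2 * \<kappa>) * \<rho> / (\<rho> + 2 * \<epsilon>)) ^ CARD('d)))"
      using R by (subst ennreal_mult'[symmetric]) (auto intro!: ennreal_leI)
  qed
  finally show ?thesis .
qed

end

section \<open>Cube averages and uniform convergence\<close>

text \<open>Tonelli: \<open>y\<close> lies in the cube with lower corner \<open>x\<close> iff
  \<open>x\<close> lies in the cube of the same side with upper corner \<open>y\<close>, so each
  value of \<open>h\<close> is counted with weight \<open>\<rho> ^ CARD('d)\<close>. The Borel
  representative \<open>h'\<close> provides joint measurability.\<close>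

lemma nn_integral_cube_averages:
  fixes h :: "real^'d \<Rightarrow> ennreal"
  assumes h: "h \<in> borel_measurable lebesgue" and \<rho>: "\<rho> > 0"
  shows "(\<lambda>x. \<integral>\<^sup>+y. h y * indicator (box x (x + \<rho> *\<^sub>R 1)) y \<partial>lebesgue) \<in> borel_measurable borel"
    and "(\<integral>\<^sup>+x. (\<integral>\<^sup>+y. h y * indicator (box x (x + \<rho> *\<^sub>R 1)) y \<partial>lebesgue) \<partial>lebesgue) =
       ennreal (\<rho> ^ CARD('d)) * (\<integral>\<^sup>+y. h y \<partial>lebesgue)"
proof -
  obtain h' where h': "h' \<in> borel_measurable lborel" "AE x in lborel. h x = h' x"
    using completion_ex_borel_measurable[OF h] by blast
  define S where "S = {p::(real^'d) \<times> (real^'d). \<forall>i. fst p $ i < snd p $ i \<and> snd p $ i < fst p $ i + \<rho>}"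
  have "S = (\<Inter>i\<in>UNIV. {p. fst p $ i < snd p $ i} \<inter> {p. snd p $ i < fst p $ i + \<rho>})" by (auto simp: S_def)
  then have "open S"
    by (simp only:) (intro open_INT open_Int open_Collect_less continuous_intros finite_class.finite_UNIV ballI)
  then have S: "S \<in> sets borel" by simp
  have indS: "indicator (box x (x + \<rho> *\<^sub>R 1)) y = (indicator S (x, y) :: ennreal)" for x y
    by (simp add: indicator_def S_def mem_box_cart)
  have e: "(\<integral>\<^sup>+y. h y * indicator (box x (x + \<rho> *\<^sub>R 1)) y \<partial>lebesgue) = (\<integral>\<^sup>+y. h' y * indicator S (x, y) \<partial>lborel)" for x
    unfolding nn_integral_completion indS by (rule nn_integral_cong_AE, use h'(2) in \<open>rule eventually_mono\<close>) simp
  have "(\<lambda>p. h' (snd p) * indicator S p) \<in> borel_measurable (borel \<Otimes>\<^sub>M borel)"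
  proof (intro borel_measurable_times_ennreal borel_measurable_indicator)
    show "(\<lambda>p. h' (snd p)) \<in> borel_measurable (borel \<Otimes>\<^sub>M borel)"
      using h'(1) by (intro measurable_compose[OF measurable_snd]) simp
    show "S \<in> sets (borel \<Otimes>\<^sub>M borel)" unfolding borel_prod by (rule S)
  qed
  then have "(\<lambda>p. h' (snd p) * indicator S p) \<in> borel_measurable (lborel \<Otimes>\<^sub>M lborel)"
    by (simp add: measurable_cong_sets[OF sets_pair_measure_cong[OF sets_lborel sets_lborel] refl])
  then have m1: "(\<lambda>(x, y). h' y * indicator S (x, y)) \<in> borel_measurable (lborel \<Otimes>\<^sub>M lborel)"
    by (simp add: split_def)
  show "(\<lambda>x. \<integral>\<^sup>+y. h y * indicator (box x (x + \<rho> *\<^sub>R 1)) y \<partial>lebesgue) \<in> borel_measurable borel"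
    unfolding e using lborel.borel_measurable_nn_integral[OF m1] by simp
  have "(\<integral>\<^sup>+x. (\<integral>\<^sup>+y. h' y * indicator S (x, y) \<partial>lborel) \<partial>lebesgue) = (\<integral>\<^sup>+x. (\<integral>\<^sup>+y. h' y * indicator S (x, y) \<partial>lborel) \<partial>lborel)"
    by (rule nn_integral_completion)
  also have "\<dots> = (\<integral>\<^sup>+y. (\<integral>\<^sup>+x. h' y * indicator S (x, y) \<partial>lborel) \<partial>lborel)"
    by (rule lborel_pair.Fubini'[symmetric]) (rule m1)
  also have "\<dots> = (\<integral>\<^sup>+y. ennreal (\<rho> ^ CARD('d)) * h' y \<partial>lborel)"
  proof (rule nn_integral_cong)
    fix y :: "real^'d"
    have "(\<integral>\<^sup>+x. h' y * indicator S (x, y) \<partial>lborel) = (\<integral>\<^sup>+x. h' y * indicator (box (y - \<rho> *\<^sub>R 1) ((y - \<rho> *\<^sub>R 1) + \<rho> *\<^sub>R 1)) x \<partial>lborel)"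
      by (intro nn_integral_cong arg_cong2[where f="(*)"] refl) (auto simp: indicator_def S_def mem_box_cart algebra_simps)
    also have "\<dots> = h' y * emeasure lborel (box (y - \<rho> *\<^sub>R 1) ((y - \<rho> *\<^sub>R 1) + \<rho> *\<^sub>R 1))"
      by (rule nn_integral_cmult_indicator) simp
    also have "\<dots> = ennreal (\<rho> ^ CARD('d)) * h' y"
      using measure_cube(3)[of \<rho> "y - \<rho> *\<^sub>R 1"] \<rho> by (simp add: mult.commute)
    finally show "(\<integral>\<^sup>+x. h' y * indicator S (x, y) \<partial>lborel) = ennreal (\<rho> ^ CARD('d)) * h' y" .
  qed
  also have "\<dots> = ennreal (\<rho> ^ CARD('d)) * (\<integral>\<^sup>+y. h' y \<partial>lborel)"
    by (rule nn_integral_cmult) (rule h'(1))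
  also have "(\<integral>\<^sup>+y. h' y \<partial>lborel) = (\<integral>\<^sup>+y. h y \<partial>lebesgue)"
    unfolding nn_integral_completion by (rule nn_integral_cong_AE, use h'(2) in \<open>rule eventually_mono\<close>) simp
  finally show "(\<integral>\<^sup>+x. (\<integral>\<^sup>+y. h y * indicator (box x (x + \<rho> *\<^sub>R 1)) y \<partial>lebesgue) \<partial>lebesgue) =
       ennreal (\<rho> ^ CARD('d)) * (\<integral>\<^sup>+y. h y \<partial>lebesgue)" unfolding e .
qed

text \<open>A value of norm at least \<open>s\<close> forces norm at least \<open>s / 2\<close> on
  the corner cube of side \<open>s / (2 * L * CARD('d))\<close>, which is too much for the integral.
  This upgrades L1 convergence of equi-Lipschitz functions to uniform convergence.\<close>

lemma lipschitz_L1_imp_sup: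
  fixes g :: "real^'d \<Rightarrow> 'b::real_normed_vector"
  assumes L: "L-lipschitz_on UNIV g" "L > 0" and s: "s > 0"
    and small: "(\<integral>\<^sup>+y. ennreal (norm (g y)) \<partial>lebesgue) < ennreal (s / 2 * (s / (2 * L * CARD('d))) ^ CARD('d))"
  shows "norm (g x) < s"
proof (rule ccontr)
  assume "\<not> norm (g x) < s"
  then have gx: "s \<le> norm (g x)" by simp
  define \<rho> where "\<rho> = s / (2 * L * CARD('d))"
  have \<rho>: "\<rho> > 0" using L s by (simp add: \<rho>_def)
  let ?B = "cbox x (x + \<rho> *\<^sub>R 1)"
  have "ennreal (s / 2) * emeasure lebesgue ?B = (\<integral>\<^sup>+y. ennreal (s / 2) * indicator ?B y \<partial>lebesgue)"
    by (rule nn_integral_cmult_indicator[symmetric]) simp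
  also have "\<dots> \<le> (\<integral>\<^sup>+y. ennreal (norm (g y)) \<partial>lebesgue)"
  proof (rule nn_integral_mono)
    fix y
    have "s / 2 \<le> norm (g y)" if "y \<in> ?B"
    proof -
      have "norm (g x - g y) \<le> L * dist x y" using lipschitz_onD[OF L(1), of x y] by (simp add: dist_norm)
      also have "\<dots> \<le> L * (\<rho> * CARD('d))"
        using corner_cube_subset_ball[OF _ that] \<rho> L(2) by (intro mult_left_mono) auto
      also have "\<dots> = s / 2" using L(2) by (simp add: \<rho>_def)
      finally show ?thesis using gx norm_triangle_ineq2[of "g x" "g y"] by linarith
    qed
    then show "ennreal (s / 2) * indicator ?B y \<le> ennreal (norm (g y))"
      by (auto simp: indicator_def intro: ennreal_leI)
  qed
  also have "emeasure lebesgue ?B = ennreal (\<rho> ^ CARD('d))" using \<rho> by (intro emeasure_corner_cube) simp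
  finally have "ennreal (s / 2 * \<rho> ^ CARD('d)) \<le> (\<integral>\<^sup>+y. ennreal (norm (g y)) \<partial>lebesgue)"
    using s \<rho> by (subst ennreal_mult) auto
  with small show False by (simp add: \<rho>_def not_less[symmetric])
qed

text \<open>Bernoulli's inequality bounds the volume fraction of a layer of relative width \<kappa>
  by \<open>2 * CARD('d) * \<kappa>\<close>. On that layer the energy density is only known to be at
  most \<open>M\<close>.\<close>

lemma thin_margin:
  fixes M \<delta> :: real
  assumes \<delta>: "\<delta> > 0" and M: "M \<ge> 0"
  obtains \<kappa> :: real where "0 < \<kappa>" "\<kappa> < 1/2" "M * (1 - (1 - 2 * \<kappa>) ^ CARD('d::finite)) < \<delta>"
proof -
  define \<kappa> where "\<kappa> = min (1/4) (\<delta> / (4 * CARD('d) * (M + 1)))"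
  have \<kappa>: "0 < \<kappa>" "\<kappa> < 1/2" using \<delta> M by (auto simp: \<kappa>_def)
  have \<kappa>M: "M * (1 - (1 - 2 * \<kappa>) ^ CARD('d)) < \<delta>"
  proof -
    have "1 + real CARD('d) * (- 2 * \<kappa>) \<le> (1 + (- 2 * \<kappa>)) ^ CARD('d)" using \<kappa> by (intro Bernoulli_inequality) auto
    then have "M * (1 - (1 - 2 * \<kappa>) ^ CARD('d)) \<le> M * (2 * CARD('d) * \<kappa>)" using M by (intro mult_left_mono) (auto simp: algebra_simps)
    also have "\<dots> \<le> (M + 1) * (2 * CARD('d) * \<kappa>)" using \<kappa> by (intro mult_right_mono) auto
    also have "\<dots> \<le> (M + 1) * (2 * CARD('d) * (\<delta> / (4 * CARD('d) * (M + 1))))"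
      using M by (intro mult_left_mono) (auto simp: \<kappa>_def)
    also have "\<dots> = \<delta> / 2"
    proof -
      have h: "q * (2 * CARD('d) * (\<delta> / (4 * CARD('d) * q))) = \<delta> / 2" if "q > 0" for q :: real using that by (simp add: field_simps)
      show ?thesis by (rule h) (use M in simp)
    qed
    finally show ?thesis using \<delta> by simp
  qed
  from that[OF \<kappa> \<kappa>M] show thesis .
qed

section \<open>Finite energy and the pointwise lower bound\<close>

context homogenization
begin

text \<open>A competitor of finite energy has \<open>\<xi> + G x\<close> in the closed convex set
  \<open>closure C\<close> almost everywhere, and the mean of this field is
  \<open>\<xi>\<close>.\<close>

lemma HW_outside:
  assumes "\<xi> \<notin> closure C" shows "HW W \<xi> = \<infinity>"
proof (rule ccontr)
  assume "HW W \<xi> \<noteq> \<infinity>"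
  then have "HW W \<xi> < \<infinity>" by (simp add: less_top)
  then obtain n f G where n: "n \<ge> 1" "lip_grad (box 0 (real n *\<^sub>R 1)) f G" "\<And>x. x \<notin> box 0 (real n *\<^sub>R 1) \<Longrightarrow> f x = 0"
    and I: "ennreal (1 / real n ^ CARD('d)) * (\<integral>\<^sup>+x. W x (\<xi> + G x) * indicator (box 0 (real n *\<^sub>R 1)) x \<partial>lebesgue) < \<infinity>"
    by (rule HW_less_obtain) blast
  let ?B = "box 0 (real n *\<^sub>R 1) :: (real^'d) set"
  let ?h = "\<lambda>x. W x (\<xi> + G x) * indicator ?B x"
  have "?h \<in> borel_measurable lebesgue"
    using measurable_integrand_indicator[OF W_measurable continuous_on_id lip_grad_measurable[OF n(2) open_box], of \<xi> 1] by simp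
  moreover have "(\<integral>\<^sup>+x. ?h x \<partial>lebesgue) \<noteq> \<infinity>"
    using I n(1) by (auto simp: ennreal_mult_less_top)
  ultimately have "AE x in lebesgue. ?h x \<noteq> \<infinity>" by (rule nn_integral_noteq_infinite)
  then have "AE x in lebesgue. x \<in> ?B \<longrightarrow> \<xi> + G x \<in> closure C"
    by (rule eventually_mono) (auto simp: less_top[symmetric] intro: mem_closure_C)
  then have "\<xi> \<in> closure C"
    using mean_gradient_in_convex[OF closed_closure convex_closure_C, of "real n" 0 f G \<xi>] n by simp
  with assms show False ..
qed

text \<open>The complement of \<open>closure C\<close> is open, so the function that is infinite
  there and zero elsewhere is a lower semicontinuous minorant of \<open>HW W\<close>.\<close>

lemma W_hom_outside: assumes "\<xi> \<notin> closure C" shows "W_hom W \<xi> = \<infinity>"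
proof -
  have "(\<lambda>\<xi>. if \<xi> \<in> - closure C then \<infinity> else 0) \<le> HW W"
    using HW_outside by (auto simp: le_fun_def)
  from lsc_envelope_greatest[OF lower_semicontinuous_const_on_open[OF open_Compl[OF closed_closure]] this, of \<xi>]
  have "\<infinity> \<le> lsc_envelope (HW W) \<xi>" using assms by simp
  then show ?thesis by (simp add: W_hom_def top_unique)
qed

text \<open>For fixed \<open>n\<close> the cube is fixed while \<open>\<epsilon> k\<close> tends to
  0, so the rounding to whole cells disappears; then one-sided differentiability at \<open>x\<close>
  makes the limit affine on the cubes up to an error small compared with \<open>\<rho> n\<close>.
  The iterated lower limit is the form that Fatou's lemma accepts.\<close>

lemma pointwise_liminf:
  fixes f :: "real^'d \<Rightarrow> real^'m" and fk :: "nat \<Rightarrow> real^'d \<Rightarrow> real^'m"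
  assumes \<Omega>: "open \<Omega>" "x \<in> \<Omega>" and der: "(f has_derivative (\<lambda>h. \<xi> *v h)) (at x within {x..})"
    and fk: "\<And>k. lip_grad \<Omega> (fk k) (Fk k)" "\<And>k. AE y in lebesgue. y \<in> \<Omega> \<longrightarrow> Fk k y \<in> closure C"
    and unif: "\<And>e. e > 0 \<Longrightarrow> \<forall>\<^sub>F k in sequentially. \<forall>y. norm (fk k y - f y) \<le> e"
    and \<epsilon>: "\<And>k. \<epsilon> k > 0" "\<epsilon> \<longlonglongrightarrow> 0"
    and \<rho>: "\<And>n. \<rho> n > 0" "\<rho> \<longlonglongrightarrow> 0"
  shows "W_hom W \<xi> \<le> liminf (\<lambda>n. liminf (\<lambda>k. ennreal (1 / \<rho> n ^ CARD('d)) *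
     (\<integral>\<^sup>+y. (W (y /\<^sub>R \<epsilon> k) (Fk k y) * indicator \<Omega> y) * indicator (box x (x + \<rho> n *\<^sub>R 1)) y \<partial>lebesgue)))"
    (is "_ \<le> liminf (\<lambda>n. liminf (\<lambda>k. ?A n k))")
proof -
  let ?l = "\<lambda>y. f x + \<xi> *v (y - x)"
  \<comment> \<open>Two contributions of \<open>\<tau> / 2 * \<rho> n\<close>: differentiability of
    \<open>f\<close> at \<open>x\<close> decides how large \<open>n\<close> must be, and uniform
    convergence then decides how large \<open>k\<close> must be for that \<open>n\<close>.\<close>
  have near: "\<forall>\<^sub>F n in sequentially. box x (x + \<rho> n *\<^sub>R 1) \<subseteq> \<Omega> \<and>
      (\<forall>\<^sub>F k in sequentially. \<forall>y\<in>box x (x + \<rho> n *\<^sub>R 1). norm (fk k y - ?l y) \<le> \<tau> * \<rho> n)" if \<tau>: "\<tau> > 0" for \<tau>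
  proof -
    have "\<tau> / (2 * CARD('d)) > 0" using \<tau> by simp
    then obtain d where d: "d > 0" "\<And>y. y \<in> {x..} \<Longrightarrow> norm (y - x) < d \<Longrightarrow> norm (f y - f x - \<xi> *v (y - x)) \<le> \<tau> / (2 * CARD('d)) * norm (y - x)"
      using der unfolding has_derivative_within_alt by blast
    obtain e where e: "e > 0" "ball x e \<subseteq> \<Omega>" using \<Omega> open_contains_ball by blast
    have "min d e / CARD('d) > 0" using d e by simp
    from order_tendstoD(2)[OF \<rho>(2) this] show ?thesis
    proof (rule eventually_mono)
      fix n assume n: "\<rho> n < min d e / CARD('d)"
      have dist: "dist x y < min d e" "dist x y \<le> \<rho> n * CARD('d)" if "y \<in> box x (x + \<rho> n *\<^sub>R 1)" for y
      proof -
        have "y \<in> cbox x (x + \<rho> n *\<^sub>R 1)" using that box_subset_cbox by blast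
        then show "dist x y \<le> \<rho> n * CARD('d)" using \<rho>(1)[of n] by (intro corner_cube_subset_ball) auto
        also have "\<dots> < min d e" using n by (simp add: less_divide_eq)
        finally show "dist x y < min d e" .
      qed
      have "box x (x + \<rho> n *\<^sub>R 1) \<subseteq> \<Omega>" using dist(1) e(2) by (auto simp del: mem_box)
      moreover have "\<tau> / 2 * \<rho> n > 0" using \<tau> \<rho>(1)[of n] by simp
      from unif[OF this]
      have "\<forall>\<^sub>F k in sequentially. \<forall>y\<in>box x (x + \<rho> n *\<^sub>R 1). norm (fk k y - ?l y) \<le> \<tau> * \<rho> n"
      proof (rule eventually_mono, intro ballI)
        fix k y assume k: "\<forall>y. norm (fk k y - f y) \<le> \<tau> / 2 * \<rho> n" and y: "y \<in> box x (x + \<rho> n *\<^sub>R 1)"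
        have "y \<in> {x..}" using y by (auto simp: mem_box_cart less_eq_vec_def less_imp_le)
        moreover have "norm (y - x) < d" using dist(1)[OF y] by (simp add: dist_norm norm_minus_commute)
        ultimately have "norm (f y - f x - \<xi> *v (y - x)) \<le> \<tau> / (2 * CARD('d)) * norm (y - x)" by (rule d(2))
        also have "\<dots> \<le> \<tau> / (2 * CARD('d)) * (\<rho> n * CARD('d))"
          using dist(2)[OF y] \<tau> by (intro mult_left_mono) (auto simp: dist_norm norm_minus_commute)
        also have "\<dots> = \<tau> / 2 * \<rho> n" by simp
        finally have 1: "norm (f y - f x - \<xi> *v (y - x)) \<le> \<tau> / 2 * \<rho> n" .
        have "fk k y - ?l y = (fk k y - f y) + (f y - f x - \<xi> *v (y - x))" by simp
        then have "norm (fk k y - ?l y) \<le> norm (fk k y - f y) + norm (f y - f x - \<xi> *v (y - x))"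
          using norm_triangle_ineq by metis
        then show "norm (fk k y - ?l y) \<le> \<tau> * \<rho> n" using k[rule_format, of y] 1 by linarith
      qed
      ultimately show "box x (x + \<rho> n *\<^sub>R 1) \<subseteq> \<Omega> \<and>
        (\<forall>\<^sub>F k in sequentially. \<forall>y\<in>box x (x + \<rho> n *\<^sub>R 1). norm (fk k y - ?l y) \<le> \<tau> * \<rho> n)" by blast
    qed
  qed
  have FC: "AE y in lebesgue. y \<in> box x (x + \<rho> n *\<^sub>R 1) \<longrightarrow> Fk k y \<in> closure C" if "box x (x + \<rho> n *\<^sub>R 1) \<subseteq> \<Omega>" for n k
    using fk(2)[of k] by (rule eventually_mono) (use that in blast)
  have \<xi>: "\<xi> \<in> closure C"
  proof (rule affine_limit_gradient_in_convex[OF closed_closure convex_closure_C])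
    fix \<tau> :: real assume "\<tau> > 0"
    from eventually_happens'[OF sequentially_bot near[OF this]]
    obtain n where n: "box x (x + \<rho> n *\<^sub>R 1) \<subseteq> \<Omega>"
      "\<forall>\<^sub>F k in sequentially. \<forall>y\<in>box x (x + \<rho> n *\<^sub>R 1). norm (fk k y - ?l y) \<le> \<tau> * \<rho> n" by blast
    from eventually_happens'[OF sequentially_bot n(2)]
    obtain k where "\<forall>y\<in>box x (x + \<rho> n *\<^sub>R 1). norm (fk k y - ?l y) \<le> \<tau> * \<rho> n" by blast
    then show "\<exists>f F a \<rho> c. \<rho> > 0 \<and> lip_grad (box a (a + \<rho> *\<^sub>R 1)) f F \<and>
      (AE y in lebesgue. y \<in> box a (a + \<rho> *\<^sub>R 1) \<longrightarrow> F y \<in> closure C) \<and>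
      (\<forall>y\<in>box a (a + \<rho> *\<^sub>R 1). norm (f y - (c + \<xi> *v (y - a))) \<le> \<tau> * \<rho>)"
      using \<rho>(1)[of n] lip_grad_subset[OF fk(1) n(1)] FC[OF n(1)] by blast
  qed
  let ?L = "liminf (\<lambda>n. liminf (\<lambda>k. ?A n k))"
  \<comment> \<open>One \<delta> pays for the radial condition, the other for the layer.\<close>
  have step: "W_hom W (t *\<^sub>R \<xi>) \<le> ?L + ennreal (2 * \<delta>)"
    if \<delta>: "\<delta> > 0" and t: "0 < t" "t < 1"
      and rad: "\<And>x \<xi>. \<xi> \<in> eff_dom (W x) \<Longrightarrow> W x (t *\<^sub>R \<xi>) \<le> W x \<xi> + ennreal \<delta>" for \<delta> t
  proof -
    obtain M r where M: "M \<ge> 0" "r > 0"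
      "AE x in lebesgue. \<forall>p q. p \<in> closure C \<longrightarrow> norm q \<le> r \<longrightarrow> W x (t *\<^sub>R p + q) \<le> ennreal M"
      by (rule bounded_on_shrunk[OF t])
    obtain \<kappa> :: real where \<kappa>: "0 < \<kappa>" "\<kappa> < 1/2" and \<kappa>M: "M * (1 - (1 - 2 * \<kappa>) ^ CARD('d)) < \<delta>"
      by (rule thin_margin[OF \<delta> M(1)])
    obtain \<psi> :: "real^'d \<Rightarrow> real" and g \<Lambda> where \<psi>:
      "\<And>x. (\<psi> has_derivative (\<lambda>h. h \<bullet> g x)) (at x)" "\<And>x. 0 \<le> \<psi> x" "\<And>x. \<psi> x \<le> 1"
      "\<And>x. x \<notin> box 0 1 \<Longrightarrow> \<psi> x = 0" "\<And>x. x \<in> cbox (\<kappa> *\<^sub>R 1) ((1 - \<kappa>) *\<^sub>R 1) \<Longrightarrow> \<psi> x = 1"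
      "\<Lambda> \<ge> 0" "\<And>x. norm (g x) \<le> \<Lambda>" "\<And>x y. \<bar>\<psi> x - \<psi> y\<bar> \<le> \<Lambda> * norm (x - y)"
      by (rule cube_cutoff[OF \<kappa>(1)]) auto
    define \<tau> where "\<tau> = r / (\<Lambda> + 1)"
    have \<tau>: "\<tau> > 0" using M(2) \<psi>(6) by (simp add: \<tau>_def)
    have "\<tau> * \<Lambda> \<le> r" using M(2) \<psi>(6) by (simp add: \<tau>_def field_simps)
    moreover have "t * (\<tau> * \<Lambda>) \<le> \<tau> * \<Lambda>" using t \<tau> \<psi>(6) by (intro mult_left_le_one_le) auto
    ultimately have \<tau>r: "t * (\<tau> * \<Lambda>) \<le> r" by linarith
    \<comment> \<open>The error stands on the left, so that a bound by a constant, valid eventually,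
      passes to both lower limits.\<close>
    have "\<forall>\<^sub>F n in sequentially. HW W (t *\<^sub>R \<xi>) - ennreal (2 * \<delta>) \<le> liminf (\<lambda>k. ?A n k)"
      using near[OF \<tau>]
    proof (rule eventually_mono)
      fix n assume n: "box x (x + \<rho> n *\<^sub>R 1) \<subseteq> \<Omega> \<and>
        (\<forall>\<^sub>F k in sequentially. \<forall>y\<in>box x (x + \<rho> n *\<^sub>R 1). norm (fk k y - ?l y) \<le> \<tau> * \<rho> n)"
      let ?B = "box x (x + \<rho> n *\<^sub>R 1)"
      have "(\<lambda>k. M * (1 - ((1 - 2 * \<kappa>) * \<rho> n / (\<rho> n + 2 * \<epsilon> k)) ^ CARD('d))) \<longlonglongrightarrow>
          M * (1 - ((1 - 2 * \<kappa>) * \<rho> n / (\<rho> n + 2 * 0)) ^ CARD('d))"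
        using \<rho>(1)[of n] by (intro tendsto_intros \<epsilon>(2)) auto
      then have "(\<lambda>k. M * (1 - ((1 - 2 * \<kappa>) * \<rho> n / (\<rho> n + 2 * \<epsilon> k)) ^ CARD('d))) \<longlonglongrightarrow> M * (1 - (1 - 2 * \<kappa>) ^ CARD('d))"
        using \<rho>(1)[of n] by simp
      from order_tendstoD(2)[OF this \<kappa>M]
      have "\<forall>\<^sub>F k in sequentially. HW W (t *\<^sub>R \<xi>) - ennreal (2 * \<delta>) \<le> ?A n k"
        using n[THEN conjunct2]
      proof eventually_elim
        case (elim k)
        have "HW W (t *\<^sub>R \<xi>) \<le> ennreal (1 / \<rho> n ^ CARD('d)) *
            (\<integral>\<^sup>+y. W (y /\<^sub>R \<epsilon> k) (Fk k y) * indicator ?B y \<partial>lebesgue)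
           + ennreal (\<delta> + M * (1 - ((1 - 2 * \<kappa>) * \<rho> n / (\<rho> n + 2 * \<epsilon> k)) ^ CARD('d)))"
          by (rule HW_le_cube_energy[OF t rad less_imp_le[OF \<delta>] M \<kappa> \<psi> lip_grad_subset[OF fk(1)] \<rho>(1) FC \<xi> elim(2)[rule_format] \<tau>r less_imp_le[OF \<tau>] \<epsilon>(1)])
             (use n in auto)
        also have "(\<lambda>y. W (y /\<^sub>R \<epsilon> k) (Fk k y) * indicator ?B y) = (\<lambda>y. (W (y /\<^sub>R \<epsilon> k) (Fk k y) * indicator \<Omega> y) * indicator ?B y)"
          using n by (auto simp: fun_eq_iff indicator_def simp del: mem_box)
        also have "ennreal (\<delta> + M * (1 - ((1 - 2 * \<kappa>) * \<rho> n / (\<rho> n + 2 * \<epsilon> k)) ^ CARD('d))) \<le> ennreal (2 * \<delta>)"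
          using elim(1) by (intro ennreal_leI) simp
        finally show ?case by (simp add: ennreal_minus_le_iff add.commute)
      qed
      then show "HW W (t *\<^sub>R \<xi>) - ennreal (2 * \<delta>) \<le> liminf (\<lambda>k. ?A n k)" by (rule Liminf_bounded)
    qed
    then have "HW W (t *\<^sub>R \<xi>) - ennreal (2 * \<delta>) \<le> ?L" by (rule Liminf_bounded)
    then have "HW W (t *\<^sub>R \<xi>) \<le> ?L + ennreal (2 * \<delta>)" by (simp add: ennreal_minus_le_iff add.commute)
    then show ?thesis using lsc_envelope_le[of "HW W" "t *\<^sub>R \<xi>"] unfolding W_hom_def by (rule order_trans[rotated])
  qed
  have fin: "W_hom W \<xi> \<le> ?L + ennreal (2 * \<delta>)" if \<delta>: "\<delta> > 0" for \<delta>
  proof -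
    obtain \<eta> where \<eta>: "\<eta> > 0" "\<And>x \<xi> t. \<xi> \<in> eff_dom (W x) \<Longrightarrow> t \<in> {0..<1} \<Longrightarrow> 1 - t \<le> \<eta> \<Longrightarrow> W x (t *\<^sub>R \<xi>) \<le> W x \<xi> + ennreal \<delta>"
      using radial[OF \<delta>] by blast
    \<comment> \<open>From here on the envelope takes over from \<open>HW\<close>: it is lower
      semicontinuous along \<open>t *\<^sub>R \<xi>\<close>, which permits letting \<open>t\<close>
      tend to 1.\<close>
    have T: "((\<lambda>t. t *\<^sub>R \<xi>) \<longlongrightarrow> 1 *\<^sub>R \<xi>) (at_left (1::real))" by (intro tendsto_intros)
    have ev: "\<forall>\<^sub>F t in at_left (1::real). W_hom W (t *\<^sub>R \<xi>) \<le> ?L + ennreal (2 * \<delta>)"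
    proof (rule eventually_at_leftI[of "max 0 (1 - \<eta>)"])
      fix t assume "t \<in> {max 0 (1 - \<eta>)<..<1}"
      then show "W_hom W (t *\<^sub>R \<xi>) \<le> ?L + ennreal (2 * \<delta>)"
        by (intro step[OF \<delta>] \<eta>(2)) auto
    qed (use \<eta>(1) in auto)
    have "W_hom W \<xi> \<le> Liminf (at_left 1) (\<lambda>t. W_hom W (t *\<^sub>R \<xi>))"
      using lower_semicontinuous_le_Liminf[OF lower_semicontinuous_lsc_envelope T] by (simp add: W_hom_def)
    also have "\<dots> \<le> Limsup (at_left 1) (\<lambda>t. W_hom W (t *\<^sub>R \<xi>))" by (rule Liminf_le_Limsup) simp
    also have "\<dots> \<le> ?L + ennreal (2 * \<delta>)" by (rule Limsup_bounded[OF ev])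
    finally show ?thesis .
  qed
  show ?thesis
  proof (rule ennreal_le_epsilon)
    fix e :: real assume "e > 0"
    then show "W_hom W \<xi> \<le> ?L + ennreal e" using fin[of "e / 2"] by simp
  qed
qed

end

section \<open>The lower limit inequality\<close>

lemma measurable_ennreal_norm_diff:
  fixes f g :: "'a \<Rightarrow> 'b::euclidean_space"
  assumes "f \<in> borel_measurable M" "g \<in> borel_measurable M"
  shows "(\<lambda>x. ennreal (norm (f x - g x))) \<in> borel_measurable M"
  using assms by measurable

text \<open>\<open>u\<close> serves as an intermediate point for the L1 distance and is only
  measurable on \<Omega>. Both Lipschitz functions vanish off \<Omega>, so their L1 distance over
  the whole space is the one over \<Omega>.\<close>

lemma sup_small_of_L1_close:
  fixes f g u :: "real^'d \<Rightarrow> real^'m"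
  assumes \<Omega>: "open \<Omega>" and L: "L-lipschitz_on UNIV f" "L-lipschitz_on UNIV g" "L > 0"
    and zero: "\<And>x. x \<notin> \<Omega> \<Longrightarrow> f x = 0" "\<And>x. x \<notin> \<Omega> \<Longrightarrow> g x = 0"
    and u: "u \<in> borel_measurable (lebesgue_on \<Omega>)" and s: "s > 0"
    and small: "(\<integral>\<^sup>+x. ennreal (norm (f x - u x)) \<partial>lebesgue_on \<Omega>) + (\<integral>\<^sup>+x. ennreal (norm (g x - u x)) \<partial>lebesgue_on \<Omega>)
       < ennreal (s / 2 * (s / (2 * (L + L) * CARD('d))) ^ CARD('d))"
  shows "norm (f x - g x) < s"
proof (rule lipschitz_L1_imp_sup[where L="L + L" and g="\<lambda>x. f x - g x"])
  show "(L + L)-lipschitz_on UNIV (\<lambda>x. f x - g x)" by (rule lipschitz_on_diff[OF L(1,2)])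
  have m: "(\<lambda>x. ennreal (norm (h x - u x))) \<in> borel_measurable (lebesgue_on \<Omega>)" if "L-lipschitz_on UNIV h" for h
  proof -
    have "h \<in> borel_measurable (lebesgue_on \<Omega>)"
      by (intro measurable_restrict_space1 continuous_imp_measurable_lebesgue lipschitz_on_continuous_on[OF that])
    then show ?thesis using u by (rule measurable_ennreal_norm_diff)
  qed
  have "(\<integral>\<^sup>+x. ennreal (norm (f x - g x)) \<partial>lebesgue) = (\<integral>\<^sup>+x. ennreal (norm (f x - g x)) * indicator \<Omega> x \<partial>lebesgue)"
    by (intro nn_integral_cong) (auto simp: indicator_def zero)
  also have "\<dots> = (\<integral>\<^sup>+x. ennreal (norm (f x - g x)) \<partial>lebesgue_on \<Omega>)" by (rule nn_integral_lebesgue_on[OF \<Omega>, symmetric])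
  also have "\<dots> \<le> (\<integral>\<^sup>+x. ennreal (norm (f x - u x)) + ennreal (norm (g x - u x)) \<partial>lebesgue_on \<Omega>)"
  proof (rule nn_integral_mono)
    fix x
    have "norm (f x - g x) \<le> norm (f x - u x) + norm (g x - u x)" by (rule norm_diff_triangle_le[where y="u x"]) (auto simp: norm_minus_commute)
    then show "ennreal (norm (f x - g x)) \<le> ennreal (norm (f x - u x)) + ennreal (norm (g x - u x))"
      using ennreal_leI[of "norm (f x - g x)" "norm (f x - u x) + norm (g x - u x)"] by (simp only: ennreal_plus norm_ge_zero)
  qed
  also have "\<dots> = (\<integral>\<^sup>+x. ennreal (norm (f x - u x)) \<partial>lebesgue_on \<Omega>) + (\<integral>\<^sup>+x. ennreal (norm (g x - u x)) \<partial>lebesgue_on \<Omega>)"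
    by (rule nn_integral_add[OF m[OF L(1)] m[OF L(2)]])
  also note small
  finally show "(\<integral>\<^sup>+x. ennreal (norm (f x - g x)) \<partial>lebesgue) < ennreal (s / 2 * (s / (2 * (L + L) * CARD('d))) ^ CARD('d))" .
qed (use L s in auto)

context homogenization
begin

lemma measurable_energy_density:
  assumes "lip_grad \<Omega> f G" "open \<Omega>"
  shows "(\<lambda>y. W (y /\<^sub>R \<epsilon>) (G y) * indicator \<Omega> y) \<in> borel_measurable lebesgue"
proof -
  have cs: "continuous_on UNIV (\<lambda>y::real^'d. y /\<^sub>R \<epsilon>)" by (intro continuous_intros)
  from measurable_integrand_indicator[OF W_measurable cs lip_grad_measurable[OF assms], of 0 1] assms(2)
  show ?thesis by simp
qed

lemma liminf_inequality:
  fixes u :: "real^'d \<Rightarrow> real^'m"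
  assumes \<Omega>: "open \<Omega>" "bounded \<Omega>" and u: "u \<in> W1inf \<Omega>" and v: "v \<in> L1_families \<Omega> u"
  shows "J_hom \<Omega> W u \<le> Liminf (at_right 0) (\<lambda>\<epsilon>. J \<Omega> W \<epsilon> (v \<epsilon>))"
proof (rule dense_ge)
  fix c assume c: "Liminf (at_right 0) (\<lambda>\<epsilon>. J \<Omega> W \<epsilon> (v \<epsilon>)) < c"
  let ?M = "lebesgue_on \<Omega>"
  have um: "u \<in> borel_measurable ?M" using u by (auto simp: W1inf_def Linf_def)
  \<comment> \<open>Energies below \<open>c\<close> occur frequently, not eventually, as \<epsilon>
    tends to 0, so a sequence \<open>\<epsilon> k\<close> is selected along which all of them
    are.\<close>
  have freq: "\<exists>\<^sub>F \<epsilon> in at_right 0. J \<Omega> W \<epsilon> (v \<epsilon>) < c"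
  proof (rule ccontr)
    assume "\<not> ?thesis"
    then have "\<forall>\<^sub>F \<epsilon> in at_right 0. c \<le> J \<Omega> W \<epsilon> (v \<epsilon>)" by (simp add: not_frequently not_less)
    then have "c \<le> Liminf (at_right 0) (\<lambda>\<epsilon>. J \<Omega> W \<epsilon> (v \<epsilon>))" by (rule Liminf_bounded)
    with c show False by simp
  qed
  let ?I = "\<lambda>f. \<integral>\<^sup>+x. ennreal (norm (f x - u x)) \<partial>?M"
  have lim: "((\<lambda>\<epsilon>. ?I (v \<epsilon>)) \<longlongrightarrow> 0) (at_right 0)" using v by (simp add: L1_families_def)
  have ex: "\<exists>\<epsilon>. \<epsilon> > 0 \<and> \<epsilon> < 1 / real (Suc k) \<and> ?I (v \<epsilon>) < ennreal (1 / real (Suc k)) \<and> J \<Omega> W \<epsilon> (v \<epsilon>) < c" for k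
  proof -
    have "\<forall>\<^sub>F \<epsilon> in at_right 0. 0 < \<epsilon> \<and> \<epsilon> < 1 / real (Suc k)"
      by (intro eventually_conj eventually_at_right_less) (rule eventually_at_rightI[of 0 "1 / real (Suc k)"], auto)
    moreover have "\<forall>\<^sub>F \<epsilon> in at_right 0. ?I (v \<epsilon>) < ennreal (1 / real (Suc k))"
      by (rule order_tendstoD(2)[OF lim]) simp
    ultimately have "\<forall>\<^sub>F \<epsilon> in at_right 0. (0 < \<epsilon> \<and> \<epsilon> < 1 / real (Suc k)) \<and> ?I (v \<epsilon>) < ennreal (1 / real (Suc k))"
      by (rule eventually_conj)
    from frequently_ex[OF frequently_eventually_conj[OF freq this]] show ?thesis by blast
  qed
  from choice[OF allI[OF ex]] obtain \<epsilon> where "\<forall>k. \<epsilon> k > 0 \<and> \<epsilon> k < 1 / real (Suc k) \<and>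
     ?I (v (\<epsilon> k)) < ennreal (1 / real (Suc k)) \<and> J \<Omega> W (\<epsilon> k) (v (\<epsilon> k)) < c" ..
  then have \<epsilon>: "\<And>k. \<epsilon> k > 0" "\<And>k. \<epsilon> k < 1 / real (Suc k)" "\<And>k. ?I (v (\<epsilon> k)) < ennreal (1 / real (Suc k))"
    "\<And>k. J \<Omega> W (\<epsilon> k) (v (\<epsilon> k)) < c" by blast+
  have \<epsilon>0: "\<epsilon> \<longlonglongrightarrow> 0"
  proof (rule tendsto_sandwich[OF _ _ tendsto_const LIMSEQ_inverse_real_of_nat])
    show "\<forall>\<^sub>F k in sequentially. 0 \<le> \<epsilon> k" using \<epsilon>(1) by (simp add: less_imp_le)
    show "\<forall>\<^sub>F k in sequentially. \<epsilon> k \<le> inverse (real (Suc k))" using \<epsilon>(2) by (intro always_eventually) (auto simp: inverse_eq_divide less_imp_le)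
  qed
  define F where "F = (\<lambda>k. weak_gradient \<Omega> (v (\<epsilon> k)))"
  have vW: "v (\<epsilon> k) \<in> W1inf0 \<Omega>" for k
    using \<epsilon>(4)[of k] by (auto simp: J_def split: if_splits)
  have Jk: "J \<Omega> W (\<epsilon> k) (v (\<epsilon> k)) = (\<integral>\<^sup>+y. W (y /\<^sub>R \<epsilon> k) (F k y) * indicator \<Omega> y \<partial>lebesgue)" for k
    using vW[of k] nn_integral_lebesgue_on[OF \<Omega>(1)] by (simp add: J_def F_def)
  have "bounded (closure C)" using bounded_C by (rule bounded_closure)
  then obtain R0 where R0: "R0 > 0" "\<And>x. x \<in> closure C \<Longrightarrow> norm x \<le> R0" by (meson bounded_pos)
  define L where "L = CARD('m) * R0"
  have L0: "L > 0" using R0 by (simp add: L_def)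
  \<comment> \<open>Finite energy forces the gradients into \<open>closure C\<close>; they are
    bounded by \<open>R0\<close>, and the representatives share the Lipschitz constant
    \<open>L\<close>.\<close>
  have exf: "\<exists>f. lip_grad \<Omega> f (F k) \<and> (AE x in lebesgue. x \<in> \<Omega> \<longrightarrow> f x = v (\<epsilon> k) x) \<and> (\<forall>x. x \<notin> \<Omega> \<longrightarrow> f x = 0) \<and>
      L-lipschitz_on UNIV f \<and> (AE y in lebesgue. y \<in> \<Omega> \<longrightarrow> F k y \<in> closure C)" for k
  proof -
    obtain f where f: "lip_grad \<Omega> f (F k)" "AE x in lebesgue. x \<in> \<Omega> \<longrightarrow> f x = v (\<epsilon> k) x" "\<And>x. x \<notin> \<Omega> \<Longrightarrow> f x = 0"
      and lip: "\<And>R::real. R \<ge> 0 \<Longrightarrow> AE x in lebesgue. x \<in> \<Omega> \<longrightarrow> norm (F k x) \<le> R \<Longrightarrow> (CARD('m) * R)-lipschitz_on UNIV f"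
      unfolding F_def by (rule W1inf0_obtain_lip_grad[OF \<Omega>(1) vW]) blast
    have "(\<integral>\<^sup>+y. W (y /\<^sub>R \<epsilon> k) (F k y) * indicator \<Omega> y \<partial>lebesgue) \<noteq> \<infinity>"
      using \<epsilon>(4)[of k] unfolding Jk by auto
    from nn_integral_noteq_infinite[OF measurable_energy_density[OF f(1) \<Omega>(1)] this]
    have FC: "AE y in lebesgue. y \<in> \<Omega> \<longrightarrow> F k y \<in> closure C"
      by (rule eventually_mono) (auto simp: less_top[symmetric] intro: mem_closure_C)
    then have "AE y in lebesgue. y \<in> \<Omega> \<longrightarrow> norm (F k y) \<le> R0" by (rule eventually_mono) (use R0(2) in blast)
    then have "L-lipschitz_on UNIV f" unfolding L_def using R0(1) by (intro lip) auto
    then show ?thesis using f FC by blast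
  qed
  from choice[OF allI[OF exf]] obtain f where "\<forall>k. lip_grad \<Omega> (f k) (F k) \<and> (AE x in lebesgue. x \<in> \<Omega> \<longrightarrow> f k x = v (\<epsilon> k) x) \<and>
     (\<forall>x. x \<notin> \<Omega> \<longrightarrow> f k x = 0) \<and> L-lipschitz_on UNIV (f k) \<and> (AE y in lebesgue. y \<in> \<Omega> \<longrightarrow> F k y \<in> closure C)" ..
  then have f: "\<And>k. lip_grad \<Omega> (f k) (F k)" "\<And>k. AE x in lebesgue. x \<in> \<Omega> \<longrightarrow> f k x = v (\<epsilon> k) x"
    "\<And>k x. x \<notin> \<Omega> \<Longrightarrow> f k x = 0" "\<And>k. L-lipschitz_on UNIV (f k)" "\<And>k. AE y in lebesgue. y \<in> \<Omega> \<longrightarrow> F k y \<in> closure C"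
    by blast+
  have If: "?I (f k) < ennreal (1 / real (Suc k))" for k
  proof -
    have "AE x in ?M. f k x = v (\<epsilon> k) x" using f(2)[of k] \<Omega>(1) by (subst AE_lebesgue_on_iff) auto
    then have "?I (f k) = ?I (v (\<epsilon> k))" by (intro nn_integral_cong_AE, rule eventually_mono) simp
    then show ?thesis using \<epsilon>(3) by simp
  qed
  have If0: "(\<lambda>k. ?I (f k)) \<longlonglongrightarrow> 0"
  proof (rule tendsto_sandwich[OF _ _ tendsto_const])
    have "(\<lambda>k. ennreal (1 / real (Suc k))) \<longlonglongrightarrow> ennreal 0"
      using LIMSEQ_inverse_real_of_nat by (intro tendsto_ennrealI) (simp add: inverse_eq_divide)
    then show "(\<lambda>k. ennreal (1 / real (Suc k))) \<longlonglongrightarrow> 0" by simp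
    show "\<forall>\<^sub>F k in sequentially. ?I (f k) \<le> ennreal (1 / real (Suc k))" using If by (simp add: less_imp_le)
  qed simp
  have fm: "f k \<in> borel_measurable ?M" for k
    by (intro measurable_restrict_space1 continuous_imp_measurable_lebesgue lipschitz_on_continuous_on[OF f(4)])
  have fum: "(\<lambda>x. ennreal (norm (f k x - u x))) \<in> borel_measurable ?M" for k
    by (rule measurable_ennreal_norm_diff[OF fm um])
  \<comment> \<open>L1 convergence and the common Lipschitz constant make the representatives Cauchy
    at every point. The limit is a continuous representative of \<open>u\<close> that vanishes off
    \<Omega>, so \<open>u\<close> belongs to \<open>W1inf0\<close> and \<open>J_hom\<close> is given
    by the integral.\<close>
  have "Cauchy (\<lambda>k. f k x)" for x
  proof (rule metric_CauchyI)
    fix s :: real assume s: "s > 0"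
    define \<theta> where "\<theta> = s / 2 * (s / (2 * (L + L) * CARD('d))) ^ CARD('d)"
    have "\<theta> > 0" using s L0 by (simp add: \<theta>_def)
    then have "\<forall>\<^sub>F k in sequentially. ?I (f k) < ennreal (\<theta> / 2)" by (intro order_tendstoD(2)[OF If0]) simp
    then obtain N where N: "\<And>k. k \<ge> N \<Longrightarrow> ?I (f k) < ennreal (\<theta> / 2)" by (auto simp: eventually_sequentially)
    have "dist (f k x) (f l x) < s" if "k \<ge> N" "l \<ge> N" for k l
    proof -
      have "?I (f k) + ?I (f l) < ennreal (\<theta> / 2) + ennreal (\<theta> / 2)" by (intro add_strict_mono N that)
      also have "\<dots> = ennreal \<theta>" using \<open>\<theta> > 0\<close> by (subst ennreal_plus[symmetric]) auto
      finally show ?thesis unfolding dist_norm \<theta>_def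
        by (intro sup_small_of_L1_close[OF \<Omega>(1) f(4) f(4) L0 f(3) f(3) um s])
    qed
    then show "\<exists>N. \<forall>k\<ge>N. \<forall>l\<ge>N. dist (f k x) (f l x) < s" by blast
  qed
  then have "convergent (\<lambda>k. f k x)" for x by (simp add: Cauchy_convergent_iff)
  then have g: "(\<lambda>k. f k x) \<longlonglongrightarrow> lim (\<lambda>k. f k x)" for x by (simp add: convergent_LIMSEQ_iff)
  define g where "g = (\<lambda>x. lim (\<lambda>k. f k x))"
  have g: "(\<lambda>k. f k x) \<longlonglongrightarrow> g x" for x unfolding g_def by (rule g)
  have gL: "L-lipschitz_on UNIV g"
  proof (rule lipschitz_onI)
    fix x y
    show "dist (g x) (g y) \<le> L * dist x y"
      by (rule tendsto_upperbound[OF tendsto_dist[OF g g]]) (use lipschitz_onD[OF f(4)] in auto)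
  qed (use L0 in simp)
  have gm: "g \<in> borel_measurable ?M"
    by (intro measurable_restrict_space1 continuous_imp_measurable_lebesgue lipschitz_on_continuous_on[OF gL])
  have "?I g = 0"
  proof -
    have "?I g = (\<integral>\<^sup>+x. liminf (\<lambda>k. ennreal (norm (f k x - u x))) \<partial>?M)"
    proof (rule nn_integral_cong)
      fix x
      have "(\<lambda>k. ennreal (norm (f k x - u x))) \<longlonglongrightarrow> ennreal (norm (g x - u x))" by (intro tendsto_intros g)
      from lim_imp_Liminf[OF sequentially_bot this]
      show "ennreal (norm (g x - u x)) = liminf (\<lambda>k. ennreal (norm (f k x - u x)))" by simp
    qed
    also have "\<dots> \<le> liminf (\<lambda>k. ?I (f k))" by (rule nn_integral_liminf[OF fum])
    also have "\<dots> = 0" using If0 by (simp add: lim_imp_Liminf)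
    finally show ?thesis by simp
  qed
  then have "AE x in ?M. ennreal (norm (g x - u x)) = 0"
    using nn_integral_0_iff_AE[OF measurable_ennreal_norm_diff[OF gm um]] by blast
  then have gu: "AE x in ?M. g x = u x" by (rule eventually_mono) simp
  have "g x = 0" if "x \<notin> \<Omega>" for x using LIMSEQ_unique[OF g[of x], of 0] f(3)[OF that] by simp
  then have "\<forall>x\<in>frontier \<Omega>. g x = 0" using \<Omega>(1) by (auto simp: frontier_def interior_open)
  then have u0: "u \<in> W1inf0 \<Omega>"
    unfolding W1inf0_def using u gu continuous_on_subset[OF lipschitz_on_continuous_on[OF gL]] by blast
  let ?G = "weak_gradient \<Omega> u"
  \<comment> \<open>The limit \<open>g\<close> is exchanged for the representative that comes with
    the one-sided gradient \<open>?G\<close>. It agrees with \<open>u\<close> almost everywhere on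
    \<Omega>, so uniform convergence to it can be derived directly from the L1 convergence.\<close>
  obtain w where w: "lip_grad \<Omega> w ?G" "AE x in lebesgue. x \<in> \<Omega> \<longrightarrow> w x = u x" "\<And>x. x \<notin> \<Omega> \<Longrightarrow> w x = 0"
    by (rule W1inf0_obtain_lip_grad[OF \<Omega>(1) u0]) blast
  obtain L1 where L1: "L1-lipschitz_on UNIV w" using w(1) by (auto simp: lip_grad_def)
  define L2 where "L2 = max L L1"
  have L2: "L2 > 0" "L2-lipschitz_on UNIV w" "\<And>k. L2-lipschitz_on UNIV (f k)"
    using L0 by (auto simp: L2_def intro: lipschitz_on_mono[OF L1] lipschitz_on_mono[OF f(4)])
  have Iw: "?I w = 0"
  proof -
    have "AE x in ?M. w x = u x" using w(2) \<Omega>(1) by (subst AE_lebesgue_on_iff) auto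
    then have "?I w = (\<integral>\<^sup>+x. 0 \<partial>?M)" by (intro nn_integral_cong_AE, rule eventually_mono) simp
    then show ?thesis by simp
  qed
  have unif: "\<forall>\<^sub>F k in sequentially. \<forall>y. norm (f k y - w y) \<le> s" if s: "s > 0" for s
  proof -
    have "s / 2 * (s / (2 * (L2 + L2) * CARD('d))) ^ CARD('d) > 0" using s L2(1) by simp
    then have "\<forall>\<^sub>F k in sequentially. ?I (f k) < ennreal (s / 2 * (s / (2 * (L2 + L2) * CARD('d))) ^ CARD('d))"
      by (intro order_tendstoD(2)[OF If0]) simp
    then show ?thesis
    proof (rule eventually_mono, intro allI less_imp_le)
      fix k y assume "?I (f k) < ennreal (s / 2 * (s / (2 * (L2 + L2) * CARD('d))) ^ CARD('d))"
      then show "norm (f k y - w y) < s"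
        using Iw by (intro sup_small_of_L1_close[OF \<Omega>(1) L2(3) L2(2) L2(1) f(3) w(3) um s]) simp_all
    qed
  qed
  define \<rho> where "\<rho> = (\<lambda>n. inverse (real (Suc n)))"
  have \<rho>: "\<And>n. \<rho> n > 0" "\<rho> \<longlonglongrightarrow> 0" using LIMSEQ_inverse_real_of_nat by (auto simp: \<rho>_def)
  define h where "h = (\<lambda>k y. W (y /\<^sub>R \<epsilon> k) (F k y) * indicator \<Omega> y)"
  have hm: "h k \<in> borel_measurable lebesgue" for k
    unfolding h_def by (rule measurable_energy_density[OF f(1) \<Omega>(1)])
  \<comment> \<open>Averages of the energy density over the cubes of side \<open>\<rho> n\<close>,
    as functions of the corner; their integral equals the energy for every \<open>n\<close>, so the
    bound \<open>c\<close> is uniform.\<close>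
  define A where "A = (\<lambda>n k x. ennreal (1 / \<rho> n ^ CARD('d)) * (\<integral>\<^sup>+y. h k y * indicator (box x (x + \<rho> n *\<^sub>R 1)) y \<partial>lebesgue))"
  have Am: "A n k \<in> borel_measurable lebesgue" for n k
    unfolding A_def using nn_integral_cube_averages(1)[OF hm \<rho>(1)]
    by (intro borel_measurable_times_ennreal borel_measurable_const measurable_completion) simp
  have Ac: "(\<integral>\<^sup>+x. A n k x \<partial>lebesgue) \<le> c" for n k
  proof -
    have "(\<integral>\<^sup>+x. A n k x \<partial>lebesgue) = ennreal (1 / \<rho> n ^ CARD('d)) * (ennreal (\<rho> n ^ CARD('d)) * (\<integral>\<^sup>+y. h k y \<partial>lebesgue))"
      unfolding A_def nn_integral_cube_averages(2)[OF hm \<rho>(1), symmetric]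
      by (rule nn_integral_cmult) (intro measurable_completion, use nn_integral_cube_averages(1)[OF hm \<rho>(1)] in simp)
    also have "\<dots> = ennreal (1 / \<rho> n ^ CARD('d) * \<rho> n ^ CARD('d)) * (\<integral>\<^sup>+y. h k y \<partial>lebesgue)"
      using \<rho>(1)[of n] by (subst ennreal_mult) (auto simp: mult.assoc)
    also have "\<dots> = J \<Omega> W (\<epsilon> k) (v (\<epsilon> k))" using \<rho>(1)[of n] by (simp add: Jk h_def)
    finally show ?thesis using \<epsilon>(4)[of k] by simp
  qed
  define B where "B = (\<lambda>n x. liminf (\<lambda>k. A n k x))"
  have Bm: "B n \<in> borel_measurable lebesgue" for n
    unfolding B_def by (rule borel_measurable_liminf) (rule Am)
  have Bc: "(\<integral>\<^sup>+x. B n x \<partial>lebesgue) \<le> c" for n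
  proof -
    have "(\<integral>\<^sup>+x. B n x \<partial>lebesgue) \<le> liminf (\<lambda>k. \<integral>\<^sup>+x. A n k x \<partial>lebesgue)"
      unfolding B_def by (rule nn_integral_liminf) (rule Am)
    also have "\<dots> \<le> limsup (\<lambda>k. \<integral>\<^sup>+x. A n k x \<partial>lebesgue)" by (rule Liminf_le_Limsup) simp
    also have "\<dots> \<le> c" by (rule Limsup_bounded) (simp add: Ac)
    finally show ?thesis .
  qed
  have "J_hom \<Omega> W u = (\<integral>\<^sup>+x. W_hom W (?G x) * indicator \<Omega> x \<partial>lebesgue)"
    using u0 nn_integral_lebesgue_on[OF \<Omega>(1)] by (simp add: J_hom_def)
  also have "\<dots> \<le> (\<integral>\<^sup>+x. liminf (\<lambda>n. B n x) \<partial>lebesgue)"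
  proof (rule nn_integral_mono_AE)
    show "AE x in lebesgue. W_hom W (?G x) * indicator \<Omega> x \<le> liminf (\<lambda>n. B n x)"
      using w(1)[unfolded lip_grad_def, THEN conjunct2]
    proof (rule eventually_mono)
      fix x assume *: "x \<in> \<Omega> \<longrightarrow> (w has_derivative (\<lambda>h. ?G x *v h)) (at x within {x..})"
      show "W_hom W (?G x) * indicator \<Omega> x \<le> liminf (\<lambda>n. B n x)"
      proof (cases "x \<in> \<Omega>")
        case True
        from pointwise_liminf[OF \<Omega>(1) True *[rule_format, OF True] f(1,5) unif \<epsilon>(1) \<epsilon>0 \<rho>] True
        show ?thesis by (simp add: B_def A_def h_def)
      qed simp
    qed
  qed
  also have "\<dots> \<le> liminf (\<lambda>n. \<integral>\<^sup>+x. B n x \<partial>lebesgue)" by (rule nn_integral_liminf) (rule Bm)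
  also have "\<dots> \<le> limsup (\<lambda>n. \<integral>\<^sup>+x. B n x \<partial>lebesgue)" by (rule Liminf_le_Limsup) simp
  also have "\<dots> \<le> c" by (rule Limsup_bounded) (simp add: Bc)
  finally show "J_hom \<Omega> W u \<le> c" .
qed

end

section \<open>The recovery sequence\<close>

lemma AE_off_grid:
  assumes n: "n > 0" shows "AE x::real^'d in lebesgue. \<forall>i. x $ i / n \<notin> \<int>"
proof -
  have "AE x::real^'d in lebesgue. x $ i \<noteq> c" for i c
  proof -
    have "negligible {x::real^'d. x \<bullet> axis i 1 = c}" by (rule negligible_standard_hyperplane) (simp add: axis_in_Basis_iff)
    then have "AE x::real^'d in lebesgue. x \<notin> {x. x \<bullet> axis i 1 = c}" by (intro AE_not_in) (simp add: negligible_iff_null_sets)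
    then show ?thesis by (rule eventually_mono) (simp add: inner_axis)
  qed
  then have "AE x::real^'d in lebesgue. \<forall>i. \<forall>k::int. x $ i \<noteq> n * of_int k"
    by (simp add: AE_all_countable)
  then show ?thesis proof (rule eventually_mono, intro allI notI)
    fix x :: "real^'d" and i assume *: "\<forall>i. \<forall>k::int. x $ i \<noteq> n * of_int k" and "x $ i / n \<in> \<int>"
    then obtain k where "x $ i / n = of_int k" by (auto elim: Ints_cases)
    then have "x $ i = n * of_int k" using n by (simp add: field_simps)
    with * show False by blast
  qed
qed

definition nat_vec :: "('d \<Rightarrow> nat) \<Rightarrow> real^'d" where
  "nat_vec k = (\<chi> i. real (k i))"

lemma cell_index_unique:
  assumes "n > 0" "x - n *\<^sub>R nat_vec k \<in> box 0 (n *\<^sub>R 1)" "x - n *\<^sub>R nat_vec l \<in> box 0 (n *\<^sub>R 1)"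
  shows "k = l"
proof
  fix i
  have "n * real (k i) < x $ i \<and> x $ i < n * real (k i) + n" "n * real (l i) < x $ i \<and> x $ i < n * real (l i) + n"
    using assms(2,3) by (auto simp: mem_box_cart nat_vec_def algebra_simps)
  then have "n * real (k i) < n * (real (l i) + 1)" "n * real (l i) < n * (real (k i) + 1)" by (auto simp: algebra_simps)
  then have "real (k i) < real (l i) + 1" "real (l i) < real (k i) + 1" using assms(1) by auto
  then show "k i = l i" by linarith
qed

context homogenization
begin

text \<open>A sum of translates of the cell function with disjoint supports: at a given point at
  most one summand is nonzero, so the sup norm is unchanged, and each cell has the same energy
  because the shifts are integer vectors. Written as a finite sum of zero extensions, the tiling
  gets its gradient by linearity; the faces between cells are a null set.\<close>

lemma tile:
  fixes f :: "real^'d \<Rightarrow> real^'m"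
  assumes n: "n \<ge> 1" and f: "lip_grad (box 0 (real n *\<^sub>R 1)) f G" and f0: "\<And>x. x \<notin> box 0 (real n *\<^sub>R 1) \<Longrightarrow> f x = 0"
    and R: "\<And>x. norm (f x) \<le> R"
  obtains f' G' where "lip_grad UNIV f' G'" "\<And>x. x \<notin> box 0 (real (N * n) *\<^sub>R 1) \<Longrightarrow> f' x = 0" "\<And>x. norm (f' x) \<le> R"
    "(\<integral>\<^sup>+x. W x (\<zeta> + G' x) * indicator (box 0 (real (N * n) *\<^sub>R 1)) x \<partial>lebesgue)
      \<le> ennreal (real N ^ CARD('d)) * (\<integral>\<^sup>+x. W x (\<zeta> + G x) * indicator (box 0 (real n *\<^sub>R 1)) x \<partial>lebesgue)"
proof -
  let ?B = "box 0 (real n *\<^sub>R 1) :: (real^'d) set" and ?B' = "box 0 (real (N * n) *\<^sub>R 1) :: (real^'d) set"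
  define K where "K = (PiE UNIV (\<lambda>_. {..<N}) :: ('d \<Rightarrow> nat) set)"
  have K: "finite K" "card K = N ^ CARD('d)" by (auto simp: K_def card_PiE intro: finite_PiE)
  have n0: "real n > 0" using n by simp
  define H where "H = (\<lambda>x. indicator ?B x *\<^sub>R G x)"
  have fH: "lip_grad UNIV f H"
    unfolding H_def by (rule lip_grad_zero_extension[OF f open_box _ f0]) (auto intro: negligible_convex_frontier)
  define f' where "f' = (\<lambda>x. \<Sum>k\<in>K. f (x - real n *\<^sub>R nat_vec k))"
  define G' where "G' = (\<lambda>x. \<Sum>k\<in>K. H (x - real n *\<^sub>R nat_vec k))"
  have lg: "lip_grad UNIV f' G'"
    unfolding f'_def G'_def
  proof (rule lip_grad_sum[OF K(1)])
    show "lip_grad UNIV (\<lambda>x. f (x - real n *\<^sub>R nat_vec k)) (\<lambda>x. H (x - real n *\<^sub>R nat_vec k))" for k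
      using lip_grad_rescale[OF fH, of 1 UNIV "real n *\<^sub>R nat_vec k" 1] by simp
  qed
  have single: "f' x = f (x - real n *\<^sub>R nat_vec k) \<and> G' x = H (x - real n *\<^sub>R nat_vec k)"
    if k: "k \<in> K" "x - real n *\<^sub>R nat_vec k \<in> ?B" for x k
  proof -
    have out: "x - real n *\<^sub>R nat_vec l \<notin> ?B" if "l \<noteq> k" for l
      using cell_index_unique[OF n0 k(2), of l] that by blast
    have "f' x = (\<Sum>l\<in>{k}. f (x - real n *\<^sub>R nat_vec l))"
      unfolding f'_def using K(1) k(1) out f0 by (intro sum.mono_neutral_right) auto
    moreover have "G' x = (\<Sum>l\<in>{k}. H (x - real n *\<^sub>R nat_vec l))"
      unfolding G'_def using K(1) k(1) out by (intro sum.mono_neutral_right) (auto simp: H_def)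
    ultimately show ?thesis by simp
  qed
  have none: "f' x = 0" if "\<And>k. k \<in> K \<Longrightarrow> x - real n *\<^sub>R nat_vec k \<notin> ?B" for x
    unfolding f'_def using that f0 by (intro sum.neutral) blast
  have f'0: "f' x = 0" if x: "x \<notin> ?B'" for x
  proof (rule none, rule notI)
    fix k assume k: "k \<in> K" "x - real n *\<^sub>R nat_vec k \<in> ?B"
    have "0 < x $ i \<and> x $ i < real (N * n)" for i
    proof -
      have 1: "real n * real (k i) < x $ i" "x $ i < real n * real (k i) + real n"
        using k(2) by (auto simp: mem_box_cart nat_vec_def algebra_simps)
      have "k i + 1 \<le> N" using k(1) by (auto simp: K_def PiE_iff Suc_le_eq)
      then have "n * (k i + 1) \<le> n * N" by (rule mult_left_mono) simp
      then have "real n * real (k i) + real n \<le> real (N * n)"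
        unfolding of_nat_mult[symmetric] of_nat_add[symmetric] of_nat_le_iff by (simp add: algebra_simps)
      moreover have "0 \<le> real n * real (k i)" by simp
      ultimately show ?thesis using 1 by linarith
    qed
    then have "x \<in> ?B'" by (simp add: mem_box_cart)
    with x show False ..
  qed
  have nf': "norm (f' x) \<le> R" for x
  proof (cases "\<exists>k\<in>K. x - real n *\<^sub>R nat_vec k \<in> ?B")
    case True then show ?thesis using single R by fastforce
  next
    case False
    then have "f' x = 0" using none by blast
    then show ?thesis using order_trans[OF norm_ge_zero R] by simp
  qed
  define h where "h = (\<lambda>y. W y (\<zeta> + G y) * indicator ?B y)"
  have hm: "h \<in> borel_measurable lebesgue"
    unfolding h_def
    using measurable_integrand_indicator[OF W_measurable continuous_on_id lip_grad_measurable[OF f open_box], of \<zeta> 1] by simp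
  have hk: "(\<lambda>x. h (x - real n *\<^sub>R nat_vec k)) \<in> borel_measurable lebesgue"
    "(\<integral>\<^sup>+x. h (x - real n *\<^sub>R nat_vec k) \<partial>lebesgue) = (\<integral>\<^sup>+x. h x \<partial>lebesgue)" for k
    using measurable_compose[OF measurable_affine_lebesgue[of 1 "- real n *\<^sub>R nat_vec k"] hm]
      nn_integral_affine_lebesgue[OF hm, of 1 "- real n *\<^sub>R nat_vec k"] by (simp_all add: algebra_simps)
  have "(\<integral>\<^sup>+x. W x (\<zeta> + G' x) * indicator ?B' x \<partial>lebesgue) \<le> (\<integral>\<^sup>+x. (\<Sum>k\<in>K. h (x - real n *\<^sub>R nat_vec k)) \<partial>lebesgue)"
  proof (rule nn_integral_mono_AE)
    show "AE x in lebesgue. W x (\<zeta> + G' x) * indicator ?B' x \<le> (\<Sum>k\<in>K. h (x - real n *\<^sub>R nat_vec k))"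
      using AE_off_grid[OF n0]
    proof (rule eventually_mono)
      fix x :: "real^'d" assume off: "\<forall>i. x $ i / real n \<notin> \<int>"
      show "W x (\<zeta> + G' x) * indicator ?B' x \<le> (\<Sum>k\<in>K. h (x - real n *\<^sub>R nat_vec k))"
      proof (cases "x \<in> ?B'")
        case True
        \<comment> \<open>The index of the cell that contains \<open>x\<close>. Off the grid both
          bounds are strict, so \<open>x\<close> lies in the open cell.\<close>
        define k where "k = (\<lambda>i. nat \<lfloor>x $ i / real n\<rfloor>)"
        have x: "0 < x $ i" "x $ i < real N * real n" for i using True by (auto simp: mem_box_cart)
        have fl: "real (k i) = of_int \<lfloor>x $ i / real n\<rfloor>" for i using x(1)[of i] n0 by (simp add: k_def)
        have lt: "real (k i) < x $ i / real n" "x $ i / real n < real (k i) + 1" for i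
        proof -
          have "of_int \<lfloor>x $ i / real n\<rfloor> \<noteq> x $ i / real n" using off Ints_of_int by metis
          then show "real (k i) < x $ i / real n" unfolding fl using of_int_floor_le[of "x $ i / real n"] by linarith
          show "x $ i / real n < real (k i) + 1" unfolding fl by linarith
        qed
        have "k \<in> K"
        proof -
          have "real (k i) < real N" for i
          proof -
            have "real (k i) * real n < x $ i" using lt(1)[of i] n0 by (simp only: pos_less_divide_eq)
            then have "real (k i) * real n < real N * real n" using x(2)[of i] by linarith
            then show ?thesis using n0 by simp
          qed
          then show ?thesis by (auto simp: K_def)
        qed
        moreover have "x - real n *\<^sub>R nat_vec k \<in> ?B"
        proof -
          have "real n * real (k i) < x $ i \<and> x $ i < real n * real (k i) + real n" for i
            using lt(1)[of i] lt(2)[of i] n0 unfolding pos_less_divide_eq[OF n0] pos_divide_less_eq[OF n0] by (simp add: algebra_simps)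
          then show ?thesis by (simp add: mem_box_cart nat_vec_def algebra_simps)
        qed
        ultimately have k: "k \<in> K" "x - real n *\<^sub>R nat_vec k \<in> ?B" by auto
        have "W x (\<zeta> + G' x) = W (x - real n *\<^sub>R nat_vec k) (\<zeta> + G (x - real n *\<^sub>R nat_vec k))"
          using W_plus_integer[of "real n *\<^sub>R nat_vec k" "x - real n *\<^sub>R nat_vec k"] single[OF k] k(2)
          by (simp add: nat_vec_def H_def)
        also have "\<dots> = h (x - real n *\<^sub>R nat_vec k)" using k(2) by (simp add: h_def)
        also have "\<dots> \<le> (\<Sum>k\<in>K. h (x - real n *\<^sub>R nat_vec k))" by (rule member_le_sum[OF k(1) _ K(1)]) simp
        finally show ?thesis using True by simp
      qed simp
    qed
  qed
  also have "\<dots> = (\<Sum>k\<in>K. \<integral>\<^sup>+x. h x \<partial>lebesgue)" by (subst nn_integral_sum) (simp_all add: hk)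
  also have "\<dots> = ennreal (real N ^ CARD('d)) * (\<integral>\<^sup>+x. h x \<partial>lebesgue)"
    using K(2) by (simp add: ennreal_of_nat_eq_real_of_nat)
  finally show ?thesis using that[OF lg f'0 nf'] unfolding h_def by blast
qed

text \<open>Counterpart of the cube estimate for the lower bound. There a competitor is bent into an
  affine function near the boundary of the cube; here \<open>u\<close> is bent into an affine
  function in the core, where a tiling by a rescaled cell function is added. The correction
  \<open>w\<close> vanishes off the cube, so that corrections on disjoint cubes can be
  superposed.\<close>

lemma local_recovery:
  fixes \<psi> :: "real^'d \<Rightarrow> real" and g :: "real^'d \<Rightarrow> real^'d" and u :: "real^'d \<Rightarrow> real^'m"
  assumes t: "0 < t" "t < 1"
    and rad: "\<And>x \<xi>. \<xi> \<in> eff_dom (W x) \<Longrightarrow> W x (t *\<^sub>R \<xi>) \<le> W x \<xi> + ennreal \<delta>" and \<delta>: "\<delta> \<ge> 0"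
    and M: "M \<ge> 0" and r: "r > 0"
    and MW: "AE x in lebesgue. \<forall>p q. p \<in> closure C \<longrightarrow> norm q \<le> r \<longrightarrow> W x (t *\<^sub>R p + q) \<le> ennreal M"
    and \<kappa>: "0 < \<kappa>" "\<kappa> < 1/2"
    and \<psi>: "\<And>x. (\<psi> has_derivative (\<lambda>h. h \<bullet> g x)) (at x)" "\<And>x. 0 \<le> \<psi> x" "\<And>x. \<psi> x \<le> 1"
      "\<And>x. x \<notin> box 0 1 \<Longrightarrow> \<psi> x = 0" "\<And>x. x \<in> cbox (\<kappa> *\<^sub>R 1) ((1 - \<kappa>) *\<^sub>R 1) \<Longrightarrow> \<psi> x = 1"
      "\<Lambda> \<ge> 0" "\<And>x. norm (g x) \<le> \<Lambda>" "\<And>x y. \<bar>\<psi> x - \<psi> y\<bar> \<le> \<Lambda> * norm (x - y)"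
    and u: "lip_grad (box a (a + \<rho> *\<^sub>R 1)) u U" and \<rho>: "\<rho> > 0"
    and UC: "AE y in lebesgue. y \<in> box a (a + \<rho> *\<^sub>R 1) \<longrightarrow> U y \<in> closure C" and \<zeta>: "\<zeta> \<in> closure C"
    and near: "\<And>y. y \<in> box a (a + \<rho> *\<^sub>R 1) \<Longrightarrow> norm (u y - (c + \<zeta> *v (y - a))) \<le> \<sigma> * \<rho>" and \<sigma>: "t * (\<sigma> * \<Lambda>) \<le> r" "\<sigma> \<ge> 0"
    and n: "n \<ge> 1" and f: "lip_grad (box 0 (real n *\<^sub>R 1)) f G" and f0: "\<And>x. x \<notin> box 0 (real n *\<^sub>R 1) \<Longrightarrow> f x = 0"
    and R: "\<And>x. norm (f x) \<le> R" and e: "e \<ge> 0"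
    and energy: "(\<integral>\<^sup>+x. W x (\<zeta> + G x) * indicator (box 0 (real n *\<^sub>R 1)) x \<partial>lebesgue) \<le> ennreal (real n ^ CARD('d) * e)"
    and \<epsilon>: "\<epsilon> > 0" "2 * \<epsilon> * real n \<le> (1 - 2 * \<kappa>) * \<rho>"
  shows "\<exists>w V. lip_grad (box a (a + \<rho> *\<^sub>R 1)) w V \<and> (\<forall>y. y \<notin> box a (a + \<rho> *\<^sub>R 1) \<longrightarrow> w y = 0) \<and>
     (\<forall>y. norm (w y) \<le> \<sigma> * \<rho> + \<epsilon> * R) \<and>
     (\<integral>\<^sup>+y. W (y /\<^sub>R \<epsilon>) (t *\<^sub>R (U y + V y)) * indicator (box a (a + \<rho> *\<^sub>R 1)) y \<partial>lebesgue) \<le>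
       ennreal ((e + \<delta>) * \<rho> ^ CARD('d) + M * (\<rho> ^ CARD('d) - ((1 - 2 * \<kappa>) * \<rho> - 2 * \<epsilon> * real n) ^ CARD('d)))"
proof -
  let ?Q = "box a (a + \<rho> *\<^sub>R 1) :: (real^'d) set"
  let ?E = "box (a + (\<rho> * \<kappa>) *\<^sub>R 1) (a + (\<rho> * (1 - \<kappa>)) *\<^sub>R 1) :: (real^'d) set"
  let ?s = "\<lambda>y. (y - a) /\<^sub>R \<rho>"
  \<comment> \<open>Rounding the lower corner of the core up to the \<epsilon>-lattice loses less
    than \<epsilon>, hence the \<open>- \<epsilon>\<close> in \<open>N\<close>; taking a whole
    number of blocks of side \<open>\<epsilon> * real n\<close> loses less than one block. As
    \<open>\<epsilon> \<le> \<epsilon> * real n\<close>, at most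
    \<open>2 * \<epsilon> * real n\<close> of the side is lost.\<close>
  define z :: "real^'d" where "z = (\<chi> i. of_int \<lceil>(a $ i + \<rho> * \<kappa>) / \<epsilon>\<rceil>)"
  define N where "N = nat \<lfloor>((1 - 2 * \<kappa>) * \<rho> - \<epsilon>) / (\<epsilon> * real n)\<rfloor>"
  define T where "T = \<epsilon> * real (N * n)"
  have \<epsilon>n: "\<epsilon> * real n > 0" "\<epsilon> \<le> \<epsilon> * real n" using \<epsilon>(1) n by auto
  have q: "0 \<le> ((1 - 2 * \<kappa>) * \<rho> - \<epsilon>) / (\<epsilon> * real n)" using \<epsilon>(2) \<epsilon>n by (intro divide_nonneg_pos) auto
  have NT: "real N \<le> ((1 - 2 * \<kappa>) * \<rho> - \<epsilon>) / (\<epsilon> * real n)" "((1 - 2 * \<kappa>) * \<rho> - \<epsilon>) / (\<epsilon> * real n) < real N + 1"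
    using q unfolding N_def by (simp_all add: of_nat_nat)
  have T: "T \<le> (1 - 2 * \<kappa>) * \<rho> - \<epsilon>" "(1 - 2 * \<kappa>) * \<rho> - 2 * \<epsilon> * real n \<le> T" "0 \<le> T"
  proof -
    show "T \<le> (1 - 2 * \<kappa>) * \<rho> - \<epsilon>" using NT(1) \<epsilon>n(1) by (simp add: T_def pos_le_divide_eq mult_ac)
    have "(1 - 2 * \<kappa>) * \<rho> - \<epsilon> < (real N + 1) * (\<epsilon> * real n)" using NT(2) \<epsilon>n(1) by (simp add: pos_divide_less_eq)
    also have "\<dots> = T + \<epsilon> * real n" by (simp add: T_def algebra_simps)
    finally show "(1 - 2 * \<kappa>) * \<rho> - 2 * \<epsilon> * real n \<le> T" using \<epsilon>n by linarith
    show "0 \<le> T" using \<epsilon> by (simp add: T_def)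
  qed
  let ?D = "box (\<epsilon> *\<^sub>R z) (\<epsilon> *\<^sub>R z + T *\<^sub>R 1) :: (real^'d) set" and ?B = "box 0 (real (N * n) *\<^sub>R 1) :: (real^'d) set"
  have DE: "?D \<subseteq> ?E"
  proof
    fix y assume y: "y \<in> ?D"
    have "a $ i + \<rho> * \<kappa> < y $ i \<and> y $ i < a $ i + \<rho> * (1 - \<kappa>)" for i
    proof -
      have "\<epsilon> * z $ i < a $ i + \<rho> * \<kappa> + \<epsilon>" "a $ i + \<rho> * \<kappa> \<le> \<epsilon> * z $ i"
        using ceiling_divide_lower[OF \<epsilon>(1), of "a $ i + \<rho> * \<kappa>"] ceiling_divide_upper[OF \<epsilon>(1), of "a $ i + \<rho> * \<kappa>"]
        by (auto simp: z_def algebra_simps)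
      moreover have "\<epsilon> * z $ i < y $ i" "y $ i < \<epsilon> * z $ i + T" using y by (auto simp: mem_box_cart)
      moreover have "\<rho> * (1 - \<kappa>) = \<rho> * \<kappa> + (1 - 2 * \<kappa>) * \<rho>" by (simp add: algebra_simps)
      ultimately show ?thesis using T(1) by linarith
    qed
    then show "y \<in> ?E" by (simp add: mem_box_cart)
  qed
  have EQ: "?E \<subseteq> ?Q" using \<rho> \<kappa> by (intro inner_box_subset) auto
  have DQ: "?D \<subseteq> ?Q" using DE EQ by blast
  obtain f' G' where f': "lip_grad UNIV f' G'" "\<And>x. x \<notin> ?B \<Longrightarrow> f' x = 0" "\<And>x. norm (f' x) \<le> R"
    and energy': "(\<integral>\<^sup>+x. W x (\<zeta> + G' x) * indicator ?B x \<partial>lebesgue)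
      \<le> ennreal (real N ^ CARD('d)) * (\<integral>\<^sup>+x. W x (\<zeta> + G x) * indicator (box 0 (real n *\<^sub>R 1)) x \<partial>lebesgue)"
    by (rule tile[where N=N and \<zeta>=\<zeta>, OF n f f0 R]) blast+
  \<comment> \<open>The sign is opposite to that in the lower bound: adding \<open>k\<close> to
    \<open>u\<close> produces the affine function.\<close>
  define k where "k = (\<lambda>y. (c + \<zeta> *v (y - a)) - u y)"
  have k: "lip_grad ?Q k (\<lambda>y. \<zeta> - U y)" unfolding k_def by (intro lip_grad_diff u lip_grad_affine)
  define H where "H = (\<lambda>y. \<psi> (?s y) *\<^sub>R (\<zeta> - U y) + (1 / \<rho>) *\<^sub>R outer (k y) (g (?s y)))"
  have w1: "lip_grad ?Q (\<lambda>y. \<psi> (?s y) *\<^sub>R k y) H"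
    unfolding H_def by (rule lip_grad_cutoff[OF k \<rho> \<psi>(1-4,6,8)])
  have B_iff: "(y - \<epsilon> *\<^sub>R z) /\<^sub>R \<epsilon> \<in> ?B \<longleftrightarrow> y \<in> ?D" for y
    using rescale_mem_box[OF \<epsilon>(1), of y "\<epsilon> *\<^sub>R z" 0 "real (N * n)"] by (simp add: T_def)
  define H2 where "H2 = (\<lambda>y. indicator ?D y *\<^sub>R G' ((y - \<epsilon> *\<^sub>R z) /\<^sub>R \<epsilon>))"
  have w2: "lip_grad ?Q (\<lambda>y. \<epsilon> *\<^sub>R f' ((y - \<epsilon> *\<^sub>R z) /\<^sub>R \<epsilon>)) H2"
  proof -
    have "lip_grad ?D (\<lambda>y. \<epsilon> *\<^sub>R f' ((y - \<epsilon> *\<^sub>R z) /\<^sub>R \<epsilon>)) (\<lambda>y. (\<epsilon> / \<epsilon>) *\<^sub>R G' ((y - \<epsilon> *\<^sub>R z) /\<^sub>R \<epsilon>))"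
      by (rule lip_grad_rescale[OF f'(1) \<epsilon>(1)]) simp
    then have "lip_grad ?D (\<lambda>y. \<epsilon> *\<^sub>R f' ((y - \<epsilon> *\<^sub>R z) /\<^sub>R \<epsilon>)) (\<lambda>y. G' ((y - \<epsilon> *\<^sub>R z) /\<^sub>R \<epsilon>))" using \<epsilon>(1) by simp
    moreover have "negligible (frontier ?D)" by (intro negligible_convex_frontier convex_box)
    moreover have "\<epsilon> *\<^sub>R f' ((y - \<epsilon> *\<^sub>R z) /\<^sub>R \<epsilon>) = 0" if "y \<notin> ?D" for y
      using f'(2)[of "(y - \<epsilon> *\<^sub>R z) /\<^sub>R \<epsilon>"] B_iff[of y] that by simp
    ultimately have "lip_grad UNIV (\<lambda>y. \<epsilon> *\<^sub>R f' ((y - \<epsilon> *\<^sub>R z) /\<^sub>R \<epsilon>)) H2"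
      unfolding H2_def by (intro lip_grad_zero_extension open_box)
    then show ?thesis by (rule lip_grad_subset) simp
  qed
  define w where "w = (\<lambda>y. \<psi> (?s y) *\<^sub>R k y + \<epsilon> *\<^sub>R f' ((y - \<epsilon> *\<^sub>R z) /\<^sub>R \<epsilon>))"
  define V where "V = (\<lambda>y. H y + H2 y)"
  have w: "lip_grad ?Q w V" unfolding w_def V_def by (rule lip_grad_add[OF w1 w2])
  have \<psi>0: "\<psi> (?s y) = 0" if "y \<notin> ?Q" for y
    using \<psi>(4)[of "?s y"] rescale_mem_box[OF \<rho>, of y a 0 1] that by simp
  have w0: "w y = 0" if "y \<notin> ?Q" for y
    using \<psi>0[OF that] f'(2)[of "(y - \<epsilon> *\<^sub>R z) /\<^sub>R \<epsilon>"] B_iff[of y] DQ that by (auto simp: w_def simp del: mem_box)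
  have wb: "norm (w y) \<le> \<sigma> * \<rho> + \<epsilon> * R" for y
  proof -
    have "norm (\<psi> (?s y) *\<^sub>R k y) \<le> \<sigma> * \<rho>"
    proof (cases "y \<in> ?Q")
      case True
      have "\<psi> (?s y) * norm (k y) \<le> 1 * (\<sigma> * \<rho>)"
        using near[OF True] \<psi>(2,3)[of "?s y"] by (intro mult_mono) (auto simp: k_def norm_minus_commute)
      then show ?thesis using \<psi>(2)[of "?s y"] by simp
    next
      case False then show ?thesis using \<psi>0 \<sigma>(2) \<rho> by simp
    qed
    moreover have "norm (\<epsilon> *\<^sub>R f' ((y - \<epsilon> *\<^sub>R z) /\<^sub>R \<epsilon>)) \<le> \<epsilon> * R" using f'(3) \<epsilon>(1) by simp
    ultimately show ?thesis unfolding w_def by (rule norm_triangle_mono)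
  qed
  define P where "P = (\<lambda>y. W ((y - \<epsilon> *\<^sub>R z) /\<^sub>R \<epsilon>) (\<zeta> + G' ((y - \<epsilon> *\<^sub>R z) /\<^sub>R \<epsilon>)) * indicator ?D y)"
  have Pm: "P \<in> borel_measurable lebesgue"
    and PI: "(\<integral>\<^sup>+y. P y \<partial>lebesgue) \<le> ennreal (e * \<rho> ^ CARD('d))"
  proof -
    define h where "h = (\<lambda>x. W x (\<zeta> + G' x) * indicator ?B x)"
    have hm: "h \<in> borel_measurable lebesgue"
      unfolding h_def
      using measurable_integrand_indicator[OF W_measurable continuous_on_id lip_grad_measurable[OF lip_grad_subset[OF f'(1) subset_UNIV[of ?B]] open_box], of \<zeta> 1] by simp
    have Ph: "P y = h ((y - \<epsilon> *\<^sub>R z) /\<^sub>R \<epsilon>)" for y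
      using B_iff[of y] by (simp add: P_def h_def indicator_def del: mem_box)
    have shift: "(\<lambda>y. (y - \<epsilon> *\<^sub>R z) /\<^sub>R \<epsilon>) = (\<lambda>y. - z + (1 / \<epsilon>) *\<^sub>R y)" using \<epsilon>(1) by (auto simp: fun_eq_iff algebra_simps divide_inverse)
    show Pm: "P \<in> borel_measurable lebesgue"
      unfolding Ph[abs_def] using measurable_compose[OF measurable_affine_lebesgue[of "1 / \<epsilon>" "- z"] hm] \<epsilon>(1) shift
      by (simp add: fun_eq_iff)
    have "(\<integral>\<^sup>+y. P y \<partial>lebesgue) = ennreal (\<epsilon> ^ CARD('d)) * (\<integral>\<^sup>+x. P (\<epsilon> *\<^sub>R z + \<epsilon> *\<^sub>R x) \<partial>lebesgue)"
      by (rule nn_integral_affine_lebesgue[OF Pm \<epsilon>(1)])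
    also have "(\<lambda>x. P (\<epsilon> *\<^sub>R z + \<epsilon> *\<^sub>R x)) = h" using \<epsilon>(1) by (simp add: Ph fun_eq_iff)
    also have "ennreal (\<epsilon> ^ CARD('d)) * (\<integral>\<^sup>+x. h x \<partial>lebesgue) \<le>
       ennreal (\<epsilon> ^ CARD('d)) * (ennreal (real N ^ CARD('d)) * ennreal (real n ^ CARD('d) * e))"
      unfolding h_def by (intro mult_left_mono order_trans[OF energy'] energy) auto
    also have "\<dots> = ennreal (e * T ^ CARD('d))"
      using \<epsilon>(1) e by (simp add: ennreal_mult[symmetric] T_def power_mult_distrib mult_ac)
    also have "\<dots> \<le> ennreal (e * \<rho> ^ CARD('d))"
    proof (intro ennreal_leI mult_left_mono power_mono)
      have "(1 - 2 * \<kappa>) * \<rho> \<le> 1 * \<rho>" using \<kappa> \<rho> by (intro mult_right_mono) auto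
      then show "T \<le> \<rho>" using T(1) \<epsilon>(1) by linarith
    qed (use T e in auto)
    finally show "(\<integral>\<^sup>+y. P y \<partial>lebesgue) \<le> ennreal (e * \<rho> ^ CARD('d))" .
  qed
  have zint: "z $ i \<in> \<int>" for i by (simp add: z_def)
  have "(\<integral>\<^sup>+y. W (y /\<^sub>R \<epsilon>) (t *\<^sub>R (U y + V y)) * indicator ?Q y \<partial>lebesgue) \<le>
     (\<integral>\<^sup>+y. (P y + ennreal \<delta> * indicator ?Q y) + ennreal M * indicator (?Q - ?D) y \<partial>lebesgue)"
  proof (rule nn_integral_mono_AE)
    show "AE y in lebesgue. W (y /\<^sub>R \<epsilon>) (t *\<^sub>R (U y + V y)) * indicator ?Q y \<le> (P y + ennreal \<delta> * indicator ?Q y) + ennreal M * indicator (?Q - ?D) y"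
      using AE_scaled[OF MW \<epsilon>(1)] UC
    proof eventually_elim
      case (elim y)
      have bd: "W (y /\<^sub>R \<epsilon>) (t *\<^sub>R p + q) \<le> ennreal M" if "p \<in> closure C" "norm q \<le> r" for p q
        using elim(1) that by blast
      \<comment> \<open>On \<open>?D\<close> the unscaled gradient is \<open>\<zeta>\<close> plus
        that of the tiling, whose energy is known, and the radial condition admits the factor
        \<open>t\<close>. Elsewhere in \<open>?Q\<close> the scaled gradient is \<open>t\<close>
        times a convex combination of \<open>U y\<close> and \<open>\<zeta>\<close> plus a small
        rank-one term, so the bound \<open>M\<close> applies.\<close>
      consider "y \<in> ?D" | "y \<in> ?Q" "y \<notin> ?D" | "y \<notin> ?Q" by blast
      then show ?case
      proof cases
        case 1
        then have yQ: "y \<in> ?Q" and yE: "y \<in> ?E" using DQ DE by auto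
        have sy: "?s y \<in> box (\<kappa> *\<^sub>R 1) ((1 - \<kappa>) *\<^sub>R 1)" using yE rescale_mem_box[OF \<rho>, of y a \<kappa> "1 - \<kappa>"] by simp
        then have "\<psi> (?s y) = 1" using \<psi>(5) box_subset_cbox by blast
        moreover have "g (?s y) = 0" by (rule cutoff_gradient_core[OF \<psi>(1,5) sy])
        ultimately have "H y = \<zeta> - U y" by (simp add: H_def outer_def vec_eq_iff)
        then have e1: "U y + V y = \<zeta> + G' ((y - \<epsilon> *\<^sub>R z) /\<^sub>R \<epsilon>)" using 1 by (simp add: V_def H2_def del: mem_box)
        have sh: "(y - \<epsilon> *\<^sub>R z) /\<^sub>R \<epsilon> + z = y /\<^sub>R \<epsilon>" using \<epsilon>(1) by (simp add: algebra_simps)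
        have "W (y /\<^sub>R \<epsilon>) (U y + V y) = P y"
          unfolding P_def e1 sh[symmetric] using W_plus_integer[OF zint] 1 by (simp del: mem_box)
        moreover have "W (y /\<^sub>R \<epsilon>) (t *\<^sub>R (U y + V y)) \<le> W (y /\<^sub>R \<epsilon>) (U y + V y) + ennreal \<delta>"
        proof (cases "U y + V y \<in> eff_dom (W (y /\<^sub>R \<epsilon>))")
          case True then show ?thesis by (rule rad)
        next
          case False then show ?thesis by (simp add: eff_dom_def not_less top_unique)
        qed
        ultimately show ?thesis using 1 yQ by simp
      next
        case 2
        let ?p = "(1 - \<psi> (?s y)) *\<^sub>R U y + \<psi> (?s y) *\<^sub>R \<zeta>" and ?q = "(t / \<rho>) *\<^sub>R outer (k y) (g (?s y))"
        have "?p \<in> closure C"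
          using elim(2) 2 \<zeta> \<psi>(2,3)[of "?s y"] by (intro convexD[OF convex_closure_C]) auto
        moreover have "norm ?q \<le> r"
        proof -
          have "norm (k y) * norm (g (?s y)) \<le> (\<sigma> * \<rho>) * \<Lambda>"
            using near[OF 2(1)] \<psi>(7) \<sigma>(2) \<rho> by (intro mult_mono) (auto simp: k_def norm_minus_commute)
          then have "t / \<rho> * (norm (k y) * norm (g (?s y))) \<le> t / \<rho> * ((\<sigma> * \<rho>) * \<Lambda>)"
            using t \<rho> by (intro mult_left_mono) auto
          also have "\<dots> = t * (\<sigma> * \<Lambda>)" using \<rho> by simp
          finally show ?thesis using \<sigma>(1) t \<rho> by (simp add: norm_outer)
        qed
        moreover have "t *\<^sub>R (U y + V y) = t *\<^sub>R ?p + ?q"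
          using 2 by (simp add: V_def H2_def H_def algebra_simps)
        ultimately have "W (y /\<^sub>R \<epsilon>) (t *\<^sub>R (U y + V y)) \<le> ennreal M" using bd by metis
        then show ?thesis using 2 by (simp add: add_increasing)
      next
        case 3 then show ?thesis by simp
      qed
    qed
  qed
  also have "\<dots> = ((\<integral>\<^sup>+y. P y \<partial>lebesgue) + ennreal \<delta> * emeasure lebesgue ?Q) + ennreal M * emeasure lebesgue (?Q - ?D)"
  proof -
    have m2: "(indicator ?Q :: _ \<Rightarrow> ennreal) \<in> borel_measurable lebesgue" by (rule borel_measurable_indicator) simp
    have m3: "(indicator (?Q - ?D) :: _ \<Rightarrow> ennreal) \<in> borel_measurable lebesgue" by (rule borel_measurable_indicator) simp
    have c1: "(\<integral>\<^sup>+y. ennreal \<delta> * indicator ?Q y \<partial>lebesgue) = ennreal \<delta> * emeasure lebesgue ?Q"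
      by (rule nn_integral_cmult_indicator) simp
    have c2: "(\<integral>\<^sup>+y. ennreal M * indicator (?Q - ?D) y \<partial>lebesgue) = ennreal M * emeasure lebesgue (?Q - ?D)"
      by (rule nn_integral_cmult_indicator) simp
    have "(\<integral>\<^sup>+y. P y + ennreal \<delta> * indicator ?Q y \<partial>lebesgue) = (\<integral>\<^sup>+y. P y \<partial>lebesgue) + ennreal \<delta> * emeasure lebesgue ?Q"
      by (subst nn_integral_add[OF Pm]) (auto simp only: c1 intro!: borel_measurable_times_ennreal m2 borel_measurable_const)
    then show ?thesis
      by (subst nn_integral_add) (auto simp only: c2 intro!: borel_measurable_add borel_measurable_times_ennreal Pm m2 m3 borel_measurable_const)
  qed
  also have "emeasure lebesgue (?Q - ?D) = ennreal (\<rho> ^ CARD('d) - T ^ CARD('d))"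
  proof -
    have "emeasure lebesgue ?D = ennreal (T ^ CARD('d))" using T by (intro measure_cube) auto
    moreover have "emeasure lebesgue ?Q = ennreal (\<rho> ^ CARD('d))" using \<rho> by (intro measure_cube) auto
    moreover have "emeasure lebesgue (?Q - ?D) = emeasure lebesgue ?Q - emeasure lebesgue ?D"
      using DQ calculation by (intro emeasure_Diff) auto
    ultimately show ?thesis using T by (simp add: ennreal_minus)
  qed
  also have "emeasure lebesgue ?Q = ennreal (\<rho> ^ CARD('d))" using \<rho> by (intro measure_cube) auto
  also have "(\<integral>\<^sup>+y. P y \<partial>lebesgue) + ennreal \<delta> * ennreal (\<rho> ^ CARD('d)) + ennreal M * ennreal (\<rho> ^ CARD('d) - T ^ CARD('d))
    \<le> ennreal (e * \<rho> ^ CARD('d)) + ennreal (\<delta> * \<rho> ^ CARD('d)) + ennreal (M * (\<rho> ^ CARD('d) - ((1 - 2 * \<kappa>) * \<rho> - 2 * \<epsilon> * real n) ^ CARD('d)))"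
  proof (intro add_mono PI)
    show "ennreal \<delta> * ennreal (\<rho> ^ CARD('d)) \<le> ennreal (\<delta> * \<rho> ^ CARD('d))" using \<delta> \<rho> by (simp add: ennreal_mult)
    have "((1 - 2 * \<kappa>) * \<rho> - 2 * \<epsilon> * real n) ^ CARD('d) \<le> T ^ CARD('d)"
      using T(2) \<epsilon>(2) by (intro power_mono) auto
    then show "ennreal M * ennreal (\<rho> ^ CARD('d) - T ^ CARD('d)) \<le> ennreal (M * (\<rho> ^ CARD('d) - ((1 - 2 * \<kappa>) * \<rho> - 2 * \<epsilon> * real n) ^ CARD('d)))"
      using M by (subst ennreal_mult'[symmetric]) (auto intro!: ennreal_leI mult_left_mono)
  qed
  also have "\<dots> = ennreal ((e + \<delta>) * \<rho> ^ CARD('d) + M * (\<rho> ^ CARD('d) - ((1 - 2 * \<kappa>) * \<rho> - 2 * \<epsilon> * real n) ^ CARD('d)))"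
  proof -
    have "((1 - 2 * \<kappa>) * \<rho> - 2 * \<epsilon> * real n) ^ CARD('d) \<le> \<rho> ^ CARD('d)"
    proof (rule power_mono)
      have "(1 - 2 * \<kappa>) * \<rho> \<le> 1 * \<rho>" using \<kappa> \<rho> by (intro mult_right_mono) auto
      moreover have "0 \<le> 2 * \<epsilon> * real n" using \<epsilon>(1) by simp
      ultimately show "(1 - 2 * \<kappa>) * \<rho> - 2 * \<epsilon> * real n \<le> \<rho>" by linarith
    qed (use \<epsilon>(2) in simp)
    then have nn: "0 \<le> M * (\<rho> ^ CARD('d) - ((1 - 2 * \<kappa>) * \<rho> - 2 * \<epsilon> * real n) ^ CARD('d))" using M by simp
    have "0 \<le> e * \<rho> ^ CARD('d)" "0 \<le> \<delta> * \<rho> ^ CARD('d)" using e \<delta> \<rho> by auto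
    then show ?thesis using nn by (simp only: ennreal_plus[symmetric] add_nonneg_nonneg distrib_right)
  qed
  finally have "(\<integral>\<^sup>+y. W (y /\<^sub>R \<epsilon>) (t *\<^sub>R (U y + V y)) * indicator ?Q y \<partial>lebesgue) \<le>
       ennreal ((e + \<delta>) * \<rho> ^ CARD('d) + M * (\<rho> ^ CARD('d) - ((1 - 2 * \<kappa>) * \<rho> - 2 * \<epsilon> * real n) ^ CARD('d)))" .
  then show ?thesis using w w0 wb by blast
qed

end

section \<open>Grids, offsets and nearly affine corners\<close>

definition int_vec :: "('d \<Rightarrow> int) \<Rightarrow> real^'d" where
  "int_vec k = (\<chi> i. of_int (k i))"

text \<open>The range is half-open because a cell index is a floor: a point with coordinates of
  modulus below \<open>\<rho> * of_int B\<close> has its indices in \<open>{-B..<B}\<close>.\<close>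

definition grid :: "int \<Rightarrow> ('d::finite \<Rightarrow> int) set" where
  "grid B = PiE UNIV (\<lambda>_. {-B..<B})"

lemma finite_grid: "finite (grid B)"
  by (simp add: grid_def finite_PiE)

lemma integral_lebesgue_plus:
  fixes f :: "real^'d \<Rightarrow> real"
  assumes f: "integrable lebesgue f"
  shows "integrable lebesgue (\<lambda>x. f (c + x))" and "(\<integral>x. f (c + x) \<partial>lebesgue) = (\<integral>x. f x \<partial>lebesgue)"
proof -
  have T: "(\<lambda>x::real^'d. c + (\<Sum>j\<in>Basis. (1 * (x \<bullet> j)) *\<^sub>R j)) = (+) c"
    by (simp add: fun_eq_iff euclidean_representation)
  have d: "lebesgue = distr lebesgue lebesgue ((+) c)"
    using lebesgue_affine_euclidean[of "\<lambda>_. 1" c] unfolding T by (simp add: density_1)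
  have m: "(+) c \<in> lebesgue \<rightarrow>\<^sub>M lebesgue" using measurable_affine_lebesgue[of 1 c] by simp
  have fm: "f \<in> borel_measurable lebesgue" using f by simp
  show "integrable lebesgue (\<lambda>x. f (c + x))" using f d integrable_distr_eq[OF m fm] by metis
  show "(\<integral>x. f (c + x) \<partial>lebesgue) = (\<integral>x. f x \<partial>lebesgue)" using d integral_distr[OF m fm] by metis
qed

text \<open>The average over all offsets of the Riemann sums of \<open>g\<close> is the integral, so some offset does
  at least as well.\<close>

lemma grid_offset:
  fixes g :: "real^'d \<Rightarrow> real"
  assumes g: "integrable lebesgue g" and \<rho>: "\<rho> > 0" and \<eta>: "\<eta> > 0"
    and supp: "\<And>x i. g x \<noteq> 0 \<Longrightarrow> \<bar>x $ i\<bar> < \<rho> * of_int B"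
  shows "\<exists>s. \<rho> ^ CARD('d) * (\<Sum>k\<in>grid B. g (s + \<rho> *\<^sub>R int_vec k)) \<le> (\<integral>x. g x \<partial>lebesgue) + \<eta>"
proof (rule ccontr)
  assume "\<not> ?thesis"
  then have big: "\<And>s. (\<integral>x. g x \<partial>lebesgue) + \<eta> < \<rho> ^ CARD('d) * (\<Sum>k\<in>grid B. g (s + \<rho> *\<^sub>R int_vec k))" by (simp add: not_le)
  \<comment> \<open>The half-open cell, described by floors so that its translates partition the
    space exactly; \<open>x\<close> lies only in the translate indexed by the floors of
    \<open>x $ i / \<rho>\<close>.\<close>
  define Q where "Q = {x::real^'d. \<forall>i. \<lfloor>x $ i / \<rho>\<rfloor> = 0}"
  have Qb: "box 0 (0 + \<rho> *\<^sub>R 1) \<subseteq> Q" "Q \<subseteq> cbox 0 (0 + \<rho> *\<^sub>R 1)"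
  proof -
    have iff: "\<lfloor>y / \<rho>\<rfloor> = 0 \<longleftrightarrow> 0 \<le> y \<and> y < \<rho>" for y using \<rho> by (simp add: floor_eq_iff divide_less_eq zero_le_divide_iff)
    show "box 0 (0 + \<rho> *\<^sub>R 1) \<subseteq> Q" "Q \<subseteq> cbox 0 (0 + \<rho> *\<^sub>R 1)"
      unfolding Q_def iff by (auto simp: mem_box_cart less_imp_le)
  qed
  have Qs: "Q \<in> sets lebesgue"
  proof -
    have "negligible (cbox 0 (0 + \<rho> *\<^sub>R 1) - box 0 (0 + \<rho> *\<^sub>R 1 :: real^'d))"
      using negligible_frontier_interval by blast
    then have "negligible (Q - box 0 (0 + \<rho> *\<^sub>R 1))" by (rule negligible_subset) (use Qb in blast)
    then have "Q - box 0 (0 + \<rho> *\<^sub>R 1) \<in> sets lebesgue" by (rule negligible_imp_sets)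
    then have "box 0 (0 + \<rho> *\<^sub>R 1) \<union> (Q - box 0 (0 + \<rho> *\<^sub>R 1)) \<in> sets lebesgue" by (intro sets.Un) auto
    then show ?thesis using Qb(1) by (simp add: Un_absorb1)
  qed
  have Ql: "Q \<in> lmeasurable" using Qs Qb(2) by (meson lmeasurable_cbox fmeasurableI2)
  have mQ: "measure lebesgue Q = \<rho> ^ CARD('d)"
  proof (rule antisym)
    show "measure lebesgue Q \<le> \<rho> ^ CARD('d)"
      using measure_mono_fmeasurable[OF Qb(2) Qs] measure_cube(2)[of \<rho> "0::real^'d"] \<rho> by simp
    show "\<rho> ^ CARD('d) \<le> measure lebesgue Q"
      using measure_mono_fmeasurable[OF Qb(1) _ Ql] measure_cube(1)[of \<rho> "0::real^'d"] \<rho> by simp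
  qed
  have cell: "x - \<rho> *\<^sub>R int_vec k \<in> Q \<longleftrightarrow> k = (\<lambda>i. \<lfloor>x $ i / \<rho>\<rfloor>)" for x k
  proof -
    have "\<lfloor>(x - \<rho> *\<^sub>R int_vec k) $ i / \<rho>\<rfloor> = \<lfloor>x $ i / \<rho>\<rfloor> - k i" for i
    proof -
      have "(x - \<rho> *\<^sub>R int_vec k) $ i / \<rho> = x $ i / \<rho> - of_int (k i)" using \<rho> by (simp add: int_vec_def diff_divide_distrib)
      then show ?thesis by (simp only: floor_diff_of_int)
    qed
    then show ?thesis by (auto simp: Q_def fun_eq_iff)
  qed
  have sumQ: "(\<Sum>k\<in>grid B. indicator Q (x - \<rho> *\<^sub>R int_vec k) * g x) = g x" for x
  proof (cases "g x = 0")
    case False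
    define k where "k = (\<lambda>i. \<lfloor>x $ i / \<rho>\<rfloor>)"
    have "k \<in> grid B"
    proof -
      have "- of_int B \<le> x $ i / \<rho>" "x $ i / \<rho> < of_int B" for i
        using supp[OF False, of i] \<rho> by (auto simp: abs_less_iff le_divide_eq divide_less_eq mult.commute[of \<rho>])
      then show ?thesis by (auto simp: grid_def k_def le_floor_iff floor_less_iff)
    qed
    have "(\<Sum>l\<in>grid B. indicator Q (x - \<rho> *\<^sub>R int_vec l) * g x) = (\<Sum>l\<in>{k}. indicator Q (x - \<rho> *\<^sub>R int_vec l) * g x)"
      using finite_grid \<open>k \<in> grid B\<close> cell by (intro sum.mono_neutral_right) (auto simp: k_def)
    also have "\<dots> = indicator Q (x - \<rho> *\<^sub>R int_vec k) * g x"
      by (simp only: sum.insert sum.empty finite.emptyI empty_iff not_False_eq_True add_0_right)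
    also have "\<dots> = g x" using cell[of x k] by (simp add: k_def)
    finally show ?thesis .
  qed simp
  have i1: "integrable lebesgue (\<lambda>x. indicator Q (x - \<rho> *\<^sub>R int_vec k) * g x)" for k
  proof (rule Bochner_Integration.integrable_bound[OF g])
    have "(\<lambda>x. indicator Q (- \<rho> *\<^sub>R int_vec k + 1 *\<^sub>R x) :: real) \<in> borel_measurable lebesgue"
      by (rule measurable_compose[OF measurable_affine_lebesgue borel_measurable_indicator[OF Qs]]) simp
    then have "(\<lambda>x. indicator Q (x - \<rho> *\<^sub>R int_vec k) :: real) \<in> borel_measurable lebesgue" by (simp add: algebra_simps)
    then show "(\<lambda>x. indicator Q (x - \<rho> *\<^sub>R int_vec k) * g x) \<in> borel_measurable lebesgue" using g by (intro borel_measurable_times) auto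
    show "AE x in lebesgue. norm (indicator Q (x - \<rho> *\<^sub>R int_vec k) * g x) \<le> norm (g x)" by (simp add: indicator_def)
  qed
  have i2: "integrable lebesgue (\<lambda>s. indicator Q s * g (s + \<rho> *\<^sub>R int_vec k))"
    and e2: "(\<integral>s. indicator Q s * g (s + \<rho> *\<^sub>R int_vec k) \<partial>lebesgue) = (\<integral>x. indicator Q (x - \<rho> *\<^sub>R int_vec k) * g x \<partial>lebesgue)" for k
    using integral_lebesgue_plus[OF i1[of k], of "\<rho> *\<^sub>R int_vec k"] by (simp_all add: add.commute)
  \<comment> \<open>Splitting the integral over the translates of \<open>Q\<close> and shifting each
    piece back writes it as an integral of grid sums over the offsets in \<open>Q\<close>; if all
    these sums were too large, the integral would exceed itself.\<close>
  have "(\<integral>x. g x \<partial>lebesgue) = (\<integral>x. (\<Sum>k\<in>grid B. indicator Q (x - \<rho> *\<^sub>R int_vec k) * g x) \<partial>lebesgue)"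
    by (simp only: sumQ)
  also have "\<dots> = (\<Sum>k\<in>grid B. (\<integral>s. indicator Q s * g (s + \<rho> *\<^sub>R int_vec k) \<partial>lebesgue))"
    by (subst Bochner_Integration.integral_sum) (simp_all add: i1 e2)
  also have "\<dots> = (\<integral>s. (\<Sum>k\<in>grid B. indicator Q s * g (s + \<rho> *\<^sub>R int_vec k)) \<partial>lebesgue)"
    by (rule Bochner_Integration.integral_sum[symmetric]) (rule i2)
  finally have "\<rho> ^ CARD('d) * (\<integral>x. g x \<partial>lebesgue) = (\<integral>s. \<rho> ^ CARD('d) * (\<Sum>k\<in>grid B. indicator Q s * g (s + \<rho> *\<^sub>R int_vec k)) \<partial>lebesgue)"
    by simp
  also have "\<dots> \<ge> (\<integral>s. indicator Q s * ((\<integral>x. g x \<partial>lebesgue) + \<eta>) \<partial>lebesgue)"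
  proof (rule integral_mono)
    show "integrable lebesgue (\<lambda>s. indicator Q s * ((\<integral>x. g x \<partial>lebesgue) + \<eta>))"
      using Ql by (intro integrable_mult_left) (simp add: lmeasurable_iff_integrable)
    show "integrable lebesgue (\<lambda>s. \<rho> ^ CARD('d) * (\<Sum>k\<in>grid B. indicator Q s * g (s + \<rho> *\<^sub>R int_vec k)))"
      by (intro integrable_mult_right Bochner_Integration.integrable_sum i2)
    fix s
    show "indicator Q s * ((\<integral>x. g x \<partial>lebesgue) + \<eta>) \<le> \<rho> ^ CARD('d) * (\<Sum>k\<in>grid B. indicator Q s * g (s + \<rho> *\<^sub>R int_vec k))"
      using big[of s] by (simp add: indicator_def)
  qed
  also have "(\<integral>s. indicator Q s * ((\<integral>x. g x \<partial>lebesgue) + \<eta>) \<partial>lebesgue) = \<rho> ^ CARD('d) * ((\<integral>x. g x \<partial>lebesgue) + \<eta>)"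
    using Qs by (simp add: mQ del: measure_completion)
  finally show False using \<rho> \<eta> by simp
qed

lemma grid_cubes_disjoint:
  assumes \<rho>: "\<rho> > 0" and y: "y \<in> box (s + \<rho> *\<^sub>R int_vec k) (s + \<rho> *\<^sub>R int_vec k + \<rho> *\<^sub>R 1)"
    "y \<in> box (s + \<rho> *\<^sub>R int_vec l) (s + \<rho> *\<^sub>R int_vec l + \<rho> *\<^sub>R 1)"
  shows "k = l"
proof
  fix i
  have "s $ i + \<rho> * of_int (k i) < y $ i" "y $ i < s $ i + \<rho> * of_int (k i) + \<rho>"
    "s $ i + \<rho> * of_int (l i) < y $ i" "y $ i < s $ i + \<rho> * of_int (l i) + \<rho>"
    using y by (auto simp: mem_box_cart int_vec_def)
  then have "\<rho> * of_int (k i) < \<rho> * (of_int (l i) + 1)" "\<rho> * of_int (l i) < \<rho> * (of_int (k i) + 1)"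
    by (auto simp: algebra_simps)
  then have "of_int (k i) < (of_int (l i) + 1 :: real)" "of_int (l i) < (of_int (k i) + 1 :: real)" using \<rho> by auto
  then show "k i = l i" by linarith
qed

text \<open>The deviation is measured relative to the side \<rho>, because the gradient of a cutoff
  carries the factor \<open>1 / \<rho>\<close>. The closed cube in the first condition makes the set
  of admissible corners open.\<close>

definition affine_points :: "(real^'d) set \<Rightarrow> (real^'d \<Rightarrow> real^'m) \<Rightarrow> (real^'d \<Rightarrow> real^'d^'m) \<Rightarrow> real \<Rightarrow> real \<Rightarrow> (real^'d) set" where
  "affine_points \<Omega> u G \<tau> \<rho> = {x\<in>\<Omega>. cbox x (x + \<rho> *\<^sub>R 1) \<subseteq> \<Omega> \<and>
     (\<forall>h\<in>box 0 (\<rho> *\<^sub>R 1). norm (u (x + h) - u x - G x *v h) \<le> \<tau> * \<rho>)}"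

lemma measurable_norm_diff:
  fixes f g :: "'a \<Rightarrow> 'b::euclidean_space"
  assumes "f \<in> borel_measurable M" "g \<in> borel_measurable M"
  shows "(\<lambda>x. norm (f x - g x)) \<in> borel_measurable M"
  using assms by measurable

text \<open>The uncountably many conditions, one for each \<open>h\<close>, follow by continuity in
  \<open>h\<close> from those with \<open>h\<close> in a countable dense set.\<close>

lemma affine_points_measurable:
  fixes u :: "real^'d \<Rightarrow> real^'m"
  assumes u: "lip_grad \<Omega> u G" and \<Omega>: "open \<Omega>" and \<rho>: "\<rho> > 0"
  shows "affine_points \<Omega> u G \<tau> \<rho> \<in> sets lebesgue"
proof -
  obtain L where "L-lipschitz_on UNIV u" using u by (auto simp: lip_grad_def)
  then have cu: "continuous_on UNIV u" by (rule lipschitz_on_continuous_on)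
  define G' where "G' = (\<lambda>x. indicator \<Omega> x *\<^sub>R G x)"
  have G'm: "G' \<in> borel_measurable lebesgue" unfolding G'_def by (rule lip_grad_measurable[OF u \<Omega>])
  obtain D :: "(real^'d) set" where D: "countable D" "\<And>X. open X \<Longrightarrow> X \<noteq> {} \<Longrightarrow> \<exists>d\<in>D. d \<in> X"
    using countable_dense_setE by blast
  let ?H = "D \<inter> box 0 (\<rho> *\<^sub>R 1)"
  define S1 where "S1 = {x::real^'d. cbox x (x + \<rho> *\<^sub>R 1) \<subseteq> \<Omega>}"
  have "open S1"
    unfolding open_contains_ball
  proof
    fix x assume "x \<in> S1"
    then have sub: "cbox x (x + \<rho> *\<^sub>R 1) \<subseteq> \<Omega>" by (simp add: S1_def)
    obtain e where e: "e > 0" "(\<Union>p\<in>cbox x (x + \<rho> *\<^sub>R 1). ball p e) \<subseteq> \<Omega>"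
      using compact_subset_open_imp_ball_epsilon_subset[OF compact_cbox \<Omega> sub] by metis
    have "ball x e \<subseteq> S1"
    proof
      fix y assume y: "y \<in> ball x e"
      have "cbox y (y + \<rho> *\<^sub>R 1) \<subseteq> \<Omega>"
      proof
        fix z assume "z \<in> cbox y (y + \<rho> *\<^sub>R 1)"
        then have "z - (y - x) \<in> cbox x (x + \<rho> *\<^sub>R 1)" by (auto simp: mem_box_cart algebra_simps)
        moreover have "z \<in> ball (z - (y - x)) e" using y by (simp add: dist_norm norm_minus_commute)
        ultimately show "z \<in> \<Omega>" using e(2) by blast
      qed
      then show "y \<in> S1" by (simp add: S1_def)
    qed
    then show "\<exists>e>0. ball x e \<subseteq> S1" using e(1) by blast
  qed
  then have S1: "S1 \<in> sets lebesgue" by simp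
  have S2: "{x. norm (u (x + h) - u x - G' x *v h) \<le> \<tau> * \<rho>} \<in> sets lebesgue" for h
  proof -
    have c1: "continuous_on UNIV (\<lambda>x. u (x + h) - u x)"
      by (intro continuous_intros cu continuous_on_compose2[OF cu]) auto
    have "(\<lambda>w::real^'d^'m. w *v h) \<in> borel_measurable borel"
      unfolding matrix_vector_mult_def by (intro borel_measurable_continuous_onI continuous_intros continuous_on_vec_lambda)
    from measurable_norm_diff[OF continuous_imp_measurable_lebesgue[OF c1] measurable_compose[OF G'm this]]
    have "(\<lambda>x. norm (u (x + h) - u x - G' x *v h)) \<in> borel_measurable lebesgue" .
    then have "(\<lambda>x. norm (u (x + h) - u x - G' x *v h)) -` {.. \<tau> * \<rho>} \<inter> space lebesgue \<in> sets lebesgue"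
      by (rule measurable_sets) simp
    then show ?thesis by (simp add: vimage_def)
  qed
  have dense: "norm (u (x + h) - u x - G x *v h) \<le> \<tau> * \<rho>"
    if all: "\<And>h. h \<in> ?H \<Longrightarrow> norm (u (x + h) - u x - G x *v h) \<le> \<tau> * \<rho>" and h: "h \<in> box 0 (\<rho> *\<^sub>R 1)" for x h
  proof (rule ccontr)
    assume n: "\<not> ?thesis"
    let ?N = "{h. \<tau> * \<rho> < norm (u (x + h) - u x - G x *v h)}"
    have "continuous_on UNIV (\<lambda>h. norm (u (x + h) - u x - G x *v h))"
      by (intro continuous_intros continuous_on_compose2[OF cu] linear_continuous_on matrix_vector_mul_bounded_linear) auto
    then have "open ?N" by (intro open_Collect_less continuous_on_const)
    then have "open (?N \<inter> box 0 (\<rho> *\<^sub>R 1))" by (intro open_Int open_box)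
    moreover have "h \<in> ?N \<inter> box 0 (\<rho> *\<^sub>R 1)" using n h by simp
    ultimately obtain d where "d \<in> D" "d \<in> ?N \<inter> box 0 (\<rho> *\<^sub>R 1)" using D(2) by blast
    then show False using all[of d] by simp
  qed
  \<comment> \<open>The index 0 lies outside the open box and carries the trivial condition; it
    keeps the index set of the countable intersection visibly nonempty.\<close>
  have "affine_points \<Omega> u G \<tau> \<rho> = (\<Omega> \<inter> S1) \<inter> (\<Inter>h\<in>insert 0 ?H. if h = 0 then UNIV else {x. norm (u (x + h) - u x - G' x *v h) \<le> \<tau> * \<rho>})"
  proof -
    have "0 \<notin> box 0 (\<rho> *\<^sub>R 1 :: real^'d)" by (simp add: mem_box_cart)
    then have "(\<Inter>h\<in>insert 0 ?H. if h = 0 then UNIV else {x. norm (u (x + h) - u x - G' x *v h) \<le> \<tau> * \<rho>})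
      = {x. \<forall>h\<in>?H. norm (u (x + h) - u x - G' x *v h) \<le> \<tau> * \<rho>}" by auto
    then show ?thesis unfolding affine_points_def S1_def using dense by (auto simp: G'_def)
  qed
  moreover have "(\<Inter>h\<in>insert 0 ?H. if h = 0 then UNIV else {x. norm (u (x + h) - u x - G' x *v h) \<le> \<tau> * \<rho>}) \<in> sets lebesgue"
    using D(1) S2 by (intro sets.countable_INT') auto
  moreover have "\<Omega> \<inter> S1 \<in> sets lebesgue" using \<Omega> S1 by auto
  ultimately show ?thesis by (simp only: sets.Int)
qed

text \<open>A point of one-sided differentiability belongs to \<open>affine_points\<close> for all
  large \<open>n\<close>, so the indicators of the exceptional sets tend to 0 almost everywhere and
  are dominated by that of \<Omega>.\<close>

lemma affine_points_measure:
  fixes u :: "real^'d \<Rightarrow> real^'m"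
  assumes u: "lip_grad \<Omega> u G" and \<Omega>: "open \<Omega>" "bounded \<Omega>" and \<tau>: "\<tau> > 0" and \<rho>: "\<And>n. \<rho> n > 0" "\<rho> \<longlonglongrightarrow> 0"
  shows "(\<lambda>n. measure lebesgue (\<Omega> - affine_points \<Omega> u G \<tau> (\<rho> n))) \<longlonglongrightarrow> 0"
proof -
  have \<Omega>m: "\<Omega> \<in> lmeasurable" using \<Omega> by (simp add: lmeasurable_open)
  let ?S = "\<lambda>n. \<Omega> - affine_points \<Omega> u G \<tau> (\<rho> n)"
  have Sm: "?S n \<in> sets lebesgue" for n
    using affine_points_measurable[OF u \<Omega>(1) \<rho>(1)] \<Omega>(1) by (intro sets.Diff) auto
  have "(\<lambda>n. \<integral>x. indicat_real (?S n) x \<partial>lebesgue) \<longlonglongrightarrow> integral\<^sup>L lebesgue (\<lambda>x::real^'d. 0)"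
  proof (rule integral_dominated_convergence[where w="indicator \<Omega>"])
    show "integrable lebesgue (indicat_real \<Omega>)" using \<Omega>m by (simp add: lmeasurable_iff_integrable)
    show "indicator (?S n) \<in> borel_measurable lebesgue" for n using Sm by (rule borel_measurable_indicator)
    show "AE x in lebesgue. norm (indicat_real (?S n) x) \<le> indicator \<Omega> x" for n
      by (intro always_eventually) (auto simp: indicator_def)
    show "AE x in lebesgue. (\<lambda>n. indicat_real (?S n) x) \<longlonglongrightarrow> 0"
      using u[unfolded lip_grad_def, THEN conjunct2]
    proof (rule eventually_mono)
      fix x assume *: "x \<in> \<Omega> \<longrightarrow> (u has_derivative (\<lambda>h. G x *v h)) (at x within {x..})"
      have "\<forall>\<^sub>F n in sequentially. indicat_real (?S n) x = 0"
      proof (cases "x \<in> \<Omega>")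
        case True
        have "\<tau> / CARD('d) > 0" using \<tau> by simp
        then obtain d where d: "d > 0" "\<And>y. y \<in> {x..} \<Longrightarrow> norm (y - x) < d \<Longrightarrow> norm (u y - u x - G x *v (y - x)) \<le> \<tau> / CARD('d) * norm (y - x)"
          using * True unfolding has_derivative_within_alt by blast
        obtain e where e: "e > 0" "ball x e \<subseteq> \<Omega>" using \<Omega> True open_contains_ball by blast
        have "min d e / CARD('d) > 0" using d e by simp
        from order_tendstoD(2)[OF \<rho>(2) this] show ?thesis
        proof (rule eventually_mono)
          fix n assume n: "\<rho> n < min d e / CARD('d)"
          have dist: "dist x y < min d e" "dist x y \<le> \<rho> n * CARD('d)" if "y \<in> cbox x (x + \<rho> n *\<^sub>R 1)" for y
          proof -
            show "dist x y \<le> \<rho> n * CARD('d)" using \<rho>(1)[of n] that by (intro corner_cube_subset_ball) auto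
            also have "\<dots> < min d e" using n by (simp add: less_divide_eq)
            finally show "dist x y < min d e" .
          qed
          have "cbox x (x + \<rho> n *\<^sub>R 1) \<subseteq> \<Omega>" using dist(1) e(2) by (auto simp del: mem_box)
          moreover have "norm (u (x + h) - u x - G x *v h) \<le> \<tau> * \<rho> n" if h: "h \<in> box 0 (\<rho> n *\<^sub>R 1)" for h
          proof -
            have hc: "x + h \<in> cbox x (x + \<rho> n *\<^sub>R 1)" "x + h \<in> {x..}"
              using h by (auto simp: mem_box_cart less_eq_vec_def less_imp_le)
            have "norm (u (x + h) - u x - G x *v ((x + h) - x)) \<le> \<tau> / CARD('d) * norm ((x + h) - x)"
              using d(2)[OF hc(2)] dist(1)[OF hc(1)] by (simp add: dist_norm)
            also have "\<dots> \<le> \<tau> / CARD('d) * (\<rho> n * CARD('d))"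
              using dist(2)[OF hc(1)] \<tau> by (intro mult_left_mono) (auto simp: dist_norm)
            also have "\<dots> = \<tau> * \<rho> n" by simp
            finally show ?thesis by simp
          qed
          ultimately show "indicat_real (?S n) x = 0" using True by (simp add: affine_points_def)
        qed
      qed simp
      then show "(\<lambda>n. indicat_real (?S n) x) \<longlonglongrightarrow> 0" by (rule tendsto_eventually)
    qed
  qed simp
  then show ?thesis using Sm by (simp add: integral_indicator del: measure_completion)
qed

section \<open>Approximate recovery on all of \<Omega>\<close>

context homogenization
begin

text \<open>There are finitely many cubes, so one range of \<epsilon> serves them all, although the
  cell function, its number of cells and its sup norm vary from cube to cube. The corrections are
  added to \<open>u\<close> before the factor \<open>t\<close> is applied; on the rest of \<Omega>
  the gradient is \<open>t *\<^sub>R U y\<close>, where the energy density is at most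
  \<open>M\<close>.\<close>

lemma grid_recovery:
  fixes \<psi> :: "real^'d \<Rightarrow> real" and g :: "real^'d \<Rightarrow> real^'d" and u :: "real^'d \<Rightarrow> real^'m" and A :: "(real^'d) set"
  assumes t: "0 < t" "t < 1"
    and rad: "\<And>x \<xi>. \<xi> \<in> eff_dom (W x) \<Longrightarrow> W x (t *\<^sub>R \<xi>) \<le> W x \<xi> + ennreal \<delta>" and \<delta>: "\<delta> > 0"
    and M: "M \<ge> 0" and r: "r > 0"
    and MW: "AE x in lebesgue. \<forall>p q. p \<in> closure C \<longrightarrow> norm q \<le> r \<longrightarrow> W x (t *\<^sub>R p + q) \<le> ennreal M"
    and \<kappa>: "0 < \<kappa>" "\<kappa> < 1/2" and \<kappa>M: "M * (1 - (1 - 2 * \<kappa>) ^ CARD('d)) < \<delta>"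
    and \<psi>: "\<And>x. (\<psi> has_derivative (\<lambda>h. h \<bullet> g x)) (at x)" "\<And>x. 0 \<le> \<psi> x" "\<And>x. \<psi> x \<le> 1"
      "\<And>x. x \<notin> box 0 1 \<Longrightarrow> \<psi> x = 0" "\<And>x. x \<in> cbox (\<kappa> *\<^sub>R 1) ((1 - \<kappa>) *\<^sub>R 1) \<Longrightarrow> \<psi> x = 1"
      "\<Lambda> \<ge> 0" "\<And>x. norm (g x) \<le> \<Lambda>" "\<And>x y. \<bar>\<psi> x - \<psi> y\<bar> \<le> \<Lambda> * norm (x - y)"
    and \<Omega>: "open \<Omega>" and u: "lip_grad \<Omega> u U" and u0: "\<And>x. x \<notin> \<Omega> \<Longrightarrow> u x = 0"
    and UC: "AE y in lebesgue. y \<in> \<Omega> \<longrightarrow> U y \<in> closure C"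
    and \<rho>: "\<rho> > 0" and \<sigma>: "t * (\<sigma> * \<Lambda>) \<le> r" "\<sigma> > 0"
    and A: "finite A" "\<And>a. a \<in> A \<Longrightarrow> box a (a + \<rho> *\<^sub>R 1) \<subseteq> \<Omega>"
      "\<And>a b y. a \<in> A \<Longrightarrow> b \<in> A \<Longrightarrow> y \<in> box a (a + \<rho> *\<^sub>R 1) \<Longrightarrow> y \<in> box b (b + \<rho> *\<^sub>R 1) \<Longrightarrow> a = b"
    and near: "\<And>a h. a \<in> A \<Longrightarrow> h \<in> box 0 (\<rho> *\<^sub>R 1) \<Longrightarrow> norm (u (a + h) - u a - U a *v h) \<le> \<sigma> / 2 * \<rho>"
    and e: "\<And>a. a \<in> A \<Longrightarrow> e a \<ge> 0" "\<And>a. a \<in> A \<Longrightarrow> W_hom W (U a) < ennreal (e a)"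
  shows "\<forall>\<^sub>F \<epsilon> in at_right 0. \<exists>w V. lip_grad \<Omega> w V \<and> (\<forall>y. y \<notin> \<Omega> \<longrightarrow> w y = 0) \<and>
      (\<forall>y. norm (w y - t *\<^sub>R u y) \<le> (\<sigma> + 1) * \<rho>) \<and>
      (\<integral>\<^sup>+y. W (y /\<^sub>R \<epsilon>) (V y) * indicator \<Omega> y \<partial>lebesgue) \<le>
        (\<Sum>a\<in>A. ennreal ((e a + 2 * \<delta>) * \<rho> ^ CARD('d))) + ennreal M * emeasure lebesgue (\<Omega> - (\<Union>a\<in>A. box a (a + \<rho> *\<^sub>R 1)))"
proof -
  let ?Q = "\<lambda>a. box a (a + \<rho> *\<^sub>R 1) :: (real^'d) set"
  have local: "\<forall>\<^sub>F \<epsilon> in at_right 0. \<exists>w V. lip_grad (?Q a) w V \<and> (\<forall>y. y \<notin> ?Q a \<longrightarrow> w y = 0) \<and>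
     (\<forall>y. norm (w y) \<le> (\<sigma> + 1) * \<rho>) \<and>
     (\<integral>\<^sup>+y. W (y /\<^sub>R \<epsilon>) (t *\<^sub>R (U y + V y)) * indicator (?Q a) y \<partial>lebesgue) \<le> ennreal ((e a + 2 * \<delta>) * \<rho> ^ CARD('d))"
    if a: "a \<in> A" for a
  proof -
    \<comment> \<open>Points of a cube are within \<open>\<rho> * CARD('d)\<close> of its corner, so
      replacing \<open>U a\<close> by a matrix this close changes the affine map by at most
      \<open>\<sigma> / 2 * \<rho>\<close>. Together with the same amount from \<open>near\<close>
      this makes \<open>\<sigma> * \<rho>\<close>.\<close>
    have "\<sigma> / (2 * CARD('d)) > 0" using \<sigma>(2) by simp
    from lsc_envelope_less_obtain[OF e(2)[OF a, unfolded W_hom_def] this]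
    obtain \<zeta> where \<zeta>: "dist \<zeta> (U a) < \<sigma> / (2 * CARD('d))" "HW W \<zeta> < ennreal (e a)" by blast
    have \<zeta>C: "\<zeta> \<in> closure C"
    proof (rule ccontr)
      assume "\<zeta> \<notin> closure C"
      with HW_outside[OF this] \<zeta>(2) show False by simp
    qed
    obtain n f G where n: "n \<ge> 1" and f: "lip_grad (box 0 (real n *\<^sub>R 1)) f G" and f0: "\<And>x. x \<notin> box 0 (real n *\<^sub>R 1) \<Longrightarrow> f x = 0"
      and en: "ennreal (1 / real n ^ CARD('d)) * (\<integral>\<^sup>+x. W x (\<zeta> + G x) * indicator (box 0 (real n *\<^sub>R 1)) x \<partial>lebesgue) < ennreal (e a)"
      using HW_less_obtain[OF \<zeta>(2)] by blast
    let ?I = "\<integral>\<^sup>+x. W x (\<zeta> + G x) * indicator (box 0 (real n *\<^sub>R 1)) x \<partial>lebesgue"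
    have energy: "?I \<le> ennreal (real n ^ CARD('d) * e a)"
    proof -
      have "?I = ennreal (real n ^ CARD('d) * (1 / real n ^ CARD('d))) * ?I" using n by simp
      also have "\<dots> = ennreal (real n ^ CARD('d)) * (ennreal (1 / real n ^ CARD('d)) * ?I)"
        by (subst ennreal_mult) (auto simp: mult.assoc)
      also have "\<dots> \<le> ennreal (real n ^ CARD('d)) * ennreal (e a)" using en by (intro mult_left_mono) auto
      also have "\<dots> = ennreal (real n ^ CARD('d) * e a)" using e(1)[OF a] by (simp add: ennreal_mult)
      finally show ?thesis .
    qed
    obtain L where "L-lipschitz_on UNIV f" using f by (auto simp: lip_grad_def)
    then have cf: "continuous_on UNIV f" by (rule lipschitz_on_continuous_on)
    have "bounded (f ` cbox 0 (real n *\<^sub>R 1))"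
      by (intro compact_imp_bounded compact_continuous_image compact_cbox continuous_on_subset[OF cf]) auto
    then obtain R0 where R0: "\<And>x. x \<in> cbox 0 (real n *\<^sub>R 1) \<Longrightarrow> norm (f x) \<le> R0" by (auto simp: bounded_iff)
    define R where "R = max 0 R0"
    have R: "norm (f x) \<le> R" for x
      using R0[of x] f0[of x] box_subset_cbox[of 0 "real n *\<^sub>R 1 :: real^'d"] by (cases "x \<in> box 0 (real n *\<^sub>R 1)") (auto simp: R_def subset_iff simp del: mem_box)
    have nr: "norm (u y - (u a + \<zeta> *v (y - a))) \<le> \<sigma> * \<rho>" if y: "y \<in> ?Q a" for y
    proof -
      have h: "y - a \<in> box 0 (\<rho> *\<^sub>R 1)" using y by (auto simp: mem_box_cart algebra_simps)
      have "y \<in> cbox a (a + \<rho> *\<^sub>R 1)" using y box_subset_cbox by blast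
      then have d: "norm (y - a) \<le> \<rho> * CARD('d)" using corner_cube_subset_ball[of \<rho> y a] \<rho> by (simp add: dist_norm norm_minus_commute)
      have "norm ((U a - \<zeta>) *v (y - a)) \<le> norm (U a - \<zeta>) * norm (y - a)" by (rule norm_matrix_vector_mult_le)
      also have "\<dots> \<le> \<sigma> / (2 * CARD('d)) * (\<rho> * CARD('d))"
        using \<zeta>(1) d \<sigma>(2) by (intro mult_mono) (auto simp: dist_norm norm_minus_commute)
      also have "\<dots> = \<sigma> / 2 * \<rho>" by simp
      finally have 2: "norm ((U a - \<zeta>) *v (y - a)) \<le> \<sigma> / 2 * \<rho>" .
      have "u y - (u a + \<zeta> *v (y - a)) = (u (a + (y - a)) - u a - U a *v (y - a)) + (U a - \<zeta>) *v (y - a)"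
        by (simp add: matrix_vector_mult_diff_rdistrib)
      then have "norm (u y - (u a + \<zeta> *v (y - a))) \<le> norm (u (a + (y - a)) - u a - U a *v (y - a)) + norm ((U a - \<zeta>) *v (y - a))"
        using norm_triangle_ineq by metis
      then show ?thesis using near[OF a h] 2 by linarith
    qed
    have UCa: "AE y in lebesgue. y \<in> ?Q a \<longrightarrow> U y \<in> closure C" using UC by (rule eventually_mono) (use A(2)[OF a] in blast)
    \<comment> \<open>The thresholds for \<epsilon>: room for at least one block of cells in the
      core, a rescaled cell function of norm below \<rho>, and a layer whose energy is below
      \<delta> per unit volume, as \<open>\<kappa>M\<close> guarantees in the limit.\<close>
    have ev0: "\<forall>\<^sub>F \<epsilon> in at_right (0::real). \<epsilon> > 0" by (rule eventually_at_right_less)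
    have lin: "((\<lambda>\<epsilon>. c * \<epsilon>) \<longlongrightarrow> c * 0) (at_right (0::real))" for c by (intro tendsto_intros)
    have ev1: "\<forall>\<^sub>F \<epsilon> in at_right 0. (2 * real n) * \<epsilon> < (1 - 2 * \<kappa>) * \<rho>"
      using \<kappa> \<rho> by (intro order_tendstoD(2)[OF lin]) simp
    have ev2: "\<forall>\<^sub>F \<epsilon> in at_right 0. R * \<epsilon> < \<rho>" using \<rho> by (intro order_tendstoD(2)[OF lin]) simp
    have ev3: "\<forall>\<^sub>F \<epsilon> in at_right 0. M * (\<rho> ^ CARD('d) - ((1 - 2 * \<kappa>) * \<rho> - 2 * \<epsilon> * real n) ^ CARD('d)) < \<delta> * \<rho> ^ CARD('d)"
    proof (rule order_tendstoD(2))
      show "((\<lambda>\<epsilon>. M * (\<rho> ^ CARD('d) - ((1 - 2 * \<kappa>) * \<rho> - 2 * \<epsilon> * real n) ^ CARD('d))) \<longlongrightarrow>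
         M * (\<rho> ^ CARD('d) - ((1 - 2 * \<kappa>) * \<rho> - 2 * 0 * real n) ^ CARD('d))) (at_right 0)"
        by (intro tendsto_intros)
      have "M * (p - X * p) = (M * (1 - X)) * p" for p X :: real by (simp add: algebra_simps)
      then have "M * (\<rho> ^ CARD('d) - ((1 - 2 * \<kappa>) * \<rho> - 2 * 0 * real n) ^ CARD('d)) = (M * (1 - (1 - 2 * \<kappa>) ^ CARD('d))) * \<rho> ^ CARD('d)"
        by (simp only: power_mult_distrib mult_zero_right mult_zero_left diff_zero)
      also have "\<dots> < \<delta> * \<rho> ^ CARD('d)" using \<kappa>M \<rho> by (intro mult_strict_right_mono) auto
      finally show "M * (\<rho> ^ CARD('d) - ((1 - 2 * \<kappa>) * \<rho> - 2 * 0 * real n) ^ CARD('d)) < \<delta> * \<rho> ^ CARD('d)" .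
    qed
    show ?thesis
      using ev0 ev1 ev2 ev3
    proof eventually_elim
      case (elim \<epsilon>)
      have \<epsilon>n: "2 * \<epsilon> * real n \<le> (1 - 2 * \<kappa>) * \<rho>" using elim(2) by (simp add: mult_ac)
      obtain w V where w: "lip_grad (?Q a) w V" "\<And>y. y \<notin> ?Q a \<Longrightarrow> w y = 0" "\<And>y. norm (w y) \<le> \<sigma> * \<rho> + \<epsilon> * R"
        and I: "(\<integral>\<^sup>+y. W (y /\<^sub>R \<epsilon>) (t *\<^sub>R (U y + V y)) * indicator (?Q a) y \<partial>lebesgue) \<le>
         ennreal ((e a + \<delta>) * \<rho> ^ CARD('d) + M * (\<rho> ^ CARD('d) - ((1 - 2 * \<kappa>) * \<rho> - 2 * \<epsilon> * real n) ^ CARD('d)))"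
        using local_recovery[OF t rad less_imp_le[OF \<delta>] M r MW \<kappa> \<psi> lip_grad_subset[OF u A(2)[OF a]] \<rho> UCa \<zeta>C nr \<sigma>(1) less_imp_le[OF \<sigma>(2)] n f f0 R e(1)[OF a] energy elim(1) \<epsilon>n]
        by blast
      have "norm (w y) \<le> (\<sigma> + 1) * \<rho>" for y using w(3)[of y] elim(3) by (simp add: algebra_simps)
      moreover have "(e a + \<delta>) * \<rho> ^ CARD('d) + M * (\<rho> ^ CARD('d) - ((1 - 2 * \<kappa>) * \<rho> - 2 * \<epsilon> * real n) ^ CARD('d)) \<le> (e a + 2 * \<delta>) * \<rho> ^ CARD('d)"
        using elim(4) by (simp add: algebra_simps)
      ultimately show ?case using w(1,2) order_trans[OF I ennreal_leI] by blast
    qed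
  qed
  have "\<forall>\<^sub>F \<epsilon> in at_right 0. \<forall>a\<in>A. \<exists>w V. lip_grad (?Q a) w V \<and> (\<forall>y. y \<notin> ?Q a \<longrightarrow> w y = 0) \<and>
     (\<forall>y. norm (w y) \<le> (\<sigma> + 1) * \<rho>) \<and>
     (\<integral>\<^sup>+y. W (y /\<^sub>R \<epsilon>) (t *\<^sub>R (U y + V y)) * indicator (?Q a) y \<partial>lebesgue) \<le> ennreal ((e a + 2 * \<delta>) * \<rho> ^ CARD('d))"
    using A(1) local by (intro eventually_ball_finite) auto
  with eventually_at_right_less[of 0] show ?thesis
  proof eventually_elim
    case (elim \<epsilon>)
    from bchoice[OF elim(2)] obtain w where "\<forall>a\<in>A. \<exists>V. lip_grad (?Q a) (w a) V \<and> (\<forall>y. y \<notin> ?Q a \<longrightarrow> w a y = 0) \<and>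
     (\<forall>y. norm (w a y) \<le> (\<sigma> + 1) * \<rho>) \<and>
     (\<integral>\<^sup>+y. W (y /\<^sub>R \<epsilon>) (t *\<^sub>R (U y + V y)) * indicator (?Q a) y \<partial>lebesgue) \<le> ennreal ((e a + 2 * \<delta>) * \<rho> ^ CARD('d))" ..
    from bchoice[OF this] obtain V where "\<forall>a\<in>A. lip_grad (?Q a) (w a) (V a) \<and> (\<forall>y. y \<notin> ?Q a \<longrightarrow> w a y = 0) \<and>
     (\<forall>y. norm (w a y) \<le> (\<sigma> + 1) * \<rho>) \<and>
     (\<integral>\<^sup>+y. W (y /\<^sub>R \<epsilon>) (t *\<^sub>R (U y + V a y)) * indicator (?Q a) y \<partial>lebesgue) \<le> ennreal ((e a + 2 * \<delta>) * \<rho> ^ CARD('d))" ..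
    then have w: "\<And>a. a \<in> A \<Longrightarrow> lip_grad (?Q a) (w a) (V a)" "\<And>a y. a \<in> A \<Longrightarrow> y \<notin> ?Q a \<Longrightarrow> w a y = 0"
      "\<And>a y. a \<in> A \<Longrightarrow> norm (w a y) \<le> (\<sigma> + 1) * \<rho>"
      "\<And>a. a \<in> A \<Longrightarrow> (\<integral>\<^sup>+y. W (y /\<^sub>R \<epsilon>) (t *\<^sub>R (U y + V a y)) * indicator (?Q a) y \<partial>lebesgue) \<le> ennreal ((e a + 2 * \<delta>) * \<rho> ^ CARD('d))"
      by blast+
    define v where "v = (\<lambda>y. t *\<^sub>R (u y + (\<Sum>a\<in>A. w a y)))"
    define Z where "Z = (\<lambda>y. t *\<^sub>R (U y + (\<Sum>a\<in>A. indicator (?Q a) y *\<^sub>R V a y)))"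
    have ext: "lip_grad \<Omega> (w a) (\<lambda>y. indicator (?Q a) y *\<^sub>R V a y)" if "a \<in> A" for a
    proof (rule lip_grad_subset[OF lip_grad_zero_extension[OF w(1)[OF that] open_box] subset_UNIV])
      show "negligible (frontier (?Q a))" by (intro negligible_convex_frontier convex_box)
      show "w a y = 0" if "y \<notin> ?Q a" for y using w(2) \<open>a \<in> A\<close> that by blast
    qed
    have lg: "lip_grad \<Omega> v Z"
      unfolding v_def Z_def by (intro lip_grad_scaleR lip_grad_add u lip_grad_sum A(1) ext)
    have v0: "v y = 0" if "y \<notin> \<Omega>" for y
      using u0[OF that] w(2) A(2) that by (auto simp: v_def intro!: sum.neutral simp del: mem_box)
    have wsum: "(\<Sum>a\<in>A. w a y) = w b y \<and> (\<Sum>a\<in>A. indicator (?Q a) y *\<^sub>R V a y) = V b y" if b: "b \<in> A" "y \<in> ?Q b" for b y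
    proof -
      have out: "y \<notin> ?Q a" if "a \<in> A - {b}" for a using A(3)[of a b y] b that by blast
      have "(\<Sum>a\<in>A. w a y) = w b y + (\<Sum>a\<in>A - {b}. w a y)" by (rule sum.remove[OF A(1) b(1)])
      also have "(\<Sum>a\<in>A - {b}. w a y) = 0" using out w(2) by (intro sum.neutral) blast
      finally have 1: "(\<Sum>a\<in>A. w a y) = w b y" by simp
      have "(\<Sum>a\<in>A. indicator (?Q a) y *\<^sub>R V a y) = indicator (?Q b) y *\<^sub>R V b y + (\<Sum>a\<in>A - {b}. indicator (?Q a) y *\<^sub>R V a y)"
        by (rule sum.remove[OF A(1) b(1)])
      also have "(\<Sum>a\<in>A - {b}. indicator (?Q a) y *\<^sub>R V a y) = 0" using out by (intro sum.neutral) (auto simp: indicator_def simp del: mem_box)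
      finally show ?thesis using 1 b(2) by (simp del: mem_box)
    qed
    have close: "norm (v y - t *\<^sub>R u y) \<le> (\<sigma> + 1) * \<rho>" for y
    proof -
      have "norm (\<Sum>a\<in>A. w a y) \<le> (\<sigma> + 1) * \<rho>"
      proof (cases "\<exists>b\<in>A. y \<in> ?Q b")
        case True then show ?thesis using wsum w(3) by fastforce
      next
        case False
        then have "(\<Sum>a\<in>A. w a y) = 0" using w(2) by (intro sum.neutral) blast
        then show ?thesis using \<sigma>(2) \<rho> by simp
      qed
      moreover have "v y - t *\<^sub>R u y = t *\<^sub>R (\<Sum>a\<in>A. w a y)" by (simp add: v_def scaleR_add_right)
      moreover have "t * norm (\<Sum>a\<in>A. w a y) \<le> norm (\<Sum>a\<in>A. w a y)" using t by (intro mult_left_le_one_le) auto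
      ultimately show ?thesis using t by simp
    qed
    let ?X = "\<Omega> - (\<Union>a\<in>A. ?Q a)"
    have Xm: "?X \<in> sets lebesgue" using \<Omega> A(1) by (intro sets.Diff sets.finite_UN) auto
    define h where "h = (\<lambda>a y. W (y /\<^sub>R \<epsilon>) (t *\<^sub>R (U y + V a y)) * indicator (?Q a) y)"
    have hm: "h a \<in> borel_measurable lebesgue" if "a \<in> A" for a
    proof -
      have "lip_grad (?Q a) (\<lambda>y. t *\<^sub>R (u y + w a y)) (\<lambda>y. t *\<^sub>R (U y + V a y))"
        by (intro lip_grad_scaleR lip_grad_add lip_grad_subset[OF u A(2)[OF that]] w(1)[OF that])
      from measurable_energy_density[OF this open_box] show ?thesis by (simp add: h_def)
    qed
    have "(\<integral>\<^sup>+y. W (y /\<^sub>R \<epsilon>) (Z y) * indicator \<Omega> y \<partial>lebesgue) \<le> (\<integral>\<^sup>+y. (\<Sum>a\<in>A. h a y) + ennreal M * indicator ?X y \<partial>lebesgue)"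
    proof (rule nn_integral_mono_AE)
      show "AE y in lebesgue. W (y /\<^sub>R \<epsilon>) (Z y) * indicator \<Omega> y \<le> (\<Sum>a\<in>A. h a y) + ennreal M * indicator ?X y"
        using AE_scaled[OF MW elim(1)] UC
      proof eventually_elim
        case (elim y)
        show ?case
        proof (cases "y \<in> \<Omega>")
          case True
          show ?thesis
          proof (cases "\<exists>b\<in>A. y \<in> ?Q b")
            case True
            then obtain b where b: "b \<in> A" "y \<in> ?Q b" by blast
            then have "Z y = t *\<^sub>R (U y + V b y)" using wsum by (simp add: Z_def del: mem_box)
            then have "W (y /\<^sub>R \<epsilon>) (Z y) * indicator \<Omega> y \<le> h b y" using b(2) by (simp add: h_def indicator_def del: mem_box)
            also have "\<dots> \<le> (\<Sum>a\<in>A. h a y)" by (rule member_le_sum[OF b(1) _ A(1)]) simp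
            finally show ?thesis by (simp add: add_increasing2)
          next
            case False
            have "(\<Sum>a\<in>A. indicator (?Q a) y *\<^sub>R V a y) = 0" using False by (intro sum.neutral) (auto simp: indicator_def simp del: mem_box)
            then have "Z y = t *\<^sub>R U y + 0" by (simp add: Z_def)
            moreover have "W (y /\<^sub>R \<epsilon>) (t *\<^sub>R U y + 0) \<le> ennreal M"
              using elim True r by (metis less_imp_le norm_zero)
            ultimately have "W (y /\<^sub>R \<epsilon>) (Z y) \<le> ennreal M" by simp
            moreover have "y \<in> ?X" using True False by blast
            ultimately show ?thesis using True by (simp add: add_increasing)
          qed
        qed simp
      qed
    qed
    also have "\<dots> = (\<integral>\<^sup>+y. (\<Sum>a\<in>A. h a y) \<partial>lebesgue) + (\<integral>\<^sup>+y. ennreal M * indicator ?X y \<partial>lebesgue)"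
      using hm Xm by (intro nn_integral_add borel_measurable_sum borel_measurable_times_ennreal borel_measurable_indicator) auto
    also have "(\<integral>\<^sup>+y. ennreal M * indicator ?X y \<partial>lebesgue) = ennreal M * emeasure lebesgue ?X"
      by (rule nn_integral_cmult_indicator[OF Xm])
    also have "(\<integral>\<^sup>+y. (\<Sum>a\<in>A. h a y) \<partial>lebesgue) = (\<Sum>a\<in>A. \<integral>\<^sup>+y. h a y \<partial>lebesgue)" by (rule nn_integral_sum) (rule hm)
    also have "\<dots> \<le> (\<Sum>a\<in>A. ennreal ((e a + 2 * \<delta>) * \<rho> ^ CARD('d)))"
      unfolding h_def by (intro sum_mono w(4))
    finally have "(\<integral>\<^sup>+y. W (y /\<^sub>R \<epsilon>) (Z y) * indicator \<Omega> y \<partial>lebesgue) \<le>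
        (\<Sum>a\<in>A. ennreal ((e a + 2 * \<delta>) * \<rho> ^ CARD('d))) + ennreal M * emeasure lebesgue ?X"
      by (simp add: add_right_mono)
    then show ?case using lg v0 close by blast
  qed
qed

text \<open>The L1 error stems from the factor \<open>t\<close> and from the side of the cubes; the
  energy error stems from a multiple of \<delta> per unit volume on the cubes, from the offset of
  the grid, and from the part of \<Omega> outside \<open>S\<close>.\<close>

lemma approx_recovery:
  fixes u :: "real^'d \<Rightarrow> real^'m"
  assumes \<Omega>: "open \<Omega>" "bounded \<Omega>" and u: "u \<in> W1inf0 \<Omega>" and fin: "J_hom \<Omega> W u < \<infinity>" and \<delta>0: "\<delta>0 > 0"
  shows "\<forall>\<^sub>F \<epsilon> in at_right 0. \<exists>v\<in>W1inf \<Omega>. (\<integral>\<^sup>+x. ennreal (norm (v x - u x)) \<partial>lebesgue_on \<Omega>) \<le> ennreal \<delta>0 \<and>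
     J \<Omega> W \<epsilon> v \<le> J_hom \<Omega> W u + ennreal \<delta>0"
proof -
  let ?U = "weak_gradient \<Omega> u"
  obtain f where f: "lip_grad \<Omega> f ?U" and fu: "AE x in lebesgue. x \<in> \<Omega> \<longrightarrow> f x = u x" and f0: "\<And>x. x \<notin> \<Omega> \<Longrightarrow> f x = 0"
    by (rule W1inf0_obtain_lip_grad[OF \<Omega>(1) u]) (rule that)
  have \<Omega>l: "\<Omega> \<in> lmeasurable" using \<Omega> by (intro lmeasurable_open)
  then have \<Omega>m: "\<Omega> \<in> sets lebesgue" by auto
  define Vol where "Vol = measure lebesgue \<Omega>"
  have Vol: "Vol \<ge> 0" "emeasure lebesgue \<Omega> = ennreal Vol"
    using \<Omega>l by (auto simp: Vol_def emeasure_eq_measure2)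
  \<comment> \<open>Energy budget: one \<delta> for the offset, one for the part of \<Omega> outside
    \<open>S\<close>, and \<open>3 * \<delta>\<close> per unit volume, made of the gap in
    \<open>e\<close> and the \<open>2 * \<delta>\<close> of the recovery on each cube.\<close>
  define \<delta> where "\<delta> = \<delta>0 / (2 + 3 * Vol)"
  have \<delta>: "\<delta> > 0" using \<delta>0 Vol by (simp add: \<delta>_def)
  have \<delta>e: "2 * \<delta> + 3 * \<delta> * Vol = \<delta>0"
  proof -
    have "2 * \<delta> + 3 * \<delta> * Vol = \<delta> * (2 + 3 * Vol)" by (simp add: algebra_simps)
    then show ?thesis using Vol by (simp add: \<delta>_def)
  qed
  obtain L where "L-lipschitz_on UNIV f" using f by (auto simp: lip_grad_def)
  then have cf: "continuous_on UNIV f" by (rule lipschitz_on_continuous_on)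
  have "bounded (f ` closure \<Omega>)"
    using \<Omega>(2) by (intro compact_imp_bounded compact_continuous_image continuous_on_subset[OF cf]) auto
  then obtain K0 where K0: "\<And>x. x \<in> closure \<Omega> \<Longrightarrow> norm (f x) \<le> K0" by (auto simp: bounded_iff)
  define K where "K = max 0 K0"
  have K: "norm (f x) \<le> K" "K \<ge> 0" for x
    using K0[of x] f0[of x] closure_subset[of \<Omega>] by (cases "x \<in> \<Omega>") (auto simp: K_def)
  obtain R where R: "\<And>x. x \<in> \<Omega> \<Longrightarrow> norm x < R"
  proof -
    from \<Omega>(2) obtain R0 where "\<And>x. x \<in> \<Omega> \<Longrightarrow> norm x \<le> R0" by (auto simp: bounded_iff)
    then have "\<And>x. x \<in> \<Omega> \<Longrightarrow> norm x < R0 + 1" by fastforce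
    then show ?thesis by (rule that)
  qed
  obtain \<eta> :: real where \<eta>: "\<eta> > 0" "\<And>x \<xi> t. \<xi> \<in> eff_dom (W x) \<Longrightarrow> t \<in> {0..<1} \<Longrightarrow> 1 - t \<le> \<eta> \<Longrightarrow> W x (t *\<^sub>R \<xi>) \<le> W x \<xi> + ennreal \<delta>"
    using radial[OF \<delta>] by blast
  \<comment> \<open>Keeps \<open>t = 1 - \<theta>\<close> positive and within the range of the
    radial condition, and keeps the L1 cost \<open>\<theta> * K * Vol\<close> of the factor
    \<open>t\<close> at most \<open>\<delta>0 / 2\<close>.\<close>
  define \<theta> where "\<theta> = min (1/2) (min \<eta> (\<delta>0 / (2 * (K * Vol + 1))))"
  have KV: "K * Vol \<ge> 0" using K Vol by simp
  have \<theta>: "0 < \<theta>" "\<theta> < 1" "\<theta> \<le> \<eta>" using \<eta> \<delta>0 KV by (auto simp: \<theta>_def)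
  have \<theta>K: "\<theta> * K * Vol \<le> \<delta>0 / 2"
  proof -
    have "\<theta> * (K * Vol) \<le> \<theta> * (K * Vol + 1)" using \<theta> by (intro mult_left_mono) auto
    also have "\<dots> \<le> \<delta>0 / (2 * (K * Vol + 1)) * (K * Vol + 1)" using KV by (intro mult_right_mono) (auto simp: \<theta>_def)
    also have "\<dots> = \<delta>0 / 2"
    proof -
      have h: "\<delta>0 / (2 * q) * q = \<delta>0 / 2" if "q > 0" for q :: real using that by simp
      show ?thesis by (rule h) (use KV in simp)
    qed
    finally show ?thesis by (simp add: mult.assoc)
  qed
  define t where "t = 1 - \<theta>"
  have t: "0 < t" "t < 1" using \<theta> by (auto simp: t_def)
  have rad: "W x (t *\<^sub>R \<xi>) \<le> W x \<xi> + ennreal \<delta>" if "\<xi> \<in> eff_dom (W x)" for x \<xi>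
    using that t \<theta> by (intro \<eta>(2)) (auto simp: t_def)
  obtain M r where M: "M \<ge> 0" "r > 0"
    "AE x in lebesgue. \<forall>p q. p \<in> closure C \<longrightarrow> norm q \<le> r \<longrightarrow> W x (t *\<^sub>R p + q) \<le> ennreal M"
    by (rule bounded_on_shrunk[OF t])
  obtain \<kappa> :: real where \<kappa>: "0 < \<kappa>" "\<kappa> < 1/2" and \<kappa>M: "M * (1 - (1 - 2 * \<kappa>) ^ CARD('d)) < \<delta>"
    by (rule thin_margin[OF \<delta> M(1)])
  obtain \<psi> :: "real^'d \<Rightarrow> real" and g \<Lambda> where \<psi>:
    "\<And>x. (\<psi> has_derivative (\<lambda>h. h \<bullet> g x)) (at x)" "\<And>x. 0 \<le> \<psi> x" "\<And>x. \<psi> x \<le> 1"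
    "\<And>x. x \<notin> box 0 1 \<Longrightarrow> \<psi> x = 0" "\<And>x. x \<in> cbox (\<kappa> *\<^sub>R 1) ((1 - \<kappa>) *\<^sub>R 1) \<Longrightarrow> \<psi> x = 1"
    "\<Lambda> \<ge> 0" "\<And>x. norm (g x) \<le> \<Lambda>" "\<And>x y. \<bar>\<psi> x - \<psi> y\<bar> \<le> \<Lambda> * norm (x - y)"
    by (rule cube_cutoff[OF \<kappa>(1)]) auto
  define \<sigma> where "\<sigma> = r / (\<Lambda> + 1)"
  have \<sigma>: "\<sigma> > 0" using M(2) \<psi>(6) by (simp add: \<sigma>_def)
  have "\<sigma> * \<Lambda> \<le> r" using M(2) \<psi>(6) by (simp add: \<sigma>_def field_simps)
  moreover have "t * (\<sigma> * \<Lambda>) \<le> \<sigma> * \<Lambda>" using t \<sigma> \<psi>(6) by (intro mult_left_le_one_le) auto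
  ultimately have \<sigma>r: "t * (\<sigma> * \<Lambda>) \<le> r" by linarith

  \<comment> \<open>The gradient is measurable only on \<Omega>; the indicator makes
    \<open>q\<close> measurable on the whole space without changing it on \<Omega>.\<close>
  define q where "q = (\<lambda>x. W_hom W (indicator \<Omega> x *\<^sub>R ?U x))"
  have Wh: "W_hom W \<in> borel_measurable borel"
    unfolding W_hom_def by (rule lower_semicontinuous_measurable[OF lower_semicontinuous_lsc_envelope])
  have qm: "q \<in> borel_measurable lebesgue"
    unfolding q_def by (rule measurable_compose[OF lip_grad_measurable[OF f \<Omega>(1)] Wh])
  have qU: "x \<in> \<Omega> \<Longrightarrow> q x = W_hom W (?U x)" for x by (simp add: q_def)
  have J: "J_hom \<Omega> W u = (\<integral>\<^sup>+x. q x * indicator \<Omega> x \<partial>lebesgue)"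
    using u unfolding J_hom_def by (simp add: nn_integral_lebesgue_on[OF \<Omega>(1)]) (intro nn_integral_cong, simp add: indicator_def qU)
  have qfin: "AE x in lebesgue. x \<in> \<Omega> \<longrightarrow> q x < \<infinity>"
  proof -
    have "AE x in lebesgue. q x * indicator \<Omega> x \<noteq> \<infinity>"
      using fin qm \<Omega>m unfolding J by (intro nn_integral_noteq_infinite borel_measurable_times_ennreal borel_measurable_indicator) auto
    then show ?thesis by (rule eventually_mono) (auto simp: less_top)
  qed
  have UC: "AE x in lebesgue. x \<in> \<Omega> \<longrightarrow> ?U x \<in> closure C"
    using qfin by (rule eventually_mono) (use W_hom_outside qU in fastforce)

  let ?\<rho> = "\<lambda>n::nat. 1 / (real n + 1)"
  have \<rho>n: "?\<rho> n > 0" for n by simp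
  have \<rho>0: "?\<rho> \<longlonglongrightarrow> 0" using LIMSEQ_inverse_real_of_nat by (simp add: inverse_eq_divide add.commute)
  have \<sigma>2: "\<sigma> / 2 > 0" using \<sigma> by simp
  have "(\<lambda>n. M * measure lebesgue (\<Omega> - affine_points \<Omega> f ?U (\<sigma> / 2) (?\<rho> n))) \<longlonglongrightarrow> M * 0"
    by (rule tendsto_mult_left[OF affine_points_measure[OF f \<Omega> \<sigma>2 \<rho>n \<rho>0]])
  then have ev1: "\<forall>\<^sub>F n in sequentially. M * measure lebesgue (\<Omega> - affine_points \<Omega> f ?U (\<sigma> / 2) (?\<rho> n)) < \<delta>"
    by (rule order_tendstoD(2)) (use \<delta> in simp)
  have "(\<lambda>n. ((\<sigma> + 1) * Vol) * ?\<rho> n) \<longlonglongrightarrow> ((\<sigma> + 1) * Vol) * 0"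
    by (rule tendsto_mult_left[OF \<rho>0])
  then have ev2: "\<forall>\<^sub>F n in sequentially. ((\<sigma> + 1) * Vol) * ?\<rho> n < \<delta>0 / 2"
    by (rule order_tendstoD(2)) (use \<delta>0 in simp)
  obtain n where n: "M * measure lebesgue (\<Omega> - affine_points \<Omega> f ?U (\<sigma> / 2) (?\<rho> n)) < \<delta>" "((\<sigma> + 1) * Vol) * ?\<rho> n < \<delta>0 / 2"
    using eventually_happens'[OF sequentially_bot eventually_conj[OF ev1 ev2]] by blast
  define \<rho> where "\<rho> = ?\<rho> n"
  have \<rho>: "\<rho> > 0" by (simp add: \<rho>_def)
  note n = n[folded \<rho>_def]
  let ?P = "affine_points \<Omega> f ?U (\<sigma> / 2) \<rho>"
  \<comment> \<open>Admissible corners: nearly affine and of finite density. Finiteness removes only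
    a null set, because the energy of \<open>u\<close> is finite.\<close>
  define S where "S = ?P \<inter> {x. q x < \<infinity>}"
  have Pm: "?P \<in> sets lebesgue" by (rule affine_points_measurable[OF f \<Omega>(1) \<rho>])
  have "{x \<in> space lebesgue. q x < \<infinity>} \<in> sets lebesgue" by (rule borel_measurable_less[OF qm]) simp
  then have Sm: "S \<in> sets lebesgue" using Pm by (simp add: S_def)
  have S\<Omega>: "S \<subseteq> \<Omega>" by (auto simp: S_def affine_points_def)
  have Sl: "S \<in> lmeasurable" by (rule fmeasurableI2[OF \<Omega>l S\<Omega> Sm])

  define F where "F = (\<lambda>x. enn2real (q x))"
  have Fm: "F \<in> borel_measurable lebesgue" unfolding F_def using qm by simp
  have F: "F x \<ge> 0" for x by (simp add: F_def)
  have FS: "x \<in> S \<Longrightarrow> q x = ennreal (F x)" for x by (simp add: F_def S_def less_top)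
  have FI: "(\<integral>\<^sup>+x. ennreal (F x * indicator S x) \<partial>lebesgue) \<le> J_hom \<Omega> W u"
    unfolding J using S\<Omega> by (intro nn_integral_mono) (auto simp: indicator_def FS)
  have Fi: "integrable lebesgue (\<lambda>x. F x * indicator S x)"
  proof (rule integrableI_nonneg)
    show "(\<lambda>x. F x * indicator S x) \<in> borel_measurable lebesgue"
      using Fm Sm by (intro borel_measurable_times borel_measurable_indicator)
    show "AE x in lebesgue. 0 \<le> F x * indicator S x" using F by simp
    show "(\<integral>\<^sup>+x. ennreal (F x * indicator S x) \<partial>lebesgue) < \<infinity>" using FI fin by (rule le_less_trans)
  qed
  define I where "I = (\<integral>x. F x * indicator S x \<partial>lebesgue)"
  have I: "ennreal I \<le> J_hom \<Omega> W u"
    using FI nn_integral_eq_integral[OF Fi] F by (simp add: I_def)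
  have Si: "integrable lebesgue (\<lambda>x. M * indicator S x)"
    using Sl by (intro integrable_mult_right) (auto simp: fmeasurable_def)
  \<comment> \<open>Subtracting \<open>M\<close> lets one offset control two things at once: the
    energy on the chosen cubes plus \<open>M\<close> times the uncovered volume is the Riemann sum
    of \<open>F - M\<close> over the chosen corners plus \<open>M * Vol\<close>, up to
    \<open>3 * \<delta>\<close> per unit of covered volume. The subtracted integral
    \<open>M * measure lebesgue S\<close> then cancels \<open>M * Vol\<close> up to
    \<delta>.\<close>
  define G where "G = (\<lambda>x. F x * indicator S x - M * indicator S x)"
  have Gi: "integrable lebesgue G" unfolding G_def by (rule Bochner_Integration.integrable_diff[OF Fi Si])
  have "(\<integral>x. G x \<partial>lebesgue) = I - (\<integral>x. M * indicator S x \<partial>lebesgue)"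
    unfolding G_def I_def by (rule Bochner_Integration.integral_diff[OF Fi Si])
  also have "(\<integral>x. M * indicator S x \<partial>lebesgue) = M * measure lebesgue S" by simp
  finally have GI: "(\<integral>x. G x \<partial>lebesgue) = I - M * measure lebesgue S" .
  define B where "B = \<lceil>R / \<rho>\<rceil>"
  have "R / \<rho> \<le> of_int B" by (simp add: B_def)
  then have B: "R \<le> \<rho> * of_int B" using \<rho> by (simp add: pos_divide_le_eq mult.commute)
  have supp: "\<bar>x $ i\<bar> < \<rho> * of_int B" if "G x \<noteq> 0" for x i
  proof -
    have "x \<in> S" using that by (auto simp: G_def indicator_def split: if_splits)
    then have "norm x < R" using R S\<Omega> by blast
    then show ?thesis using component_le_norm_cart[of x i] B by linarith
  qed
  obtain s where s: "\<rho> ^ CARD('d) * (\<Sum>k\<in>grid B. G (s + \<rho> *\<^sub>R int_vec k)) \<le> (\<integral>x. G x \<partial>lebesgue) + \<delta>"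
    using grid_offset[OF Gi \<rho> \<delta> supp] by blast
  let ?p = "\<lambda>k. s + \<rho> *\<^sub>R int_vec k"
  \<comment> \<open>Equal corners carry the same cube, so disjointness of the grid cubes gives the
    injectivity that reindexing by corners requires.\<close>
  have inj: "k = l" if "?p k = ?p l" for k l
  proof -
    have "?p k + (\<rho> / 2) *\<^sub>R 1 \<in> box (?p k) (?p k + \<rho> *\<^sub>R 1)" using \<rho> by (simp add: mem_box_cart)
    then obtain y where "y \<in> box (?p k) (?p k + \<rho> *\<^sub>R 1)" by blast
    from grid_cubes_disjoint[OF \<rho> this this[unfolded that]] show ?thesis .
  qed
  define A where "A = ?p ` {k \<in> grid B. ?p k \<in> S}"
  have Af: "finite A" unfolding A_def by (intro finite_imageI finite_Collect_conjI disjI1) (simp add: finite_grid)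
  have AS: "A \<subseteq> S" by (auto simp: A_def)
  let ?Q = "\<lambda>a. box a (a + \<rho> *\<^sub>R 1) :: (real^'d) set"
  have AQ: "?Q a \<subseteq> \<Omega>" if "a \<in> A" for a
    using that AS box_subset_cbox by (fastforce simp: S_def affine_points_def simp del: mem_box)
  have Adis: "a = b" if "a \<in> A" "b \<in> A" "y \<in> ?Q a" "y \<in> ?Q b" for a b y
    using that grid_cubes_disjoint[OF \<rho>] by (auto simp: A_def simp del: mem_box)
  have near: "norm (f (a + h) - f a - ?U a *v h) \<le> \<sigma> / 2 * \<rho>" if "a \<in> A" "h \<in> box 0 (\<rho> *\<^sub>R 1)" for a h
  proof -
    have "a \<in> ?P" using that(1) AS by (auto simp: S_def)
    then show ?thesis using that(2) unfolding affine_points_def by blast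
  qed
  \<comment> \<open>Strictly above the density, since an envelope value is undercut by
    \<open>HW\<close> at nearby matrices only after it has been enlarged.\<close>
  define e where "e = (\<lambda>a. F a + \<delta>)"
  have e: "e a \<ge> 0" for a using F[of a] \<delta> by (simp add: e_def)
  have eW: "W_hom W (?U a) < ennreal (e a)" if "a \<in> A" for a
  proof -
    have a: "a \<in> S" "a \<in> \<Omega>" using that AS S\<Omega> by auto
    have "W_hom W (?U a) = ennreal (F a)" using FS[OF a(1)] qU[OF a(2)] by simp
    also have "\<dots> < ennreal (e a)" using F[of a] \<delta> by (simp add: e_def ennreal_lessI)
    finally show ?thesis .
  qed
  have "(\<Sum>k\<in>grid B. G (?p k)) = (\<Sum>k\<in>{k \<in> grid B. ?p k \<in> S}. F (?p k) - M)"
    unfolding sum.inter_filter[OF finite_grid] by (intro sum.cong refl) (simp add: G_def)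
  also have "\<dots> = (\<Sum>a\<in>A. F a - M)"
    unfolding A_def by (subst sum.reindex) (auto intro: inj_onI inj)
  finally have sumA: "\<rho> ^ CARD('d) * (\<Sum>a\<in>A. F a - M) \<le> I - M * measure lebesgue S + \<delta>"
    using s unfolding GI by simp
  define c where "c = real (card A) * \<rho> ^ CARD('d)"
  have union: "measure lebesgue (\<Union>a\<in>A. ?Q a) = c"
  proof -
    have "measure lebesgue (\<Union>a\<in>A. ?Q a) = (\<Sum>a\<in>A. measure lebesgue (?Q a))"
      using Adis by (intro measure_finite_Union[OF Af]) (auto simp: disjoint_family_on_def measure_cube(3)[OF less_imp_le[OF \<rho>]] simp del: mem_box)
    also have "\<dots> = (\<Sum>a\<in>A. \<rho> ^ CARD('d))" using \<rho> by (intro sum.cong refl measure_cube(1)) simp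
    finally show ?thesis by (simp add: c_def)
  qed
  have Um: "(\<Union>a\<in>A. ?Q a) \<in> sets lebesgue" by (intro sets.finite_UN Af) simp
  have U\<Omega>: "(\<Union>a\<in>A. ?Q a) \<subseteq> \<Omega>" using AQ by blast
  have cV: "c \<le> Vol" unfolding union[symmetric] Vol_def by (rule measure_mono_fmeasurable[OF U\<Omega> Um \<Omega>l])
  have rest: "emeasure lebesgue (\<Omega> - (\<Union>a\<in>A. ?Q a)) = ennreal (Vol - c)"
  proof -
    have "\<Omega> - (\<Union>a\<in>A. ?Q a) \<in> lmeasurable" by (rule fmeasurable_Diff[OF \<Omega>l Um])
    then show ?thesis using measurable_measure_Diff[OF \<Omega>l Um U\<Omega>] by (simp add: emeasure_eq_measure2 Vol_def union)
  qed
  have MS: "M * Vol - M * measure lebesgue S < \<delta>"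
  proof -
    have "measure lebesgue (\<Omega> - S) = measure lebesgue (\<Omega> - ?P)"
    proof (rule measure_eq_AE)
      show "AE x in lebesgue. x \<in> \<Omega> - S \<longleftrightarrow> x \<in> \<Omega> - ?P"
        using qfin by (rule eventually_mono) (auto simp: S_def)
    qed (use \<Omega>m Sm Pm in auto)
    moreover have "measure lebesgue (\<Omega> - S) = Vol - measure lebesgue S"
      unfolding Vol_def by (rule measurable_measure_Diff[OF \<Omega>l Sm S\<Omega>])
    ultimately show ?thesis using n(1) by (simp only: right_diff_distrib[symmetric])
  qed
  have total: "(\<Sum>a\<in>A. (e a + 2 * \<delta>) * \<rho> ^ CARD('d)) + M * (Vol - c) \<le> I + \<delta>0"
  proof -
    have "(\<Sum>a\<in>A. (e a + 2 * \<delta>) * \<rho> ^ CARD('d)) = (\<Sum>a\<in>A. \<rho> ^ CARD('d) * (F a - M) + (3 * \<delta> + M) * \<rho> ^ CARD('d))"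
      by (intro sum.cong refl) (simp add: e_def algebra_simps)
    also have "\<dots> = \<rho> ^ CARD('d) * (\<Sum>a\<in>A. F a - M) + (3 * \<delta> + M) * c"
      by (simp add: sum.distrib sum_distrib_left c_def)
    finally have "(\<Sum>a\<in>A. (e a + 2 * \<delta>) * \<rho> ^ CARD('d)) + M * (Vol - c) =
      \<rho> ^ CARD('d) * (\<Sum>a\<in>A. F a - M) + 3 * \<delta> * c + M * Vol" by (simp add: algebra_simps)
    moreover have "3 * \<delta> * c \<le> 3 * \<delta> * Vol" using cV \<delta> by (intro mult_left_mono) auto
    ultimately show ?thesis using sumA MS \<delta>e by linarith
  qed
  have energy: "(\<Sum>a\<in>A. ennreal ((e a + 2 * \<delta>) * \<rho> ^ CARD('d))) + ennreal M * emeasure lebesgue (\<Omega> - (\<Union>a\<in>A. ?Q a)) \<le>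
     J_hom \<Omega> W u + ennreal \<delta>0"
  proof -
    have "(\<Sum>a\<in>A. ennreal ((e a + 2 * \<delta>) * \<rho> ^ CARD('d))) + ennreal M * emeasure lebesgue (\<Omega> - (\<Union>a\<in>A. ?Q a)) =
      ennreal ((\<Sum>a\<in>A. (e a + 2 * \<delta>) * \<rho> ^ CARD('d)) + M * (Vol - c))"
    proof -
      have nn: "0 \<le> (e a + 2 * \<delta>) * \<rho> ^ CARD('d)" for a using e[of a] \<delta> \<rho> by simp
      have "(\<Sum>a\<in>A. ennreal ((e a + 2 * \<delta>) * \<rho> ^ CARD('d))) = ennreal (\<Sum>a\<in>A. (e a + 2 * \<delta>) * \<rho> ^ CARD('d))"
        by (rule sum_ennreal) (rule nn)
      moreover have "ennreal M * ennreal (Vol - c) = ennreal (M * (Vol - c))" using M(1) cV by (simp add: ennreal_mult)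
      ultimately show ?thesis unfolding rest using M(1) cV by (simp only:) (intro ennreal_plus[symmetric] sum_nonneg nn mult_nonneg_nonneg, auto)
    qed
    also have "\<dots> \<le> ennreal (I + \<delta>0)" by (rule ennreal_leI[OF total])
    also have "\<dots> = ennreal I + ennreal \<delta>0"
      using \<delta>0 F by (intro ennreal_plus) (auto simp: I_def intro!: integral_nonneg_AE)
    also have "\<dots> \<le> J_hom \<Omega> W u + ennreal \<delta>0" by (intro add_right_mono I)
    finally show ?thesis .
  qed
  have ev: "\<forall>\<^sub>F \<epsilon> in at_right 0. \<exists>w V. lip_grad \<Omega> w V \<and> (\<forall>y. y \<notin> \<Omega> \<longrightarrow> w y = 0) \<and>
      (\<forall>y. norm (w y - t *\<^sub>R f y) \<le> (\<sigma> + 1) * \<rho>) \<and>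
      (\<integral>\<^sup>+y. W (y /\<^sub>R \<epsilon>) (V y) * indicator \<Omega> y \<partial>lebesgue) \<le>
        (\<Sum>a\<in>A. ennreal ((e a + 2 * \<delta>) * \<rho> ^ CARD('d))) + ennreal M * emeasure lebesgue (\<Omega> - (\<Union>a\<in>A. ?Q a))"
    by (rule grid_recovery[OF t rad \<delta> M \<kappa> \<kappa>M \<psi> \<Omega>(1) f f0 UC \<rho> \<sigma>r \<sigma> Af AQ Adis near e eW])
  show ?thesis
    using ev
  proof (rule eventually_mono)
    fix \<epsilon>
    assume "\<exists>w V. lip_grad \<Omega> w V \<and> (\<forall>y. y \<notin> \<Omega> \<longrightarrow> w y = 0) \<and>
      (\<forall>y. norm (w y - t *\<^sub>R f y) \<le> (\<sigma> + 1) * \<rho>) \<and>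
      (\<integral>\<^sup>+y. W (y /\<^sub>R \<epsilon>) (V y) * indicator \<Omega> y \<partial>lebesgue) \<le>
        (\<Sum>a\<in>A. ennreal ((e a + 2 * \<delta>) * \<rho> ^ CARD('d))) + ennreal M * emeasure lebesgue (\<Omega> - (\<Union>a\<in>A. ?Q a))"
    then obtain w V where w: "lip_grad \<Omega> w V" "\<And>y. y \<notin> \<Omega> \<Longrightarrow> w y = 0" "\<And>y. norm (w y - t *\<^sub>R f y) \<le> (\<sigma> + 1) * \<rho>"
      and E: "(\<integral>\<^sup>+y. W (y /\<^sub>R \<epsilon>) (V y) * indicator \<Omega> y \<partial>lebesgue) \<le>
        (\<Sum>a\<in>A. ennreal ((e a + 2 * \<delta>) * \<rho> ^ CARD('d))) + ennreal M * emeasure lebesgue (\<Omega> - (\<Union>a\<in>A. ?Q a))"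
      by blast
    note w0 = lip_grad_W1inf0[OF w(1) \<Omega> w(2)]
    have w1: "w \<in> W1inf0 \<Omega>" by (rule w0(1)) auto
    have wV: "AE x in lebesgue. x \<in> \<Omega> \<longrightarrow> weak_gradient \<Omega> w x = V x" by (rule w0(2)) auto
    have "J \<Omega> W \<epsilon> w = (\<integral>\<^sup>+y. W (y /\<^sub>R \<epsilon>) (V y) * indicator \<Omega> y \<partial>lebesgue)"
      unfolding J_def nn_integral_lebesgue_on[OF \<Omega>(1)] using w1
      by (simp, intro nn_integral_cong_AE, use wV in \<open>rule eventually_mono\<close>) (simp add: indicator_def)
    then have "J \<Omega> W \<epsilon> w \<le> J_hom \<Omega> W u + ennreal \<delta>0" using E energy by simp
    moreover have "(\<integral>\<^sup>+x. ennreal (norm (w x - u x)) \<partial>lebesgue_on \<Omega>) \<le> ennreal \<delta>0"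
    proof -
      \<comment> \<open>The first term bounds the corrections on the cubes; the second accounts for
        their being added around \<open>t *\<^sub>R f\<close> rather than \<open>f\<close>.\<close>
      define D where "D = (\<sigma> + 1) * \<rho> + \<theta> * K"
      have D: "D \<ge> 0" using \<sigma> \<rho> \<theta> K(2) by (simp add: D_def)
      have wf: "norm (w x - f x) \<le> D" for x
      proof -
        have "w x - f x = (w x - t *\<^sub>R f x) + (- \<theta>) *\<^sub>R f x" by (simp add: t_def algebra_simps)
        then have "norm (w x - f x) \<le> norm (w x - t *\<^sub>R f x) + norm ((- \<theta>) *\<^sub>R f x)" by (simp only: norm_triangle_ineq)
        moreover have "norm ((- \<theta>) *\<^sub>R f x) \<le> \<theta> * K" using \<theta> K(1)[of x] by simp
        ultimately show ?thesis using w(3)[of x] by (simp add: D_def)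
      qed
      have "(\<integral>\<^sup>+x. ennreal (norm (w x - u x)) \<partial>lebesgue_on \<Omega>) = (\<integral>\<^sup>+x. ennreal (norm (w x - u x)) * indicator \<Omega> x \<partial>lebesgue)"
        by (rule nn_integral_lebesgue_on[OF \<Omega>(1)])
      also have "\<dots> \<le> (\<integral>\<^sup>+x. ennreal D * indicator \<Omega> x \<partial>lebesgue)"
      proof (rule nn_integral_mono_AE, use fu in \<open>rule eventually_mono\<close>)
        fix x assume "x \<in> \<Omega> \<longrightarrow> f x = u x"
        then show "ennreal (norm (w x - u x)) * indicator \<Omega> x \<le> ennreal D * indicator \<Omega> x"
          using wf[of x] by (cases "x \<in> \<Omega>") (auto intro: ennreal_leI)
      qed
      also have "\<dots> = ennreal D * emeasure lebesgue \<Omega>" by (rule nn_integral_cmult_indicator[OF \<Omega>m])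
      also have "\<dots> = ennreal (D * Vol)" using D Vol(1) unfolding Vol(2) by (simp add: ennreal_mult)
      also have "\<dots> \<le> ennreal \<delta>0"
      proof (rule ennreal_leI)
        have "D * Vol = ((\<sigma> + 1) * Vol) * \<rho> + \<theta> * K * Vol" by (simp add: D_def algebra_simps)
        then show "D * Vol \<le> \<delta>0" using n(2) \<theta>K by linarith
      qed
      finally show ?thesis .
    qed
    moreover have "w \<in> W1inf \<Omega>" using w1 by (simp add: W1inf0_def)
    ultimately show "\<exists>v\<in>W1inf \<Omega>. (\<integral>\<^sup>+x. ennreal (norm (v x - u x)) \<partial>lebesgue_on \<Omega>) \<le> ennreal \<delta>0 \<and>
     J \<Omega> W \<epsilon> v \<le> J_hom \<Omega> W u + ennreal \<delta>0" by blast
  qed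
qed

end

section \<open>Diagonal argument and conclusion\<close>

text \<open>For each \<epsilon> the largest solvable level \<open>n\<close> with
  \<open>real n \<le> 1 / \<epsilon>\<close> is taken. The cap makes a maximum exist and still
  admits every level for small \<epsilon>; monotonicity lets the witness serve all lower
  levels.\<close>

lemma diagonal_choice:
  fixes P :: "nat \<Rightarrow> real \<Rightarrow> 'a \<Rightarrow> bool"
  assumes ex: "\<And>n. \<forall>\<^sub>F \<epsilon> in at_right 0. \<exists>v. P n \<epsilon> v" and mono: "\<And>m n \<epsilon> v. m \<le> n \<Longrightarrow> P n \<epsilon> v \<Longrightarrow> P m \<epsilon> v"
  obtains v where "\<And>n. \<forall>\<^sub>F \<epsilon> in at_right 0. P n \<epsilon> (v \<epsilon>)"
proof -
  define N where "N = (\<lambda>\<epsilon>. {n. real n \<le> 1 / \<epsilon> \<and> (\<exists>v. P n \<epsilon> v)})"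
  define v where "v = (\<lambda>\<epsilon>. SOME v. P (Max (N \<epsilon>)) \<epsilon> v)"
  have "\<forall>\<^sub>F \<epsilon> in at_right 0. P n \<epsilon> (v \<epsilon>)" for n
  proof -
    have "\<forall>\<^sub>F \<epsilon> in at_right (0::real). \<epsilon> < 1 / (real n + 1)" by (intro order_tendstoD(2)[OF tendsto_ident_at]) simp
    with ex[of n] eventually_at_right_less[of "0::real"] show ?thesis
    proof eventually_elim
      case (elim \<epsilon>)
      have "N \<epsilon> \<subseteq> {..nat \<lfloor>1 / \<epsilon>\<rfloor>}" by (auto simp: N_def le_nat_floor)
      then have fin: "finite (N \<epsilon>)" by (rule finite_subset) simp
      have "real n * \<epsilon> \<le> (real n + 1) * \<epsilon>" using elim(2) by (intro mult_right_mono) auto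
      also have "\<dots> \<le> 1" using elim(3) by (simp add: pos_less_divide_eq mult.commute)
      finally have "real n \<le> 1 / \<epsilon>" using elim(2) by (simp add: pos_le_divide_eq)
      then have n: "n \<in> N \<epsilon>" using elim(1) by (simp add: N_def)
      then have "Max (N \<epsilon>) \<in> N \<epsilon>" using fin by (intro Max_in) auto
      then have "\<exists>v. P (Max (N \<epsilon>)) \<epsilon> v" by (simp add: N_def)
      then have "P (Max (N \<epsilon>)) \<epsilon> (v \<epsilon>)" unfolding v_def by (rule someI_ex)
      then show ?case by (rule mono[OF Max_ge[OF fin n]])
    qed
  qed
  then show thesis by (rule that)
qed

context homogenization
begin

text \<open>A finite value of \<open>J_hom\<close> puts \<open>u\<close> into \<open>W1inf0\<close>,
  and the approximate recoveries with error \<open>1 / (real n + 1)\<close> are combined into one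
  family by the diagonal choice. An infinite value leaves nothing to prove.\<close>

lemma limsup_inequality:
  fixes u :: "real^'d \<Rightarrow> real^'m"
  assumes \<Omega>: "open \<Omega>" "bounded \<Omega>" and u: "u \<in> W1inf \<Omega>"
  shows "Gamma_limsup \<Omega> (J \<Omega> W) u \<le> J_hom \<Omega> W u"
proof (cases "J_hom \<Omega> W u < \<infinity>")
  case True
  have u0: "u \<in> W1inf0 \<Omega>" using True by (auto simp: J_hom_def split: if_splits)
  define D where "D = (\<lambda>v. \<integral>\<^sup>+x. ennreal (norm (v x - u x)) \<partial>lebesgue_on \<Omega>)"
  define P where "P = (\<lambda>(n::nat) \<epsilon> v. v \<in> W1inf \<Omega> \<and> D v \<le> ennreal (1 / (real n + 1)) \<and>
     J \<Omega> W \<epsilon> v \<le> J_hom \<Omega> W u + ennreal (1 / (real n + 1)))"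
  have "\<forall>\<^sub>F \<epsilon> in at_right 0. \<exists>v. P n \<epsilon> v" for n
  proof -
    have "0 < 1 / (real n + 1)" by simp
    from approx_recovery[OF \<Omega> u0 True this] show ?thesis
      by (rule eventually_mono) (auto simp: P_def D_def)
  qed
  moreover have "P m \<epsilon> v" if mn: "m \<le> n" and Pn: "P n \<epsilon> v" for m n \<epsilon> v
  proof -
    have "ennreal (1 / (real n + 1)) \<le> ennreal (1 / (real m + 1))"
      using mn by (intro ennreal_leI divide_left_mono) auto
    then show ?thesis using Pn add_left_mono[of _ _ "J_hom \<Omega> W u"] unfolding P_def by (meson order_trans)
  qed
  ultimately obtain v0 where v0: "\<And>n. \<forall>\<^sub>F \<epsilon> in at_right 0. P n \<epsilon> (v0 \<epsilon>)" by (rule diagonal_choice[of P]) (blast+)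
  \<comment> \<open>A family has to lie in \<open>W1inf\<close> for every \<epsilon>, while the
    diagonal choice is known to do so only for small \<epsilon>; elsewhere \<open>u\<close> itself
    is used.\<close>
  define v where "v = (\<lambda>\<epsilon>. if v0 \<epsilon> \<in> W1inf \<Omega> then v0 \<epsilon> else u)"
  have v: "\<forall>\<^sub>F \<epsilon> in at_right 0. P n \<epsilon> (v \<epsilon>)" for n
    using v0[of n] by (rule eventually_mono) (simp add: v_def P_def)
  have small: "\<exists>n. 1 / (real n + 1) < e" if "e > 0" for e :: real
    using reals_Archimedean[OF that] by (simp add: inverse_eq_divide add.commute)
  have "((\<lambda>\<epsilon>. D (v \<epsilon>)) \<longlongrightarrow> 0) (at_right 0)"
  proof (rule order_tendstoI)
    fix a :: ennreal assume "0 < a"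
    then obtain b where b: "0 < b" "b < a" using dense by blast
    then have "b < top" by (simp add: less_le_trans[OF _ top_greatest])
    then obtain e where e: "b = ennreal e" "e > 0" using b(1) by (cases b) auto
    obtain n where "1 / (real n + 1) < e" using small[OF e(2)] ..
    then have "ennreal (1 / (real n + 1)) \<le> b" unfolding e(1) by (intro ennreal_leI) simp
    with b(2) have n: "ennreal (1 / (real n + 1)) < a" by simp
    show "\<forall>\<^sub>F \<epsilon> in at_right 0. D (v \<epsilon>) < a"
      using v[of n] by (rule eventually_mono) (use n in \<open>auto simp: P_def intro: le_less_trans\<close>)
  qed simp
  moreover have "v \<epsilon> \<in> W1inf \<Omega>" for \<epsilon> using u by (simp add: v_def)
  ultimately have "v \<in> L1_families \<Omega> u" by (simp add: L1_families_def D_def)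
  then have "Gamma_limsup \<Omega> (J \<Omega> W) u \<le> Limsup (at_right 0) (\<lambda>\<epsilon>. J \<Omega> W \<epsilon> (v \<epsilon>))"
    unfolding Gamma_limsup_def by (rule INF_lower)
  also have "\<dots> \<le> J_hom \<Omega> W u"
  proof (rule ennreal_le_epsilon)
    fix e :: real assume "e > 0"
    then obtain n where "1 / (real n + 1) < e" using small by blast
    then have n: "ennreal (1 / (real n + 1)) \<le> ennreal e" by (intro ennreal_leI) simp
    show "Limsup (at_right 0) (\<lambda>\<epsilon>. J \<Omega> W \<epsilon> (v \<epsilon>)) \<le> J_hom \<Omega> W u + ennreal e"
      by (rule Limsup_bounded, use v[of n] in \<open>rule eventually_mono\<close>)
        (use add_left_mono[OF n, of "J_hom \<Omega> W u"] in \<open>auto simp: P_def intro: order_trans\<close>)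
  qed
  finally show ?thesis .
qed (simp add: not_less top_unique)

end

theorem theorem1p2:
  fixes \<Omega> :: "(real^'d) set"
    and C :: "(real^'d^'m) set"
    and W :: "real^'d \<Rightarrow> real^'d^'m \<Rightarrow> ennreal"
  assumes "\<Omega> \<noteq> {}" and "bounded \<Omega>" and "open \<Omega>" and "lipschitz_boundary \<Omega>"
    and "bounded C" and "convex C" and "0 \<in> interior C"
    and "(\<lambda>(x, \<xi>). W x \<xi>) \<in> borel_measurable borel"
    and "periodic W"
    and "\<And>x. eff_dom (W x) \<subseteq> closure C"
    and cond1: "\<And>\<delta>::real. \<delta> > 0 \<Longrightarrow>
          \<exists>\<eta>::real. \<eta> > 0 \<and> (\<forall>x. \<forall>\<xi> \<in> eff_dom (W x). \<forall>t \<in> {0..<1}.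
            1 - t \<le> \<eta> \<longrightarrow> W x (t *\<^sub>R \<xi>) \<le> W x \<xi> + ennreal \<delta>)"
    and cond2: "\<And>K. compact K \<Longrightarrow> K \<subseteq> interior C \<Longrightarrow> locally_Linf (\<lambda>x. SUP \<xi>\<in>K. W x \<xi>)"
    and cond3: "\<And>s::real. s > 0 \<Longrightarrow>
          \<exists>K. compact K \<and> K \<subseteq> interior C \<and>
              (\<forall>x. (INF \<xi>\<in>closure C - K. W x \<xi>) \<ge> ennreal s)"
  shows "Gamma_converges \<Omega> (J \<Omega> W) (J_hom \<Omega> W)"
proof -
  interpret homogenization C W by (standard; fact assms)
  have "J_hom \<Omega> W u \<le> Gamma_liminf \<Omega> (J \<Omega> W) u" if "u \<in> W1inf \<Omega>" for u :: "real^'d \<Rightarrow> real^'m"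
    unfolding Gamma_liminf_def by (rule INF_greatest) (rule liminf_inequality[OF \<open>open \<Omega>\<close> \<open>bounded \<Omega>\<close> that])
  then show ?thesis
    unfolding Gamma_converges_def using limsup_inequality[OF \<open>open \<Omega>\<close> \<open>bounded \<Omega>\<close>] by blast
qed

end
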